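(* Consider any one of the three settings (A), (B), (C) described in the context, with its Fourier operator $f\mapsto\widehat f$ from functions on $D$ to functions on $E$. Let $0<\beta\le1$ and let $\|\cdot\|_X$ be a left-admissible functional on functions on $E$. Define, for $f\in L^1(D)+L^2(D)$, $$\|f\|_{\widetilde X}:=\sup_T\big\||T(f)|^\beta\big\|_X^{1/\beta},$$ where the supremum is taken over all sublinear operators $T$ of joint strong type $(1,\infty;2,2)$. Then $\|\cdot\|_{\widetilde X}$ is a rearrangement-invariant right-admissible functional, and for every right-admissible functional $\|\cdot\|_Y$ on functions on $D$ for which $$\big\||\widehat f|^\beta\big\|_X^{1/\beta}\le\|f\|_Y\qquad\text{for every } f\in L^1(D),$$ one has $$\|f\|_{\widetilde X}\lesssim_\beta\|f\|_Y\qquad\text{for every } f\in L^1(D),$$ where the implied constant depends only on $\beta$ and $d$.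
   Context: Settings. (A) $D=E=\mathbb R^d$ with Lebesgue measure normalized so that the unit ball has measure $1$, and $\widehat f(\xi)=\int_{\mathbb R^d}f(x)e^{-2\pi i\langle x,\xi\rangle}dx$. (B) $D=\mathbb Z$ with counting measure, $E=[-\frac12,\frac12]$ (identified with the torus) with Lebesgue measure, and $\widehat f(x)=\sum_{n\in\mathbb Z}f(n)e^{2\pi i nx}$. (C) $D=[-\frac12,\frac12]$ (identified with the torus), $E=\mathbb Z$, and $\widehat f(n)=\int_{-1/2}^{1/2}f(x)e^{-2\pi i nx}dx$. In (B), (C) take $d=1$. All functions are measurable and complex valued; on $\mathbb Z$ "function" means sequence and "integral" means sum. Rearrangements. For $h$ on a measure space with measure $\mu$ let $h^*(t)=\inf\{\lambda\ge0:\mu(|h|>\lambda)\le t\}$, $t\geq 0$. The symmetric non-increasing rearrangement $h^\circ$ is the symmetric, non-increasing (in $|x|$) function equimeasurable with $|h|$: on $\mathbb R^d$, $h^\circ(x)=h^*(|x|^d)$; on $[-\frac12,\frac12]$, $h^\circ(x)=h^*(2|x|)$; on $\mathbb Z$, $h^\circ$ takes the values $h^*(0),h^*(1),h^*(2),\dots$ at the points $0,1,-1,2,-2,\dots$ respectively. A functional is rearrangement-invariant if its value at $f$ depends only on $f^*$. Associate functional. For a functional $\|\cdot\|_X$ with values in $[0,\infty]$, write $f\in X$ if $\|f\|_X<\infty$, and set $\|f\|_{X'}=\sup\{\int|fg|:\|g\|_X\le1\}$ (a sum in the sequence case). $X''$ is the associate of $X'$. Left-admissible: (i) $\|F\|_X=\|F\|_{X''}$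 for every $F\in X''$; (ii) $\|h^\circ\|_{X'}\le\|h\|_{X'}$ for every $h\in X'$. Right-admissible: (i) $\|mG\|_Y\le\|G\|_Y\|m\|_\infty$ for all $G\in Y$, $m\in L^\infty$; (ii) $\|G^\circ\|_Y\le\|G\|_Y$ for all $G\in Y$. For $\widetilde X$ these are understood for functions in $L^1(D)+L^2(D)$. An operator $T$ defined on $L^1(D)+L^2(D)$ with values in measurable functions on $E$ is sublinear if $|T(f+g)|\le|T(f)|+|T(g)|$ and $|T(\lambda f)|=|\lambda||T(f)|$. It is of joint strong type $(1,\infty;2,2)$ if $\|T(f)\|_\infty\le K\|f\|_1$ for $f\in L^1$ and $\|T(f)\|_2\le K\|f\|_2$ for $f\in L^2$, where $K\ge1$ is a fixed constant depending only on $d$.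
   Formalization: The functional X is additionally assumed positively homogeneous (‖cF‖_X = c‖F‖_X for c > 0); without this the claim fails, e.g. for ‖F‖_X = 0 if F = 0 a.e. and 5 otherwise, which is left-admissible but gives a non-right-admissible X~. *)

theory Defs
  imports "HOL-Analysis.Analysis" "HOL-Probability.Essential_Supremum"
begin

section \<open>Lebesgue norms and spaces\<close>

definition ennreal_powr :: "ennreal \<Rightarrow> real \<Rightarrow> ennreal" where
  "ennreal_powr a p = (if a = \<infinity> then \<infinity> else ennreal (enn2real a powr p))"

definition Lp_norm :: "'a measure \<Rightarrow> real \<Rightarrow> ('a \<Rightarrow> complex) \<Rightarrow> ennreal" where
  "Lp_norm M p f = ennreal_powr (\<integral>\<^sup>+x. ennreal (cmod (f x) powr p) \<partial>M) (1 / p)"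

definition Lp_space :: "'a measure \<Rightarrow> real \<Rightarrow> ('a \<Rightarrow> complex) set" where
  "Lp_space M p = {f \<in> borel_measurable M. Lp_norm M p f < \<infinity>}"

definition Linf_norm :: "'a measure \<Rightarrow> ('a \<Rightarrow> complex) \<Rightarrow> ennreal" where
  "Linf_norm M f = esssup M (\<lambda>x. ennreal (cmod (f x)))"

definition Linf_space :: "'a measure \<Rightarrow> ('a \<Rightarrow> complex) set" where
  "Linf_space M = {f \<in> borel_measurable M. Linf_norm M f < \<infinity>}"

definition L1_plus_L2 :: "'a measure \<Rightarrow> ('a \<Rightarrow> complex) set" where
  "L1_plus_L2 M = {\<lambda>x. g x + h x | g h. g \<in> Lp_space M 1 \<and> h \<in> Lp_space M 2}"

section \<open>Rearrangements\<close>

text \<open>As \<^term>\<open>Inf {} = (\<infinity>::ennreal)\<close>, the value is infinite when no level is admissible.\<close>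

definition decr_rearr :: "'a measure \<Rightarrow> ('a \<Rightarrow> complex) \<Rightarrow> real \<Rightarrow> ennreal" where
  "decr_rearr M h t =
    Inf {ennreal s | s. 0 \<le> s \<and> emeasure M {x \<in> space M. cmod (h x) > s} \<le> ennreal t}"

text \<open>The underlying space enters the symmetric rearrangement only through a function \<open>\<rho>\<close>
  that sends a point to the argument at which the decreasing rearrangement is evaluated there.
  The result may be infinite: at the origin of Euclidean space when \<open>h\<close> is unbounded, or on a
  set of positive measure.\<close>

definition sym_rearr :: "'a measure \<Rightarrow> ('a \<Rightarrow> real) \<Rightarrow> ('a \<Rightarrow> complex) \<Rightarrow> 'a \<Rightarrow> ennreal" where
  "sym_rearr M \<rho> h x = decr_rearr M h (\<rho> x)"

definition rearrangement_invariant ::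
  "'a measure \<Rightarrow> ('a \<Rightarrow> complex) set \<Rightarrow> (('a \<Rightarrow> complex) \<Rightarrow> ennreal) \<Rightarrow> bool" where
  "rearrangement_invariant M \<F> \<Phi> \<longleftrightarrow>
    (\<forall>f\<in>\<F>. \<forall>g\<in>\<F>. (\<forall>t\<ge>0. decr_rearr M f t = decr_rearr M g t) \<longrightarrow> \<Phi> f = \<Phi> g)"

section \<open>Associate and admissible functionals\<close>

text \<open>The associate functional depends on the modulus only. It is defined on extended
  non-negative functions, so that it applies to symmetric rearrangements with infinite values.\<close>

definition associate ::
  "'a measure \<Rightarrow> (('a \<Rightarrow> complex) \<Rightarrow> ennreal) \<Rightarrow> ('a \<Rightarrow> ennreal) \<Rightarrow> ennreal" where
  "associate M X u =
    (SUP g\<in>{g \<in> borel_measurable M. X g \<le> 1}. \<integral>\<^sup>+x. u x * ennreal (cmod (g x)) \<partial>M)"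

definition associate_norm ::
  "'a measure \<Rightarrow> (('a \<Rightarrow> complex) \<Rightarrow> ennreal) \<Rightarrow> ('a \<Rightarrow> complex) \<Rightarrow> ennreal" where
  "associate_norm M X f = associate M X (\<lambda>x. ennreal (cmod (f x)))"

text \<open>Left-admissibility alone does not control a functional outside its second associate space:
  \<open>0\<close> for null functions and \<open>5\<close> for all others is left-admissible, its second associate being
  infinite off the null functions. Positive homogeneity excludes this.\<close>

definition pos_homogeneous :: "'a measure \<Rightarrow> (('a \<Rightarrow> complex) \<Rightarrow> ennreal) \<Rightarrow> bool" where
  "pos_homogeneous M X \<longleftrightarrow>
    (\<forall>F\<in>borel_measurable M. \<forall>c>0. X (\<lambda>x. complex_of_real c * F x) = ennreal c * X F)"

definition left_admissible ::
  "'a measure \<Rightarrow> ('a \<Rightarrow> real) \<Rightarrow> (('a \<Rightarrow> complex) \<Rightarrow> ennreal) \<Rightarrow> bool" where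
  "left_admissible M \<rho> X \<longleftrightarrow>
    (\<forall>F\<in>borel_measurable M. associate_norm M (associate_norm M X) F < \<infinity> \<longrightarrow>
       X F = associate_norm M (associate_norm M X) F) \<and>
    (\<forall>h\<in>borel_measurable M. associate_norm M X h < \<infinity> \<longrightarrow>
       associate M X (sym_rearr M \<rho> h) \<le> associate_norm M X h)"

text \<open>\<open>\<F>\<close> is the class of functions for which the conditions are understood. The second one is
  imposed when the rearrangement is finite almost everywhere, that is, when it is a complex-valued
  function up to a null set; \<^const>\<open>enn2real\<close> then only affects a null set.\<close>

definition right_admissible ::
  "'a measure \<Rightarrow> ('a \<Rightarrow> real) \<Rightarrow> ('a \<Rightarrow> complex) set \<Rightarrow> (('a \<Rightarrow> complex) \<Rightarrow> ennreal) \<Rightarrow> bool" where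
  "right_admissible M \<rho> \<F> Y \<longleftrightarrow>
    (\<forall>G\<in>\<F>. Y G < \<infinity> \<longrightarrow>
       (\<forall>m\<in>Linf_space M. Y (\<lambda>x. m x * G x) \<le> Y G * Linf_norm M m)) \<and>
    (\<forall>G\<in>\<F>. Y G < \<infinity> \<longrightarrow> (AE x in M. sym_rearr M \<rho> G x < \<infinity>) \<longrightarrow>
       Y (\<lambda>x. complex_of_real (enn2real (sym_rearr M \<rho> G x))) \<le> Y G)"

section \<open>Sublinear operators of joint strong type\<close>

definition sublinear_operator ::
  "'d measure \<Rightarrow> 'e measure \<Rightarrow> (('d \<Rightarrow> complex) \<Rightarrow> 'e \<Rightarrow> complex) \<Rightarrow> bool" where
  "sublinear_operator D E T \<longleftrightarrow>
    (\<forall>f\<in>L1_plus_L2 D. T f \<in> borel_measurable E) \<and>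
    (\<forall>f\<in>L1_plus_L2 D. \<forall>g\<in>L1_plus_L2 D.
       AE y in E. cmod (T (\<lambda>x. f x + g x) y) \<le> cmod (T f y) + cmod (T g y)) \<and>
    (\<forall>f\<in>L1_plus_L2 D. \<forall>c::complex.
       AE y in E. cmod (T (\<lambda>x. c * f x) y) = cmod c * cmod (T f y))"

definition joint_strong_type ::
  "'d measure \<Rightarrow> 'e measure \<Rightarrow> real \<Rightarrow> (('d \<Rightarrow> complex) \<Rightarrow> 'e \<Rightarrow> complex) \<Rightarrow> bool" where
  "joint_strong_type D E K T \<longleftrightarrow>
    (\<forall>f\<in>Lp_space D 1. Linf_norm E (T f) \<le> ennreal K * Lp_norm D 1 f) \<and>
    (\<forall>f\<in>Lp_space D 2. Lp_norm E 2 (T f) \<le> ennreal K * Lp_norm D 2 f)"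

definition power_norm ::
  "real \<Rightarrow> (('e \<Rightarrow> complex) \<Rightarrow> ennreal) \<Rightarrow> ('e \<Rightarrow> complex) \<Rightarrow> ennreal" where
  "power_norm \<beta> X F = ennreal_powr (X (\<lambda>y. complex_of_real (cmod (F y) powr \<beta>))) (1 / \<beta>)"

definition tilde_norm ::
  "'d measure \<Rightarrow> 'e measure \<Rightarrow> real \<Rightarrow> real \<Rightarrow> (('e \<Rightarrow> complex) \<Rightarrow> ennreal)
    \<Rightarrow> ('d \<Rightarrow> complex) \<Rightarrow> ennreal" where
  "tilde_norm D E K \<beta> X f =
    (SUP T\<in>{T. sublinear_operator D E T \<and> joint_strong_type D E K T}. power_norm \<beta> X (T f))"

section \<open>The three settings\<close>

definition space_leb :: "(real ^ 'n) measure" where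
  "space_leb = scale_measure (inverse (emeasure lebesgue (ball (0::real ^ 'n) 1))) lebesgue"

definition space_pos :: "real ^ 'n \<Rightarrow> real" where
  "space_pos x = norm x ^ CARD('n)"

definition space_fourier :: "(real ^ 'n \<Rightarrow> complex) \<Rightarrow> real ^ 'n \<Rightarrow> complex" where
  "space_fourier f \<xi> = (\<integral>x. f x * cis (- 2 * pi * (x \<bullet> \<xi>)) \<partial>space_leb)"

definition torus_leb :: "real measure" where
  "torus_leb = lebesgue_on {-1/2..1/2}"

definition torus_pos :: "real \<Rightarrow> real" where
  "torus_pos x = 2 * \<bar>x\<bar>"

definition torus_fourier :: "(real \<Rightarrow> complex) \<Rightarrow> int \<Rightarrow> complex" where
  "torus_fourier f n = (\<integral>x. f x * cis (- 2 * pi * real_of_int n * x) \<partial>torus_leb)"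

definition int_count :: "int measure" where
  "int_count = count_space UNIV"

text \<open>This enumerates the integers in the order \<open>0, 1, -1, 2, -2, \<dots>\<close>.\<close>

definition int_pos :: "int \<Rightarrow> real" where
  "int_pos n = (if n > 0 then 2 * real_of_int n - 1 else - 2 * real_of_int n)"

definition int_fourier :: "(int \<Rightarrow> complex) \<Rightarrow> real \<Rightarrow> complex" where
  "int_fourier f x = (\<Sum>\<^sub>\<infinity>n\<in>UNIV. f n * cis (2 * pi * real_of_int n * x))"

end

theory Submission
  imports Defs
begin

text \<open>
  The extremal functional inherits rearrangement invariance and right-admissibility from the freedom in the
  choice of \<open>T\<close>. If \<open>f\<close> and \<open>g\<close> are equidistributed, averaging over the shells where \<open>|g|\<close> is almost constant gives a linear
  operator \<open>S\<close> with \<open>S g = f\<close> that is almost a contraction on \<open>L\<^sup>1\<close> and \<open>L\<^sup>2\<close> (lemma \<open>transplantation\<close>), and the composition of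
  \<open>T\<close> with \<open>S\<close> competes for \<open>g\<close>. Multipliers are absorbed into \<open>T\<close> in the same way.

  Minimality is a statement about single functions. Positive homogeneity makes \<open>X\<close> equal to its second associate on all
  measurable functions, so \<open>T f\<close> has to be tested against functions \<open>g\<close> in the unit ball of the associate
  functional. Left-admissibility allows one to use the rearrangement of \<open>g\<close> as a weight on the Fourier side, and right-admissibility of
  \<open>Y\<close> allows one to use every \<open>G\<close> whose modulus stays below the rearrangement of \<open>f\<close>. What remains is
  theorem \<open>Fourier_extremal\<close>: up to a constant, the integral of \<open>|T f|\<^sup>\<beta> |g|\<close> is at most the supremum over such \<open>G\<close> of the integral of \<open>|G|\<^sup>\<beta>\<close>,
  with \<open>G\<close> replaced by its Fourier transform, against the rearrangement of \<open>g\<close>.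

  By the Hardy-Littlewood inequality only the levels of the rearrangement of \<open>T f\<close> at dyadic scales matter. At frequency scale \<open>j\<close>
  split \<open>f\<close> at the height of its rearrangement at the dual scale. The image of the head is bounded by the \<open>L\<^sup>1\<close> norm of the
  head, the image of the tail has its energy bounded by that of the tail.

  Where the head is responsible for the level of \<open>T f\<close>, the superposition of Fejer kernels in \<open>head_multiplier\<close> has a Fourier
  transform of this size. Since the transforms of all Fejer kernels are non-negative, different scales do not cancel.

  At the other scales, \<open>tail_energy\<close> bounds the total energy of \<open>T f\<close> on frequency scales up to \<open>j\<close> by the energy of \<open>f\<close> on
  spatial scales from \<open>-j\<close> on. These frequency scales all draw on the same energy of \<open>f\<close>, so it has to be
  distributed among them, and the inequality for partial sums is exactly the condition for a
  transport plan which sends energy from spatial scale \<open>k\<close> to frequency scales \<open>j \<ge> -k\<close>. The plan is realized by cutting a region of spatial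
  scale \<open>k\<close> into slabs, one for each frequency scale, and the slab for \<open>j\<close> into cells so small that characters
  of frequency scale \<open>j\<close> are almost constant on them. With random signs on the cells, the
  Khinchine inequality yields a function whose Fourier transform has the required size (\<open>tail_cells\<close>, \<open>random_multiplier\<close>).

  The locale \<open>fourier_pair\<close> collects what this argument uses about the measure spaces and the characters; the
  three settings are instances.
\<close>

section \<open>Lebesgue norms\<close>

lemma ennreal_powr_one [simp]: "ennreal_powr a 1 = a"
  by (cases a) (auto simp: ennreal_powr_def)

lemma ennreal_powr_mono: "a \<le> b \<Longrightarrow> 0 \<le> p \<Longrightarrow> ennreal_powr a p \<le> ennreal_powr b p"
  by (cases a; cases b) (auto simp: ennreal_powr_def top_unique intro!: powr_mono2)

lemma ennreal_powr_powr: "0 < p \<Longrightarrow> 0 < r \<Longrightarrow> ennreal_powr (ennreal_powr a p) r = ennreal_powr a (p * r)"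
  by (cases a) (auto simp: ennreal_powr_def powr_powr)

lemma ennreal_powr_le_iff: "0 < p \<Longrightarrow> ennreal_powr a p \<le> ennreal_powr b p \<longleftrightarrow> a \<le> b"
  using ennreal_powr_mono[of a b p] ennreal_powr_mono[of "ennreal_powr a p" "ennreal_powr b p" "1 / p"]
  by (auto simp: ennreal_powr_powr)

lemma ennreal_powr_mult:
  "0 < c \<Longrightarrow> 0 < p \<Longrightarrow> ennreal_powr (ennreal c * a) p = ennreal (c powr p) * ennreal_powr a p"
  by (cases a) (auto simp: ennreal_powr_def powr_mult ennreal_mult_top ennreal_mult[symmetric])

lemma ennreal_powr_zero [simp]: "0 < p \<Longrightarrow> ennreal_powr 0 p = 0"
  by (auto simp: ennreal_powr_def)

lemma Lp_norm_one: "Lp_norm M 1 f = (\<integral>\<^sup>+x. ennreal (cmod (f x)) \<partial>M)"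
  by (simp add: Lp_norm_def)

lemma Lp_norm_two_le_iff:
  assumes "0 < c"
  shows "Lp_norm M 2 f \<le> ennreal c * Lp_norm N 2 g \<longleftrightarrow>
    (\<integral>\<^sup>+x. ennreal ((cmod (f x))\<^sup>2) \<partial>M) \<le> ennreal (c\<^sup>2) * (\<integral>\<^sup>+x. ennreal ((cmod (g x))\<^sup>2) \<partial>N)"
proof -
  have "ennreal c = ennreal ((c\<^sup>2) powr (1 / 2))"
    using assms by (simp add: powr_half_sqrt)
  then have "ennreal c * Lp_norm N 2 g
      = ennreal_powr (ennreal (c\<^sup>2) * (\<integral>\<^sup>+x. ennreal ((cmod (g x))\<^sup>2) \<partial>N)) (1 / 2)"
    using assms by (simp add: Lp_norm_def ennreal_powr_mult)
  then show ?thesis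
    by (simp add: Lp_norm_def ennreal_powr_le_iff)
qed

lemma Lp_norm_two_less_top_iff:
  "Lp_norm M 2 f < \<infinity> \<longleftrightarrow> (\<integral>\<^sup>+x. ennreal ((cmod (f x))\<^sup>2) \<partial>M) < \<infinity>"
  by (auto simp: Lp_norm_def ennreal_powr_def less_top)

lemma Lp_space_one_iff:
  "f \<in> Lp_space M 1 \<longleftrightarrow> f \<in> borel_measurable M \<and> (\<integral>\<^sup>+x. ennreal (cmod (f x)) \<partial>M) < \<infinity>"
  by (simp add: Lp_space_def Lp_norm_one)

lemma Lp_space_two_iff:
  "f \<in> Lp_space M 2 \<longleftrightarrow> f \<in> borel_measurable M \<and> (\<integral>\<^sup>+x. ennreal ((cmod (f x))\<^sup>2) \<partial>M) < \<infinity>"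
  using Lp_norm_two_less_top_iff[of M f] by (simp add: Lp_space_def)

section \<open>Distribution functions and rearrangements\<close>

text \<open>The infimum in the definition of \<^const>\<open>decr_rearr\<close> is attained, because a measure is continuous along
  the increasing sets \<open>{s + 1/n < |h|}\<close>. This Galois connection between the rearrangement and the
  distribution function replaces all computations with infima.\<close>

lemma decr_rearr_le_iff:
  assumes [measurable]: "h \<in> borel_measurable M" and s: "0 \<le> s"
  shows "decr_rearr M h t \<le> ennreal s \<longleftrightarrow> emeasure M {x \<in> space M. s < cmod (h x)} \<le> ennreal t"
proof
  assume le: "decr_rearr M h t \<le> ennreal s"
  have *: "emeasure M {x \<in> space M. s + 1 / Suc n < cmod (h x)} \<le> ennreal t" for n
  proof -
    have "decr_rearr M h t < ennreal (s + 1 / Suc n)"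
      using le s by (auto intro!: le_less_trans[OF le] ennreal_lessI simp: field_simps add_pos_nonneg)
    then obtain r where r: "0 \<le> r" "ennreal r < ennreal (s + 1 / Suc n)"
      "emeasure M {x \<in> space M. r < cmod (h x)} \<le> ennreal t"
      unfolding decr_rearr_def Inf_less_iff by auto
    have "r < s + 1 / Suc n" using r(1,2) by (simp add: ennreal_less_iff)
    then have "emeasure M {x \<in> space M. s + 1 / Suc n < cmod (h x)}
        \<le> emeasure M {x \<in> space M. r < cmod (h x)}"
      by (intro emeasure_mono) auto
    with r(3) show ?thesis by auto
  qed
  have eq: "{x \<in> space M. s < cmod (h x)} = (\<Union>n. {x \<in> space M. s + 1 / Suc n < cmod (h x)})"
  proof (auto simp del: of_nat_Suc)
    fix x assume "s < cmod (h x)"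
    then show "\<exists>n. s + 1 / real (Suc n) < cmod (h x)"
      using reals_Archimedean[of "cmod (h x) - s"] by (auto simp: inverse_eq_divide algebra_simps)
  next
    fix x n assume "s + 1 / real (Suc n) < cmod (h x)"
    moreover have "0 < 1 / real (Suc n)" by simp
    ultimately show "s < cmod (h x)" by linarith
  qed
  have "incseq (\<lambda>n. {x \<in> space M. s + 1 / Suc n < cmod (h x)})"
  proof (intro incseq_SucI subsetI, clarsimp simp del: of_nat_Suc)
    fix n x assume "s + 1 / real (Suc n) < cmod (h x)"
    moreover have "1 / real (Suc (Suc n)) \<le> 1 / real (Suc n)" by (simp add: field_simps)
    ultimately show "s + 1 / real (Suc (Suc n)) < cmod (h x)" by linarith
  qed
  then have "emeasure M {x \<in> space M. s < cmod (h x)}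
      = (SUP n. emeasure M {x \<in> space M. s + 1 / Suc n < cmod (h x)})"
    unfolding eq by (intro SUP_emeasure_incseq[symmetric]) auto
  also have "\<dots> \<le> ennreal t" using * by (intro SUP_least)
  finally show "emeasure M {x \<in> space M. s < cmod (h x)} \<le> ennreal t" .
next
  assume "emeasure M {x \<in> space M. s < cmod (h x)} \<le> ennreal t"
  then show "decr_rearr M h t \<le> ennreal s"
    unfolding decr_rearr_def using s by (intro Inf_lower) auto
qed

lemma less_decr_rearr_iff:
  assumes "h \<in> borel_measurable M" "0 \<le> s"
  shows "ennreal s < decr_rearr M h t \<longleftrightarrow> ennreal t < emeasure M {x \<in> space M. s < cmod (h x)}"
  using decr_rearr_le_iff[OF assms, of t] by (auto simp: not_le[symmetric])

lemma decr_rearr_antimono: "t \<le> t' \<Longrightarrow> decr_rearr M h t' \<le> decr_rearr M h t"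
  unfolding decr_rearr_def by (intro Inf_superset_mono) (blast intro: order_trans ennreal_leI)

text \<open>A value of the distribution function is the least \<open>t\<close> at which the rearrangement falls to the given
  height, or infinite if there is none.\<close>

lemma equidistributedI:
  assumes [measurable]: "f \<in> borel_measurable M" "g \<in> borel_measurable M"
    and eq: "\<And>t. 0 \<le> t \<Longrightarrow> decr_rearr M f t = decr_rearr M g t" and s: "0 \<le> s"
  shows "emeasure M {x \<in> space M. s < cmod (f x)} = emeasure M {x \<in> space M. s < cmod (g x)}"
proof -
  have "emeasure M {x \<in> space M. s < cmod (f x)} \<le> ennreal t \<longleftrightarrow>
      emeasure M {x \<in> space M. s < cmod (g x)} \<le> ennreal t" if "0 \<le> t" for t
    using eq[OF that] decr_rearr_le_iff[of f M s t] decr_rearr_le_iff[of g M s t] s by auto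
  then have "emeasure M {x \<in> space M. s < cmod (f x)} \<le> u \<longleftrightarrow>
      emeasure M {x \<in> space M. s < cmod (g x)} \<le> u" for u
    by (cases u) auto
  then show ?thesis by (meson antisym order_refl)
qed

lemma ennreal_layers: "(u :: ennreal) = (\<integral>\<^sup>+s. indicator {s. 0 \<le> s \<and> ennreal s < u} s \<partial>lborel)"
proof (cases u)
  case (real r)
  then have "{s. 0 \<le> s \<and> ennreal s < u} = {0..<r}" by (auto simp: ennreal_less_iff)
  then show ?thesis using real by simp
next
  case top
  have "of_nat n \<le> emeasure lborel {0::real..}" for n
  proof -
    have "emeasure lborel {0..<real n} \<le> emeasure lborel {0::real..}"
      by (intro emeasure_mono) auto
    then show ?thesis by (simp add: ennreal_of_nat_eq_real_of_nat)
  qed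
  then have "emeasure lborel {0::real..} = top"
    by (metis ennreal_SUP_of_nat_eq_top SUP_least top_unique)
  moreover have "{s. 0 \<le> s \<and> ennreal s < u} = {0..}" using top by auto
  ultimately show ?thesis using top by simp
qed

lemma (in sigma_finite_measure) nn_integral_layers:
  assumes [measurable]: "u \<in> borel_measurable M"
  shows "(\<integral>\<^sup>+x. u x \<partial>M) =
    (\<integral>\<^sup>+s. indicator {0..} s * emeasure M {x \<in> space M. ennreal s < u x} \<partial>lborel)"
proof -
  interpret P: pair_sigma_finite lborel M ..
  have "(\<integral>\<^sup>+x. u x \<partial>M) = (\<integral>\<^sup>+x. \<integral>\<^sup>+s. indicator {s. 0 \<le> s \<and> ennreal s < u x} s \<partial>lborel \<partial>M)"
    by (subst ennreal_layers) simp
  also have "\<dots> = (\<integral>\<^sup>+s. \<integral>\<^sup>+x. indicator {s. 0 \<le> s \<and> ennreal s < u x} s \<partial>M \<partial>lborel)"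
    by (rule P.Fubini') measurable
  also have "\<dots> = (\<integral>\<^sup>+s. indicator {0..} s * (\<integral>\<^sup>+x. indicator {x \<in> space M. ennreal s < u x} x \<partial>M) \<partial>lborel)"
    by (subst nn_integral_cmult[symmetric])
      (auto intro!: nn_integral_cong split: split_indicator)
  finally show ?thesis by simp
qed

text \<open>The bathtub form of the integral of a product: only measures of intersections of level sets enter,
  which is what rearrangement inequalities compare.\<close>

lemma (in sigma_finite_measure) nn_integral_product_layers:
  assumes [measurable]: "u \<in> borel_measurable M" "v \<in> borel_measurable M"
  shows "(\<integral>\<^sup>+x. u x * v x \<partial>M) =
    (\<integral>\<^sup>+s. \<integral>\<^sup>+t. indicator {0..} s * (indicator {0..} t *
      emeasure M {x \<in> space M. ennreal s < u x \<and> ennreal t < v x}) \<partial>lborel \<partial>lborel)"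
proof -
  interpret P: pair_sigma_finite lborel M ..
  have "(\<integral>\<^sup>+x. u x * v x \<partial>M)
      = (\<integral>\<^sup>+x. \<integral>\<^sup>+s. indicator {s. 0 \<le> s \<and> ennreal s < u x} s * v x \<partial>lborel \<partial>M)"
    by (subst nn_integral_multc) (auto simp: ennreal_layers[symmetric])
  also have "\<dots> = (\<integral>\<^sup>+s. \<integral>\<^sup>+x. indicator {s. 0 \<le> s \<and> ennreal s < u x} s * v x \<partial>M \<partial>lborel)"
    by (rule P.Fubini') measurable
  also have "\<dots> = (\<integral>\<^sup>+s. \<integral>\<^sup>+x. \<integral>\<^sup>+t. indicator {s. 0 \<le> s \<and> ennreal s < u x} s
      * indicator {t. 0 \<le> t \<and> ennreal t < v x} t \<partial>lborel \<partial>M \<partial>lborel)"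
    by (subst nn_integral_cmult) (auto simp: ennreal_layers[symmetric])
  also have "\<dots> = (\<integral>\<^sup>+s. \<integral>\<^sup>+t. \<integral>\<^sup>+x. indicator {s. 0 \<le> s \<and> ennreal s < u x} s
      * indicator {t. 0 \<le> t \<and> ennreal t < v x} t \<partial>M \<partial>lborel \<partial>lborel)"
    by (intro nn_integral_cong P.Fubini') measurable
  also have "\<dots> = (\<integral>\<^sup>+s. \<integral>\<^sup>+t. indicator {0..} s * (indicator {0..} t *
      (\<integral>\<^sup>+x. indicator {x \<in> space M. ennreal s < u x \<and> ennreal t < v x} x \<partial>M)) \<partial>lborel \<partial>lborel)"
    by (subst nn_integral_cmult[symmetric], simp, subst nn_integral_cmult[symmetric], simp)
      (auto intro!: nn_integral_cong split: split_indicator)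
  finally show ?thesis by simp
qed

text \<open>A space together with a function \<open>\<rho>\<close> whose sublevel sets serve as the balls around the origin. Condition
  \<open>emeasure_rho_less\<close> is required only for radii that are measures of sets: on the integers other radii
  give a ball of larger measure. The last condition expresses that \<open>\<rho>\<close> vanishes only on a null set, unless sets
  of small positive measure do not exist; it makes rearrangements of unbounded functions finite almost
  everywhere.\<close>

locale rearr_space = sigma_finite_measure M for M :: "'a measure" +
  fixes \<rho> :: "'a \<Rightarrow> real"
  assumes rho_measurable [measurable]: "\<rho> \<in> borel_measurable M"
    and rho_nonneg: "0 \<le> \<rho> x"
    and emeasure_rho_less: "S \<in> sets M \<Longrightarrow>
      emeasure M {x \<in> space M. ennreal (\<rho> x) < emeasure M S} = emeasure M S"
    and rho_pos: "AE x in M. \<exists>\<delta>>0. \<forall>S\<in>sets M. emeasure M S \<le> ennreal \<delta> \<longrightarrow> emeasure M S \<le> ennreal (\<rho> x)"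
begin

lemma less_sym_rearr_iff:
  assumes "h \<in> borel_measurable M" "0 \<le> s"
  shows "ennreal s < sym_rearr M \<rho> h x \<longleftrightarrow> ennreal (\<rho> x) < emeasure M {x \<in> space M. s < cmod (h x)}"
  using less_decr_rearr_iff[OF assms] by (simp add: sym_rearr_def)

lemma measurable_sym_rearr [measurable]:
  assumes [measurable]: "h \<in> borel_measurable M"
  shows "sym_rearr M \<rho> h \<in> borel_measurable M"
proof (rule borel_measurableI_greater)
  fix a :: ennreal
  show "{x \<in> space M. a < sym_rearr M \<rho> h x} \<in> sets M"
  proof (cases a)
    case (real r)
    then have "{x \<in> space M. a < sym_rearr M \<rho> h x} =
        {x \<in> space M. ennreal (\<rho> x) < emeasure M {x \<in> space M. r < cmod (h x)}}"
      using less_sym_rearr_iff[of h r] by auto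
    then show ?thesis by simp
  qed auto
qed

lemma emeasure_sym_rearr:
  assumes [measurable]: "h \<in> borel_measurable M" and "0 \<le> s"
  shows "emeasure M {x \<in> space M. ennreal s < sym_rearr M \<rho> h x} = emeasure M {x \<in> space M. s < cmod (h x)}"
  using emeasure_rho_less[of "{x \<in> space M. s < cmod (h x)}"] less_sym_rearr_iff[of h s] assms by simp

text \<open>Compare the level sets under the integral. The intersection of two sets has at most the measure of
  the smaller one, and the corresponding balls are nested, so that for them this bound is attained.\<close>

lemma Hardy_Littlewood:
  assumes [measurable]: "F \<in> borel_measurable M" "g \<in> borel_measurable M"
  shows "(\<integral>\<^sup>+x. ennreal (cmod (F x)) * ennreal (cmod (g x)) \<partial>M)
    \<le> (\<integral>\<^sup>+x. sym_rearr M \<rho> F x * sym_rearr M \<rho> g x \<partial>M)"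
proof -
  have *: "emeasure M {x \<in> space M. ennreal s < ennreal (cmod (F x)) \<and> ennreal t < ennreal (cmod (g x))}
    \<le> emeasure M {x \<in> space M. ennreal s < sym_rearr M \<rho> F x \<and> ennreal t < sym_rearr M \<rho> g x}"
    if st: "0 \<le> s" "0 \<le> t" for s t
  proof -
    let ?A = "{x \<in> space M. s < cmod (F x)}" and ?B = "{x \<in> space M. t < cmod (g x)}"
    have "emeasure M {x \<in> space M. ennreal s < ennreal (cmod (F x)) \<and> ennreal t < ennreal (cmod (g x))}
        \<le> min (emeasure M ?A) (emeasure M ?B)"
      using st by (auto intro!: emeasure_mono simp: ennreal_less_iff)
    also have "\<dots> = emeasure M {x \<in> space M. ennreal (\<rho> x) < min (emeasure M ?A) (emeasure M ?B)}"
      using emeasure_rho_less[of ?A] emeasure_rho_less[of ?B] by (auto simp: min_def)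
    also have "\<dots> = emeasure M {x \<in> space M. ennreal s < sym_rearr M \<rho> F x \<and> ennreal t < sym_rearr M \<rho> g x}"
      using st by (simp add: less_sym_rearr_iff)
    finally show ?thesis .
  qed
  show ?thesis
    by (subst (1 2) nn_integral_product_layers; (measurable)?)
      (intro nn_integral_mono, use * in \<open>auto split: split_indicator\<close>)
qed

end

section \<open>The sum of the first and the second Lebesgue space\<close>

lemma Linf_norm_le_iff:
  assumes [measurable]: "f \<in> borel_measurable M"
  shows "Linf_norm M f \<le> c \<longleftrightarrow> (AE x in M. ennreal (cmod (f x)) \<le> c)"
proof
  assume "Linf_norm M f \<le> c"
  then show "AE x in M. ennreal (cmod (f x)) \<le> c"
    using esssup_AE[of "\<lambda>x. ennreal (cmod (f x))" M] unfolding Linf_norm_def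
    by (auto elim!: eventually_mono intro: order_trans)
qed (auto simp: Linf_norm_def)

lemma norm_sum_split_bound:
  fixes g h :: complex
  shows "min (cmod (g + h)) ((cmod (g + h))\<^sup>2) \<le> 2 * cmod g + 4 * (cmod h)\<^sup>2"
proof (cases "cmod h \<le> cmod g")
  case True
  then have "cmod (g + h) \<le> 2 * cmod g" using norm_triangle_ineq[of g h] by linarith
  then show ?thesis by (intro min.coboundedI1) (simp add: add_increasing2)
next
  case False
  then have "cmod (g + h) \<le> 2 * cmod h" using norm_triangle_ineq[of g h] by linarith
  then have "(cmod (g + h))\<^sup>2 \<le> 4 * (cmod h)\<^sup>2"
    using power_mono[of "cmod (g + h)" "2 * cmod h" 2] by (simp add: power_mult_distrib)
  then show ?thesis by (intro min.coboundedI2) (simp add: add_increasing)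
qed

text \<open>Membership depends on the distribution of \<open>|f|\<close> only: large values have to be integrable and small
  values square integrable.\<close>

lemma L1_plus_L2_iff:
  "f \<in> L1_plus_L2 M \<longleftrightarrow> f \<in> borel_measurable M \<and>
    (\<integral>\<^sup>+x. ennreal (min (cmod (f x)) ((cmod (f x))\<^sup>2)) \<partial>M) < \<infinity>"
proof
  assume "f \<in> L1_plus_L2 M"
  then obtain g h where f: "f = (\<lambda>x. g x + h x)" and gh: "g \<in> Lp_space M 1" "h \<in> Lp_space M 2"
    unfolding L1_plus_L2_def by auto
  have [measurable]: "g \<in> borel_measurable M" "h \<in> borel_measurable M"
    using gh by (auto simp: Lp_space_def)
  have "(\<integral>\<^sup>+x. ennreal (min (cmod (f x)) ((cmod (f x))\<^sup>2)) \<partial>M)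
      \<le> (\<integral>\<^sup>+x. 2 * ennreal (cmod (g x)) + 4 * ennreal ((cmod (h x))\<^sup>2) \<partial>M)"
  proof (intro nn_integral_mono)
    fix x
    have "ennreal (min (cmod (f x)) ((cmod (f x))\<^sup>2)) \<le> ennreal (2 * cmod (g x) + 4 * (cmod (h x))\<^sup>2)"
      unfolding f by (intro ennreal_leI norm_sum_split_bound)
    then show "ennreal (min (cmod (f x)) ((cmod (f x))\<^sup>2))
        \<le> 2 * ennreal (cmod (g x)) + 4 * ennreal ((cmod (h x))\<^sup>2)"
      by (simp add: ennreal_mult)
  qed
  also have "\<dots> = 2 * (\<integral>\<^sup>+x. ennreal (cmod (g x)) \<partial>M) + 4 * (\<integral>\<^sup>+x. ennreal ((cmod (h x))\<^sup>2) \<partial>M)"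
    by (simp add: nn_integral_add nn_integral_cmult)
  also have "\<dots> < \<infinity>"
    using gh unfolding Lp_space_one_iff Lp_space_two_iff
    by (auto simp: ennreal_mult_less_top)
  finally show "f \<in> borel_measurable M \<and>
      (\<integral>\<^sup>+x. ennreal (min (cmod (f x)) ((cmod (f x))\<^sup>2)) \<partial>M) < \<infinity>"
    by (simp add: f)
next
  assume *: "f \<in> borel_measurable M \<and> (\<integral>\<^sup>+x. ennreal (min (cmod (f x)) ((cmod (f x))\<^sup>2)) \<partial>M) < \<infinity>"
  then have [measurable]: "f \<in> borel_measurable M" by simp
  let ?g = "\<lambda>x. if 1 < cmod (f x) then f x else 0" and ?h = "\<lambda>x. if 1 < cmod (f x) then 0 else f x"
  have "(\<integral>\<^sup>+x. ennreal (cmod (?g x)) \<partial>M) \<le> (\<integral>\<^sup>+x. ennreal (min (cmod (f x)) ((cmod (f x))\<^sup>2)) \<partial>M)"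
    by (intro nn_integral_mono) (auto simp: power2_eq_square mult_le_cancel_left1)
  then have "?g \<in> Lp_space M 1" using * by (auto simp: Lp_space_one_iff)
  moreover have "(\<integral>\<^sup>+x. ennreal ((cmod (?h x))\<^sup>2) \<partial>M) \<le> (\<integral>\<^sup>+x. ennreal (min (cmod (f x)) ((cmod (f x))\<^sup>2)) \<partial>M)"
    by (intro nn_integral_mono) (auto simp: power2_eq_square mult_left_le)
  then have "?h \<in> Lp_space M 2" using * by (auto simp: Lp_space_two_iff)
  moreover have "f = (\<lambda>x. ?g x + ?h x)" by auto
  ultimately show "f \<in> L1_plus_L2 M"
    unfolding L1_plus_L2_def mem_Collect_eq by (intro exI[of _ ?g] exI[of _ ?h]) simp
qed

lemma L1_plus_L2_measurable: "f \<in> L1_plus_L2 M \<Longrightarrow> f \<in> borel_measurable M"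
  by (simp add: L1_plus_L2_iff)

lemma Lp_one_subset: "f \<in> Lp_space M 1 \<Longrightarrow> f \<in> L1_plus_L2 M"
  unfolding L1_plus_L2_def mem_Collect_eq
  by (rule exI[of _ f], rule exI[of _ "\<lambda>_. 0"]) (simp add: Lp_space_two_iff)

lemma Lp_two_subset: "f \<in> Lp_space M 2 \<Longrightarrow> f \<in> L1_plus_L2 M"
  unfolding L1_plus_L2_def mem_Collect_eq
  by (rule exI[of _ "\<lambda>_. 0"], rule exI[of _ f]) (simp add: Lp_space_one_iff)

lemma L1_plus_L2_level_finite:
  assumes f: "f \<in> L1_plus_L2 M" and "0 < s"
  shows "emeasure M {x \<in> space M. s < cmod (f x)} < \<infinity>"
proof -
  have [measurable]: "f \<in> borel_measurable M" using f by (rule L1_plus_L2_measurable)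
  let ?c = "min s (s\<^sup>2)"
  have c: "0 < ?c" using \<open>0 < s\<close> by auto
  have "emeasure M {x \<in> space M. s < cmod (f x)}
      \<le> emeasure M {x \<in> space M. 1 \<le> ennreal (1 / ?c) * ennreal (min (cmod (f x)) ((cmod (f x))\<^sup>2))}"
  proof (intro emeasure_mono subsetI; clarsimp)
    fix x assume "s < cmod (f x)"
    then have "?c \<le> min (cmod (f x)) ((cmod (f x))\<^sup>2)"
      using \<open>0 < s\<close> by (intro min.mono) (auto intro!: power_mono)
    then have "1 \<le> (1 / ?c) * min (cmod (f x)) ((cmod (f x))\<^sup>2)"
      using c by (simp add: pos_le_divide_eq)
    then show "1 \<le> ennreal (1 / ?c) * ennreal (min (cmod (f x)) ((cmod (f x))\<^sup>2))"
      using c by (simp add: ennreal_mult[symmetric])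
  qed
  also have "\<dots> \<le> ennreal (1 / ?c) * (\<integral>\<^sup>+x. ennreal (min (cmod (f x)) ((cmod (f x))\<^sup>2)) * indicator (space M) x \<partial>M)"
    by (rule nn_integral_Markov_inequality) auto
  also have "(\<integral>\<^sup>+x. ennreal (min (cmod (f x)) ((cmod (f x))\<^sup>2)) * indicator (space M) x \<partial>M)
      = (\<integral>\<^sup>+x. ennreal (min (cmod (f x)) ((cmod (f x))\<^sup>2)) \<partial>M)"
    by (intro nn_integral_cong) simp
  also have "ennreal (1 / ?c) * (\<integral>\<^sup>+x. ennreal (min (cmod (f x)) ((cmod (f x))\<^sup>2)) \<partial>M) < \<infinity>"
    using f unfolding L1_plus_L2_iff by (simp add: ennreal_mult_less_top)
  finally show ?thesis .
qed

text \<open>The level sets decrease to the empty set and have finite measure.\<close>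

lemma L1_plus_L2_levels_tendsto_zero:
  assumes f: "f \<in> L1_plus_L2 M" and "0 < \<delta>"
  shows "\<exists>n. emeasure M {x \<in> space M. real (Suc n) < cmod (f x)} < ennreal \<delta>"
proof -
  have [measurable]: "f \<in> borel_measurable M" using f by (rule L1_plus_L2_measurable)
  let ?L = "\<lambda>n. {x \<in> space M. real (Suc n) < cmod (f x)}"
  have "decseq ?L" by (auto simp: decseq_def)
  have "x \<notin> (\<Inter>n. ?L n)" for x
  proof -
    obtain n where "cmod (f x) < real n" using reals_Archimedean2 by blast
    then have "x \<notin> ?L n" by simp
    then show ?thesis by blast
  qed
  then have "(\<Inter>n. ?L n) = {}" by blast
  have lim: "(\<lambda>n. emeasure M (?L n)) \<longlonglongrightarrow> 0"
  proof -
    have "emeasure M (?L n) \<noteq> \<infinity>" for n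
      using L1_plus_L2_level_finite[OF f, of "real (Suc n)"] by simp
    moreover have "range ?L \<subseteq> sets M" by auto
    ultimately show ?thesis
      using Lim_emeasure_decseq[of ?L M] \<open>decseq ?L\<close> \<open>(\<Inter>n. ?L n) = {}\<close> by simp
  qed
  have "eventually (\<lambda>n. emeasure M (?L n) < ennreal \<delta>) sequentially"
    using lim \<open>0 < \<delta>\<close> by (intro order_tendstoD) auto
  then show ?thesis by (auto simp: eventually_sequentially)
qed

lemma decr_rearr_finite:
  assumes f: "f \<in> L1_plus_L2 M" and "0 < t"
  shows "decr_rearr M f t < \<infinity>"
proof -
  have [measurable]: "f \<in> borel_measurable M" using f by (rule L1_plus_L2_measurable)
  obtain n where "emeasure M {x \<in> space M. real (Suc n) < cmod (f x)} < ennreal t"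
    using L1_plus_L2_levels_tendsto_zero[OF assms] by auto
  then have "decr_rearr M f t \<le> ennreal (real (Suc n))"
    by (subst decr_rearr_le_iff) auto
  then show ?thesis by (auto intro: le_less_trans)
qed

text \<open>The function \<open>\<phi>\<close> is a generalized inverse of \<open>\<psi>\<close>; it turns level sets of \<open>\<psi>(|f|)\<close> into level sets of \<open>|f|\<close>.\<close>

lemma (in sigma_finite_measure) nn_integral_eq_of_equidistributed:
  assumes [measurable]: "f \<in> borel_measurable M" "g \<in> borel_measurable M"
    and eq: "\<And>s. 0 \<le> s \<Longrightarrow> emeasure M {x \<in> space M. s < cmod (f x)} = emeasure M {x \<in> space M. s < cmod (g x)}"
    and \<psi> [measurable]: "\<psi> \<in> borel_measurable borel"
    and \<phi>: "\<And>s x. 0 \<le> s \<Longrightarrow> 0 \<le> x \<Longrightarrow> s < \<psi> x \<longleftrightarrow> \<phi> s < x" "\<And>s. 0 \<le> s \<Longrightarrow> 0 \<le> \<phi> s"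
  shows "(\<integral>\<^sup>+x. ennreal (\<psi> (cmod (f x))) \<partial>M) = (\<integral>\<^sup>+x. ennreal (\<psi> (cmod (g x))) \<partial>M)"
proof -
  have "emeasure M {x \<in> space M. ennreal s < ennreal (\<psi> (cmod (f x)))} =
    emeasure M {x \<in> space M. ennreal s < ennreal (\<psi> (cmod (g x)))}" if "0 \<le> s" for s
    using that eq[of "\<phi> s"] \<phi> by (simp add: ennreal_less_iff)
  then show ?thesis
    by (subst (1 2) nn_integral_layers) (auto intro!: nn_integral_cong split: split_indicator)
qed

lemma (in sigma_finite_measure) L1_plus_L2_equidistributed:
  assumes "f \<in> L1_plus_L2 M" "g \<in> borel_measurable M"
    and "\<And>s. 0 \<le> s \<Longrightarrow> emeasure M {x \<in> space M. s < cmod (f x)} = emeasure M {x \<in> space M. s < cmod (g x)}"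
  shows "g \<in> L1_plus_L2 M"
proof -
  have *: "s < min x (x\<^sup>2) \<longleftrightarrow> max s (sqrt s) < x" if "0 \<le> s" "0 \<le> x" for s x :: real
    using that real_sqrt_less_iff[of s "x\<^sup>2"] by (simp add: real_sqrt_abs)
  have "(\<integral>\<^sup>+x. ennreal (min (cmod (f x)) ((cmod (f x))\<^sup>2)) \<partial>M) = (\<integral>\<^sup>+x. ennreal (min (cmod (g x)) ((cmod (g x))\<^sup>2)) \<partial>M)"
    using assms L1_plus_L2_measurable[OF assms(1)] *
    by (intro nn_integral_eq_of_equidistributed[where \<phi> = "\<lambda>s. max s (sqrt s)"]) auto
  then show ?thesis using assms by (simp add: L1_plus_L2_iff)
qed

text \<open>The symmetric rearrangement as a complex-valued function. The default value zero of \<^const>\<open>enn2real\<close> is taken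
  where the rearrangement is infinite.\<close>

definition fin_rearr :: "'a measure \<Rightarrow> ('a \<Rightarrow> real) \<Rightarrow> ('a \<Rightarrow> complex) \<Rightarrow> 'a \<Rightarrow> complex" where
  "fin_rearr M \<rho> h x = complex_of_real (enn2real (sym_rearr M \<rho> h x))"

context rearr_space
begin

lemma measurable_fin_rearr [measurable]:
  assumes [measurable]: "h \<in> borel_measurable M"
  shows "fin_rearr M \<rho> h \<in> borel_measurable M"
  unfolding fin_rearr_def by measurable

lemma emeasure_fin_rearr:
  assumes [measurable]: "h \<in> borel_measurable M" and "0 \<le> s"
    and fin: "AE x in M. sym_rearr M \<rho> h x < \<infinity>"
  shows "emeasure M {x \<in> space M. s < cmod (fin_rearr M \<rho> h x)} = emeasure M {x \<in> space M. s < cmod (h x)}"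
proof -
  have "emeasure M {x \<in> space M. s < cmod (fin_rearr M \<rho> h x)} =
      emeasure M {x \<in> space M. ennreal s < sym_rearr M \<rho> h x}"
  proof (rule emeasure_eq_AE)
    show "AE x in M. (x \<in> {x \<in> space M. s < cmod (fin_rearr M \<rho> h x)}) =
        (x \<in> {x \<in> space M. ennreal s < sym_rearr M \<rho> h x})"
      using fin
    proof (eventually_elim)
      case (elim x)
      then show ?case using \<open>0 \<le> s\<close>
        by (cases "sym_rearr M \<rho> h x") (auto simp: fin_rearr_def ennreal_less_iff)
    qed
  qed measurable
  then show ?thesis using emeasure_sym_rearr assms by simp
qed

lemma sym_rearr_finite_AE:
  assumes f: "f \<in> L1_plus_L2 M"
  shows "AE x in M. sym_rearr M \<rho> f x < \<infinity>"
  using rho_pos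
proof eventually_elim
  case (elim x)
  then obtain \<delta> where \<delta>: "0 < \<delta>" "\<And>S. S \<in> sets M \<Longrightarrow> emeasure M S \<le> ennreal \<delta> \<Longrightarrow> emeasure M S \<le> ennreal (\<rho> x)"
    by auto
  have [measurable]: "f \<in> borel_measurable M" using f by (rule L1_plus_L2_measurable)
  obtain n where "emeasure M {x \<in> space M. real (Suc n) < cmod (f x)} < ennreal \<delta>"
    using L1_plus_L2_levels_tendsto_zero[OF f \<delta>(1)] by auto
  then have "emeasure M {x \<in> space M. real (Suc n) < cmod (f x)} \<le> ennreal (\<rho> x)" by (intro \<delta>) auto
  then have "sym_rearr M \<rho> f x \<le> ennreal (real (Suc n))"
    unfolding sym_rearr_def using f by (subst decr_rearr_le_iff) (auto intro: L1_plus_L2_measurable)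
  then show ?case by (auto intro: le_less_trans)
qed

lemma fin_rearr_L1_plus_L2:
  assumes "f \<in> L1_plus_L2 M" shows "fin_rearr M \<rho> f \<in> L1_plus_L2 M"
  using L1_plus_L2_measurable[OF assms] sym_rearr_finite_AE[OF assms]
  by (intro L1_plus_L2_equidistributed[OF assms]) (simp_all add: measurable_fin_rearr emeasure_fin_rearr)

lemma fin_rearr_L1:
  assumes "f \<in> Lp_space M 1" shows "fin_rearr M \<rho> f \<in> Lp_space M 1"
proof -
  have [measurable]: "f \<in> borel_measurable M" using assms by (simp add: Lp_space_one_iff)
  have "(\<integral>\<^sup>+x. ennreal (cmod (f x)) \<partial>M) = (\<integral>\<^sup>+x. ennreal (cmod (fin_rearr M \<rho> f x)) \<partial>M)"
    using sym_rearr_finite_AE[OF Lp_one_subset[OF assms]]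
    by (intro nn_integral_eq_of_equidistributed[where \<phi> = "\<lambda>s. s" and \<psi> = "\<lambda>s. s"])
      (auto simp: emeasure_fin_rearr)
  then show ?thesis using assms by (simp add: Lp_space_one_iff)
qed

end

section \<open>Associate functionals\<close>

lemma ennreal_zero_if_multiples_bounded:
  fixes I A :: ennreal
  assumes "\<And>n. of_nat (Suc n) * I \<le> A" "A < \<infinity>"
  shows "I = 0"
proof (cases I)
  case (real r)
  obtain a where a: "A = ennreal a" "0 \<le> a" using \<open>A < \<infinity>\<close> by (cases A) auto
  have le: "real (Suc n) * r \<le> a" for n
    using assms(1)[of n] real a
    by (simp add: ennreal_of_nat_eq_real_of_nat ennreal_mult[symmetric] del: of_nat_Suc)
  have "r \<le> 0"
  proof (rule ccontr)
    assume "\<not> r \<le> 0"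
    then obtain n where "a < real n * r" using reals_Archimedean3[of r] by auto
    with le[of n] \<open>\<not> r \<le> 0\<close> show False by (auto simp: algebra_simps)
  qed
  then show ?thesis using real by simp
next
  case top
  then show ?thesis using assms(1)[of 0] assms(2) by (auto simp: top_unique)
qed

text \<open>Hoelder's inequality. Positive homogeneity allows one to normalize \<open>F\<close>; if \<open>X F = 0\<close>, all multiples of \<open>F\<close>
  lie in the unit ball, hence the integral vanishes.\<close>

lemma nn_integral_le_associate:
  assumes X: "pos_homogeneous M X"
    and [measurable]: "u \<in> borel_measurable M" "F \<in> borel_measurable M"
    and fin: "associate M X u < \<infinity>" "X F < \<infinity>"
  shows "(\<integral>\<^sup>+x. u x * ennreal (cmod (F x)) \<partial>M) \<le> associate M X u * X F"
proof -
  have *: "ennreal c * (\<integral>\<^sup>+x. u x * ennreal (cmod (F x)) \<partial>M) \<le> associate M X u"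
    if c: "0 < c" "ennreal c * X F \<le> 1" for c
  proof -
    have "X (\<lambda>x. complex_of_real c * F x) \<le> 1"
      using X c unfolding pos_homogeneous_def by simp
    then have "(\<integral>\<^sup>+x. u x * ennreal (cmod (complex_of_real c * F x)) \<partial>M) \<le> associate M X u"
      unfolding associate_def by (intro SUP_upper2[of "\<lambda>x. complex_of_real c * F x"]) auto
    also have "(\<integral>\<^sup>+x. u x * ennreal (cmod (complex_of_real c * F x)) \<partial>M)
        = ennreal c * (\<integral>\<^sup>+x. u x * ennreal (cmod (F x)) \<partial>M)"
      using c by (subst nn_integral_cmult[symmetric])
        (auto intro!: nn_integral_cong simp: norm_mult ennreal_mult ac_simps)
    finally show ?thesis .
  qed
  show ?thesis
  proof (cases "X F = 0")
    case True
    have "of_nat (Suc n) * (\<integral>\<^sup>+x. u x * ennreal (cmod (F x)) \<partial>M) \<le> associate M X u" for n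
      using *[of "real (Suc n)"] True by (simp add: ennreal_of_nat_eq_real_of_nat del: of_nat_Suc)
    from ennreal_zero_if_multiples_bounded[OF this fin(1)] show ?thesis by simp
  next
    case False
    then obtain r where r: "X F = ennreal r" "0 < r" using fin(2)
      by (cases "X F") (auto simp: less_le)
    then have "ennreal (1 / r) * (\<integral>\<^sup>+x. u x * ennreal (cmod (F x)) \<partial>M) \<le> associate M X u"
      by (intro *) (auto simp: ennreal_mult[symmetric])
    then have "ennreal r * (ennreal (1 / r) * (\<integral>\<^sup>+x. u x * ennreal (cmod (F x)) \<partial>M)) \<le> ennreal r * associate M X u"
      by (rule mult_left_mono) simp
    then show ?thesis using r by (simp add: mult.assoc[symmetric] ennreal_mult[symmetric]) (simp add: ac_simps)
  qed
qed

text \<open>By Hoelder's inequality the second associate never exceeds the functional, so a function on which the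
  second associate is infinite is one on which the functional itself is infinite. Left-admissibility covers
  the others. This is how positive homogeneity turns left-admissibility into an identity on all
  measurable functions.\<close>

lemma eq_second_associate:
  assumes X: "pos_homogeneous M X" and L: "left_admissible M \<rho> X" and F [measurable]: "F \<in> borel_measurable M"
  shows "X F = associate_norm M (associate_norm M X) F"
proof -
  have "associate_norm M (associate_norm M X) F \<le> X F"
  proof (cases "X F < \<infinity>")
    case True
    show ?thesis
      unfolding associate_norm_def[of M "associate_norm M X"] associate_def[of M "associate_norm M X"]
    proof (rule SUP_least, clarify)
      fix g assume [measurable]: "g \<in> borel_measurable M" and g: "associate_norm M X g \<le> 1"
      have "(\<integral>\<^sup>+x. ennreal (cmod (g x)) * ennreal (cmod (F x)) \<partial>M) \<le> associate M X (\<lambda>x. ennreal (cmod (g x))) * X F"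
        using g True by (intro nn_integral_le_associate[OF X]) (auto simp: associate_norm_def intro: le_less_trans)
      also have "\<dots> \<le> 1 * X F"
        using g unfolding associate_norm_def by (intro mult_right_mono) auto
      finally show "(\<integral>\<^sup>+x. ennreal (cmod (F x)) * ennreal (cmod (g x)) \<partial>M) \<le> X F"
        by (simp add: mult.commute)
    qed
  qed (auto simp: not_less top_unique)
  moreover have "X F = associate_norm M (associate_norm M X) F" if "associate_norm M (associate_norm M X) F < \<infinity>"
    using L F that unfolding left_admissible_def by blast
  ultimately show ?thesis
    by (cases "associate_norm M (associate_norm M X) F < \<infinity>") (auto simp: not_less top_unique)
qed

text \<open>As a supremum of integrals against \<open>|F|\<close>, the functional depends monotonically on \<open>|F|\<close> up to null sets.\<close>

lemma functional_mono_AE: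
  assumes X: "pos_homogeneous M X" "left_admissible M \<rho> X"
    and [measurable]: "F \<in> borel_measurable M" "G \<in> borel_measurable M"
    and le: "AE x in M. cmod (F x) \<le> cmod (G x)"
  shows "X F \<le> X G"
  unfolding eq_second_associate[OF X \<open>F \<in> _\<close>] eq_second_associate[OF X \<open>G \<in> _\<close>]
    associate_norm_def[of M "associate_norm M X"] associate_def[of M "associate_norm M X"]
proof (rule SUP_mono)
  fix g assume g: "g \<in> {g \<in> borel_measurable M. associate_norm M X g \<le> 1}"
  have "(\<integral>\<^sup>+x. ennreal (cmod (F x)) * ennreal (cmod (g x)) \<partial>M) \<le> (\<integral>\<^sup>+x. ennreal (cmod (G x)) * ennreal (cmod (g x)) \<partial>M)"
    using le by (intro nn_integral_mono_AE, eventually_elim) (auto intro!: mult_right_mono ennreal_leI)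
  with g show "\<exists>m\<in>{g \<in> borel_measurable M. associate_norm M X g \<le> 1}.
      (\<integral>\<^sup>+x. ennreal (cmod (F x)) * ennreal (cmod (g x)) \<partial>M) \<le> (\<integral>\<^sup>+x. ennreal (cmod (G x)) * ennreal (cmod (m x)) \<partial>M)"
    by blast
qed

lemma power_norm_mono_AE:
  assumes X: "pos_homogeneous M X" "left_admissible M \<rho> X" and "0 < \<beta>"
    and [measurable]: "F \<in> borel_measurable M" "G \<in> borel_measurable M"
    and le: "AE x in M. cmod (F x) \<le> cmod (G x)"
  shows "power_norm \<beta> X F \<le> power_norm \<beta> X G"
  unfolding power_norm_def
proof (intro ennreal_powr_mono functional_mono_AE[OF X])
  show "AE x in M. cmod (complex_of_real (cmod (F x) powr \<beta>)) \<le> cmod (complex_of_real (cmod (G x) powr \<beta>))"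
    using le by eventually_elim (use \<open>0 < \<beta>\<close> in \<open>auto intro!: powr_mono2\<close>)
qed (use \<open>0 < \<beta>\<close> in auto)

lemma power_norm_scale:
  assumes X: "pos_homogeneous M X" and "0 < \<beta>" "0 < c"
    and [measurable]: "F \<in> borel_measurable M"
  shows "power_norm \<beta> X (\<lambda>x. complex_of_real c * F x) = ennreal c * power_norm \<beta> X F"
proof -
  have "(\<lambda>x. complex_of_real (cmod (complex_of_real c * F x) powr \<beta>))
      = (\<lambda>x. complex_of_real (c powr \<beta>) * complex_of_real (cmod (F x) powr \<beta>))"
    using \<open>0 < c\<close> by (auto simp: norm_mult powr_mult)
  moreover have "X (\<lambda>x. complex_of_real (c powr \<beta>) * complex_of_real (cmod (F x) powr \<beta>))
      = ennreal (c powr \<beta>) * X (\<lambda>x. complex_of_real (cmod (F x) powr \<beta>))"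
    using X \<open>0 < c\<close> unfolding pos_homogeneous_def by simp
  ultimately show ?thesis
    using assms(2,3) by (simp add: power_norm_def ennreal_powr_mult powr_powr)
qed

section \<open>Invariance properties of the extremal functional\<close>

text \<open>The difference of the two functions has zero norm in \<open>L\<^sup>1\<close>, so its image vanishes almost everywhere.\<close>

lemma sublinear_AE_cong:
  assumes T: "sublinear_operator D E T" "joint_strong_type D E K T"
    and f: "f \<in> L1_plus_L2 D" "f' \<in> L1_plus_L2 D" and eq: "AE x in D. f x = f' x"
  shows "AE y in E. cmod (T f y) \<le> cmod (T f' y)"
proof -
  have [measurable]: "f \<in> borel_measurable D" "f' \<in> borel_measurable D"
    using f by (auto intro: L1_plus_L2_measurable)
  let ?d = "\<lambda>x. f x - f' x"
  have "(\<integral>\<^sup>+x. ennreal (cmod (?d x)) \<partial>D) = (\<integral>\<^sup>+x. 0 \<partial>D)"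
    using eq by (intro nn_integral_cong_AE) (auto elim: eventually_mono)
  then have 0: "(\<integral>\<^sup>+x. ennreal (cmod (?d x)) \<partial>D) = 0" by simp
  then have d: "?d \<in> Lp_space D 1" by (simp add: Lp_space_one_iff)
  then have dL: "?d \<in> L1_plus_L2 D" by (rule Lp_one_subset)
  have [measurable]: "T ?d \<in> borel_measurable E"
    using T(1) dL by (simp add: sublinear_operator_def)
  have "Linf_norm E (T ?d) \<le> ennreal K * Lp_norm D 1 ?d"
    using T(2) d by (simp add: joint_strong_type_def)
  then have "AE y in E. ennreal (cmod (T ?d y)) \<le> 0"
    by (intro Linf_norm_le_iff[THEN iffD1]) (simp_all add: Lp_norm_one 0)
  moreover have "AE y in E. cmod (T (\<lambda>x. f' x + ?d x) y) \<le> cmod (T f' y) + cmod (T ?d y)"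
    using T(1)[unfolded sublinear_operator_def, THEN conjunct2, THEN conjunct1, rule_format, OF f(2) dL] .
  ultimately show ?thesis by eventually_elim simp
qed

lemma nn_integral_fibres:
  assumes [measurable]: "u \<in> borel_measurable M" "k \<in> M \<rightarrow>\<^sub>M count_space (UNIV :: int set)"
  shows "(\<integral>\<^sup>+x. u x \<partial>M) = (\<integral>\<^sup>+i. (\<integral>\<^sup>+x. u x * indicator {x. k x = i} x \<partial>M) \<partial>count_space UNIV)"
proof -
  have "(\<integral>\<^sup>+i. (\<integral>\<^sup>+x. u x * indicator {x. k x = i} x \<partial>M) \<partial>count_space UNIV)
      = (\<integral>\<^sup>+x. (\<integral>\<^sup>+i. u x * indicator {x. k x = i} x \<partial>count_space UNIV) \<partial>M)"
    by (rule nn_integral_count_space_nn_integral[symmetric]) auto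
  also have "\<dots> = (\<integral>\<^sup>+x. u x \<partial>M)"
  proof (rule nn_integral_cong)
    fix x
    have "(\<integral>\<^sup>+i. u x * indicator {x. k x = i} x \<partial>count_space UNIV)
        = (\<integral>\<^sup>+i. u x * indicator {k x} i \<partial>count_space UNIV)"
      by (intro nn_integral_cong) (auto split: split_indicator)
    then show "(\<integral>\<^sup>+i. u x * indicator {x. k x = i} x \<partial>count_space UNIV) = u x"
      by (simp add: nn_integral_cmult)
  qed
  finally show ?thesis by simp
qed

lemma ceiling_log_bounds:
  assumes "1 < r" "0 < x"
  shows "r powr (of_int (\<lceil>log r x\<rceil> - 1)) < x" "x \<le> r powr (of_int \<lceil>log r x\<rceil>)"
proof -
  have "of_int (\<lceil>log r x\<rceil> - 1) < log r x" by linarith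
  then show "r powr (of_int (\<lceil>log r x\<rceil> - 1)) < x"
    by (intro less_log_iff[THEN iffD1] assms)
  have "log r x \<le> of_int \<lceil>log r x\<rceil>" by linarith
  then show "x \<le> r powr (of_int \<lceil>log r x\<rceil>)"
    by (intro log_le_iff[THEN iffD1] assms)
qed

lemma ceiling_log_iff:
  assumes "1 < r"
  shows "r powr of_int (i - 1) < x \<and> x \<le> r powr of_int i \<longleftrightarrow> 0 < x \<and> \<lceil>log r x\<rceil> = i"
proof safe
  assume *: "r powr of_int (i - 1) < x" "x \<le> r powr of_int i"
  show x: "0 < x" using *(1) powr_gt_zero[of r "of_int (i - 1)"] assms by linarith
  have "of_int (i - 1) < log r x" by (intro less_log_iff[THEN iffD2] assms x *)
  moreover have "log r x \<le> of_int i" by (intro log_le_iff[THEN iffD2] assms x *)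
  ultimately show "\<lceil>log r x\<rceil> = i" by (intro ceiling_unique) auto
qed (use ceiling_log_bounds[OF assms] in auto)

lemma average_L1_bound:
  fixes h g :: "'a \<Rightarrow> complex"
  assumes [measurable]: "h \<in> borel_measurable M" "g \<in> borel_measurable M" "A \<in> sets M"
    and b: "0 < b" "\<And>x. x \<in> A \<Longrightarrow> b \<le> cmod (g x)" and fin: "emeasure M A < \<infinity>"
  shows "ennreal (cmod ((\<integral>x. indicator A x *\<^sub>R (h x / g x) \<partial>M) / measure M A)) * emeasure M A
    \<le> ennreal (1 / b) * (\<integral>\<^sup>+x. ennreal (cmod (h x)) * indicator A x \<partial>M)"
proof (cases "measure M A = 0")
  case True
  then show ?thesis using fin by (simp add: emeasure_eq_ennreal_measure less_top)
next
  case False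
  have eA: "emeasure M A = ennreal (measure M A)" using fin by (simp add: emeasure_eq_ennreal_measure less_top)
  have mA: "0 < measure M A" using False measure_nonneg[of M A] by linarith
  let ?I = "\<integral>x. indicator A x *\<^sub>R (h x / g x) \<partial>M"
  have "ennreal (cmod (?I / measure M A)) * emeasure M A = ennreal (cmod ?I)"
    using mA by (simp add: eA ennreal_mult[symmetric] norm_divide)
  also have "\<dots> \<le> (\<integral>\<^sup>+x. ennreal (cmod (indicator A x *\<^sub>R (h x / g x))) \<partial>M)"
  proof (cases "integrable M (\<lambda>x. indicator A x *\<^sub>R (h x / g x))")
    case True
    then show ?thesis by (rule integral_norm_bound_ennreal)
  qed (simp add: not_integrable_integral_eq)
  also have "\<dots> \<le> (\<integral>\<^sup>+x. ennreal (1 / b) * (ennreal (cmod (h x)) * indicator A x) \<partial>M)"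
  proof (intro nn_integral_mono)
    fix x
    show "ennreal (cmod (indicator A x *\<^sub>R (h x / g x))) \<le> ennreal (1 / b) * (ennreal (cmod (h x)) * indicator A x)"
    proof (cases "x \<in> A")
      case True
      then have "cmod (h x) / cmod (g x) \<le> cmod (h x) / b"
        using b by (intro divide_left_mono) (auto intro!: mult_pos_pos intro: less_le_trans)
      then show ?thesis using b True by (simp add: ennreal_mult[symmetric] norm_divide)
    qed simp
  qed
  also have "\<dots> = ennreal (1 / b) * (\<integral>\<^sup>+x. ennreal (cmod (h x)) * indicator A x \<partial>M)"
    by (rule nn_integral_cmult) auto
  finally show ?thesis .
qed

text \<open>The Cauchy-Schwarz inequality upgrades the bound for averages in the mean to mean squares.\<close>

lemma average_L2_bound:
  fixes h g :: "'a \<Rightarrow> complex"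
  assumes [measurable]: "h \<in> borel_measurable M" "g \<in> borel_measurable M" "A \<in> sets M"
    and b: "0 < b" "\<And>x. x \<in> A \<Longrightarrow> b \<le> cmod (g x)" and fin: "emeasure M A < \<infinity>"
  shows "ennreal ((cmod ((\<integral>x. indicator A x *\<^sub>R (h x / g x) \<partial>M) / measure M A))\<^sup>2) * emeasure M A
    \<le> ennreal ((1 / b)\<^sup>2) * (\<integral>\<^sup>+x. ennreal ((cmod (h x))\<^sup>2) * indicator A x \<partial>M)"
    (is "ennreal (?c\<^sup>2) * _ \<le> _ * ?B")
proof (cases "measure M A = 0")
  case True
  then show ?thesis using fin by (simp add: emeasure_eq_ennreal_measure less_top)
next
  case False
  have eA: "emeasure M A = ennreal (measure M A)" using fin by (simp add: emeasure_eq_ennreal_measure less_top)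
  have mA: "0 < measure M A" using False measure_nonneg[of M A] by linarith
  let ?m = "emeasure M A"
  have m: "?m \<noteq> 0" "?m \<noteq> top" using fin mA eA by auto
  have "?m * (ennreal (?c\<^sup>2) * ?m) = (ennreal ?c * ?m)\<^sup>2"
    by (simp add: power2_eq_square ennreal_mult ac_simps)
  also have "\<dots> \<le> (ennreal (1 / b) * (\<integral>\<^sup>+x. ennreal (cmod (h x)) * indicator A x \<partial>M))\<^sup>2"
    using average_L1_bound[OF assms] by (intro power_mono) auto
  also have "\<dots> = ennreal ((1 / b)\<^sup>2) * (\<integral>\<^sup>+x. (ennreal (cmod (h x)) * indicator A x) * indicator A x \<partial>M)\<^sup>2"
    using b by (simp add: power_mult_distrib ennreal_power mult.assoc indicator_inter_arith[symmetric])
  also have "\<dots> \<le> ennreal ((1 / b)\<^sup>2) * ((\<integral>\<^sup>+x. (ennreal (cmod (h x)) * indicator A x)\<^sup>2 \<partial>M) * (\<integral>\<^sup>+x. (indicator A x)\<^sup>2 \<partial>M))"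
    by (intro mult_left_mono Cauchy_Schwarz_nn_integral) auto
  also have "(\<integral>\<^sup>+x. (ennreal (cmod (h x)) * indicator A x)\<^sup>2 \<partial>M) = ?B"
    by (intro nn_integral_cong) (auto simp: ennreal_power split: split_indicator)
  also have "(\<integral>\<^sup>+x. (indicator A x)\<^sup>2 \<partial>M) = (\<integral>\<^sup>+x. indicator A x \<partial>M)"
    by (intro nn_integral_cong) (auto split: split_indicator)
  finally have "?m * (ennreal (?c\<^sup>2) * ?m) \<le> ?m * (ennreal ((1 / b)\<^sup>2) * ?B)"
    by (simp add: ac_simps)
  then show ?thesis using m by (simp add: ennreal_mult_le_mult_iff)
qed

lemma L1_plus_L2_integrable_on_finite:
  assumes h: "h \<in> L1_plus_L2 M" and [measurable]: "g \<in> borel_measurable M" "A \<in> sets M"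
    and b: "0 < b" "\<And>x. x \<in> A \<Longrightarrow> b \<le> cmod (g x)" and fin: "emeasure M A < \<infinity>"
  shows "integrable M (\<lambda>x. indicator A x *\<^sub>R (h x / g x))"
proof (rule integrableI_bounded)
  have [measurable]: "h \<in> borel_measurable M" using h by (rule L1_plus_L2_measurable)
  show "(\<lambda>x. indicator A x *\<^sub>R (h x / g x)) \<in> borel_measurable M" by measurable
  have "(\<integral>\<^sup>+x. ennreal (norm (indicator A x *\<^sub>R (h x / g x))) \<partial>M)
      \<le> (\<integral>\<^sup>+x. ennreal (1 / b) * (ennreal (min (cmod (h x)) ((cmod (h x))\<^sup>2)) + indicator A x) \<partial>M)"
  proof (intro nn_integral_mono)
    fix x
    show "ennreal (norm (indicator A x *\<^sub>R (h x / g x)))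
      \<le> ennreal (1 / b) * (ennreal (min (cmod (h x)) ((cmod (h x))\<^sup>2)) + indicator A x)"
    proof (cases "x \<in> A")
      case True
      have "cmod (h x) / cmod (g x) \<le> cmod (h x) / b"
        using b True by (intro divide_left_mono) (auto intro!: mult_pos_pos intro: less_le_trans)
      also have "\<dots> \<le> (1 / b) * (min (cmod (h x)) ((cmod (h x))\<^sup>2) + 1)"
      proof -
        have "t \<le> min t (t\<^sup>2) + 1" if "0 \<le> t" for t :: real
          using that by (cases "t \<le> 1") (auto simp: min_def power2_eq_square intro: add_increasing)
        from this[of "cmod (h x)"] show ?thesis
          using b by (simp add: divide_right_mono)
      qed
      finally show ?thesis using b True
        by (simp add: ennreal_mult[symmetric] norm_divide flip: ennreal_1 ennreal_plus)
    qed simp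
  qed
  also have "\<dots> = ennreal (1 / b) * ((\<integral>\<^sup>+x. ennreal (min (cmod (h x)) ((cmod (h x))\<^sup>2)) \<partial>M) + emeasure M A)"
    by (subst nn_integral_cmult) (auto simp: nn_integral_add)
  also have "\<dots> < \<infinity>"
    using h fin by (auto simp: L1_plus_L2_iff ennreal_mult_less_top)
  finally show "(\<integral>\<^sup>+x. ennreal (norm (indicator A x *\<^sub>R (h x / g x))) \<partial>M) < \<infinity>" .
qed

text \<open>Equidistributed functions are moved onto each other by a linear operator that is almost a contraction on
  \<open>L\<^sup>1\<close> and on \<open>L\<^sup>2\<close>. On the shell where \<open>|f|\<close> lies between two consecutive powers of \<open>r\<close> the operator is
  multiplication of \<open>f\<close> with the average of \<open>h / g\<close> over the corresponding shell of \<open>g\<close>. Both shells have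
  the same finite measure, and on them \<open>|f|\<close> and \<open>|g|\<close> agree up to the factor \<open>r\<close>; so \<open>|S h|\<close> is at most \<open>r\<close>
  times the average of \<open>|h|\<close> over the shell.\<close>

lemma transplantation:
  fixes f g :: "'a \<Rightarrow> complex"
  assumes f: "f \<in> L1_plus_L2 M" and g: "g \<in> L1_plus_L2 M" and "1 < r"
    and eq: "\<And>s. 0 \<le> s \<Longrightarrow> emeasure M {x \<in> space M. s < cmod (f x)} = emeasure M {x \<in> space M. s < cmod (g x)}"
  obtains S :: "('a \<Rightarrow> complex) \<Rightarrow> 'a \<Rightarrow> complex" where
    "\<And>h. h \<in> L1_plus_L2 M \<Longrightarrow> S h \<in> L1_plus_L2 M"
    "\<And>h h'. h \<in> L1_plus_L2 M \<Longrightarrow> h' \<in> L1_plus_L2 M \<Longrightarrow> S (\<lambda>x. h x + h' x) = (\<lambda>x. S h x + S h' x)"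
    "\<And>c h. S (\<lambda>x. c * h x) = (\<lambda>x. c * S h x)"
    "\<And>h. h \<in> Lp_space M 1 \<Longrightarrow> S h \<in> Lp_space M 1 \<and> Lp_norm M 1 (S h) \<le> ennreal r * Lp_norm M 1 h"
    "\<And>h. h \<in> Lp_space M 2 \<Longrightarrow> S h \<in> Lp_space M 2 \<and> Lp_norm M 2 (S h) \<le> ennreal r * Lp_norm M 2 h"
    "AE x in M. S g x = f x"
proof -
  have [measurable]: "f \<in> borel_measurable M" "g \<in> borel_measurable M"
    using f g by (auto intro: L1_plus_L2_measurable)
  have r0: "0 < r" using \<open>1 < r\<close> by simp
  define G where "G k = {x \<in> space M. r powr of_int (k - 1) < cmod (g x) \<and> cmod (g x) \<le> r powr of_int k}" for k :: int
  define F where "F k = {x \<in> space M. r powr of_int (k - 1) < cmod (f x) \<and> cmod (f x) \<le> r powr of_int k}" for k :: int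
  have [measurable]: "G k \<in> sets M" "F k \<in> sets M" for k unfolding G_def F_def by auto
  have level_diff: "emeasure M {x \<in> space M. r powr of_int (k - 1) < cmod (u x) \<and> cmod (u x) \<le> r powr of_int k}
      = emeasure M {x \<in> space M. r powr of_int (k - 1) < cmod (u x)} - emeasure M {x \<in> space M. r powr of_int k < cmod (u x)}"
    if u: "u \<in> L1_plus_L2 M" for u :: "'a \<Rightarrow> complex" and k :: int
  proof -
    have [measurable]: "u \<in> borel_measurable M" using u by (rule L1_plus_L2_measurable)
    have "r powr of_int (k - 1) \<le> r powr of_int k" using \<open>1 < r\<close> by (intro powr_mono) auto
    then have "{x \<in> space M. r powr of_int (k - 1) < cmod (u x) \<and> cmod (u x) \<le> r powr of_int k} =
      {x \<in> space M. r powr of_int (k - 1) < cmod (u x)} - {x \<in> space M. r powr of_int k < cmod (u x)}"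
      and "{x \<in> space M. r powr of_int k < cmod (u x)} \<subseteq> {x \<in> space M. r powr of_int (k - 1) < cmod (u x)}"
      by auto
    moreover have "emeasure M {x \<in> space M. r powr of_int k < cmod (u x)} \<noteq> \<infinity>"
      using L1_plus_L2_level_finite[OF u, of "r powr of_int k"] r0 by simp
    ultimately show ?thesis by (simp add: emeasure_Diff)
  qed
  have FG: "emeasure M (F k) = emeasure M (G k)" for k
    unfolding F_def G_def level_diff[OF f] level_diff[OF g] using eq by simp
  have Gfin: "emeasure M (G k) < \<infinity>" for k
  proof -
    have "emeasure M (G k) \<le> emeasure M {x \<in> space M. r powr of_int (k - 1) < cmod (g x)}"
      unfolding G_def by (intro emeasure_mono) auto
    also have "\<dots> < \<infinity>" using r0 by (intro L1_plus_L2_level_finite[OF g]) auto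
    finally show ?thesis .
  qed
  have Gb: "r powr of_int (k - 1) \<le> cmod (g x)" if "x \<in> G k" for x k
    using that by (auto simp: G_def)
  have rp: "0 < r powr of_int (k - 1)" for k using r0 by simp
  define kf where "kf x = \<lceil>log r (cmod (f x))\<rceil>" for x
  define kg where "kg x = \<lceil>log r (cmod (g x))\<rceil>" for x
  have [measurable]: "kf \<in> M \<rightarrow>\<^sub>M count_space UNIV" "kg \<in> M \<rightarrow>\<^sub>M count_space UNIV"
    unfolding kf_def kg_def by measurable
  have F_iff: "x \<in> F k \<longleftrightarrow> f x \<noteq> 0 \<and> kf x = k" if "x \<in> space M" for x k
    using that ceiling_log_iff[OF \<open>1 < r\<close>, of k "cmod (f x)"] by (simp add: F_def kf_def)
  have G_iff: "x \<in> G k \<longleftrightarrow> g x \<noteq> 0 \<and> kg x = k" if "x \<in> space M" for x k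
    using that ceiling_log_iff[OF \<open>1 < r\<close>, of k "cmod (g x)"] by (simp add: G_def kg_def)
  \<comment> \<open>The average of \<open>h / g\<close> over the shell; it equals one for \<open>h = g\<close>, which is why \<open>S g = f\<close>.\<close>
  define av where "av h k = (\<integral>x. indicator (G k) x *\<^sub>R (h x / g x) \<partial>M) / measure M (G k)" for h k
  define S where "S h x = (if f x = 0 then 0 else f x * av h (kf x))" for h x
  have Sm [measurable]: "S h \<in> borel_measurable M" for h
    unfolding S_def by measurable
  have S_supp: "S h x = 0 \<or> x \<in> F k \<and> cmod (S h x) \<le> r powr of_int k * cmod (av h k)"
    if "x \<in> space M" "kf x = k" for h x k
  proof (cases "f x = 0")
    case False
    then have "x \<in> F k" using F_iff that by simp
    then show ?thesis using that False
      by (auto simp: S_def norm_mult F_def intro!: mult_right_mono)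
  qed (simp add: S_def)
  have av_add: "av (\<lambda>x. h x + h' x) k = av h k + av h' k" if "h \<in> L1_plus_L2 M" "h' \<in> L1_plus_L2 M" for h h' k
  proof -
    have "integrable M (\<lambda>x. indicator (G k) x *\<^sub>R (h x / g x))" "integrable M (\<lambda>x. indicator (G k) x *\<^sub>R (h' x / g x))"
      by (rule L1_plus_L2_integrable_on_finite[OF that(1) _ _ rp Gb Gfin] L1_plus_L2_integrable_on_finite[OF that(2) _ _ rp Gb Gfin]; measurable)+
    then show ?thesis
      unfolding av_def by (simp add: add_divide_distrib scaleR_add_right)
  qed
  have av_cmult: "av (\<lambda>x. c * h x) k = c * av h k" for c h k
  proof -
    have "(\<integral>x. indicator (G k) x *\<^sub>R (c * h x / g x) \<partial>M) = (\<integral>x. c * (indicator (G k) x *\<^sub>R (h x / g x)) \<partial>M)"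
      by (intro Bochner_Integration.integral_cong) auto
    also have "\<dots> = c * (\<integral>x. indicator (G k) x *\<^sub>R (h x / g x) \<partial>M)"
      by (rule integral_mult_right_zero)
    finally show ?thesis unfolding av_def by simp
  qed
  have S1: "(\<integral>\<^sup>+x. ennreal (cmod (S h x)) \<partial>M) \<le> ennreal r * (\<integral>\<^sup>+x. ennreal (cmod (h x)) \<partial>M)"
    if [measurable]: "h \<in> borel_measurable M" for h
  proof -
    have "(\<integral>\<^sup>+x. ennreal (cmod (S h x)) * indicator {x. kf x = k} x \<partial>M)
        \<le> ennreal r * (\<integral>\<^sup>+x. ennreal (cmod (h x)) * indicator {x. kg x = k} x \<partial>M)" for k
    proof -
      have "(\<integral>\<^sup>+x. ennreal (cmod (S h x)) * indicator {x. kf x = k} x \<partial>M)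
          \<le> (\<integral>\<^sup>+x. ennreal (r powr of_int k * cmod (av h k)) * indicator (F k) x \<partial>M)"
        by (intro nn_integral_mono) (use S_supp[of _ k h] in \<open>force split: split_indicator intro: ennreal_leI\<close>)
      also have "\<dots> = ennreal (r powr of_int k) * (ennreal (cmod (av h k)) * emeasure M (G k))"
        by (subst nn_integral_cmult_indicator) (auto simp: FG ennreal_mult mult.assoc)
      also have "\<dots> \<le> ennreal (r powr of_int k) * (ennreal (1 / r powr of_int (k - 1)) * (\<integral>\<^sup>+x. ennreal (cmod (h x)) * indicator (G k) x \<partial>M))"
        unfolding av_def using rp Gb Gfin by (intro mult_left_mono average_L1_bound) auto
      also have "\<dots> = ennreal r * (\<integral>\<^sup>+x. ennreal (cmod (h x)) * indicator (G k) x \<partial>M)"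
        using r0 by (simp add: mult.assoc[symmetric] ennreal_mult[symmetric] powr_diff)
      also have "\<dots> \<le> ennreal r * (\<integral>\<^sup>+x. ennreal (cmod (h x)) * indicator {x. kg x = k} x \<partial>M)"
        by (intro mult_left_mono nn_integral_mono) (auto simp: G_iff split: split_indicator)
      finally show ?thesis .
    qed
    then have "(\<integral>\<^sup>+k. (\<integral>\<^sup>+x. ennreal (cmod (S h x)) * indicator {x. kf x = k} x \<partial>M) \<partial>count_space UNIV)
        \<le> (\<integral>\<^sup>+k. ennreal r * (\<integral>\<^sup>+x. ennreal (cmod (h x)) * indicator {x. kg x = k} x \<partial>M) \<partial>count_space UNIV)"
      by (intro nn_integral_mono)
    then show ?thesis
      by (subst nn_integral_fibres[where k = kf], measurable, subst nn_integral_fibres[where k = kg], measurable)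
        (simp add: nn_integral_cmult)
  qed
  have S2: "(\<integral>\<^sup>+x. ennreal ((cmod (S h x))\<^sup>2) \<partial>M) \<le> ennreal (r\<^sup>2) * (\<integral>\<^sup>+x. ennreal ((cmod (h x))\<^sup>2) \<partial>M)"
    if [measurable]: "h \<in> borel_measurable M" for h
  proof -
    have "(\<integral>\<^sup>+x. ennreal ((cmod (S h x))\<^sup>2) * indicator {x. kf x = k} x \<partial>M)
        \<le> ennreal (r\<^sup>2) * (\<integral>\<^sup>+x. ennreal ((cmod (h x))\<^sup>2) * indicator {x. kg x = k} x \<partial>M)" for k
    proof -
      have "(\<integral>\<^sup>+x. ennreal ((cmod (S h x))\<^sup>2) * indicator {x. kf x = k} x \<partial>M)
          \<le> (\<integral>\<^sup>+x. ennreal ((r powr of_int k)\<^sup>2 * (cmod (av h k))\<^sup>2) * indicator (F k) x \<partial>M)"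
        by (intro nn_integral_mono) (use S_supp[of _ k h] in
          \<open>force simp: power_mult_distrib[symmetric] split: split_indicator intro: ennreal_leI power_mono\<close>)
      also have "\<dots> = ennreal ((r powr of_int k)\<^sup>2) * (ennreal ((cmod (av h k))\<^sup>2) * emeasure M (G k))"
        by (subst nn_integral_cmult_indicator) (auto simp: FG ennreal_mult mult.assoc)
      also have "\<dots> \<le> ennreal ((r powr of_int k)\<^sup>2) * (ennreal ((1 / r powr of_int (k - 1))\<^sup>2) * (\<integral>\<^sup>+x. ennreal ((cmod (h x))\<^sup>2) * indicator (G k) x \<partial>M))"
        unfolding av_def using rp Gb Gfin by (intro mult_left_mono average_L2_bound) auto
      also have "\<dots> = ennreal (r\<^sup>2) * (\<integral>\<^sup>+x. ennreal ((cmod (h x))\<^sup>2) * indicator (G k) x \<partial>M)"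
        using r0 by (simp add: mult.assoc[symmetric] ennreal_mult[symmetric] powr_diff power_mult_distrib[symmetric])
      also have "\<dots> \<le> ennreal (r\<^sup>2) * (\<integral>\<^sup>+x. ennreal ((cmod (h x))\<^sup>2) * indicator {x. kg x = k} x \<partial>M)"
        by (intro mult_left_mono nn_integral_mono) (auto simp: G_iff split: split_indicator)
      finally show ?thesis .
    qed
    then have "(\<integral>\<^sup>+k. (\<integral>\<^sup>+x. ennreal ((cmod (S h x))\<^sup>2) * indicator {x. kf x = k} x \<partial>M) \<partial>count_space UNIV)
        \<le> (\<integral>\<^sup>+k. ennreal (r\<^sup>2) * (\<integral>\<^sup>+x. ennreal ((cmod (h x))\<^sup>2) * indicator {x. kg x = k} x \<partial>M) \<partial>count_space UNIV)"
      by (intro nn_integral_mono)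
    then show ?thesis
      by (subst nn_integral_fibres[where k = kf], measurable, subst nn_integral_fibres[where k = kg], measurable)
        (simp add: nn_integral_cmult)
  qed
  have SL1: "S h \<in> Lp_space M 1 \<and> Lp_norm M 1 (S h) \<le> ennreal r * Lp_norm M 1 h" if "h \<in> Lp_space M 1" for h
    using that S1[of h] Sm[of h]
    by (auto simp: Lp_space_one_iff Lp_norm_one ennreal_mult_less_top intro: le_less_trans)
  have SL2: "S h \<in> Lp_space M 2 \<and> Lp_norm M 2 (S h) \<le> ennreal r * Lp_norm M 2 h" if "h \<in> Lp_space M 2" for h
    using that S2[of h] Sm[of h] unfolding Lp_norm_two_le_iff[OF r0]
    by (auto simp: Lp_space_two_iff ennreal_mult_less_top intro: le_less_trans)
  have S_add: "S (\<lambda>x. h x + h' x) = (\<lambda>x. S h x + S h' x)" if "h \<in> L1_plus_L2 M" "h' \<in> L1_plus_L2 M" for h h'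
    by (intro ext) (simp add: S_def av_add[OF that] distrib_left)
  show thesis
  proof (rule that)
    fix h assume "h \<in> L1_plus_L2 M"
    then obtain h1 h2 where h: "h = (\<lambda>x. h1 x + h2 x)" "h1 \<in> Lp_space M 1" "h2 \<in> Lp_space M 2"
      unfolding L1_plus_L2_def by auto
    have "S h = (\<lambda>x. S h1 x + S h2 x)"
      unfolding h(1) using h(2,3) by (intro S_add Lp_one_subset Lp_two_subset)
    then show "S h \<in> L1_plus_L2 M"
      unfolding L1_plus_L2_def mem_Collect_eq using SL1[OF h(2)] SL2[OF h(3)]
      by (intro exI[of _ "S h1"] exI[of _ "S h2"]) simp
  next
    show "S (\<lambda>x. c * h x) = (\<lambda>x. c * S h x)" for c h
      by (auto simp: S_def av_cmult)
  next
    have "AE x in M. \<forall>k. emeasure M (F k) = 0 \<longrightarrow> x \<notin> F k"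
      unfolding AE_all_countable
    proof
      fix k show "AE x in M. emeasure M (F k) = 0 \<longrightarrow> x \<notin> F k"
        by (cases "emeasure M (F k) = 0") (simp_all add: AE_not_in null_setsI)
    qed
    then show "AE x in M. S g x = f x"
    proof (rule AE_mp, intro AE_I2 impI)
      fix x assume x: "x \<in> space M" and *: "\<forall>k. emeasure M (F k) = 0 \<longrightarrow> x \<notin> F k"
      show "S g x = f x"
      proof (cases "f x = 0")
        case False
        then have "x \<in> F (kf x)" using F_iff[OF x] by simp
        then have "emeasure M (G (kf x)) \<noteq> 0" using * FG by metis
        then have "measure M (G (kf x)) \<noteq> 0"
          using Gfin[of "kf x"] by (auto simp: emeasure_eq_ennreal_measure less_top)
        moreover have "(\<integral>x. indicator (G k) x *\<^sub>R (g x / g x) \<partial>M) = (\<integral>x. indicator (G k) x *\<^sub>R (1::complex) \<partial>M)" for k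
        proof (rule Bochner_Integration.integral_cong, simp)
          fix y assume "y \<in> space M"
          then show "indicator (G k) y *\<^sub>R (g y / g y) = indicator (G k) y *\<^sub>R 1"
            using G_iff[of y k] by (auto split: split_indicator)
        qed
        moreover have "(\<integral>x. indicator (G k) x *\<^sub>R (1::complex) \<partial>M) = measure M (G k)" for k
          using Gfin[of k] sets.sets_into_space[of "G k" M]
          by (subst integral_scaleR_left) (auto simp: scaleR_conv_of_real Int_absorb2)
        ultimately have "av g (kf x) = 1" by (simp add: av_def)
        then show ?thesis using False by (simp add: S_def)
      qed (simp add: S_def)
    qed
  qed (use S_add SL1 SL2 in auto)
qed

lemma ennreal_le_of_scaled:
  fixes a b :: ennreal
  assumes "\<And>r. 1 < r \<Longrightarrow> a \<le> ennreal r * b"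
  shows "a \<le> b"
proof (cases b)
  case (real c)
  have "a \<le> ennreal 2 * b" by (rule assms) simp
  then obtain d where d: "a = ennreal d" "0 \<le> d"
    using real by (cases a) (auto simp: ennreal_mult[symmetric] top_unique simp del: ennreal_numeral)
  have le: "d \<le> r * c" if "1 < r" for r
    using assms[OF that] real d that by (simp add: ennreal_mult[symmetric])
  have "z * d \<le> c" if z: "0 < z" "z < 1" for z
  proof -
    have "d \<le> (1 / z) * c" using z by (intro le) simp
    then show ?thesis using z by (simp add: pos_le_divide_eq mult.commute)
  qed
  then have "d \<le> c" by (rule field_le_mult_one_interval)
  then show ?thesis using real d by simp
qed auto

text \<open>Composing an admissible operator with a linear operator of norm at most \<open>r\<close> on \<open>L\<^sup>1\<close> and \<open>L\<^sup>2\<close> and dividing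
  by \<open>r\<close> gives an admissible operator again; homogeneity of the functional restores the factor.\<close>

lemma power_norm_compose_le:
  assumes X: "pos_homogeneous E X" and "0 < \<beta>"
    and T: "sublinear_operator D E T" "joint_strong_type D E K T"
    and S: "\<And>h. h \<in> L1_plus_L2 D \<Longrightarrow> S h \<in> L1_plus_L2 D"
      "\<And>h h'. h \<in> L1_plus_L2 D \<Longrightarrow> h' \<in> L1_plus_L2 D \<Longrightarrow> S (\<lambda>x. h x + h' x) = (\<lambda>x. S h x + S h' x)"
      "\<And>c h. S (\<lambda>x. c * h x) = (\<lambda>x. c * S h x)"
      "\<And>h. h \<in> Lp_space D 1 \<Longrightarrow> S h \<in> Lp_space D 1 \<and> Lp_norm D 1 (S h) \<le> ennreal r * Lp_norm D 1 h"
      "\<And>h. h \<in> Lp_space D 2 \<Longrightarrow> S h \<in> Lp_space D 2 \<and> Lp_norm D 2 (S h) \<le> ennreal r * Lp_norm D 2 h"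
    and r0: "0 < r" and g: "g \<in> L1_plus_L2 D"
  shows "power_norm \<beta> X (T (S g)) \<le> ennreal r * tilde_norm D E K \<beta> X g"
proof -
  have Tm: "T h \<in> borel_measurable E" if "h \<in> L1_plus_L2 D" for h
    using T(1) that by (simp add: sublinear_operator_def)
  define T' where "T' h y = complex_of_real (1 / r) * T (S h) y" for h y
  have T'm: "T' h \<in> borel_measurable E" if "h \<in> L1_plus_L2 D" for h
    unfolding T'_def using Tm[OF S(1)[OF that]] by measurable
  have T'n: "cmod (T' h y) = (1 / r) * cmod (T (S h) y)" for h y
    using r0 by (simp add: T'_def norm_mult norm_divide)
  have "sublinear_operator D E T'"
    unfolding sublinear_operator_def
  proof (intro conjI ballI allI T'm)
    fix h h' assume h: "h \<in> L1_plus_L2 D" "h' \<in> L1_plus_L2 D"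
    have "AE y in E. cmod (T (\<lambda>x. S h x + S h' x) y) \<le> cmod (T (S h) y) + cmod (T (S h') y)"
      using T(1)[unfolded sublinear_operator_def, THEN conjunct2, THEN conjunct1, rule_format, OF S(1)[OF h(1)] S(1)[OF h(2)]] .
    then show "AE y in E. cmod (T' (\<lambda>x. h x + h' x) y) \<le> cmod (T' h y) + cmod (T' h' y)"
      unfolding T'n S(2)[OF h] by eventually_elim (use r0 in \<open>simp add: field_simps\<close>)
  next
    fix h and c :: complex assume h: "h \<in> L1_plus_L2 D"
    have "AE y in E. cmod (T (\<lambda>x. c * S h x) y) = cmod c * cmod (T (S h) y)"
      using T(1)[unfolded sublinear_operator_def, THEN conjunct2, THEN conjunct2, rule_format, OF S(1)[OF h]] .
    then show "AE y in E. cmod (T' (\<lambda>x. c * h x) y) = cmod c * cmod (T' h y)"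
      unfolding T'n S(3) by eventually_elim simp
  qed
  moreover have "joint_strong_type D E K T'"
    unfolding joint_strong_type_def
  proof (intro conjI ballI)
    fix h assume h: "h \<in> Lp_space D 1"
    have [measurable]: "T (S h) \<in> borel_measurable E" "T' h \<in> borel_measurable E"
      using Tm S(1) T'm Lp_one_subset[OF h] by auto
    have "Linf_norm E (T (S h)) \<le> ennreal K * Lp_norm D 1 (S h)"
      using T(2) S(4)[OF h] by (simp add: joint_strong_type_def)
    also have "\<dots> \<le> ennreal K * (ennreal r * Lp_norm D 1 h)"
      using S(4)[OF h] by (intro mult_left_mono) auto
    finally have "AE y in E. ennreal (cmod (T (S h) y)) \<le> ennreal K * (ennreal r * Lp_norm D 1 h)"
      by (intro Linf_norm_le_iff[THEN iffD1]) auto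
    then have "AE y in E. ennreal (cmod (T' h y)) \<le> ennreal K * Lp_norm D 1 h"
    proof eventually_elim
      case (elim y)
      have "ennreal (cmod (T' h y)) = ennreal (1 / r) * ennreal (cmod (T (S h) y))"
        using r0 by (simp add: T'n ennreal_mult[symmetric])
      also have "\<dots> \<le> ennreal (1 / r) * (ennreal K * (ennreal r * Lp_norm D 1 h))"
        using elim by (intro mult_left_mono) auto
      also have "\<dots> = (ennreal (1 / r) * ennreal r) * (ennreal K * Lp_norm D 1 h)"
        by (simp only: ac_simps)
      also have "ennreal (1 / r) * ennreal r = 1"
        using r0 by (simp add: ennreal_mult[symmetric])
      finally show ?case by simp
    qed
    then show "Linf_norm E (T' h) \<le> ennreal K * Lp_norm D 1 h"
      by (intro Linf_norm_le_iff[THEN iffD2]) auto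
  next
    fix h assume h: "h \<in> Lp_space D 2"
    have [measurable]: "T (S h) \<in> borel_measurable E"
      using Tm S(1) Lp_two_subset[OF h] by auto
    have "Lp_norm E 2 (T (S h)) \<le> ennreal K * Lp_norm D 2 (S h)"
      using T(2) S(5)[OF h] by (simp add: joint_strong_type_def)
    also have "\<dots> \<le> ennreal K * (ennreal r * Lp_norm D 2 h)"
      using S(5)[OF h] by (intro mult_left_mono) auto
    finally have *: "Lp_norm E 2 (T (S h)) \<le> ennreal K * (ennreal r * Lp_norm D 2 h)" .
    have "Lp_norm E 2 (T' h) \<le> ennreal (1 / r) * Lp_norm E 2 (T (S h))"
    proof (subst Lp_norm_two_le_iff)
      have "(\<integral>\<^sup>+y. ennreal ((cmod (T' h y))\<^sup>2) \<partial>E) = (\<integral>\<^sup>+y. ennreal ((1 / r)\<^sup>2) * ennreal ((cmod (T (S h) y))\<^sup>2) \<partial>E)"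
        by (intro nn_integral_cong) (simp add: T'n power_divide ennreal_mult[symmetric])
      then show "(\<integral>\<^sup>+y. ennreal ((cmod (T' h y))\<^sup>2) \<partial>E) \<le> ennreal ((1 / r)\<^sup>2) * (\<integral>\<^sup>+y. ennreal ((cmod (T (S h) y))\<^sup>2) \<partial>E)"
        by (simp add: nn_integral_cmult)
    qed (use r0 in simp)
    also have "\<dots> \<le> ennreal (1 / r) * (ennreal K * (ennreal r * Lp_norm D 2 h))"
      using * by (intro mult_left_mono) auto
    also have "\<dots> = (ennreal (1 / r) * ennreal r) * (ennreal K * Lp_norm D 2 h)"
      by (simp only: ac_simps)
    also have "ennreal (1 / r) * ennreal r = 1"
      using r0 by (simp add: ennreal_mult[symmetric])
    finally show "Lp_norm E 2 (T' h) \<le> ennreal K * Lp_norm D 2 h" by simp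
  qed
  ultimately have le: "power_norm \<beta> X (T' g) \<le> tilde_norm D E K \<beta> X g"
    unfolding tilde_norm_def by (intro SUP_upper2[of T']) auto
  have "T (S g) = (\<lambda>y. complex_of_real r * T' g y)"
    using r0 by (auto simp: T'_def)
  then have "power_norm \<beta> X (T (S g)) = ennreal r * power_norm \<beta> X (T' g)"
    using power_norm_scale[OF X \<open>0 < \<beta>\<close> r0 T'm[OF g]] by simp
  also have "\<dots> \<le> ennreal r * tilde_norm D E K \<beta> X g" using le by (intro mult_left_mono) auto
  finally show ?thesis .
qed

text \<open>Each admissible \<open>T\<close> is compared with the composition of \<open>T\<close> and a transplantation from \<open>g\<close> to \<open>f\<close>,
  whose norm \<open>r > 1\<close> is as close to one as desired.\<close>

lemma tilde_norm_equidistributed: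
  assumes X: "pos_homogeneous E X" "left_admissible E \<rho> X" and "0 < \<beta>"
    and f: "f \<in> L1_plus_L2 D" and g: "g \<in> L1_plus_L2 D"
    and eq: "\<And>s. 0 \<le> s \<Longrightarrow> emeasure D {x \<in> space D. s < cmod (f x)} = emeasure D {x \<in> space D. s < cmod (g x)}"
  shows "tilde_norm D E K \<beta> X f \<le> tilde_norm D E K \<beta> X g"
  unfolding tilde_norm_def[of D E K \<beta> X f]
proof (rule SUP_least, clarify)
  fix T assume T: "sublinear_operator D E T" "joint_strong_type D E K T"
  have Tm: "T h \<in> borel_measurable E" if "h \<in> L1_plus_L2 D" for h
    using T(1) that by (simp add: sublinear_operator_def)
  show "power_norm \<beta> X (T f) \<le> tilde_norm D E K \<beta> X g"
  proof (rule ennreal_le_of_scaled)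
    fix r :: real assume r: "1 < r"
    obtain S where S: "\<And>h. h \<in> L1_plus_L2 D \<Longrightarrow> S h \<in> L1_plus_L2 D"
      "\<And>h h'. h \<in> L1_plus_L2 D \<Longrightarrow> h' \<in> L1_plus_L2 D \<Longrightarrow> S (\<lambda>x. h x + h' x) = (\<lambda>x. S h x + S h' x)"
      "\<And>c h. S (\<lambda>x. c * h x) = (\<lambda>x. c * S h x)"
      "\<And>h. h \<in> Lp_space D 1 \<Longrightarrow> S h \<in> Lp_space D 1 \<and> Lp_norm D 1 (S h) \<le> ennreal r * Lp_norm D 1 h"
      "\<And>h. h \<in> Lp_space D 2 \<Longrightarrow> S h \<in> Lp_space D 2 \<and> Lp_norm D 2 (S h) \<le> ennreal r * Lp_norm D 2 h"
      "AE x in D. S g x = f x"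
      using transplantation[OF f g r eq] by blast
    have "AE x in D. f x = S g x" using S(6) by eventually_elim simp
    from sublinear_AE_cong[OF T f S(1)[OF g] this]
    have "power_norm \<beta> X (T f) \<le> power_norm \<beta> X (T (S g))"
      using Tm[OF f] Tm[OF S(1)[OF g]] by (intro power_norm_mono_AE[OF X \<open>0 < \<beta>\<close>])
    also have "\<dots> \<le> ennreal r * tilde_norm D E K \<beta> X g"
      using r by (intro power_norm_compose_le[OF X(1) \<open>0 < \<beta>\<close> T S(1-5) _ g]) auto
    finally show "power_norm \<beta> X (T f) \<le> ennreal r * tilde_norm D E K \<beta> X g" .
  qed
qed

lemma tilde_norm_rearrangement_invariant:
  assumes X: "pos_homogeneous E X" "left_admissible E \<rho> X" and "0 < \<beta>"
  shows "rearrangement_invariant D (L1_plus_L2 D) (tilde_norm D E K \<beta> X)"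
  unfolding rearrangement_invariant_def
proof (intro ballI impI)
  fix f g assume fg: "f \<in> L1_plus_L2 D" "g \<in> L1_plus_L2 D" and eq: "\<forall>t\<ge>0. decr_rearr D f t = decr_rearr D g t"
  have "emeasure D {x \<in> space D. s < cmod (f x)} = emeasure D {x \<in> space D. s < cmod (g x)}" if "0 \<le> s" for s
    using fg eq that by (intro equidistributedI L1_plus_L2_measurable) auto
  then show "tilde_norm D E K \<beta> X f = tilde_norm D E K \<beta> X g"
    using tilde_norm_equidistributed[OF assms fg] tilde_norm_equidistributed[OF assms fg(2,1)] by (intro antisym) auto
qed

text \<open>Multiplication with \<open>m\<close> is absorbed into the operator, with the essential bound of \<open>m\<close> as its norm.\<close>

lemma tilde_norm_multiplier:
  assumes X: "pos_homogeneous E X" "left_admissible E \<rho> X" and "0 < \<beta>"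
    and G: "G \<in> L1_plus_L2 D" and m: "m \<in> Linf_space D"
  shows "tilde_norm D E K \<beta> X (\<lambda>x. m x * G x) \<le> tilde_norm D E K \<beta> X G * Linf_norm D m"
proof -
  have [measurable]: "m \<in> borel_measurable D" and "Linf_norm D m < \<infinity>"
    using m by (auto simp: Linf_space_def)
  then obtain c where c: "Linf_norm D m = ennreal c" "0 \<le> c" by (cases "Linf_norm D m") auto
  have "AE x in D. ennreal (cmod (m x)) \<le> ennreal c"
    by (intro Linf_norm_le_iff[THEN iffD1]) (auto simp: c)
  then have mc: "AE x in D. cmod (m x) \<le> c" using c by auto
  have M1: "(\<lambda>x. m x * h x) \<in> Lp_space D 1 \<and> Lp_norm D 1 (\<lambda>x. m x * h x) \<le> ennreal c * Lp_norm D 1 h"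
    if h: "h \<in> Lp_space D 1" for h
  proof -
    have [measurable]: "h \<in> borel_measurable D" using h by (simp add: Lp_space_def)
    have "(\<integral>\<^sup>+x. ennreal (cmod (m x * h x)) \<partial>D) \<le> (\<integral>\<^sup>+x. ennreal c * ennreal (cmod (h x)) \<partial>D)"
    proof (rule nn_integral_mono_AE)
      show "AE x in D. ennreal (cmod (m x * h x)) \<le> ennreal c * ennreal (cmod (h x))"
        using mc by eventually_elim
          (use c(2) in \<open>auto simp: norm_mult ennreal_mult[symmetric] intro!: ennreal_leI mult_right_mono\<close>)
    qed
    then have *: "(\<integral>\<^sup>+x. ennreal (cmod (m x * h x)) \<partial>D) \<le> ennreal c * (\<integral>\<^sup>+x. ennreal (cmod (h x)) \<partial>D)"
      by (simp add: nn_integral_cmult)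
    also have "\<dots> < \<infinity>" using h by (simp add: Lp_space_one_iff ennreal_mult_less_top)
    finally show ?thesis using * by (simp add: Lp_space_one_iff Lp_norm_one)
  qed
  have M2: "(\<lambda>x. m x * h x) \<in> Lp_space D 2 \<and> (0 < c \<longrightarrow> Lp_norm D 2 (\<lambda>x. m x * h x) \<le> ennreal c * Lp_norm D 2 h)"
    if h: "h \<in> Lp_space D 2" for h
  proof -
    have [measurable]: "h \<in> borel_measurable D" using h by (simp add: Lp_space_def)
    have "(\<integral>\<^sup>+x. ennreal ((cmod (m x * h x))\<^sup>2) \<partial>D) \<le> (\<integral>\<^sup>+x. ennreal (c\<^sup>2) * ennreal ((cmod (h x))\<^sup>2) \<partial>D)"
    proof (rule nn_integral_mono_AE)
      show "AE x in D. ennreal ((cmod (m x * h x))\<^sup>2) \<le> ennreal (c\<^sup>2) * ennreal ((cmod (h x))\<^sup>2)"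
        using mc by eventually_elim
          (use c(2) in \<open>auto simp: norm_mult ennreal_mult[symmetric] power_mult_distrib intro!: ennreal_leI mult_right_mono power_mono\<close>)
    qed
    then have *: "(\<integral>\<^sup>+x. ennreal ((cmod (m x * h x))\<^sup>2) \<partial>D) \<le> ennreal (c\<^sup>2) * (\<integral>\<^sup>+x. ennreal ((cmod (h x))\<^sup>2) \<partial>D)"
      by (simp add: nn_integral_cmult)
    also have "\<dots> < \<infinity>" using h by (simp add: Lp_space_two_iff ennreal_mult_less_top)
    finally show ?thesis using * by (simp add: Lp_space_two_iff Lp_norm_two_le_iff)
  qed
  have MS: "(\<lambda>x. m x * h x) \<in> L1_plus_L2 D" if hL: "h \<in> L1_plus_L2 D" for h
  proof -
    obtain h1 h2 where h: "h = (\<lambda>x. h1 x + h2 x)" "h1 \<in> Lp_space D 1" "h2 \<in> Lp_space D 2"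
      using hL unfolding L1_plus_L2_def by auto
    show ?thesis
      unfolding L1_plus_L2_def mem_Collect_eq h(1) using M1[OF h(2)] M2[OF h(3)]
      by (intro exI[of _ "\<lambda>x. m x * h1 x"] exI[of _ "\<lambda>x. m x * h2 x"]) (simp add: algebra_simps)
  qed
  show ?thesis
    unfolding tilde_norm_def[of D E K \<beta> X "\<lambda>x. m x * G x"]
  proof (rule SUP_least, clarify)
    fix T assume T: "sublinear_operator D E T" "joint_strong_type D E K T"
    have Tm: "T h \<in> borel_measurable E" if "h \<in> L1_plus_L2 D" for h
      using T(1) that by (simp add: sublinear_operator_def)
    note Tmult = T(1)[unfolded sublinear_operator_def, THEN conjunct2, THEN conjunct2, rule_format]
    show "power_norm \<beta> X (T (\<lambda>x. m x * G x)) \<le> tilde_norm D E K \<beta> X G * Linf_norm D m"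
    proof (cases "c = 0")
      case True
      have z: "(\<lambda>_. 0) \<in> L1_plus_L2 D" by (intro Lp_one_subset) (simp add: Lp_space_one_iff)
      have "AE y in E. cmod (T (\<lambda>x. 0 * 0) y) = cmod 0 * cmod (T (\<lambda>x. 0) y)"
        by (rule Tmult[OF z])
      moreover have "AE y in E. cmod (T (\<lambda>x. m x * G x) y) \<le> cmod (T (\<lambda>_. 0) y)"
        using mc True by (intro sublinear_AE_cong[OF T MS[OF G] z]) (auto elim: eventually_mono)
      ultimately have "AE y in E. cmod (T (\<lambda>x. m x * G x) y) \<le> cmod (0 :: complex)"
        by eventually_elim simp
      then have z0: "power_norm \<beta> X (T (\<lambda>x. m x * G x)) \<le> power_norm \<beta> X (\<lambda>y. 0)"
        using Tm[OF MS[OF G]] by (intro power_norm_mono_AE[OF X \<open>0 < \<beta>\<close>]) auto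
      have "X (\<lambda>y. 0) = 0"
        by (subst eq_second_associate[OF X]) (auto simp: associate_norm_def associate_def intro!: antisym SUP_least)
      then have "power_norm \<beta> X (\<lambda>y. 0) = 0" using \<open>0 < \<beta>\<close> by (simp add: power_norm_def)
      then show ?thesis using z0 by simp
    next
      case False
      then have c0: "0 < c" using c by simp
      have "power_norm \<beta> X (T (\<lambda>x. m x * G x)) \<le> ennreal c * tilde_norm D E K \<beta> X G"
        using M1 M2 MS c0
        by (intro power_norm_compose_le[OF X(1) \<open>0 < \<beta>\<close> T _ _ _ _ _ c0 G, where S = "\<lambda>h x. m x * h x"])
          (auto simp: algebra_simps)
      then show ?thesis using c by (simp add: mult.commute)
    qed
  qed
qed

lemma (in rearr_space) tilde_norm_right_admissible:
  assumes X: "pos_homogeneous E X" "left_admissible E \<rho>' X" and "0 < \<beta>"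
  shows "right_admissible M \<rho> (L1_plus_L2 M) (tilde_norm M E K \<beta> X)"
  unfolding right_admissible_def
proof (intro conjI ballI impI)
  fix G m assume "G \<in> L1_plus_L2 M" "m \<in> Linf_space M"
  then show "tilde_norm M E K \<beta> X (\<lambda>x. m x * G x) \<le> tilde_norm M E K \<beta> X G * Linf_norm M m"
    by (rule tilde_norm_multiplier[OF assms])
next
  fix G assume G: "G \<in> L1_plus_L2 M"
  have "tilde_norm M E K \<beta> X (fin_rearr M \<rho> G) \<le> tilde_norm M E K \<beta> X G"
    using L1_plus_L2_measurable[OF G] sym_rearr_finite_AE[OF G]
    by (intro tilde_norm_equidistributed[OF assms] fin_rearr_L1_plus_L2 G emeasure_fin_rearr)
  then show "tilde_norm M E K \<beta> X (\<lambda>x. complex_of_real (enn2real (sym_rearr M \<rho> G x))) \<le> tilde_norm M E K \<beta> X G"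
    by (simp add: fin_rearr_def[abs_def])
qed

section \<open>Random signs\<close>

text \<open>The sum of the \<open>c q\<close> with sign plus for \<open>q \<in> A\<close> and minus otherwise. Random signs are modelled by averaging
  over all \<open>A \<subseteq> Q\<close>.\<close>

definition signed_sum :: "'q set \<Rightarrow> ('q \<Rightarrow> 'b::real_vector) \<Rightarrow> 'q set \<Rightarrow> 'b" where
  "signed_sum Q c A = (\<Sum>q\<in>Q. (if q \<in> A then 1 else - 1) *\<^sub>R c q)"

lemma sum_Pow_signed_sum_insert:
  fixes F :: "'b::real_vector \<Rightarrow> real"
  assumes "finite Q" "q \<notin> Q"
  shows "(\<Sum>A\<in>Pow (insert q Q). F (signed_sum (insert q Q) c A))
    = (\<Sum>A\<in>Pow Q. F (signed_sum Q c A + c q) + F (signed_sum Q c A - c q))"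
proof -
  have 1: "signed_sum (insert q Q) c A = signed_sum Q c A - c q" if "A \<in> Pow Q" for A
    using that assms by (auto simp: signed_sum_def)
  have 2: "signed_sum (insert q Q) c (insert q A) = signed_sum Q c A + c q" if "A \<in> Pow Q" for A
  proof -
    have "(\<Sum>p\<in>Q. (if p \<in> insert q A then 1 else - 1) *\<^sub>R c p) = (\<Sum>p\<in>Q. (if p \<in> A then 1 else - 1) *\<^sub>R c p)"
      using assms by (intro sum.cong) auto
    then show ?thesis using assms by (simp add: signed_sum_def)
  qed
  have "inj_on (insert q) (Pow Q)" using assms by (auto simp: inj_on_def)
  moreover have "Pow Q \<inter> insert q ` Pow Q = {}" using assms by auto
  ultimately show ?thesis
    using assms by (simp add: Pow_insert sum.union_disjoint sum.reindex 1 2 sum.distrib)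
qed

lemma second_moment_signed_sum:
  fixes c :: "'q \<Rightarrow> complex"
  assumes "finite Q"
  shows "(\<Sum>A\<in>Pow Q. (cmod (signed_sum Q c A))\<^sup>2) = 2 ^ card Q * (\<Sum>q\<in>Q. (cmod (c q))\<^sup>2)"
  using assms
proof induction
  case (insert q Q)
  have "(cmod (x + y))\<^sup>2 + (cmod (x - y))\<^sup>2 = 2 * (cmod x)\<^sup>2 + 2 * (cmod y)\<^sup>2" for x y :: complex
    unfolding cmod_power2 by (simp add: power2_eq_square algebra_simps)
  then have "(\<Sum>A\<in>Pow (insert q Q). (cmod (signed_sum (insert q Q) c A))\<^sup>2)
      = (\<Sum>A\<in>Pow Q. 2 * (cmod (signed_sum Q c A))\<^sup>2 + 2 * (cmod (c q))\<^sup>2)"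
    using insert by (simp add: sum_Pow_signed_sum_insert[where F = "\<lambda>x. (cmod x)\<^sup>2"])
  also have "\<dots> = 2 * (\<Sum>A\<in>Pow Q. (cmod (signed_sum Q c A))\<^sup>2) + 2 ^ card Q * (2 * (cmod (c q))\<^sup>2)"
    using insert(1) by (simp add: sum.distrib sum_distrib_left[symmetric] card_Pow)
  finally show ?case using insert by (simp add: algebra_simps)
qed (simp add: signed_sum_def)

text \<open>Adding one more independent sign increases the fourth moment at most as much as \<open>3 (\<Sum> |c q|\<^sup>2)\<^sup>2\<close>; the
  cross term is controlled by the second moment.\<close>

lemma fourth_moment_signed_sum:
  fixes c :: "'q \<Rightarrow> complex"
  assumes "finite Q"
  shows "(\<Sum>A\<in>Pow Q. (cmod (signed_sum Q c A)) ^ 4) \<le> 3 * 2 ^ card Q * (\<Sum>q\<in>Q. (cmod (c q))\<^sup>2)\<^sup>2"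
  using assms
proof induction
  case (insert q Q)
  let ?X = "signed_sum Q c" and ?S = "\<Sum>q\<in>Q. (cmod (c q))\<^sup>2" and ?t = "(cmod (c q))\<^sup>2"
  have four: "(cmod (x + y)) ^ 4 + (cmod (x - y)) ^ 4 \<le> 2 * (cmod x) ^ 4 + 12 * ((cmod x)\<^sup>2 * (cmod y)\<^sup>2) + 2 * (cmod y) ^ 4"
    for x y :: complex
  proof -
    let ?r = "Re x * Re y + Im x * Im y"
    have p: "(cmod (x + y))\<^sup>2 = (cmod x)\<^sup>2 + (cmod y)\<^sup>2 + 2 * ?r" and m: "(cmod (x - y))\<^sup>2 = (cmod x)\<^sup>2 + (cmod y)\<^sup>2 - 2 * ?r"
      unfolding cmod_power2 by (simp_all add: power2_eq_square algebra_simps)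
    have r: "?r\<^sup>2 \<le> (cmod x)\<^sup>2 * (cmod y)\<^sup>2"
    proof -
      have "(cmod x)\<^sup>2 * (cmod y)\<^sup>2 - ?r\<^sup>2 = (Re x * Im y - Im x * Re y)\<^sup>2"
        unfolding cmod_power2 by (simp add: power2_eq_square algebra_simps)
      then show ?thesis using zero_le_power2[of "Re x * Im y - Im x * Re y"] by linarith
    qed
    have "(cmod (x + y)) ^ 4 + (cmod (x - y)) ^ 4 = ((cmod (x + y))\<^sup>2)\<^sup>2 + ((cmod (x - y))\<^sup>2)\<^sup>2"
      by simp
    also have "\<dots> = 2 * ((cmod x)\<^sup>2)\<^sup>2 + 4 * ((cmod x)\<^sup>2 * (cmod y)\<^sup>2) + 2 * ((cmod y)\<^sup>2)\<^sup>2 + 8 * ?r\<^sup>2"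
      unfolding p m by (simp add: power2_eq_square algebra_simps)
    finally show ?thesis using r by simp
  qed
  have "(\<Sum>A\<in>Pow (insert q Q). (cmod (signed_sum (insert q Q) c A)) ^ 4)
      = (\<Sum>A\<in>Pow Q. (cmod (?X A + c q)) ^ 4 + (cmod (?X A - c q)) ^ 4)"
    using insert by (simp add: sum_Pow_signed_sum_insert[where F = "\<lambda>x. (cmod x) ^ 4"])
  also have "\<dots> \<le> (\<Sum>A\<in>Pow Q. 2 * (cmod (?X A)) ^ 4 + 12 * ((cmod (?X A))\<^sup>2 * ?t) + 2 * (cmod (c q)) ^ 4)"
    by (intro sum_mono four)
  also have "\<dots> = 2 * (\<Sum>A\<in>Pow Q. (cmod (?X A)) ^ 4) + 12 * ((\<Sum>A\<in>Pow Q. (cmod (?X A))\<^sup>2) * ?t) + 2 * 2 ^ card Q * ?t\<^sup>2"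
    using insert by (simp add: sum.distrib sum_distrib_left sum_distrib_right card_Pow)
  also have "\<dots> \<le> 2 * (3 * 2 ^ card Q * ?S\<^sup>2) + 12 * (2 ^ card Q * ?S * ?t) + 6 * 2 ^ card Q * ?t\<^sup>2"
    using insert(3) unfolding second_moment_signed_sum[OF insert(1)]
    by (intro add_mono mult_left_mono mult_right_mono) (auto intro!: mult_nonneg_nonneg sum_nonneg)
  also have "\<dots> = 3 * 2 ^ card (insert q Q) * (\<Sum>q\<in>insert q Q. (cmod (c q))\<^sup>2)\<^sup>2"
    using insert by (simp add: power2_eq_square algebra_simps)
  finally show ?case .
qed (simp add: signed_sum_def)

lemma powr_ge_quadratic:
  fixes u \<gamma> :: real
  assumes "0 \<le> u" "0 < \<gamma>" "\<gamma> \<le> 1"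
  shows "u - u\<^sup>2 / 4 \<le> u powr \<gamma>"
proof (cases "u \<le> 1")
  case True
  have "u powr 1 \<le> u powr \<gamma>" using assms True by (intro powr_mono') auto
  moreover have "u - u\<^sup>2 / 4 \<le> u" by simp
  ultimately show ?thesis using assms(1) by (simp only: powr_one)
next
  case False
  then have "1 \<le> u powr \<gamma>" using assms by (intro ge_one_powr_ge_zero) auto
  moreover have "u - u\<^sup>2 / 4 \<le> 1" using zero_le_power2[of "u / 2 - 1"]
    by (simp add: power2_eq_square algebra_simps)
  ultimately show ?thesis by linarith
qed

text \<open>The lower Khinchine inequality with an explicit constant. The function \<open>u - u\<^sup>2/4\<close> lies below \<open>u\<^sup>\<gamma>\<close>, and its mean
  at \<open>u = |X|\<^sup>2 / l\<close> is bounded below by the second and fourth moments.\<close>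

lemma Khinchine_lower:
  fixes c :: "'q \<Rightarrow> complex"
  assumes Q: "finite Q" and \<beta>: "0 < \<beta>" "\<beta> \<le> 2"
  shows "2 ^ card Q * (\<Sum>q\<in>Q. (cmod (c q))\<^sup>2) powr (\<beta> / 2) \<le> 3 * (\<Sum>A\<in>Pow Q. cmod (signed_sum Q c A) powr \<beta>)"
proof -
  define S where "S = (\<Sum>q\<in>Q. (cmod (c q))\<^sup>2)"
  have S0: "0 \<le> S" by (simp add: S_def sum_nonneg)
  show ?thesis
  proof (cases "S = 0")
    case True
    then show ?thesis using \<beta> by (simp add: S_def[symmetric] sum_nonneg)
  next
    case False
    then have S: "0 < S" using S0 by simp
    \<comment> \<open>This normalization makes the lower bound \<open>1 / l' - 3 / (4 l'\<^sup>2)\<close> with \<open>l' = l / S\<close> largest, namely one third.\<close>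
    define l where "l = 3 / 2 * S"
    have l: "0 < l" using S by (simp add: l_def)
    let ?X = "\<lambda>A. cmod (signed_sum Q c A)"
    have pt: "l powr (\<beta> / 2) * ((?X A)\<^sup>2 / l - (?X A) ^ 4 / (4 * l\<^sup>2)) \<le> ?X A powr \<beta>" for A
    proof -
      have "(?X A)\<^sup>2 / l - ((?X A)\<^sup>2 / l)\<^sup>2 / 4 \<le> ((?X A)\<^sup>2 / l) powr (\<beta> / 2)"
        using \<beta> l by (intro powr_ge_quadratic) auto
      also have "\<dots> = ((?X A)\<^sup>2) powr (\<beta> / 2) / l powr (\<beta> / 2)"
        using l by (simp add: powr_divide)
      also have "((?X A)\<^sup>2) powr (\<beta> / 2) = ?X A powr \<beta>"
        by (simp add: powr_powr flip: powr_numeral)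
      finally show ?thesis
        using l by (simp add: field_simps power_divide)
    qed
    have M2: "(\<Sum>A\<in>Pow Q. (?X A)\<^sup>2) = 2 ^ card Q * S" and M4: "(\<Sum>A\<in>Pow Q. (?X A) ^ 4) \<le> 3 * 2 ^ card Q * S\<^sup>2"
      using second_moment_signed_sum[OF Q, of c] fourth_moment_signed_sum[OF Q, of c] by (simp_all add: S_def)
    have "2 ^ card Q / 3 = 2 ^ card Q * S / l - 3 * 2 ^ card Q * S\<^sup>2 / (4 * l\<^sup>2)"
      using S by (simp add: l_def power2_eq_square field_simps)
    also have "\<dots> \<le> 2 ^ card Q * S / l - (\<Sum>A\<in>Pow Q. (?X A) ^ 4) / (4 * l\<^sup>2)"
      using M4 l by (intro diff_left_mono divide_right_mono) auto
    also have "\<dots> = (\<Sum>A\<in>Pow Q. (?X A)\<^sup>2 / l - (?X A) ^ 4 / (4 * l\<^sup>2))"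
      by (simp add: sum_subtractf M2[symmetric] sum_divide_distrib)
    finally have "l powr (\<beta> / 2) * (2 ^ card Q / 3) \<le> l powr (\<beta> / 2) * (\<Sum>A\<in>Pow Q. (?X A)\<^sup>2 / l - (?X A) ^ 4 / (4 * l\<^sup>2))"
      by (intro mult_left_mono) auto
    also have "\<dots> \<le> (\<Sum>A\<in>Pow Q. ?X A powr \<beta>)"
      unfolding sum_distrib_left by (intro sum_mono pt)
    finally have "l powr (\<beta> / 2) * 2 ^ card Q \<le> 3 * (\<Sum>A\<in>Pow Q. ?X A powr \<beta>)" by simp
    moreover have "S powr (\<beta> / 2) \<le> l powr (\<beta> / 2)"
      using S \<beta> by (intro powr_mono2) (auto simp: l_def)
    then have "S powr (\<beta> / 2) * 2 ^ card Q \<le> l powr (\<beta> / 2) * 2 ^ card Q"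
      by (intro mult_right_mono) auto
    ultimately have "S powr (\<beta> / 2) * 2 ^ card Q \<le> 3 * (\<Sum>A\<in>Pow Q. ?X A powr \<beta>)" by linarith
    then show ?thesis by (simp add: S_def[symmetric] mult.commute)
  qed
qed

section \<open>Transport of energy between scales\<close>

text \<open>The length of the intersection of the intervals from \<open>a\<close> to \<open>b\<close> and from \<open>c\<close> to \<open>d\<close>.\<close>

definition overlap :: "real \<Rightarrow> real \<Rightarrow> real \<Rightarrow> real \<Rightarrow> real" where
  "overlap a b c d = max 0 (min b d - max a c)"

lemma overlap_commute: "overlap a b c d = overlap c d a b"
  by (simp add: overlap_def min.commute max.commute)

lemma overlap_split: "a \<le> b \<Longrightarrow> c \<le> d \<Longrightarrow> d \<le> d' \<Longrightarrow> overlap a b c d + overlap a b d d' = overlap a b c d'"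
  by (auto simp: overlap_def min_def max_def)

lemma sum_overlap:
  fixes P :: "int \<Rightarrow> real"
  assumes "a \<le> b" "mono P" "m \<le> n + 1"
  shows "(\<Sum>i\<in>{m..n}. overlap a b (P (i - 1)) (P i)) = overlap a b (P (m - 1)) (P n)"
  using assms(3)
proof (induction n rule: int_ge_induct[of "m - 1", consumes 0, case_names ge base step])
  case ge then show ?case using assms by simp
next
  case base
  then show ?case by (simp add: overlap_def)
next
  case (step n)
  then have "{m..n + 1} = insert (n + 1) {m..n}" by auto
  moreover have "P (m - 1) \<le> P n" "P n \<le> P (n + 1)" using \<open>mono P\<close> step by (auto intro: monoD)
  ultimately show ?case
    using step overlap_split[OF \<open>a \<le> b\<close>, of "P (m - 1)" "P n" "P (n + 1)"] by simp
qed

text \<open>The supply \<open>e i\<close> may be used for demands \<open>v j\<close> with \<open>j \<ge> i\<close> only. This can be done as soon as the partial sums of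
  the demands stay below those of the supplies: put supplies and demands as consecutive intervals on a
  line and let \<open>t j i\<close> be the length of the overlap.\<close>

lemma transport_plan:
  fixes v e :: "int \<Rightarrow> real"
  assumes v: "\<And>j. 0 \<le> v j" and e: "\<And>j. 0 \<le> e j"
    and le: "\<And>j. m \<le> j \<Longrightarrow> j \<le> n \<Longrightarrow> sum v {m..j} \<le> sum e {m..j}"
  obtains t :: "int \<Rightarrow> int \<Rightarrow> real" where "\<And>j i. 0 \<le> t j i"
    "\<And>j. m \<le> j \<Longrightarrow> j \<le> n \<Longrightarrow> (\<Sum>i\<in>{m..j}. t j i) = v j"
    "\<And>i. m \<le> i \<Longrightarrow> i \<le> n \<Longrightarrow> (\<Sum>j\<in>{i..n}. t j i) \<le> e i"
proof -
  define V where "V j = sum v {m..j}" for j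
  define E where "E j = sum e {m..j}" for j
  have mono: "mono V" "mono E"
    using v e by (auto simp: mono_def V_def E_def intro!: sum_mono2)
  have step: "V j - V (j - 1) = v j" "E j - E (j - 1) = e j" if "m \<le> j" for j
  proof -
    have "{m..j} = insert j {m..j - 1}" using that by auto
    then show "V j - V (j - 1) = v j" "E j - E (j - 1) = e j" by (auto simp: V_def E_def)
  qed
  have z: "V (m - 1) = 0" "E (m - 1) = 0" by (auto simp: V_def E_def)
  have nn: "0 \<le> V j" "0 \<le> E j" for j using v e by (auto simp: V_def E_def sum_nonneg)
  define t where "t j i = overlap (V (j - 1)) (V j) (E (i - 1)) (E i)" for j i
  show thesis
  proof (rule that)
    show "0 \<le> t j i" for j i by (simp add: t_def overlap_def)
    show "(\<Sum>i\<in>{m..j}. t j i) = v j" if "m \<le> j" "j \<le> n" for j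
    proof -
      have "(\<Sum>i\<in>{m..j}. t j i) = overlap (V (j - 1)) (V j) (E (m - 1)) (E j)"
        unfolding t_def using mono that by (intro sum_overlap) (auto intro: monoD)
      moreover have "V j \<le> E j" using le that by (simp add: V_def E_def)
      moreover have "V (j - 1) \<le> V j" using mono by (auto intro: monoD)
      ultimately show ?thesis using step(1)[OF that(1)] nn(1)[of "j - 1"] z by (simp add: overlap_def)
    qed
    show "(\<Sum>j\<in>{i..n}. t j i) \<le> e i" if "m \<le> i" "i \<le> n" for i
    proof -
      have "(\<Sum>j\<in>{i..n}. t j i) = (\<Sum>j\<in>{i..n}. overlap (E (i - 1)) (E i) (V (j - 1)) (V j))"
        by (simp add: t_def overlap_commute)
      also have "\<dots> = overlap (E (i - 1)) (E i) (V (i - 1)) (V n)"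
        using mono that by (intro sum_overlap) (auto intro: monoD)
      also have "\<dots> \<le> E i - E (i - 1)"
      proof -
        have "E (i - 1) \<le> E i" using mono by (auto intro: monoD)
        then show ?thesis by (auto simp: overlap_def)
      qed
      finally show ?thesis using step(2)[OF that(1)] by simp
    qed
  qed
qed

text \<open>Places consecutive intervals of lengths at least \<open>\<theta> j\<close> in the unit interval, the \<open>j\<close>-th one with end points on
  the grid of mesh \<open>\<eta> j\<close>. Lengths are rounded up to the grid, which costs at most \<open>\<eta> j\<close>; grids get finer with
  \<open>j\<close>, so the place where one interval ends is admissible as the start of the next.\<close>

lemma aligned_intervals:
  fixes \<eta> \<theta> :: "int \<Rightarrow> real"
  assumes \<eta>: "\<And>j. m \<le> j \<Longrightarrow> j \<le> n \<Longrightarrow> 0 < \<eta> j"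
    and nested: "\<And>j. m \<le> j \<Longrightarrow> j < n \<Longrightarrow> \<exists>l :: int. \<eta> j = of_int l * \<eta> (j + 1)"
    and \<theta>: "\<And>j. 0 \<le> \<theta> j" and total: "(\<Sum>j\<in>{m..n}. \<theta> j + \<eta> j) \<le> 1"
  obtains p :: "int \<Rightarrow> real" where "p m = 0" "mono_on {m..n + 1} p" "p (n + 1) \<le> 1"
    "\<And>j. m \<le> j \<Longrightarrow> j \<le> n \<Longrightarrow> \<theta> j \<le> p (j + 1) - p j"
    "\<And>j. m \<le> j \<Longrightarrow> j \<le> n \<Longrightarrow> \<exists>a b :: int. p j = of_int a * \<eta> j \<and> p (j + 1) = of_int b * \<eta> j"
proof -
  define p where "p j = (\<Sum>i\<in>{m..<j}. \<eta> i * of_int \<lceil>\<theta> i / \<eta> i\<rceil>)" for j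
  have step: "p (j + 1) = p j + \<eta> j * of_int \<lceil>\<theta> j / \<eta> j\<rceil>" if "m \<le> j" for j
  proof -
    have "{m..<j + 1} = insert j {m..<j}" using that by auto
    then show ?thesis by (simp add: p_def)
  qed
  have lo: "\<theta> j \<le> \<eta> j * of_int \<lceil>\<theta> j / \<eta> j\<rceil>" and hi: "\<eta> j * of_int \<lceil>\<theta> j / \<eta> j\<rceil> \<le> \<theta> j + \<eta> j" if "m \<le> j" "j \<le> n" for j
  proof -
    have "\<theta> j / \<eta> j \<le> of_int \<lceil>\<theta> j / \<eta> j\<rceil>" by linarith
    then show "\<theta> j \<le> \<eta> j * of_int \<lceil>\<theta> j / \<eta> j\<rceil>"
      using \<eta>[OF that] pos_divide_le_eq[of "\<eta> j" "\<theta> j" "of_int \<lceil>\<theta> j / \<eta> j\<rceil>"]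
      by (simp only: mult.commute)
    have "of_int \<lceil>\<theta> j / \<eta> j\<rceil> \<le> \<theta> j / \<eta> j + 1" by linarith
    then have "\<eta> j * of_int \<lceil>\<theta> j / \<eta> j\<rceil> \<le> \<eta> j * (\<theta> j / \<eta> j + 1)"
      using \<eta>[OF that] by (intro mult_left_mono) auto
    then show "\<eta> j * of_int \<lceil>\<theta> j / \<eta> j\<rceil> \<le> \<theta> j + \<eta> j"
      using \<eta>[OF that] by (simp add: distrib_left)
  qed
  have aligned: "\<exists>a :: int. p j = of_int a * \<eta> j" if "m \<le> j" "j \<le> n" for j
    using that
  proof (induction j rule: int_ge_induct)
    case base
    then show ?case by (auto simp: p_def)
  next
    case (step j)
    then obtain a :: int where "p j = of_int a * \<eta> j" by auto
    moreover obtain l :: int where "\<eta> j = of_int l * \<eta> (j + 1)" using nested[of j] step by auto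
    ultimately have "p (j + 1) = of_int ((a + \<lceil>\<theta> j / \<eta> j\<rceil>) * l) * \<eta> (j + 1)"
      using \<open>\<And>j. m \<le> j \<Longrightarrow> p (j + 1) = p j + \<eta> j * of_int \<lceil>\<theta> j / \<eta> j\<rceil>\<close>[OF step(1)]
      by (simp add: algebra_simps)
    then show ?case by blast
  qed
  show thesis
  proof (rule that)
    show "p m = 0" by (simp add: p_def)
    show "mono_on {m..n + 1} p"
    proof (rule mono_onI)
      fix r s assume rs: "r \<in> {m..n + 1}" "s \<in> {m..n + 1}" "r \<le> s"
      show "p r \<le> p s"
        unfolding p_def
      proof (rule sum_mono2)
        fix b assume "b \<in> {m..<s} - {m..<r}"
        then show "0 \<le> \<eta> b * of_int \<lceil>\<theta> b / \<eta> b\<rceil>"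
          using rs lo[of b] \<theta>[of b] by auto
      qed (use rs in auto)
    qed
    show "p (n + 1) \<le> 1"
    proof -
      have "p (n + 1) = (\<Sum>j\<in>{m..n}. \<eta> j * of_int \<lceil>\<theta> j / \<eta> j\<rceil>)"
        unfolding p_def by (intro sum.cong) auto
      also have "\<dots> \<le> (\<Sum>j\<in>{m..n}. \<theta> j + \<eta> j)" using hi by (intro sum_mono) auto
      finally show ?thesis using total by simp
    qed
    show "\<theta> j \<le> p (j + 1) - p j" if "m \<le> j" "j \<le> n" for j
      using step[OF that(1)] lo[OF that] by simp
    show "\<exists>a b :: int. p j = of_int a * \<eta> j \<and> p (j + 1) = of_int b * \<eta> j" if j: "m \<le> j" "j \<le> n" for j
    proof -
      obtain a :: int where a: "p j = of_int a * \<eta> j" using aligned[OF j] by auto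
      then have "p (j + 1) = of_int (a + \<lceil>\<theta> j / \<eta> j\<rceil>) * \<eta> j"
        using step[OF j(1)] by (simp add: algebra_simps)
      then show ?thesis using a by blast
    qed
  qed
qed

section \<open>Decomposition along a sequence of levels\<close>

lemma excess_le_sum_levels:
  fixes a :: "int \<Rightarrow> real"
  assumes a: "antimono a" and "t \<le> a m" "m \<le> k"
  shows "max 0 (t - a k) \<le> (\<Sum>i\<in>{m..<k}. (a i - a (i + 1)) * of_bool (a (i + 1) < t))"
  using assms(3)
proof (induction k rule: int_ge_induct)
  case base
  then show ?case using assms by simp
next
  case (step k)
  have "{m..<k + 1} = insert k {m..<k}" using step by auto
  moreover have "a (k + 1) \<le> a k" using a by (auto intro: antimonoD)
  ultimately show ?case using step by (auto simp del: sum_mult_of_bool_eq)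
qed

text \<open>Already the single term with \<open>a (i + 1) < t \<le> a i\<close>, or the term of \<open>k\<close>, is large enough.\<close>

lemma truncation_le_sum_levels:
  fixes a :: "int \<Rightarrow> real"
  assumes a: "antimono a" "\<And>i. 0 \<le> a i" and "0 \<le> t" "k \<le> M" "a (M + 1) < t"
  shows "(min t (a k))\<^sup>2 \<le> (\<Sum>i\<in>{k..M}. (a i)\<^sup>2 * of_bool (a (i + 1) < t))"
  using assms(4,5)
proof (induction M rule: int_ge_induct)
  case base
  then show ?case using assms by (auto intro!: power_mono)
next
  case (step M)
  have eq: "{k..M + 1} = insert (M + 1) {k..M}" using step by auto
  show ?case
  proof (cases "a (M + 1) < t")
    case True
    then have "(min t (a k))\<^sup>2 \<le> (\<Sum>i\<in>{k..M}. (a i)\<^sup>2 * of_bool (a (i + 1) < t))" by (rule step)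
    then show ?thesis unfolding eq by (simp add: add_increasing del: sum_mult_of_bool_eq)
  next
    case False
    then have "(min t (a k))\<^sup>2 \<le> (a (M + 1))\<^sup>2" using assms by (intro power_mono) auto
    moreover have "0 \<le> (\<Sum>i\<in>{k..M}. (a i)\<^sup>2 * of_bool (a (i + 1) < t))" by (intro sum_nonneg) auto
    ultimately show ?thesis unfolding eq using step by (simp del: sum_mult_of_bool_eq)
  qed
qed

text \<open>As \<open>x\<close> decreases, the condition \<open>s < x i\<close> cuts off an initial part of the sum, which telescopes to the last power of
  \<open>q\<close> that occurs.\<close>

lemma telescoping_le:
  fixes q s m :: real and x :: "int \<Rightarrow> real"
  assumes "0 < q" "0 \<le> m" "l \<le> j + 1" "antimono x"
    and "\<And>i. l \<le> i \<Longrightarrow> i \<le> j \<Longrightarrow> s < x i \<Longrightarrow> q powi i \<le> m"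
  shows "(\<Sum>i\<in>{l..j}. (q powi i - q powi (i - 1)) * of_bool (s < x i)) \<le> m"
  using assms(3,5)
proof (induction j rule: int_ge_induct[of "l - 1", consumes 0, case_names ge base step])
  case ge then show ?case using assms by simp
next
  case base
  then show ?case using assms by simp
next
  case (step j)
  show ?case
  proof (cases "s < x (j + 1)")
    case True
    have "(\<Sum>i\<in>{l..j + 1}. (q powi i - q powi (i - 1)) * of_bool (s < x i)) = (\<Sum>i\<in>{l..j + 1}. q powi i - q powi (i - 1))"
    proof (intro sum.cong refl)
      fix i assume "i \<in> {l..j + 1}"
      then have "x (j + 1) \<le> x i" using \<open>antimono x\<close> by (auto intro: antimonoD)
      then show "(q powi i - q powi (i - 1)) * of_bool (s < x i) = q powi i - q powi (i - 1)"
        using True by (simp del: sum_mult_of_bool_eq)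
    qed
    also have "\<dots> = q powi (j + 1) - q powi (l - 1)"
    proof -
      have "l - 1 \<le> n \<Longrightarrow> (\<Sum>i\<in>{l..n}. q powi i - q powi (i - 1)) = q powi n - q powi (l - 1)" for n
      proof (induction n rule: int_ge_induct)
        case (step n)
        then have "{l..n + 1} = insert (n + 1) {l..n}" by auto
        then show ?case using step by simp
      qed simp
      then show ?thesis using step by simp
    qed
    also have "\<dots> \<le> m"
    proof -
      have "q powi (j + 1) \<le> m" using step(4)[of "j + 1"] step(1) True by simp
      moreover have "0 < q powi (l - 1)" using \<open>0 < q\<close> by simp
      ultimately show ?thesis by linarith
    qed
    finally show ?thesis .
  next
    case False
    have "{l..j + 1} = insert (j + 1) {l..j}" using step by auto
    then show ?thesis using step False by (simp del: sum_mult_of_bool_eq)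
  qed
qed

lemma nn_integral_le_exhaust:
  assumes [measurable]: "u \<in> borel_measurable M" "\<And>n :: nat. A n \<in> sets M"
    and "incseq A" and cover: "AE x in M. u x = 0 \<or> (\<exists>n. x \<in> A n)"
    and le: "\<And>n. (\<integral>\<^sup>+x. u x * indicator (A n) x \<partial>M) \<le> B"
  shows "(\<integral>\<^sup>+x. u x \<partial>M) \<le> B"
proof -
  have "(\<integral>\<^sup>+x. u x \<partial>M) \<le> (\<integral>\<^sup>+x. (SUP n. u x * indicator (A n) x) \<partial>M)"
  proof (rule nn_integral_mono_AE)
    show "AE x in M. u x \<le> (SUP n. u x * indicator (A n) x)"
      using cover
    proof eventually_elim
      case (elim x)
      then show ?case
      proof
        assume "\<exists>n. x \<in> A n"
        then obtain n where "x \<in> A n" by auto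
        then show ?thesis by (intro SUP_upper2[of n]) auto
      qed simp
    qed
  qed
  also have "\<dots> = (SUP n. \<integral>\<^sup>+x. u x * indicator (A n) x \<partial>M)"
    using \<open>incseq A\<close> by (intro nn_integral_monotone_convergence_SUP)
      (auto simp: incseq_def le_fun_def split: split_indicator)
  also have "\<dots> \<le> B" using le by (intro SUP_least)
  finally show ?thesis .
qed

section \<open>Abstract Fourier pairs\<close>

lemma emeasure_above_decr_rearr:
  assumes "h \<in> borel_measurable M" "decr_rearr M h t < \<infinity>"
  shows "emeasure M {x \<in> space M. enn2real (decr_rearr M h t) < cmod (h x)} \<le> ennreal t"
  using decr_rearr_le_iff[OF assms(1), of "enn2real (decr_rearr M h t)" t] assms(2) by simp

lemma less_emeasure_below_decr_rearr:
  assumes "h \<in> borel_measurable M" "0 \<le> s" "s < enn2real (decr_rearr M h t)"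
  shows "ennreal t < emeasure M {x \<in> space M. s < cmod (h x)}"
proof -
  have "ennreal s < decr_rearr M h t"
    using assms(2,3) by (cases "decr_rearr M h t") (auto simp: ennreal_less_iff)
  then show ?thesis using less_decr_rearr_iff[OF assms(1,2)] by simp
qed

lemma enn2real_decr_rearr_antimono:
  assumes "decr_rearr M h t < \<infinity>" "t \<le> t'"
  shows "enn2real (decr_rearr M h t') \<le> enn2real (decr_rearr M h t)"
  using decr_rearr_antimono[OF assms(2)] assms(1) by (intro enn2real_mono) auto

lemma sum_telescope_int:
  fixes a :: "int \<Rightarrow> real"
  assumes "l \<le> n + 1"
  shows "(\<Sum>i\<in>{l..n}. a i - a (i + 1)) = a l - a (n + 1)"
proof -
  have "l - 1 \<le> n" using assms by simp
  then show ?thesis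
  proof (induction n rule: int_ge_induct)
    case (step n)
    then have "{l..n + 1} = insert (n + 1) {l..n}" by auto
    then show ?case using step by simp
  qed simp
qed

lemma power_int_mono_exp:
  fixes q :: real assumes "1 < q" "i \<le> j" shows "q powi i \<le> q powi j"
  using assms by (intro power_int_increasing) auto

lemma exists_power_int_ge:
  fixes q :: real assumes "1 < q" shows "\<exists>n::nat. X \<le> q powi (int n)"
  using real_arch_pow[OF assms, of X] by (auto simp: power_int_of_nat intro: less_imp_le)

text \<open>The common features of the three settings. Scales are powers of \<open>q\<close>: a point \<open>x\<close> with \<open>\<rho>D x\<close> of size \<open>q\<^sup>k\<close> has spatial
  scale \<open>k\<close>, and \<open>\<kappa> y\<close> is the scale of the frequency \<open>y\<close>. Scales \<open>k\<close> and \<open>j\<close> are dual if \<open>k = -j\<close>.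

  \<^item> The condition on \<open>\<kappa>\<close> says that a decreasing rearrangement at \<open>\<rho>E y\<close> is at most its value at \<open>q\<close> to the power \<open>\<kappa> y\<close>.
    It is phrased with measures of sets since on the integers the frequency zero has positive measure
    although \<open>\<rho>E\<close> vanishes there.
  \<^item> A bump of scale \<open>k\<close> has a non-negative transform that is of full size at frequencies below the dual scale.
  \<^item> The regions \<open>C k\<close> are disjoint pieces of the balls of scale \<open>k\<close>. If each frequency scale \<open>j \<ge> -k\<close> claims the share \<open>\<theta> j\<close>
    of such a region, then disjoint cells can be chosen whose transforms have, at
    frequencies of scale \<open>j\<close>, a square sum of the order of the number of cells of size \<open>q\<^sup>-\<^sup>j\<close> in the share times the
    square of their size.

  Only spatial scales that are smaller than the whole space matter, as rearrangements vanish beyond.\<close>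

locale fourier_pair = D: rearr_space D \<rho>D + E: rearr_space E \<rho>E
  for D :: "'d measure" and \<rho>D and E :: "'e measure" and \<rho>E +
  fixes e :: "'d \<Rightarrow> 'e \<Rightarrow> complex" and q lam c :: real and \<kappa> :: "'e \<Rightarrow> int" and E' :: "'e set" and C :: "int \<Rightarrow> 'd set"
  assumes q: "1 < q" and lam: "0 < lam" and c: "0 < c"
    and kernel_measurable [measurable]: "(\<lambda>(y, x). e x y) \<in> borel_measurable (E \<Otimes>\<^sub>M D)"
    and kernel_bound: "cmod (e x y) \<le> 1"
    and \<kappa>_measurable [measurable]: "\<kappa> \<in> E \<rightarrow>\<^sub>M count_space UNIV"
    and AE_E': "AE y in E. y \<in> E'"
    and \<kappa>: "y \<in> E' \<Longrightarrow> S \<in> sets E \<Longrightarrow> emeasure E S \<le> ennreal (q powi \<kappa> y) \<Longrightarrow> emeasure E S \<le> ennreal (\<rho>E y)"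
    and bump: "ennreal (lam * q powi k) < emeasure D (space D) \<Longrightarrow>
      \<exists>\<phi>. \<phi> \<in> borel_measurable D \<and> (\<forall>x. 0 \<le> \<phi> x \<and> \<phi> x \<le> 1 \<and> (\<phi> x \<noteq> 0 \<longrightarrow> \<rho>D x \<le> lam * q powi k)) \<and>
        (\<forall>y\<in>E'. \<exists>s. 0 \<le> s \<and> (\<integral>x. complex_of_real (\<phi> x) * e x y \<partial>D) = complex_of_real s \<and>
          (k < - \<kappa> y \<longrightarrow> c * q powi k \<le> s))"
    and C_sub: "ennreal (lam * q powi k) < emeasure D (space D) \<Longrightarrow> C k \<subseteq> {x. \<rho>D x \<le> lam * q powi k}"
    and C_disj: "k \<noteq> k' \<Longrightarrow> C k \<inter> C k' = {}"
    and cells: "ennreal (lam * q powi k) < emeasure D (space D) \<Longrightarrow> (\<And>j. 0 \<le> \<theta> j) \<Longrightarrow> (\<Sum>j\<in>{-k..n}. \<theta> j) \<le> 1 \<Longrightarrow>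
      \<exists>\<Q>. finite \<Q> \<and> disjoint \<Q> \<and> (\<forall>Q\<in>\<Q>. Q \<in> sets D \<and> Q \<subseteq> C k) \<and>
        (\<forall>y\<in>E'. - k \<le> \<kappa> y \<and> \<kappa> y \<le> n \<longrightarrow>
          c * q powi (k - \<kappa> y) * \<theta> (\<kappa> y) \<le> (\<Sum>Q\<in>\<Q>. (cmod (\<integral>x. indicator Q x * e x y \<partial>D))\<^sup>2))"
begin

definition ft :: "('d \<Rightarrow> complex) \<Rightarrow> 'e \<Rightarrow> complex" where
  "ft g y = (\<integral>x. g x * e x y \<partial>D)"

lemma q_pos [simp]: "0 < q" using q by simp

lemma q_nonneg [simp]: "0 \<le> q" using q by simp

lemma q_nonzero [simp]: "q \<noteq> 0" using q by simp

lemma kernel_section [measurable (raw)]: "y \<in> space E \<Longrightarrow> (\<lambda>x. e x y) \<in> borel_measurable D"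
  using measurable_Pair2[OF kernel_measurable] by simp

lemma ft_measurable [measurable]:
  assumes [measurable]: "g \<in> borel_measurable D" shows "ft g \<in> borel_measurable E"
  unfolding ft_def by measurable

lemma integrable_times_kernel:
  assumes "y \<in> space E" "integrable D g" shows "integrable D (\<lambda>x. g x * e x y)"
proof (rule Bochner_Integration.integrable_bound[OF assms(2)])
  have [measurable]: "g \<in> borel_measurable D" using assms(2) by auto
  show "(\<lambda>x. g x * e x y) \<in> borel_measurable D" using kernel_section[OF assms(1)] by measurable
  show "AE x in D. norm (g x * e x y) \<le> norm (g x)"
    using kernel_bound by (auto simp: norm_mult intro!: mult_left_le)
qed

lemma ft_sum:
  assumes "y \<in> space E" "finite I" "\<And>i. i \<in> I \<Longrightarrow> integrable D (g i)"
  shows "ft (\<lambda>x. \<Sum>i\<in>I. r i *\<^sub>R g i x) y = (\<Sum>i\<in>I. r i *\<^sub>R ft (g i) y)"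
proof -
  have "integrable D (\<lambda>x. g i x * e x y)" if "i \<in> I" for i
    using integrable_times_kernel[OF assms(1) assms(3)[OF that]] .
  then have "(\<integral>x. (\<Sum>i\<in>I. r i *\<^sub>R (g i x * e x y)) \<partial>D) = (\<Sum>i\<in>I. r i *\<^sub>R (\<integral>x. g i x * e x y \<partial>D))"
    by (subst Bochner_Integration.integral_sum) auto
  then show ?thesis by (simp add: ft_def sum_distrib_right)
qed

text \<open>The rearrangement of \<open>f\<close> at the ball of scale \<open>k\<close>.\<close>

definition lev :: "('d \<Rightarrow> complex) \<Rightarrow> int \<Rightarrow> real" where
  "lev f k = enn2real (decr_rearr D f (lam * q powi k))"

text \<open>The part of \<open>f\<close> above the height \<open>lev f k\<close>. Truncating values, rather than restricting \<open>f\<close> to a level set, makes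
  both the head and the tail depend on the levels in the simplest way.\<close>

definition head_of :: "('d \<Rightarrow> complex) \<Rightarrow> int \<Rightarrow> 'd \<Rightarrow> complex" where
  "head_of f k x = (if lev f k < cmod (f x) then (1 - lev f k / cmod (f x)) *\<^sub>R f x else 0)"

definition tail_of :: "('d \<Rightarrow> complex) \<Rightarrow> int \<Rightarrow> 'd \<Rightarrow> complex" where
  "tail_of f k x = f x - head_of f k x"

lemma lev_nonneg [simp]: "0 \<le> lev f k" by (simp add: lev_def)

lemma cmod_head_of: "cmod (head_of f k x) = max 0 (cmod (f x) - lev f k)"
proof (cases "lev f k < cmod (f x)")
  case True
  then have "0 < cmod (f x)" using lev_nonneg[of f k] by linarith
  moreover have "lev f k / cmod (f x) \<le> 1" using True calculation by (simp add: pos_divide_le_eq)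
  ultimately show ?thesis using True by (simp add: head_of_def left_diff_distrib abs_of_nonneg)
qed (simp add: head_of_def)

lemma cmod_tail_of: "cmod (tail_of f k x) = min (cmod (f x)) (lev f k)"
proof (cases "lev f k < cmod (f x)")
  case True
  then have "0 < cmod (f x)" using lev_nonneg[of f k] by linarith
  moreover have "tail_of f k x = (lev f k / cmod (f x)) *\<^sub>R f x"
    using True by (simp add: tail_of_def head_of_def scaleR_left_diff_distrib)
  ultimately show ?thesis using True by simp
qed (simp add: head_of_def tail_of_def)

lemma head_of_measurable [measurable]:
  assumes [measurable]: "f \<in> borel_measurable D" shows "head_of f k \<in> borel_measurable D"
  unfolding head_of_def by measurable

lemma tail_of_measurable [measurable]:
  assumes [measurable]: "f \<in> borel_measurable D" shows "tail_of f k \<in> borel_measurable D"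
  unfolding tail_of_def by measurable

context
  fixes f assumes f: "f \<in> Lp_space D 1"
begin

lemma f_meas [measurable]: "f \<in> borel_measurable D"
  using f by (simp add: Lp_space_def)

lemma f_L1_plus_L2: "f \<in> L1_plus_L2 D" using f by (rule Lp_one_subset)

lemma lev_finite: "decr_rearr D f (lam * q powi k) < \<infinity>"
  using lam by (intro decr_rearr_finite f_L1_plus_L2) auto

lemma emeasure_above_lev: "emeasure D {x \<in> space D. lev f k < cmod (f x)} \<le> ennreal (lam * q powi k)"
  unfolding lev_def by (intro emeasure_above_decr_rearr lev_finite) measurable

lemma lev_antimono: "antimono (lev f)"
  unfolding lev_def
  using lam q by (intro antimonoI enn2real_decr_rearr_antimono lev_finite mult_left_mono power_int_mono_exp) auto

lemma lev_mono: "i \<le> j \<Longrightarrow> lev f j \<le> lev f i"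
  using lev_antimono by (rule antimonoD)

lemma lev_le: assumes "emeasure D {x \<in> space D. s < cmod (f x)} \<le> ennreal (lam * q powi k)" "0 \<le> s"
  shows "lev f k \<le> s"
  using assms decr_rearr_le_iff[of f D s "lam * q powi k"] by (simp add: lev_def enn2real_leI)

lemma lev_tendsto_zero: assumes "0 < t" shows "\<exists>n::nat. lev f (k + int n) < t"
proof -
  have "emeasure D {x \<in> space D. t / 2 < cmod (f x)} < \<infinity>"
    using assms by (intro L1_plus_L2_level_finite f_L1_plus_L2) auto
  then obtain r where r: "emeasure D {x \<in> space D. t / 2 < cmod (f x)} = ennreal r" "0 \<le> r"
    by (cases "emeasure D {x \<in> space D. t / 2 < cmod (f x)}") auto
  obtain n where "r / (lam * q powi k) \<le> q powi (int n)" using exists_power_int_ge[OF q] by blast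
  then have "r \<le> lam * q powi (k + int n)"
    using lam by (simp add: pos_divide_le_eq power_int_add algebra_simps)
  then have "lev f (k + int n) \<le> t / 2"
    using r assms by (intro lev_le) (auto intro: ennreal_leI)
  then show ?thesis using assms by (intro exI[of _ n]) auto
qed

lemma lev_less_measure: assumes "0 < lev f k" shows "ennreal (lam * q powi k) < emeasure D (space D)"
proof (rule ccontr)
  assume "\<not> ennreal (lam * q powi k) < emeasure D (space D)"
  then have "emeasure D {x \<in> space D. 0 < cmod (f x)} \<le> ennreal (lam * q powi k)"
    using emeasure_space[of D "{x \<in> space D. 0 < cmod (f x)}"] by (auto simp: not_less)
  then have "lev f k \<le> 0" by (intro lev_le) auto
  then show False using assms by simp
qed

lemma AE_le_lev: "AE x in D. \<exists>n::nat. cmod (f x) \<le> lev f (- int n)"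
proof -
  let ?N = "\<Inter>n::nat. {x \<in> space D. lev f (- int n) < cmod (f x)}"
  have "emeasure D ?N \<le> ennreal t" if "0 < t" for t
  proof -
    obtain n where "lam / t \<le> q powi (int n)" using exists_power_int_ge[OF q] by blast
    then have "lam * q powi (- int n) \<le> t"
      using that by (simp add: power_int_minus field_simps)
    moreover have "emeasure D ?N \<le> emeasure D {x \<in> space D. lev f (- int n) < cmod (f x)}"
      by (intro emeasure_mono) auto
    ultimately show ?thesis
      using emeasure_above_lev[of "- int n"] ennreal_leI[of "lam * q powi (- int n)" t] by (auto intro: order_trans)
  qed
  then have "emeasure D ?N \<le> 0 + ennreal t" if "0 < t" for t
    using that by simp
  then have "emeasure D ?N \<le> 0" by (rule ennreal_le_epsilon)
  then have "?N \<in> null_sets D" by auto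
  then have "AE x in D. x \<notin> ?N" by (rule AE_not_in)
  then show ?thesis by (auto elim!: AE_mp intro!: AE_I2 simp: not_less)
qed

lemma lev_le_rearr: assumes "sym_rearr D \<rho>D f x < \<infinity>" "\<rho>D x \<le> lam * q powi k"
  shows "lev f k \<le> enn2real (sym_rearr D \<rho>D f x)"
  using assms unfolding lev_def sym_rearr_def by (intro enn2real_decr_rearr_antimono) auto

text \<open>Cut the excess into layers between consecutive levels; the set above level \<open>i + 1\<close> has measure at most
  \<open>lam\<close> times the power \<open>i + 1\<close> of \<open>q\<close>.\<close>

lemma head_of_norm:
  assumes R: "0 \<le> R" "\<And>n::nat. (\<Sum>i\<in>{- int n..<k}. (lev f i - lev f (i + 1)) * q powi i) \<le> R"
  shows "(\<integral>\<^sup>+x. ennreal (cmod (head_of f k x)) \<partial>D) \<le> ennreal (lam * q * R)"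
proof (rule nn_integral_le_exhaust[where A = "\<lambda>n. {x \<in> space D. cmod (f x) \<le> lev f (- int n)}"])
  show "incseq (\<lambda>n. {x \<in> space D. cmod (f x) \<le> lev f (- int n)})"
    by (auto simp: incseq_def intro: order_trans[OF _ lev_mono])
  show "AE x in D. ennreal (cmod (head_of f k x)) = 0 \<or> (\<exists>n. x \<in> {x \<in> space D. cmod (f x) \<le> lev f (- int n)})"
    using AE_le_lev AE_space by eventually_elim auto
next
  fix n
  let ?A = "{x \<in> space D. cmod (f x) \<le> lev f (- int n)}"
  show "(\<integral>\<^sup>+x. ennreal (cmod (head_of f k x)) * indicator ?A x \<partial>D) \<le> ennreal (lam * q * R)"
  proof (cases "- int n \<le> k")
    case True
    have d: "0 \<le> lev f i - lev f (i + 1)" for i using lev_antimono by (simp add: antimonoD)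
    have "(\<integral>\<^sup>+x. ennreal (cmod (head_of f k x)) * indicator ?A x \<partial>D)
      \<le> (\<integral>\<^sup>+x. (\<Sum>i\<in>{- int n..<k}. ennreal (lev f i - lev f (i + 1)) * indicator {x \<in> space D. lev f (i + 1) < cmod (f x)} x) \<partial>D)"
    proof (intro nn_integral_mono)
      fix x assume x: "x \<in> space D"
      show "ennreal (cmod (head_of f k x)) * indicator ?A x
        \<le> (\<Sum>i\<in>{- int n..<k}. ennreal (lev f i - lev f (i + 1)) * indicator {x \<in> space D. lev f (i + 1) < cmod (f x)} x)"
      proof (cases "x \<in> ?A")
        case True
        then have "cmod (head_of f k x) \<le> (\<Sum>i\<in>{- int n..<k}. (lev f i - lev f (i + 1)) * of_bool (lev f (i + 1) < cmod (f x)))"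
          unfolding cmod_head_of using \<open>- int n \<le> k\<close> by (intro excess_le_sum_levels lev_antimono) auto
        then have "ennreal (cmod (head_of f k x)) \<le> ennreal (\<Sum>i\<in>{- int n..<k}. (lev f i - lev f (i + 1)) * of_bool (lev f (i + 1) < cmod (f x)))"
          by (rule ennreal_leI)
        also have "\<dots> = (\<Sum>i\<in>{- int n..<k}. ennreal ((lev f i - lev f (i + 1)) * of_bool (lev f (i + 1) < cmod (f x))))"
          using d by (intro sum_ennreal[symmetric]) auto
        also have "\<dots> = (\<Sum>i\<in>{- int n..<k}. ennreal (lev f i - lev f (i + 1)) * indicator {x \<in> space D. lev f (i + 1) < cmod (f x)} x)"
          using x by (intro sum.cong) auto
        finally show ?thesis using True by simp
      qed simp
    qed
    also have "\<dots> = (\<Sum>i\<in>{- int n..<k}. ennreal (lev f i - lev f (i + 1)) * emeasure D {x \<in> space D. lev f (i + 1) < cmod (f x)})"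
      by (subst nn_integral_sum) (auto simp: nn_integral_cmult_indicator)
    also have "\<dots> \<le> (\<Sum>i\<in>{- int n..<k}. ennreal (lev f i - lev f (i + 1)) * ennreal (lam * q powi (i + 1)))"
      by (intro sum_mono mult_left_mono emeasure_above_lev) auto
    also have "\<dots> = (\<Sum>i\<in>{- int n..<k}. ennreal ((lev f i - lev f (i + 1)) * (lam * q powi (i + 1))))"
      using lam by (intro sum.cong ennreal_mult[symmetric] d) auto
    also have "\<dots> = ennreal (\<Sum>i\<in>{- int n..<k}. (lev f i - lev f (i + 1)) * (lam * q powi (i + 1)))"
      using lam by (intro sum_ennreal mult_nonneg_nonneg d) auto
    also have "(\<Sum>i\<in>{- int n..<k}. (lev f i - lev f (i + 1)) * (lam * q powi (i + 1)))
        = lam * q * (\<Sum>i\<in>{- int n..<k}. (lev f i - lev f (i + 1)) * q powi i)"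
      by (simp add: sum_distrib_left power_int_add ac_simps)
    also have "ennreal \<dots> \<le> ennreal (lam * q * R)"
      using R(2)[of n] lam by (intro ennreal_leI mult_left_mono) auto
    finally show ?thesis .
  next
    case False
    have "ennreal (cmod (head_of f k x)) * indicator ?A x = 0" for x
    proof (cases "x \<in> ?A")
      case True
      moreover have "lev f (- int n) \<le> lev f k" using False lev_antimono by (auto intro: antimonoD)
      ultimately show ?thesis by (simp add: cmod_head_of)
    qed simp
    then show ?thesis by (simp only: nn_integral_const) simp
  qed
qed measurable

text \<open>The tail is at most \<open>lev f i\<close> where \<open>|f|\<close> does not exceed this level, and the set above level \<open>i + 1\<close> is
  small.\<close>

lemma tail_of_norm:
  assumes R: "0 \<le> R" "\<And>M. k \<le> M \<Longrightarrow> (\<Sum>i\<in>{k..M}. (lev f i)\<^sup>2 * q powi i) \<le> R"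
  shows "(\<integral>\<^sup>+x. ennreal ((cmod (tail_of f k x))\<^sup>2) \<partial>D) \<le> ennreal (lam * q * R)"
proof (rule nn_integral_le_exhaust[where A = "\<lambda>n. {x \<in> space D. lev f (k + int n + 1) < cmod (f x)}"])
  show "incseq (\<lambda>n. {x \<in> space D. lev f (k + int n + 1) < cmod (f x)})"
  proof (intro incseq_SucI subsetI)
    fix n x assume x: "x \<in> {x \<in> space D. lev f (k + int n + 1) < cmod (f x)}"
    have "lev f (k + int (Suc n) + 1) \<le> lev f (k + int n + 1)" by (rule lev_mono) simp
    with x show "x \<in> {x \<in> space D. lev f (k + int (Suc n) + 1) < cmod (f x)}"
      by (simp del: of_nat_Suc)
  qed
  show "AE x in D. ennreal ((cmod (tail_of f k x))\<^sup>2) = 0 \<or> (\<exists>n. x \<in> {x \<in> space D. lev f (k + int n + 1) < cmod (f x)})"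
  proof (rule AE_I2)
    fix x assume x: "x \<in> space D"
    show "ennreal ((cmod (tail_of f k x))\<^sup>2) = 0 \<or> (\<exists>n. x \<in> {x \<in> space D. lev f (k + int n + 1) < cmod (f x)})"
    proof (cases "f x = 0")
      case False
      then obtain n where "lev f (k + 1 + int n) < cmod (f x)"
        using lev_tendsto_zero[of "cmod (f x)" "k + 1"] by auto
      then show ?thesis using x by (auto simp: algebra_simps)
    qed (simp add: cmod_tail_of)
  qed
next
  fix n
  let ?A = "{x \<in> space D. lev f (k + int n + 1) < cmod (f x)}" and ?M = "k + int n"
  have "(\<integral>\<^sup>+x. ennreal ((cmod (tail_of f k x))\<^sup>2) * indicator ?A x \<partial>D)
    \<le> (\<integral>\<^sup>+x. (\<Sum>i\<in>{k..?M}. ennreal ((lev f i)\<^sup>2) * indicator {x \<in> space D. lev f (i + 1) < cmod (f x)} x) \<partial>D)"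
  proof (intro nn_integral_mono)
    fix x assume x: "x \<in> space D"
    show "ennreal ((cmod (tail_of f k x))\<^sup>2) * indicator ?A x
      \<le> (\<Sum>i\<in>{k..?M}. ennreal ((lev f i)\<^sup>2) * indicator {x \<in> space D. lev f (i + 1) < cmod (f x)} x)"
    proof (cases "x \<in> ?A")
      case True
      then have "(cmod (tail_of f k x))\<^sup>2 \<le> (\<Sum>i\<in>{k..?M}. (lev f i)\<^sup>2 * of_bool (lev f (i + 1) < cmod (f x)))"
        unfolding cmod_tail_of by (intro truncation_le_sum_levels lev_antimono) auto
      then have "ennreal ((cmod (tail_of f k x))\<^sup>2) \<le> ennreal (\<Sum>i\<in>{k..?M}. (lev f i)\<^sup>2 * of_bool (lev f (i + 1) < cmod (f x)))"
        by (rule ennreal_leI)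
      also have "\<dots> = (\<Sum>i\<in>{k..?M}. ennreal ((lev f i)\<^sup>2 * of_bool (lev f (i + 1) < cmod (f x))))"
        by (intro sum_ennreal[symmetric]) auto
      also have "\<dots> = (\<Sum>i\<in>{k..?M}. ennreal ((lev f i)\<^sup>2) * indicator {x \<in> space D. lev f (i + 1) < cmod (f x)} x)"
        using x by (intro sum.cong) auto
      finally show ?thesis using True by simp
    qed simp
  qed
  also have "\<dots> = (\<Sum>i\<in>{k..?M}. ennreal ((lev f i)\<^sup>2) * emeasure D {x \<in> space D. lev f (i + 1) < cmod (f x)})"
    by (subst nn_integral_sum) (auto simp: nn_integral_cmult_indicator)
  also have "\<dots> \<le> (\<Sum>i\<in>{k..?M}. ennreal ((lev f i)\<^sup>2) * ennreal (lam * q powi (i + 1)))"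
    by (intro sum_mono mult_left_mono emeasure_above_lev) auto
  also have "\<dots> = ennreal (\<Sum>i\<in>{k..?M}. (lev f i)\<^sup>2 * (lam * q powi (i + 1)))"
    using lam by (subst sum_ennreal[symmetric]) (auto simp: ennreal_mult)
  also have "(\<Sum>i\<in>{k..?M}. (lev f i)\<^sup>2 * (lam * q powi (i + 1))) = lam * q * (\<Sum>i\<in>{k..?M}. (lev f i)\<^sup>2 * q powi i)"
    by (simp add: sum_distrib_left power_int_add ac_simps)
  also have "ennreal \<dots> \<le> ennreal (lam * q * R)"
    using R(2)[of ?M] lam by (intro ennreal_leI mult_left_mono) auto
  finally show "(\<integral>\<^sup>+x. ennreal ((cmod (tail_of f k x))\<^sup>2) * indicator ?A x \<partial>D) \<le> ennreal (lam * q * R)" .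
qed measurable

lemma head_of_L1: "head_of f k \<in> Lp_space D 1"
proof -
  have "(\<integral>\<^sup>+x. ennreal (cmod (head_of f k x)) \<partial>D) \<le> (\<integral>\<^sup>+x. ennreal (cmod (f x)) \<partial>D)"
    by (intro nn_integral_mono ennreal_leI) (simp add: cmod_head_of)
  then show ?thesis using f by (auto simp: Lp_space_one_iff intro: le_less_trans)
qed

lemma tail_of_L2: "tail_of f k \<in> Lp_space D 2"
proof -
  have "(\<integral>\<^sup>+x. ennreal ((cmod (tail_of f k x))\<^sup>2) \<partial>D) \<le> (\<integral>\<^sup>+x. ennreal (lev f k) * ennreal (cmod (f x)) \<partial>D)"
  proof (intro nn_integral_mono)
    fix x
    have "min (cmod (f x)) (lev f k) * min (cmod (f x)) (lev f k) \<le> lev f k * cmod (f x)"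
      by (intro mult_mono) auto
    then show "ennreal ((cmod (tail_of f k x))\<^sup>2) \<le> ennreal (lev f k) * ennreal (cmod (f x))"
      by (simp add: cmod_tail_of power2_eq_square ennreal_mult[symmetric] ennreal_leI)
  qed
  also have "\<dots> < \<infinity>" using f by (simp add: nn_integral_cmult Lp_space_one_iff ennreal_mult_less_top)
  finally show ?thesis by (simp add: Lp_space_two_iff)
qed

lemma integrable_below_rearr:
  assumes [measurable]: "G \<in> borel_measurable D"
    and le: "AE x in D. cmod (G x) \<le> enn2real (sym_rearr D \<rho>D f x)"
  shows "integrable D G"
proof (rule integrableI_bounded)
  have "(\<integral>\<^sup>+x. ennreal (norm (G x)) \<partial>D) \<le> (\<integral>\<^sup>+x. ennreal (cmod (fin_rearr D \<rho>D f x)) \<partial>D)"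
  proof (rule nn_integral_mono_AE)
    show "AE x in D. ennreal (norm (G x)) \<le> ennreal (cmod (fin_rearr D \<rho>D f x))"
      using le by eventually_elim (simp add: fin_rearr_def ennreal_leI)
  qed
  also have "\<dots> < \<infinity>" using D.fin_rearr_L1[OF f] by (simp add: Lp_space_one_iff)
  finally show "(\<integral>\<^sup>+x. ennreal (norm (G x)) \<partial>D) < \<infinity>" .
qed simp

end

declare f_meas [measurable del]

end

context fourier_pair
begin

section \<open>Energy of the image of an operator of joint strong type\<close>

text \<open>Comparable to the \<open>L\<^sup>1\<close> norm of the head at scale \<open>k\<close>, except that scales below \<open>-n\<close> are left out to keep sums
  finite.\<close>

definition head_sum :: "('d \<Rightarrow> complex) \<Rightarrow> nat \<Rightarrow> int \<Rightarrow> real" where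
  "head_sum f n k = (\<Sum>i\<in>{- int n..<k}. (lev f i - lev f (i + 1)) * q powi i)"

context
  fixes f K T assumes f: "f \<in> Lp_space D 1" and K: "1 \<le> K"
    and T: "sublinear_operator D E T" "joint_strong_type D E K T"
begin

definition out_lev :: "int \<Rightarrow> real" where
  "out_lev j = enn2real (decr_rearr E (T f) (q powi j))"

text \<open>At these frequency scales the image of the head, which is bounded by \<open>K\<close> times its \<open>L\<^sup>1\<close> norm, does not account for
  more than half of \<open>out_lev j\<close>.\<close>

definition tail_dominated :: "int \<Rightarrow> bool" where
  "tail_dominated j \<longleftrightarrow> (\<forall>n. 2 * K * (lam * q) * head_sum f n (- j) < out_lev j)"

lemma T_measurable: "h \<in> L1_plus_L2 D \<Longrightarrow> T h \<in> borel_measurable E"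
  using T(1) by (simp add: sublinear_operator_def)

lemma Tf_measurable [measurable]: "T f \<in> borel_measurable E"
  by (intro T_measurable Lp_one_subset f)

lemma T_L1_bound:
  assumes h: "h \<in> Lp_space D 1" and le: "(\<integral>\<^sup>+x. ennreal (cmod (h x)) \<partial>D) \<le> ennreal b" "0 \<le> b"
  shows "AE y in E. cmod (T h y) \<le> K * b"
proof -
  have [measurable]: "T h \<in> borel_measurable E" by (intro T_measurable Lp_one_subset h)
  have "Linf_norm E (T h) \<le> ennreal K * Lp_norm D 1 h"
    using T(2) h by (simp add: joint_strong_type_def)
  also have "\<dots> \<le> ennreal K * ennreal b" unfolding Lp_norm_one using le by (intro mult_left_mono) auto
  also have "\<dots> = ennreal (K * b)" using K le by (simp add: ennreal_mult)
  finally have "AE y in E. ennreal (cmod (T h y)) \<le> ennreal (K * b)"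
    by (intro Linf_norm_le_iff[THEN iffD1]) auto
  then show ?thesis using K le by simp
qed

lemma T_L2_bound:
  assumes h: "h \<in> Lp_space D 2"
  shows "(\<integral>\<^sup>+y. ennreal ((cmod (T h y))\<^sup>2) \<partial>E) \<le> ennreal (K\<^sup>2) * (\<integral>\<^sup>+x. ennreal ((cmod (h x))\<^sup>2) \<partial>D)"
  using T(2) h K by (intro Lp_norm_two_le_iff[THEN iffD1]) (auto simp: joint_strong_type_def)

lemma out_lev_finite: "decr_rearr E (T f) t < \<infinity>"
proof -
  define b where "b = enn2real (\<integral>\<^sup>+x. ennreal (cmod (f x)) \<partial>D)"
  have b: "(\<integral>\<^sup>+x. ennreal (cmod (f x)) \<partial>D) = ennreal b" "0 \<le> b"
    using f by (simp_all add: b_def Lp_space_one_iff)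
  have "AE y in E. cmod (T f y) \<le> K * b"
    by (rule T_L1_bound[OF f _ b(2)]) (simp add: b)
  then have "emeasure E {y \<in> space E. K * b < cmod (T f y)} = 0"
    by (subst (asm) AE_iff_measurable[OF _ refl]) (simp_all add: not_le)
  then have "decr_rearr E (T f) t \<le> ennreal (K * b)"
    using K b by (subst decr_rearr_le_iff) auto
  then show ?thesis by (auto intro: le_less_trans)
qed

lemma out_lev_nonneg [simp]: "0 \<le> out_lev j" by (simp add: out_lev_def)

lemma out_lev_mono: "i \<le> j \<Longrightarrow> out_lev j \<le> out_lev i"
  unfolding out_lev_def using q by (intro enn2real_decr_rearr_antimono out_lev_finite power_int_mono_exp)

lemma head_sum_nonneg: "0 \<le> head_sum f n k"
  unfolding head_sum_def using lev_mono[OF f] by (intro sum_nonneg mult_nonneg_nonneg) auto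

lemma head_sum_mono: "n \<le> m \<Longrightarrow> head_sum f n k \<le> head_sum f m k"
  unfolding head_sum_def using lev_mono[OF f] by (intro sum_mono2 mult_nonneg_nonneg) auto

text \<open>If the tail dominates at scale \<open>j\<close>, then at all scales \<open>i \<le> j\<close> the level \<open>out_lev i\<close> is even larger, so the head
  accounts for at most half of it as well. Hence all these levels are, up to the factor two, levels of the image of
  the one tail at scale \<open>-j\<close>, and their energy is bounded by the \<open>L\<^sup>2\<close> estimate. The point is that this bounds
  the sum over the scales up to \<open>j\<close>, and not only each term.\<close>

lemma tail_energy:
  assumes good: "tail_dominated j" and R: "0 \<le> R" "\<And>M. - j \<le> M \<Longrightarrow> (\<Sum>i\<in>{- j..M}. (lev f i)\<^sup>2 * q powi i) \<le> R"
    and "l \<le> j + 1"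
  shows "(\<Sum>i\<in>{l..j}. (q powi i - q powi (i - 1)) * (out_lev i)\<^sup>2) \<le> 4 * (K\<^sup>2 * (lam * q * R))"
proof -
  have [measurable]: "f \<in> borel_measurable D" using f by (simp add: Lp_space_def)
  let ?x = "out_lev" and ?f1 = "head_of f (- j)" and ?f2 = "tail_of f (- j)"
  have f1: "?f1 \<in> Lp_space D 1" and f2: "?f2 \<in> Lp_space D 2" by (intro head_of_L1 tail_of_L2 f)+
  have [measurable]: "T ?f1 \<in> borel_measurable E" "T ?f2 \<in> borel_measurable E"
    by (intro T_measurable Lp_one_subset[OF f1] Lp_two_subset[OF f2])+
  have Klq: "0 < 2 * K * (lam * q)" using K lam by simp
  have "(\<integral>\<^sup>+x. ennreal (cmod (?f1 x)) \<partial>D) \<le> ennreal (lam * q * (?x j / (2 * K * (lam * q))))"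
  proof (rule head_of_norm[OF f])
    show "0 \<le> ?x j / (2 * K * (lam * q))" using Klq by simp
    show "(\<Sum>i\<in>{- int n..<- j}. (lev f i - lev f (i + 1)) * q powi i) \<le> ?x j / (2 * K * (lam * q))" for n
    proof -
      have "2 * K * (lam * q) * head_sum f n (- j) \<le> ?x j"
        using good by (auto simp: tail_dominated_def intro: less_imp_le)
      then show ?thesis using Klq by (simp only: pos_le_divide_eq head_sum_def mult.commute)
    qed
  qed
  moreover have "lam * q * (?x j / (2 * K * (lam * q))) = ?x j / (2 * K)"
    using lam by simp
  ultimately have "AE y in E. cmod (T ?f1 y) \<le> K * (?x j / (2 * K))"
    using K by (intro T_L1_bound f1) auto
  then have AE1: "AE y in E. cmod (T ?f1 y) \<le> ?x j / 2" using K by simp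
  have "AE y in E. cmod (T (\<lambda>x. ?f1 x + ?f2 x) y) \<le> cmod (T ?f1 y) + cmod (T ?f2 y)"
    using T(1)[unfolded sublinear_operator_def, THEN conjunct2, THEN conjunct1, rule_format,
      OF Lp_one_subset[OF f1] Lp_two_subset[OF f2]] .
  then have AE2: "AE y in E. cmod (T f y) \<le> ?x j / 2 + cmod (T ?f2 y)"
    using AE1 by eventually_elim (simp add: tail_of_def)
  have level: "emeasure E {y \<in> space E. t + ?x j / 2 < cmod (T f y)} \<le> emeasure E {y \<in> space E. t < cmod (T ?f2 y)}" for t
  proof (rule emeasure_mono_AE)
    show "AE y in E. y \<in> {y \<in> space E. t + ?x j / 2 < cmod (T f y)} \<longrightarrow> y \<in> {y \<in> space E. t < cmod (T ?f2 y)}"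
      using AE2 by eventually_elim auto
  qed measurable
  let ?w = "\<lambda>i. q powi i - q powi (i - 1)"
  have w: "0 \<le> ?w i" for i using power_int_mono_exp[OF q, of "i - 1" i] by simp
  have key: "(\<Sum>i\<in>{l..j}. ennreal (?w i) * indicator {0..<(?x i)\<^sup>2} s)
    \<le> indicator {0..} s * emeasure E {y \<in> space E. ennreal s < ennreal (4 * (cmod (T ?f2 y))\<^sup>2)}" for s
  proof (cases "0 \<le> s")
    case True
    let ?L = "{y \<in> space E. ennreal s < ennreal (4 * (cmod (T ?f2 y))\<^sup>2)}"
    have L: "ennreal (q powi i) \<le> emeasure E ?L" if "i \<le> j" "s < (?x i)\<^sup>2" for i
    proof -
      have sx: "sqrt s < ?x i" using that(2) True by (simp add: real_less_lsqrt)
      \<comment> \<open>A height below \<open>out_lev i\<close> that still exceeds \<open>sqrt s / 2\<close> after half of \<open>out_lev j\<close> is subtracted.\<close>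
      define \<tau> where "\<tau> = max (sqrt s) ((?x j + sqrt s) / 2)"
      have "?x j \<le> ?x i" using that(1) by (rule out_lev_mono)
      then have "\<tau> < ?x i" using sx by (auto simp: \<tau>_def)
      moreover have "0 \<le> \<tau>" using True by (simp add: \<tau>_def max.coboundedI1)
      ultimately have "ennreal (q powi i) < emeasure E {y \<in> space E. \<tau> < cmod (T f y)}"
        unfolding out_lev_def by (intro less_emeasure_below_decr_rearr) auto
      also have "{y \<in> space E. \<tau> < cmod (T f y)} = {y \<in> space E. (\<tau> - ?x j / 2) + ?x j / 2 < cmod (T f y)}"
        by simp
      also have "emeasure E \<dots> \<le> emeasure E {y \<in> space E. \<tau> - ?x j / 2 < cmod (T ?f2 y)}"
        by (rule level)
      also have "\<dots> \<le> emeasure E ?L"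
      proof (intro emeasure_mono subsetI)
        fix y assume y: "y \<in> {y \<in> space E. \<tau> - ?x j / 2 < cmod (T ?f2 y)}"
        moreover have "sqrt s / 2 \<le> \<tau> - ?x j / 2" by (auto simp: \<tau>_def max_def field_simps)
        ultimately have "sqrt s < 2 * cmod (T ?f2 y)" by auto
        then have "(sqrt s)\<^sup>2 < (2 * cmod (T ?f2 y))\<^sup>2" using True by (intro power_strict_mono) auto
        then have "s < 4 * (cmod (T ?f2 y))\<^sup>2" using True by (simp add: power_mult_distrib)
        then show "y \<in> ?L" using y True by (simp add: ennreal_less_iff)
      qed measurable
      finally show ?thesis by simp
    qed
    have eq: "(\<Sum>i\<in>{l..j}. ennreal (?w i) * indicator {0..<(?x i)\<^sup>2} s) = ennreal (\<Sum>i\<in>{l..j}. ?w i * of_bool (s < (?x i)\<^sup>2))"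
    proof -
      have "(\<Sum>i\<in>{l..j}. ennreal (?w i) * indicator {0..<(?x i)\<^sup>2} s) = (\<Sum>i\<in>{l..j}. ennreal (?w i * of_bool (s < (?x i)\<^sup>2)))"
        using True by (intro sum.cong) auto
      then show ?thesis using w by (subst sum_ennreal[symmetric]) (auto simp del: sum_mult_of_bool_eq)
    qed
    show ?thesis
    proof (cases "emeasure E ?L")
      case (real m)
      have "(\<Sum>i\<in>{l..j}. ?w i * of_bool (s < (?x i)\<^sup>2)) \<le> m"
      proof (rule telescoping_le)
        show "antimono (\<lambda>i. (?x i)\<^sup>2)" by (intro antimonoI power_mono out_lev_mono) auto
        show "q powi i \<le> m" if "l \<le> i" "i \<le> j" "s < (?x i)\<^sup>2" for i
          using L[OF that(2,3)] real by simp
      qed (use real \<open>l \<le> j + 1\<close> in auto)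
      then show ?thesis unfolding eq using True real by (simp add: ennreal_leI del: sum_mult_of_bool_eq)
    qed (use True in simp)
  qed simp
  have "ennreal (\<Sum>i\<in>{l..j}. ?w i * (?x i)\<^sup>2) = (\<Sum>i\<in>{l..j}. ennreal (?w i) * ennreal ((?x i)\<^sup>2))"
    using w by (subst sum_ennreal[symmetric]) (auto simp: ennreal_mult)
  also have "\<dots> = (\<integral>\<^sup>+s. (\<Sum>i\<in>{l..j}. ennreal (?w i) * indicator {0..<(?x i)\<^sup>2} s) \<partial>lborel)"
    by (subst nn_integral_sum) (auto simp: nn_integral_cmult_indicator)
  also have "\<dots> \<le> (\<integral>\<^sup>+s. indicator {0..} s * emeasure E {y \<in> space E. ennreal s < ennreal (4 * (cmod (T ?f2 y))\<^sup>2)} \<partial>lborel)"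
    by (intro nn_integral_mono key)
  also have "\<dots> = (\<integral>\<^sup>+y. ennreal (4 * (cmod (T ?f2 y))\<^sup>2) \<partial>E)"
    by (rule E.nn_integral_layers[symmetric]) measurable
  also have "\<dots> = 4 * (\<integral>\<^sup>+y. ennreal ((cmod (T ?f2 y))\<^sup>2) \<partial>E)"
    by (simp add: ennreal_mult nn_integral_cmult)
  also have "\<dots> \<le> 4 * (ennreal (K\<^sup>2) * (\<integral>\<^sup>+x. ennreal ((cmod (?f2 x))\<^sup>2) \<partial>D))"
    by (intro mult_left_mono T_L2_bound f2) auto
  also have "\<dots> \<le> 4 * (ennreal (K\<^sup>2) * ennreal (lam * q * R))"
    by (intro mult_left_mono tail_of_norm f R) auto
  also have "\<dots> = ennreal (4 * (K\<^sup>2 * (lam * q * R)))"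
    using lam R by (simp add: ennreal_mult)
  finally show ?thesis
    using lam R K by (subst (asm) ennreal_le_iff) auto
qed

end

declare Tf_measurable [measurable del]

section \<open>Multipliers with large Fourier transform\<close>

text \<open>The superposition of bumps weighted with the increments of the levels stays below the rearrangement of \<open>f\<close>. All
  bumps have non-negative transforms, so those that are large at \<open>y\<close> cannot be cancelled by the others, and one
  multiplier serves all frequencies at once.\<close>

lemma head_multiplier:
  assumes f: "f \<in> Lp_space D 1"
  shows "\<exists>G. G \<in> borel_measurable D \<and> (AE x in D. cmod (G x) \<le> enn2real (sym_rearr D \<rho>D f x)) \<and>
    (\<forall>y\<in>E' \<inter> space E. - \<kappa> y \<le> int n + 1 \<longrightarrow> c * head_sum f n (- \<kappa> y) \<le> cmod (ft G y))"
proof -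
  let ?a = "lev f"
  have am: "i \<le> j \<Longrightarrow> ?a j \<le> ?a i" for i j by (rule lev_mono[OF f])
  define \<Phi> where "\<Phi> k \<phi> \<longleftrightarrow> \<phi> \<in> borel_measurable D \<and> (\<forall>x. 0 \<le> \<phi> x \<and> \<phi> x \<le> 1 \<and> (\<phi> x \<noteq> 0 \<longrightarrow> \<rho>D x \<le> lam * q powi k)) \<and>
    (\<forall>y\<in>E'. \<exists>s. 0 \<le> s \<and> (\<integral>x. complex_of_real (\<phi> x) * e x y \<partial>D) = complex_of_real s \<and>
       (0 < ?a k \<longrightarrow> k < - \<kappa> y \<longrightarrow> c * q powi k \<le> s))" for k :: int and \<phi> :: "'d \<Rightarrow> real"
  have "\<exists>\<phi>. \<Phi> k \<phi>" for k
  proof (cases "0 < ?a k")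
    case True
    then show ?thesis using bump[OF lev_less_measure[OF f True]] unfolding \<Phi>_def by blast
  next
    case False
    have "\<Phi> k (\<lambda>_. 0)" using False unfolding \<Phi>_def by (auto intro: exI[of _ 0])
    then show ?thesis by blast
  qed
  then obtain \<phi> where \<phi>: "\<And>k. \<Phi> k (\<phi> k)" by metis
  have [measurable]: "\<phi> k \<in> borel_measurable D" for k using \<phi> by (simp add: \<Phi>_def)
  have \<phi>01: "0 \<le> \<phi> k x" "\<phi> k x \<le> 1" "\<phi> k x \<noteq> 0 \<Longrightarrow> \<rho>D x \<le> lam * q powi k" for k x using \<phi> by (auto simp: \<Phi>_def)
  let ?b = "\<lambda>i. ?a i - ?a (i + 1)"
  have b: "0 \<le> ?b i" for i using am[of i "i + 1"] by simp
  define G where "G x = (\<Sum>i\<in>{- int n..int n}. ?b i *\<^sub>R complex_of_real (\<phi> i x))" for x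
  have G_eq: "G x = complex_of_real (\<Sum>i\<in>{- int n..int n}. ?b i * \<phi> i x)" for x
    by (simp add: G_def scaleR_conv_of_real)
  have sum_le: "(\<Sum>i\<in>{- int n..int n}. ?b i * \<phi> i x) \<le> enn2real (sym_rearr D \<rho>D f x)"
    if fin: "sym_rearr D \<rho>D f x < \<infinity>" for x
  proof -
    let ?I = "{i \<in> {- int n..int n}. \<phi> i x \<noteq> 0}"
    have eq: "(\<Sum>i\<in>{- int n..int n}. ?b i * \<phi> i x) = (\<Sum>i\<in>?I. ?b i * \<phi> i x)"
      by (intro sum.mono_neutral_right) auto
    show ?thesis
    proof (cases "?I = {}")
      case True
      then show ?thesis unfolding eq by simp
    next
      case False
      have "finite ?I" by (rule finite_subset[of _ "{- int n..int n}"]) auto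
      \<comment> \<open>Only bumps of scale at least \<open>m\<close> live at \<open>x\<close>, and their weights telescope to the level at \<open>m\<close>.\<close>
      define m where "m = Min ?I"
      have m: "m \<in> ?I" unfolding m_def using \<open>finite ?I\<close> False by (rule Min_in)
      have "(\<Sum>i\<in>?I. ?b i * \<phi> i x) \<le> (\<Sum>i\<in>?I. ?b i)"
        using b \<phi>01 by (intro sum_mono mult_left_le) auto
      also have "\<dots> \<le> (\<Sum>i\<in>{m..int n}. ?b i)"
      proof (rule sum_mono2)
        show "?I \<subseteq> {m..int n}" unfolding m_def using Min_le[OF \<open>finite ?I\<close>] by auto
      qed (use b in auto)
      also have "\<dots> = ?a m - ?a (int n + 1)" using m by (intro sum_telescope_int) auto
      also have "\<dots> \<le> ?a m" using lev_nonneg by simp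
      also have "\<dots> \<le> enn2real (sym_rearr D \<rho>D f x)"
        using m \<phi>01(3) by (intro lev_le_rearr[OF f fin]) auto
      finally show ?thesis unfolding eq .
    qed
  qed
  have AEfin: "AE x in D. sym_rearr D \<rho>D f x < \<infinity>" by (intro D.sym_rearr_finite_AE Lp_one_subset f)
  have "AE x in D. cmod (G x) \<le> enn2real (sym_rearr D \<rho>D f x)"
    using AEfin
  proof eventually_elim
    case (elim x)
    have "0 \<le> (\<Sum>i\<in>{- int n..int n}. ?b i * \<phi> i x)" using b \<phi>01 by (intro sum_nonneg mult_nonneg_nonneg) auto
    then show ?case unfolding G_eq norm_of_real using sum_le[OF elim] by simp
  qed
  moreover have "c * head_sum f n (- \<kappa> y) \<le> cmod (ft G y)"
    if y: "y \<in> E'" "y \<in> space E" and n: "- \<kappa> y \<le> int n + 1" for y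
  proof -
    have int: "integrable D (\<lambda>x. complex_of_real (?b i * \<phi> i x))" if i: "i \<in> {- int n..int n}" for i
    proof (rule integrable_below_rearr[OF f])
      show "AE x in D. cmod (complex_of_real (?b i * \<phi> i x)) \<le> enn2real (sym_rearr D \<rho>D f x)"
        using AEfin
      proof eventually_elim
        case (elim x)
        have "?b i * \<phi> i x \<le> (\<Sum>i\<in>{- int n..int n}. ?b i * \<phi> i x)"
          using i b \<phi>01 by (intro member_le_sum mult_nonneg_nonneg) auto
        moreover have "0 \<le> ?b i * \<phi> i x" using b \<phi>01 by (intro mult_nonneg_nonneg) auto
        ultimately show ?case unfolding norm_of_real using sum_le[OF elim] by simp
      qed
    qed measurable
    obtain s where s: "\<And>k. 0 \<le> s k \<and> (\<integral>x. complex_of_real (\<phi> k x) * e x y \<partial>D) = complex_of_real (s k) \<and>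
       (0 < ?a k \<longrightarrow> k < - \<kappa> y \<longrightarrow> c * q powi k \<le> s k)"
    proof -
      have "\<forall>k. \<exists>s. 0 \<le> s \<and> (\<integral>x. complex_of_real (\<phi> k x) * e x y \<partial>D) = complex_of_real s \<and>
          (0 < ?a k \<longrightarrow> k < - \<kappa> y \<longrightarrow> c * q powi k \<le> s)"
        using \<phi>[unfolded \<Phi>_def, THEN conjunct2, THEN conjunct2] y(1) by blast
      from choice[OF this] show ?thesis using that by blast
    qed
    have "ft G y = ft (\<lambda>x. \<Sum>i\<in>{- int n..int n}. 1 *\<^sub>R complex_of_real (?b i * \<phi> i x)) y"
      by (intro arg_cong2[where f = ft]) (auto simp: G_eq)
    also have "\<dots> = (\<Sum>i\<in>{- int n..int n}. 1 *\<^sub>R ft (\<lambda>x. complex_of_real (?b i * \<phi> i x)) y)"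
      using int by (intro ft_sum y(2)) auto
    also have "\<dots> = (\<Sum>i\<in>{- int n..int n}. complex_of_real (?b i * s i))"
    proof (intro sum.cong refl)
      fix i
      have "ft (\<lambda>x. complex_of_real (?b i * \<phi> i x)) y = (\<integral>x. complex_of_real (?b i) * (complex_of_real (\<phi> i x) * e x y) \<partial>D)"
        unfolding ft_def by (intro Bochner_Integration.integral_cong) (auto simp: mult.assoc)
      also have "\<dots> = complex_of_real (?b i) * (\<integral>x. complex_of_real (\<phi> i x) * e x y \<partial>D)"
        by (rule integral_mult_right_zero)
      finally show "1 *\<^sub>R ft (\<lambda>x. complex_of_real (?b i * \<phi> i x)) y = complex_of_real (?b i * s i)"
        using s by simp
    qed
    finally have "ft G y = complex_of_real (\<Sum>i\<in>{- int n..int n}. ?b i * s i)"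
      by (simp only: of_real_sum)
    then have "cmod (ft G y) = \<bar>\<Sum>i\<in>{- int n..int n}. ?b i * s i\<bar>"
      by (simp only: norm_of_real)
    then have ftG: "(\<Sum>i\<in>{- int n..int n}. ?b i * s i) \<le> cmod (ft G y)" by simp
    have "c * head_sum f n (- \<kappa> y) = (\<Sum>i\<in>{- int n..<- \<kappa> y}. ?b i * (c * q powi i))"
      by (simp add: head_sum_def sum_distrib_left ac_simps)
    also have "\<dots> \<le> (\<Sum>i\<in>{- int n..<- \<kappa> y}. ?b i * s i)"
    proof (rule sum_mono)
      fix i assume i: "i \<in> {- int n..<- \<kappa> y}"
      show "?b i * (c * q powi i) \<le> ?b i * s i"
      proof (cases "0 < ?a i")
        case True
        then show ?thesis using s[of i] i b by (intro mult_left_mono) auto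
      next
        case False
        then have "?a i = 0" "?a (i + 1) = 0"
          using lev_nonneg[of f i] lev_nonneg[of f "i + 1"] am[of i "i + 1"] by linarith+
        then show ?thesis by simp
      qed
    qed
    also have "\<dots> \<le> (\<Sum>i\<in>{- int n..int n}. ?b i * s i)"
      using n s b by (intro sum_mono2 mult_nonneg_nonneg) auto
    finally show ?thesis using ftG by simp
  qed
  moreover have "G \<in> borel_measurable D" unfolding G_def by measurable
  ultimately show ?thesis by blast
qed

text \<open>Multiply the levels of \<open>f\<close> on disjoint cells with signs. By the Khinchine inequality the mean over all signs
  of \<open>|ft G|\<^sup>\<beta>\<close> dominates the square function of the transforms of the cells; hence its integral is at most the
  largest integral for a fixed choice of signs.\<close>

lemma random_multiplier:
  fixes Q :: "int \<Rightarrow> 'd set set" and b :: "int \<Rightarrow> real"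
  assumes f: "f \<in> Lp_space D 1" and fin: "finite N" "\<And>k. k \<in> N \<Longrightarrow> finite (Q k)" and disj: "\<And>k. k \<in> N \<Longrightarrow> disjoint (Q k)"
    and Q: "\<And>k A. k \<in> N \<Longrightarrow> A \<in> Q k \<Longrightarrow> A \<in> sets D \<and> A \<subseteq> C k" and pos: "\<And>k. k \<in> N \<Longrightarrow> 0 < lev f k"
    and "0 < \<beta>" "\<beta> \<le> 2"
    and [measurable]: "w \<in> borel_measurable E"
    and B: "\<And>G. G \<in> borel_measurable D \<Longrightarrow> AE x in D. cmod (G x) \<le> enn2real (sym_rearr D \<rho>D f x) \<Longrightarrow>
      (\<integral>\<^sup>+y. ennreal (cmod (ft G y) powr \<beta>) * w y \<partial>E) \<le> B"
  shows "(\<integral>\<^sup>+y. ennreal ((\<Sum>k\<in>N. (lev f k)\<^sup>2 * (\<Sum>A\<in>Q k. (cmod (\<integral>x. indicator A x * e x y \<partial>D))\<^sup>2)) powr (\<beta> / 2)) * w y \<partial>E)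
    \<le> 3 * B"
proof -
  define I where "I = Sigma N Q"
  have finI: "finite I" using fin by (auto simp: I_def)
  define u where "u i = (\<lambda>x. complex_of_real (lev f (fst i)) * indicator (snd i) x)" for i :: "int \<times> 'd set"
  have um [measurable]: "u i \<in> borel_measurable D" if "i \<in> I" for i
  proof -
    have [measurable]: "snd i \<in> sets D" using Q that by (auto simp: I_def)
    show ?thesis unfolding u_def by measurable
  qed
  define G where "G S x = signed_sum I (\<lambda>i. u i x) S" for S x
  have Gm [measurable]: "G S \<in> borel_measurable D" for S
    unfolding G_def signed_sum_def by measurable
  have AEfin: "AE x in D. sym_rearr D \<rho>D f x < \<infinity>" by (intro D.sym_rearr_finite_AE Lp_one_subset f)
  have bound: "(\<Sum>i\<in>I. cmod (u i x)) \<le> enn2real (sym_rearr D \<rho>D f x)" if fin': "sym_rearr D \<rho>D f x < \<infinity>" for x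
  proof (cases "\<exists>i\<in>I. x \<in> snd i")
    case True
    then obtain k A where kA: "(k, A) \<in> I" "x \<in> A" by auto
    then have k: "k \<in> N" "A \<in> Q k" by (auto simp: I_def)
    have uniq: "i = (k, A)" if "i \<in> I" "x \<in> snd i" for i
    proof -
      obtain k' A' where i: "i = (k', A')" "k' \<in> N" "A' \<in> Q k'" "x \<in> A'" using \<open>i \<in> I\<close> \<open>x \<in> snd i\<close> by (auto simp: I_def)
      have "x \<in> C k" "x \<in> C k'" using Q[OF k] Q[OF i(2,3)] kA i by auto
      then have "k' = k" using C_disj[of k k'] by auto
      moreover have "A' = A"
      proof (rule ccontr)
        assume "A' \<noteq> A"
        moreover have "A' \<in> Q k" using i(3) \<open>k' = k\<close> by simp
        ultimately have "A' \<inter> A = {}" using disj[OF k(1)] k(2) unfolding disjoint_def by auto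
        then show False using i(4) kA(2) by auto
      qed
      ultimately show ?thesis using i by simp
    qed
    have "(\<Sum>i\<in>I. cmod (u i x)) = (\<Sum>i\<in>{(k, A)}. cmod (u i x))"
    proof (intro sum.mono_neutral_right finI)
      show "\<forall>i\<in>I - {(k, A)}. cmod (u i x) = 0"
      proof
        fix i assume i: "i \<in> I - {(k, A)}"
        then have "x \<notin> snd i" using uniq[of i] by blast
        then show "cmod (u i x) = 0" by (simp add: u_def)
      qed
    qed (use kA in auto)
    also have "\<dots> = lev f k" using kA by (simp add: u_def)
    also have "\<dots> \<le> enn2real (sym_rearr D \<rho>D f x)"
      using Q[OF k] kA(2) C_sub[OF lev_less_measure[OF f pos[OF k(1)]]]
      by (intro lev_le_rearr[OF f fin']) auto
    finally show ?thesis .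
  next
    case False
    then have "(\<Sum>i\<in>I. cmod (u i x)) = 0" by (intro sum.neutral) (auto simp: u_def)
    then show ?thesis by simp
  qed
  have Gle: "AE x in D. cmod (G S x) \<le> enn2real (sym_rearr D \<rho>D f x)" for S
    using AEfin
  proof eventually_elim
    case (elim x)
    have "cmod (G S x) \<le> (\<Sum>i\<in>I. cmod ((if i \<in> S then 1 else - 1) *\<^sub>R u i x))"
      unfolding G_def signed_sum_def by (rule norm_sum)
    also have "\<dots> = (\<Sum>i\<in>I. cmod (u i x))" by (intro sum.cong) auto
    finally show ?case using bound[OF elim] by simp
  qed
  have uint: "integrable D (u i)" if "i \<in> I" for i
  proof (rule integrable_below_rearr[OF f um[OF that]])
    show "AE x in D. cmod (u i x) \<le> enn2real (sym_rearr D \<rho>D f x)"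
      using AEfin
    proof eventually_elim
      case (elim x)
      have "cmod (u i x) \<le> (\<Sum>i\<in>I. cmod (u i x))" using finI that by (intro member_le_sum) auto
      then show ?case using bound[OF elim] by simp
    qed
  qed
  have ftG: "ft (G S) y = signed_sum I (\<lambda>i. ft (u i) y) S" if "y \<in> space E" for S y
    unfolding G_def signed_sum_def using that finI uint by (intro ft_sum) auto
  have ftu: "cmod (ft (u (k, A)) y) = lev f k * cmod (\<integral>x. indicator A x * e x y \<partial>D)" for k A y
  proof -
    have "ft (u (k, A)) y = (\<integral>x. complex_of_real (lev f k) * (indicator A x * e x y) \<partial>D)"
      unfolding ft_def u_def by (simp add: mult.assoc)
    then show ?thesis by (simp add: norm_mult)
  qed
  have "2 ^ card I * (\<integral>\<^sup>+y. ennreal ((\<Sum>k\<in>N. (lev f k)\<^sup>2 * (\<Sum>A\<in>Q k. (cmod (\<integral>x. indicator A x * e x y \<partial>D))\<^sup>2)) powr (\<beta> / 2)) * w y \<partial>E)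
      = (\<integral>\<^sup>+y. ennreal (2 ^ card I * (\<Sum>i\<in>I. (cmod (ft (u i) y))\<^sup>2) powr (\<beta> / 2)) * w y \<partial>E)"
  proof -
    have eq: "(\<Sum>k\<in>N. (lev f k)\<^sup>2 * (\<Sum>A\<in>Q k. (cmod (\<integral>x. indicator A x * e x y \<partial>D))\<^sup>2)) = (\<Sum>i\<in>I. (cmod (ft (u i) y))\<^sup>2)" for y
    proof -
      have "(\<Sum>k\<in>N. (lev f k)\<^sup>2 * (\<Sum>A\<in>Q k. (cmod (\<integral>x. indicator A x * e x y \<partial>D))\<^sup>2))
          = (\<Sum>k\<in>N. \<Sum>A\<in>Q k. (cmod (ft (u (k, A)) y))\<^sup>2)"
        by (simp add: ftu power_mult_distrib sum_distrib_left)
      also have "\<dots> = (\<Sum>(k, A)\<in>I. (cmod (ft (u (k, A)) y))\<^sup>2)"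
        unfolding I_def using fin by (intro sum.Sigma) auto
      finally show ?thesis by (simp add: split_def)
    qed
    have m: "(\<lambda>y. ennreal ((\<Sum>i\<in>I. (cmod (ft (u i) y))\<^sup>2) powr (\<beta> / 2)) * w y) \<in> borel_measurable E"
      by measurable
    show ?thesis
      unfolding eq by (subst nn_integral_cmult[OF m, symmetric], intro nn_integral_cong)
        (simp add: ennreal_mult mult.assoc flip: ennreal_power)
  qed
  also have "\<dots> \<le> (\<integral>\<^sup>+y. (\<Sum>S\<in>Pow I. 3 * (ennreal (cmod (ft (G S) y) powr \<beta>) * w y)) \<partial>E)"
  proof (intro nn_integral_mono)
    fix y assume y: "y \<in> space E"
    have "2 ^ card I * (\<Sum>i\<in>I. (cmod (ft (u i) y))\<^sup>2) powr (\<beta> / 2) \<le> 3 * (\<Sum>S\<in>Pow I. cmod (ft (G S) y) powr \<beta>)"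
      using Khinchine_lower[OF finI \<open>0 < \<beta>\<close> \<open>\<beta> \<le> 2\<close>, of "\<lambda>i. ft (u i) y"] by (simp add: ftG[OF y])
    then have "ennreal (2 ^ card I * (\<Sum>i\<in>I. (cmod (ft (u i) y))\<^sup>2) powr (\<beta> / 2)) \<le> ennreal (3 * (\<Sum>S\<in>Pow I. cmod (ft (G S) y) powr \<beta>))"
      by (rule ennreal_leI)
    also have "\<dots> = 3 * (\<Sum>S\<in>Pow I. ennreal (cmod (ft (G S) y) powr \<beta>))"
      by (simp add: ennreal_mult sum_nonneg)
    finally have "ennreal (2 ^ card I * (\<Sum>i\<in>I. (cmod (ft (u i) y))\<^sup>2) powr (\<beta> / 2)) * w y \<le> 3 * (\<Sum>S\<in>Pow I. ennreal (cmod (ft (G S) y) powr \<beta>)) * w y"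
      by (rule mult_right_mono) simp
    then show "ennreal (2 ^ card I * (\<Sum>i\<in>I. (cmod (ft (u i) y))\<^sup>2) powr (\<beta> / 2)) * w y \<le> (\<Sum>S\<in>Pow I. 3 * (ennreal (cmod (ft (G S) y) powr \<beta>) * w y))"
      by (simp add: sum_distrib_left sum_distrib_right mult.assoc del: sum_ennreal)
  qed
  also have "\<dots> = (\<Sum>S\<in>Pow I. 3 * (\<integral>\<^sup>+y. ennreal (cmod (ft (G S) y) powr \<beta>) * w y \<partial>E))"
    by (subst nn_integral_sum) (auto simp: nn_integral_cmult)
  also have "\<dots> \<le> (\<Sum>S\<in>Pow I. 3 * B)" by (intro sum_mono mult_left_mono B Gm Gle) auto
  also have "\<dots> = 2 ^ card I * (3 * B)" using finI by (simp add: card_Pow)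
  finally show ?thesis
    by (subst (asm) ennreal_mult_le_mult_iff) (auto simp: power_eq_top_ennreal)
qed

end

section \<open>Comparison with the Fourier operator\<close>

context fourier_pair
begin

lemma kappa_sets: "{y \<in> space E. P (\<kappa> y)} \<in> sets E"
proof -
  have "{y \<in> space E. P (\<kappa> y)} = \<kappa> -` Collect P \<inter> space E" by auto
  then show ?thesis using measurable_sets[OF \<kappa>_measurable, of "Collect P"] by simp
qed

context
  fixes f K T \<beta> w B assumes f: "f \<in> Lp_space D 1" and K: "1 \<le> K"
    and T: "sublinear_operator D E T" "joint_strong_type D E K T"
    and \<beta>: "0 < \<beta>" "\<beta> \<le> 2"
    and w [measurable]: "w \<in> borel_measurable E"
    and B: "\<And>G. G \<in> borel_measurable D \<Longrightarrow> AE x in D. cmod (G x) \<le> enn2real (sym_rearr D \<rho>D f x) \<Longrightarrow>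
      (\<integral>\<^sup>+y. ennreal (cmod (ft G y) powr \<beta>) * w y \<partial>E) \<le> B"
begin

abbreviation "xl \<equiv> out_lev f T"
abbreviation "good \<equiv> tail_dominated f K T"

lemmas xl_nonneg = out_lev_nonneg[OF f K T]

lemma head_part:
  "(\<integral>\<^sup>+y. ennreal (xl (\<kappa> y) powr \<beta> * of_bool (\<not> good (\<kappa> y))) * w y \<partial>E) \<le> ennreal ((2 * K * (lam * q) / c) powr \<beta>) * B"
proof (rule nn_integral_le_exhaust[where
    A = "\<lambda>n. {y \<in> space E. \<bar>\<kappa> y\<bar> \<le> int n \<and> xl (\<kappa> y) \<le> 2 * K * (lam * q) * head_sum f n (- \<kappa> y)}"])
  have Klq: "0 < 2 * K * (lam * q)" using K lam by simp
  show "incseq (\<lambda>n. {y \<in> space E. \<bar>\<kappa> y\<bar> \<le> int n \<and> xl (\<kappa> y) \<le> 2 * K * (lam * q) * head_sum f n (- \<kappa> y)})"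
  proof (intro incseq_SucI subsetI)
    fix n y assume y: "y \<in> {y \<in> space E. \<bar>\<kappa> y\<bar> \<le> int n \<and> xl (\<kappa> y) \<le> 2 * K * (lam * q) * head_sum f n (- \<kappa> y)}"
    have "2 * K * (lam * q) * head_sum f n (- \<kappa> y) \<le> 2 * K * (lam * q) * head_sum f (Suc n) (- \<kappa> y)"
      using Klq by (intro mult_left_mono head_sum_mono[OF f K T]) auto
    then show "y \<in> {y \<in> space E. \<bar>\<kappa> y\<bar> \<le> int (Suc n) \<and> xl (\<kappa> y) \<le> 2 * K * (lam * q) * head_sum f (Suc n) (- \<kappa> y)}"
      using y by auto
  qed
  show "AE y in E. ennreal (xl (\<kappa> y) powr \<beta> * of_bool (\<not> good (\<kappa> y))) * w y = 0 \<or>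
    (\<exists>n. y \<in> {y \<in> space E. \<bar>\<kappa> y\<bar> \<le> int n \<and> xl (\<kappa> y) \<le> 2 * K * (lam * q) * head_sum f n (- \<kappa> y)})"
  proof (rule AE_I2)
    fix y assume y: "y \<in> space E"
    show "ennreal (xl (\<kappa> y) powr \<beta> * of_bool (\<not> good (\<kappa> y))) * w y = 0 \<or>
      (\<exists>n. y \<in> {y \<in> space E. \<bar>\<kappa> y\<bar> \<le> int n \<and> xl (\<kappa> y) \<le> 2 * K * (lam * q) * head_sum f n (- \<kappa> y)})"
    proof (cases "good (\<kappa> y)")
      case False
      then obtain n where n: "xl (\<kappa> y) \<le> 2 * K * (lam * q) * head_sum f n (- \<kappa> y)"
        using tail_dominated_def[OF f K T] by (auto simp: not_less)
      let ?n = "max n (nat \<bar>\<kappa> y\<bar>)"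
      have "2 * K * (lam * q) * head_sum f n (- \<kappa> y) \<le> 2 * K * (lam * q) * head_sum f ?n (- \<kappa> y)"
        using Klq by (intro mult_left_mono head_sum_mono[OF f K T]) auto
      then have "y \<in> {y \<in> space E. \<bar>\<kappa> y\<bar> \<le> int ?n \<and> xl (\<kappa> y) \<le> 2 * K * (lam * q) * head_sum f ?n (- \<kappa> y)}"
        using n y by auto
      then show ?thesis by blast
    qed simp
  qed
  fix n
  let ?A = "{y \<in> space E. \<bar>\<kappa> y\<bar> \<le> int n \<and> xl (\<kappa> y) \<le> 2 * K * (lam * q) * head_sum f n (- \<kappa> y)}"
  show "?A \<in> sets E" by (rule kappa_sets)
  obtain G where G [measurable]: "G \<in> borel_measurable D" and Gle: "AE x in D. cmod (G x) \<le> enn2real (sym_rearr D \<rho>D f x)"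
    and Gft: "\<And>y. y \<in> E' \<Longrightarrow> y \<in> space E \<Longrightarrow> - \<kappa> y \<le> int n + 1 \<Longrightarrow> c * head_sum f n (- \<kappa> y) \<le> cmod (ft G y)"
    using head_multiplier[OF f, of n] by blast
  have "(\<integral>\<^sup>+y. ennreal (xl (\<kappa> y) powr \<beta> * of_bool (\<not> good (\<kappa> y))) * w y * indicator ?A y \<partial>E)
    \<le> (\<integral>\<^sup>+y. ennreal ((2 * K * (lam * q) / c) powr \<beta>) * (ennreal (cmod (ft G y) powr \<beta>) * w y) \<partial>E)"
  proof (rule nn_integral_mono_AE)
    show "AE y in E. ennreal (xl (\<kappa> y) powr \<beta> * of_bool (\<not> good (\<kappa> y))) * w y * indicator ?A y
      \<le> ennreal ((2 * K * (lam * q) / c) powr \<beta>) * (ennreal (cmod (ft G y) powr \<beta>) * w y)"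
      using AE_E' AE_space
    proof eventually_elim
      case (elim y)
      show ?case
      proof (cases "y \<in> ?A")
        case True
        have "xl (\<kappa> y) \<le> 2 * K * (lam * q) / c * (c * head_sum f n (- \<kappa> y))" using True c by simp
        also have "\<dots> \<le> 2 * K * (lam * q) / c * cmod (ft G y)"
          using Gft[OF elim] True Klq c by (intro mult_left_mono) auto
        finally have "xl (\<kappa> y) powr \<beta> \<le> (2 * K * (lam * q) / c * cmod (ft G y)) powr \<beta>"
          using \<beta> xl_nonneg by (intro powr_mono2) auto
        also have "\<dots> = (2 * K * (lam * q) / c) powr \<beta> * cmod (ft G y) powr \<beta>"
          using Klq c by (intro powr_mult)
        finally have "xl (\<kappa> y) powr \<beta> * of_bool (\<not> good (\<kappa> y)) \<le> (2 * K * (lam * q) / c) powr \<beta> * cmod (ft G y) powr \<beta>"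
          by (auto simp: of_bool_def)
        then have "ennreal (xl (\<kappa> y) powr \<beta> * of_bool (\<not> good (\<kappa> y))) \<le> ennreal ((2 * K * (lam * q) / c) powr \<beta>) * ennreal (cmod (ft G y) powr \<beta>)"
          by (simp add: ennreal_mult[symmetric] ennreal_leI)
        then have "ennreal (xl (\<kappa> y) powr \<beta> * of_bool (\<not> good (\<kappa> y))) * w y \<le> ennreal ((2 * K * (lam * q) / c) powr \<beta>) * ennreal (cmod (ft G y) powr \<beta>) * w y"
          by (rule mult_right_mono) simp
        then show ?thesis using True by (simp add: mult.assoc)
      qed simp
    qed
  qed
  also have "\<dots> = ennreal ((2 * K * (lam * q) / c) powr \<beta>) * (\<integral>\<^sup>+y. ennreal (cmod (ft G y) powr \<beta>) * w y \<partial>E)"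
    by (rule nn_integral_cmult) measurable
  also have "\<dots> \<le> ennreal ((2 * K * (lam * q) / c) powr \<beta>) * B"
    by (intro mult_left_mono B G Gle) auto
  finally show "(\<integral>\<^sup>+y. ennreal (xl (\<kappa> y) powr \<beta> * of_bool (\<not> good (\<kappa> y))) * w y * indicator ?A y \<partial>E)
    \<le> ennreal ((2 * K * (lam * q) / c) powr \<beta>) * B" .
qed measurable

text \<open>Chosen so that \<open>tail_energy\<close> leaves a factor two between demands and supplies.\<close>

definition demand_const :: real where "demand_const = (1 - 1 / q) / (8 * K\<^sup>2 * (lam * q))"

lemma demand_const_pos: "0 < demand_const" using q lam K by (simp add: demand_const_def)

text \<open>Only scales at which the tail dominates have a demand. At the last such scale \<open>j' \<le> j\<close> the energy bound applies, and for
  \<open>j\<close> there are even more supplies. The supplies form a series, of which a finite part suffices because of the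
  factor two in \<open>demand_const\<close>.\<close>

lemma demand_le_supply:
  assumes n: "- n \<le> j"
  shows "\<exists>M. (\<Sum>i\<in>{- n..j}. demand_const * q powi i * (xl i)\<^sup>2 * of_bool (good i)) \<le> (\<Sum>k\<in>{- j..M}. (lev f k)\<^sup>2 * q powi k)"
proof -
  define v where "v i = demand_const * q powi i * (xl i)\<^sup>2 * of_bool (good i)" for i
  have v0: "0 \<le> v i" for i using demand_const_pos by (simp add: v_def)
  define X where "X = sum v {- n..j}"
  show ?thesis
  proof (cases "X = 0")
    case True
    have "0 \<le> (\<Sum>k\<in>{- j..0}. (lev f k)\<^sup>2 * q powi k)" by (intro sum_nonneg mult_nonneg_nonneg) auto
    then show ?thesis using True unfolding X_def v_def by (intro exI[of _ 0]) simp
  next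
    case False
    then have X: "0 < X" using v0 by (simp add: X_def sum_nonneg order_less_le)
    define J where "J = {i \<in> {- n..j}. good i}"
    have "finite J" unfolding J_def by (rule finite_subset[of _ "{- n..j}"]) auto
    have "J \<noteq> {}"
    proof
      assume "J = {}"
      then have "v i = 0" if "i \<in> {- n..j}" for i using that by (auto simp: J_def v_def)
      then show False using False by (simp add: X_def)
    qed
    define j' where "j' = Max J"
    have j': "j' \<in> J" unfolding j'_def using \<open>finite J\<close> \<open>J \<noteq> {}\<close> by (rule Max_in)
    then have j'1: "- n \<le> j'" "j' \<le> j" "good j'" by (auto simp: J_def)
    have X': "X = sum v {- n..j'}"
      unfolding X_def
    proof (rule sum.mono_neutral_right)
      show "\<forall>i\<in>{- n..j} - {- n..j'}. v i = 0"
      proof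
        fix i assume i: "i \<in> {- n..j} - {- n..j'}"
        have "\<not> good i"
        proof
          assume "good i"
          then have "i \<in> J" using i by (auto simp: J_def)
          then have "i \<le> j'" unfolding j'_def using \<open>finite J\<close> by simp
          then show False using i by auto
        qed
        then show "v i = 0" by (simp add: v_def)
      qed
    qed (use j'1 in auto)
    have "\<exists>M\<ge>- j'. X \<le> (\<Sum>k\<in>{- j'..M}. (lev f k)\<^sup>2 * q powi k)"
    proof (rule ccontr)
      assume "\<not> ?thesis"
      then have R: "\<And>M. - j' \<le> M \<Longrightarrow> (\<Sum>k\<in>{- j'..M}. (lev f k)\<^sup>2 * q powi k) \<le> X" by (meson nle_le)
      have "(1 - 1 / q) * (X / demand_const) \<le> (1 - 1 / q) * (\<Sum>i\<in>{- n..j'}. q powi i * (xl i)\<^sup>2)"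
      proof (rule mult_left_mono)
        have "X / demand_const = (\<Sum>i\<in>{- n..j'}. q powi i * (xl i)\<^sup>2 * of_bool (good i))"
          unfolding X' sum_divide_distrib using demand_const_pos by (intro sum.cong) (auto simp: v_def)
        also have "\<dots> \<le> (\<Sum>i\<in>{- n..j'}. q powi i * (xl i)\<^sup>2)"
          by (intro sum_mono) (auto simp: of_bool_def)
        finally show "X / demand_const \<le> (\<Sum>i\<in>{- n..j'}. q powi i * (xl i)\<^sup>2)" .
      qed (use q in auto)
      also have "\<dots> = (\<Sum>i\<in>{- n..j'}. (q powi i - q powi (i - 1)) * (xl i)\<^sup>2)"
        unfolding sum_distrib_left by (intro sum.cong refl) (simp add: power_int_diff field_simps)
      also have "\<dots> \<le> 4 * (K\<^sup>2 * (lam * q * X))"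
        using X j'1 by (intro tail_energy[OF f K T j'1(3)] R) auto
      finally have "(1 - 1 / q) * (X / demand_const) \<le> 4 * (K\<^sup>2 * (lam * q * X))" .
      moreover have "(1 - 1 / q) * (X / demand_const) = 8 * (K\<^sup>2 * (lam * q * X))"
        using q lam K by (simp add: demand_const_def)
      moreover have "0 < K\<^sup>2 * (lam * q * X)" using X lam K by simp
      ultimately show False by linarith
    qed
    then obtain M where "X \<le> (\<Sum>k\<in>{- j'..M}. (lev f k)\<^sup>2 * q powi k)" by auto
    also have "\<dots> \<le> (\<Sum>k\<in>{- j..M}. (lev f k)\<^sup>2 * q powi k)"
      using j'1 by (intro sum_mono2 mult_nonneg_nonneg) auto
    finally show ?thesis unfolding X_def v_def by blast
  qed
qed

text \<open>Scale \<open>j\<close> demands the energy of \<open>T f\<close> there, and region \<open>C k\<close> supplies the energy of the rearrangement of \<open>f\<close> on it, to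
  frequency scales \<open>j \<ge> -k\<close>. A transport plan exists by \<open>demand_le_supply\<close>; the fraction of the supply that goes
  to \<open>j\<close> is the share of the region that is cut into cells for this scale.\<close>

lemma tail_cells:
  fixes n :: nat
  obtains N Q where "finite N" "\<And>k. k \<in> N \<Longrightarrow> finite (Q k)" "\<And>k. k \<in> N \<Longrightarrow> disjoint (Q k)"
    "\<And>k A. k \<in> N \<Longrightarrow> A \<in> Q k \<Longrightarrow> A \<in> sets D \<and> A \<subseteq> C k" "\<And>k. k \<in> N \<Longrightarrow> 0 < lev f k"
    "\<And>y. y \<in> E' \<Longrightarrow> \<bar>\<kappa> y\<bar> \<le> int n \<Longrightarrow> good (\<kappa> y) \<Longrightarrow>
      c * demand_const * (xl (\<kappa> y))\<^sup>2 \<le> (\<Sum>k\<in>N. (lev f k)\<^sup>2 * (\<Sum>A\<in>Q k. (cmod (\<integral>x. indicator A x * e x y \<partial>D))\<^sup>2))"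
proof -
  \<comment> \<open>Supplies are indexed by the dual frequency scale \<open>i = -k\<close>.\<close>
  define v where "v i = (if \<bar>i\<bar> \<le> int n then demand_const * q powi i * (xl i)\<^sup>2 * of_bool (good i) else 0)" for i
  define es where "es i = (lev f (- i))\<^sup>2 * q powi (- i)" for i
  have v0: "0 \<le> v i" for i using demand_const_pos by (simp add: v_def)
  have es0: "0 \<le> es i" for i by (simp add: es_def)
  have "\<exists>M. \<forall>j\<in>{- int n..int n}. sum v {- int n..j} \<le> (\<Sum>k\<in>{- j..M j}. (lev f k)\<^sup>2 * q powi k)"
  proof (rule bchoice, rule ballI)
    fix j assume j: "j \<in> {- int n..int n}"
    have "sum v {- int n..j} = (\<Sum>i\<in>{- int n..j}. demand_const * q powi i * (xl i)\<^sup>2 * of_bool (good i))"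
      using j by (intro sum.cong) (auto simp: v_def)
    then show "\<exists>M. sum v {- int n..j} \<le> (\<Sum>k\<in>{- j..M}. (lev f k)\<^sup>2 * q powi k)"
      using demand_le_supply[of "int n" j] j by auto
  qed
  then obtain M where M: "\<And>j. j \<in> {- int n..int n} \<Longrightarrow> sum v {- int n..j} \<le> (\<Sum>k\<in>{- j..M j}. (lev f k)\<^sup>2 * q powi k)"
    by blast
  define M0 where "M0 = Max (insert (int n) (M ` {- int n..int n}))"
  have M0: "int n \<le> M0" "\<And>j. j \<in> {- int n..int n} \<Longrightarrow> M j \<le> M0" 
    unfolding M0_def by (auto intro!: Max_ge simp del: Max_insert)
  have es_sum: "(\<Sum>i\<in>{- M0..j}. es i) = (\<Sum>k\<in>{- j..M0}. (lev f k)\<^sup>2 * q powi k)" for j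
    by (rule sum.reindex_bij_witness[of _ uminus uminus]) (auto simp: es_def)
  have le: "sum v {- M0..j} \<le> sum es {- M0..j}" if j: "- M0 \<le> j" "j \<le> int n" for j
  proof (cases "- int n \<le> j")
    case True
    have "sum v {- M0..j} = sum v {- int n..j}"
      using M0(1) by (intro sum.mono_neutral_right) (auto simp: v_def)
    also have "\<dots> \<le> (\<Sum>k\<in>{- j..M j}. (lev f k)\<^sup>2 * q powi k)" using True j by (intro M) auto
    also have "\<dots> \<le> (\<Sum>k\<in>{- j..M0}. (lev f k)\<^sup>2 * q powi k)"
      using M0(2)[of j] True j by (intro sum_mono2 mult_nonneg_nonneg) auto
    finally show ?thesis by (simp add: es_sum)
  next
    case False
    then have "sum v {- M0..j} = 0" by (intro sum.neutral) (auto simp: v_def)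
    then show ?thesis using es0 by (simp add: sum_nonneg)
  qed
  obtain t where t: "\<And>j i. 0 \<le> t j i" "\<And>j. - M0 \<le> j \<Longrightarrow> j \<le> int n \<Longrightarrow> (\<Sum>i\<in>{- M0..j}. t j i) = v j"
    "\<And>i. - M0 \<le> i \<Longrightarrow> i \<le> int n \<Longrightarrow> (\<Sum>j\<in>{i..int n}. t j i) \<le> es i"
    using transport_plan[of v es "- M0" "int n"] v0 es0 le by blast
  define N where "N = {k \<in> {- int n..M0}. 0 < lev f k}"
  have finN: "finite N" unfolding N_def by (rule finite_subset[of _ "{- int n..M0}"]) auto
  define P where "P k \<Q> \<longleftrightarrow> finite \<Q> \<and> disjoint \<Q> \<and> (\<forall>Q\<in>\<Q>. Q \<in> sets D \<and> Q \<subseteq> C k) \<and>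
        (\<forall>y\<in>E'. - k \<le> \<kappa> y \<and> \<kappa> y \<le> int n \<longrightarrow>
          c * q powi (k - \<kappa> y) * (t (\<kappa> y) (- k) / es (- k)) \<le> (\<Sum>Q\<in>\<Q>. (cmod (\<integral>x. indicator Q x * e x y \<partial>D))\<^sup>2))" for k \<Q>
  have "\<forall>k\<in>N. \<exists>\<Q>. P k \<Q>"
  proof
    fix k assume k: "k \<in> N"
    then have es: "0 < es (- k)" by (simp add: N_def es_def)
    have "(\<Sum>j\<in>{- k..int n}. t j (- k)) \<le> es (- k)" using k by (intro t(3)) (auto simp: N_def)
    then have "(\<Sum>j\<in>{- k..int n}. t j (- k) / es (- k)) \<le> 1"
      using es by (simp add: sum_divide_distrib[symmetric])
    then show "\<exists>\<Q>. P k \<Q>"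
      unfolding P_def using k es t(1)
      by (intro cells lev_less_measure[OF f]) (auto simp: N_def)
  qed
  then obtain Q where Q: "\<And>k. k \<in> N \<Longrightarrow> P k (Q k)" using bchoice[of N P] by blast
  show thesis
  proof (rule that[of N Q])
    show "finite N" by fact
    fix y assume y: "y \<in> E'" "\<bar>\<kappa> y\<bar> \<le> int n" "good (\<kappa> y)"
    let ?j = "\<kappa> y"
    have z: "t ?j (- k) = 0" if k: "k \<in> {- ?j..M0}" "k \<notin> N" for k
    proof -
      have "lev f k = 0" using k y(2) lev_nonneg[of f k] by (auto simp: N_def)
      then have "es (- k) = 0" by (simp add: es_def)
      moreover have "t ?j (- k) \<le> (\<Sum>j\<in>{- k..int n}. t j (- k))" using k y(2) t(1) by (intro member_le_sum) auto
      moreover have "(\<Sum>j\<in>{- k..int n}. t j (- k)) \<le> es (- k)" using k y(2) by (intro t(3)) auto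
      ultimately show ?thesis using t(1)[of ?j "- k"] by linarith
    qed
    have "c * demand_const * (xl ?j)\<^sup>2 = c * q powi (- ?j) * v ?j"
      using y by (simp add: v_def power_int_minus)
    also have "v ?j = (\<Sum>i\<in>{- M0..?j}. t ?j i)" using y(2) M0(1) by (intro t(2)[symmetric]) auto
    also have "\<dots> = (\<Sum>k\<in>{- ?j..M0}. t ?j (- k))"
      by (rule sum.reindex_bij_witness[of _ uminus uminus]) auto
    also have "\<dots> = (\<Sum>k\<in>{k \<in> N. - ?j \<le> k}. t ?j (- k))"
    proof (rule sum.mono_neutral_right)
      show "\<forall>k\<in>{- ?j..M0} - {k \<in> N. - ?j \<le> k}. t ?j (- k) = 0"
      proof
        fix k assume "k \<in> {- ?j..M0} - {k \<in> N. - ?j \<le> k}"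
        then have "k \<in> {- ?j..M0}" "k \<notin> N" by auto
        then show "t ?j (- k) = 0" by (rule z)
      qed
    qed (auto simp: N_def)
    also have "c * q powi (- ?j) * \<dots> = (\<Sum>k\<in>{k \<in> N. - ?j \<le> k}. (lev f k)\<^sup>2 * (c * q powi (k - ?j) * (t ?j (- k) / es (- k))))"
      unfolding sum_distrib_left
    proof (intro sum.cong refl)
      fix k assume "k \<in> {k \<in> N. - ?j \<le> k}"
      then have "0 < lev f k" by (simp add: N_def)
      then show "c * q powi (- ?j) * t ?j (- k) = (lev f k)\<^sup>2 * (c * q powi (k - ?j) * (t ?j (- k) / es (- k)))"
        by (simp add: es_def power_int_diff power_int_minus field_simps)
    qed
    also have "\<dots> \<le> (\<Sum>k\<in>{k \<in> N. - ?j \<le> k}. (lev f k)\<^sup>2 * (\<Sum>A\<in>Q k. (cmod (\<integral>x. indicator A x * e x y \<partial>D))\<^sup>2))"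
      using Q y unfolding P_def by (intro sum_mono mult_left_mono) auto
    also have "\<dots> \<le> (\<Sum>k\<in>N. (lev f k)\<^sup>2 * (\<Sum>A\<in>Q k. (cmod (\<integral>x. indicator A x * e x y \<partial>D))\<^sup>2))"
      using finN by (intro sum_mono2 mult_nonneg_nonneg sum_nonneg) auto
    finally show "c * demand_const * (xl ?j)\<^sup>2 \<le> (\<Sum>k\<in>N. (lev f k)\<^sup>2 * (\<Sum>A\<in>Q k. (cmod (\<integral>x. indicator A x * e x y \<partial>D))\<^sup>2))" .
  qed (use Q in \<open>auto simp: P_def N_def\<close>)
qed

lemma tail_part:
  "(\<integral>\<^sup>+y. ennreal (xl (\<kappa> y) powr \<beta> * of_bool (good (\<kappa> y))) * w y \<partial>E) \<le> ennreal (3 * (c * demand_const) powr (- \<beta> / 2)) * B"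
proof (rule nn_integral_le_exhaust[where A = "\<lambda>n. {y \<in> space E. \<bar>\<kappa> y\<bar> \<le> int n}"])
  show "incseq (\<lambda>n. {y \<in> space E. \<bar>\<kappa> y\<bar> \<le> int n})" by (auto simp: incseq_def)
  show "AE y in E. ennreal (xl (\<kappa> y) powr \<beta> * of_bool (good (\<kappa> y))) * w y = 0 \<or> (\<exists>n. y \<in> {y \<in> space E. \<bar>\<kappa> y\<bar> \<le> int n})"
    by (intro AE_I2 disjI2 exI[of _ "nat \<bar>\<kappa> y\<bar>" for y]) auto
  fix n
  let ?A = "{y \<in> space E. \<bar>\<kappa> y\<bar> \<le> int n}"
  show "?A \<in> sets E" by (rule kappa_sets)
  obtain N Q where NQ: "finite N" "\<And>k. k \<in> N \<Longrightarrow> finite (Q k)" "\<And>k. k \<in> N \<Longrightarrow> disjoint (Q k)"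
    "\<And>k A. k \<in> N \<Longrightarrow> A \<in> Q k \<Longrightarrow> A \<in> sets D \<and> A \<subseteq> C k" "\<And>k. k \<in> N \<Longrightarrow> 0 < lev f k"
    and main: "\<And>y. y \<in> E' \<Longrightarrow> \<bar>\<kappa> y\<bar> \<le> int n \<Longrightarrow> good (\<kappa> y) \<Longrightarrow>
      c * demand_const * (xl (\<kappa> y))\<^sup>2 \<le> (\<Sum>k\<in>N. (lev f k)\<^sup>2 * (\<Sum>A\<in>Q k. (cmod (\<integral>x. indicator A x * e x y \<partial>D))\<^sup>2))"
    by (rule tail_cells[of n], rule that)
  let ?F = "\<lambda>y. \<Sum>k\<in>N. (lev f k)\<^sup>2 * (\<Sum>A\<in>Q k. (cmod (\<integral>x. indicator A x * e x y \<partial>D))\<^sup>2)"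
  have cd: "0 < c * demand_const" using c demand_const_pos by simp
  have [measurable]: "(\<lambda>y. \<integral>x. indicator A x * e x y \<partial>D) \<in> borel_measurable E" if "k \<in> N" "A \<in> Q k" for k A
  proof -
    have [measurable]: "A \<in> sets D" using NQ(4)[OF that] by simp
    show ?thesis using ft_measurable[of "indicator A"] by (simp add: ft_def[abs_def])
  qed
  have Fm: "?F \<in> borel_measurable E" by measurable
  have "(\<integral>\<^sup>+y. ennreal (xl (\<kappa> y) powr \<beta> * of_bool (good (\<kappa> y))) * w y * indicator ?A y \<partial>E)
    \<le> (\<integral>\<^sup>+y. ennreal ((c * demand_const) powr (- \<beta> / 2)) * (ennreal (?F y powr (\<beta> / 2)) * w y) \<partial>E)"
  proof (rule nn_integral_mono_AE)
    show "AE y in E. ennreal (xl (\<kappa> y) powr \<beta> * of_bool (good (\<kappa> y))) * w y * indicator ?A y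
      \<le> ennreal ((c * demand_const) powr (- \<beta> / 2)) * (ennreal (?F y powr (\<beta> / 2)) * w y)"
      using AE_E'
    proof eventually_elim
      case (elim y)
      show ?case
      proof (cases "y \<in> ?A \<and> good (\<kappa> y)")
        case True
        have "(xl (\<kappa> y))\<^sup>2 \<le> ?F y / (c * demand_const)"
          using main[OF elim] True cd by (simp add: pos_le_divide_eq mult.commute)
        then have "((xl (\<kappa> y))\<^sup>2) powr (\<beta> / 2) \<le> (?F y / (c * demand_const)) powr (\<beta> / 2)"
          using \<beta> by (intro powr_mono2) auto
        moreover have "((xl (\<kappa> y))\<^sup>2) powr (\<beta> / 2) = xl (\<kappa> y) powr \<beta>"
          using xl_nonneg[of "\<kappa> y"] by (simp add: powr_powr flip: powr_numeral)
        moreover have "(?F y / (c * demand_const)) powr (\<beta> / 2) = (c * demand_const) powr (- \<beta> / 2) * ?F y powr (\<beta> / 2)"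
          using cd by (simp add: powr_divide sum_nonneg powr_minus_divide)
        ultimately have "ennreal (xl (\<kappa> y) powr \<beta>) \<le> ennreal ((c * demand_const) powr (- \<beta> / 2)) * ennreal (?F y powr (\<beta> / 2))"
          by (simp add: ennreal_mult[symmetric] ennreal_leI)
        then have "ennreal (xl (\<kappa> y) powr \<beta>) * w y \<le> ennreal ((c * demand_const) powr (- \<beta> / 2)) * ennreal (?F y powr (\<beta> / 2)) * w y"
          by (rule mult_right_mono) simp
        then show ?thesis using True by (simp add: mult.assoc)
      qed auto
    qed
  qed
  also have "\<dots> = ennreal ((c * demand_const) powr (- \<beta> / 2)) * (\<integral>\<^sup>+y. ennreal (?F y powr (\<beta> / 2)) * w y \<partial>E)"
    using Fm by (intro nn_integral_cmult) measurable
  also have "\<dots> \<le> ennreal ((c * demand_const) powr (- \<beta> / 2)) * (3 * B)"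
    by (intro mult_left_mono random_multiplier[OF f NQ \<beta> w B]) auto
  also have "\<dots> = ennreal (3 * (c * demand_const) powr (- \<beta> / 2)) * B"
    by (simp add: ennreal_mult ac_simps)
  finally show "(\<integral>\<^sup>+y. ennreal (xl (\<kappa> y) powr \<beta> * of_bool (good (\<kappa> y))) * w y * indicator ?A y \<partial>E)
    \<le> ennreal (3 * (c * demand_const) powr (- \<beta> / 2)) * B" .
qed measurable

lemma head_plus_tail:
  "(\<integral>\<^sup>+y. ennreal (xl (\<kappa> y) powr \<beta>) * w y \<partial>E)
    \<le> ennreal ((2 * K * (lam * q) / c) powr \<beta> + 3 * (c * demand_const) powr (- \<beta> / 2)) * B"
proof -
  have "(\<integral>\<^sup>+y. ennreal (xl (\<kappa> y) powr \<beta>) * w y \<partial>E)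
      = (\<integral>\<^sup>+y. ennreal (xl (\<kappa> y) powr \<beta> * of_bool (\<not> good (\<kappa> y))) * w y + ennreal (xl (\<kappa> y) powr \<beta> * of_bool (good (\<kappa> y))) * w y \<partial>E)"
    by (intro nn_integral_cong) auto
  also have "\<dots> = (\<integral>\<^sup>+y. ennreal (xl (\<kappa> y) powr \<beta> * of_bool (\<not> good (\<kappa> y))) * w y \<partial>E)
      + (\<integral>\<^sup>+y. ennreal (xl (\<kappa> y) powr \<beta> * of_bool (good (\<kappa> y))) * w y \<partial>E)"
    by (intro nn_integral_add) measurable
  also have "\<dots> \<le> ennreal ((2 * K * (lam * q) / c) powr \<beta>) * B + ennreal (3 * (c * demand_const) powr (- \<beta> / 2)) * B"
    by (intro add_mono head_part tail_part)
  finally show ?thesis by (simp add: distrib_right ennreal_plus)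
qed

end

lemma rearr_of_image_le:
  assumes f: "f \<in> Lp_space D 1" and K: "1 \<le> K"
    and T: "sublinear_operator D E T" "joint_strong_type D E K T" and "0 < \<beta>" and y: "y \<in> E'"
  shows "sym_rearr E \<rho>E (\<lambda>y. complex_of_real (cmod (T f y) powr \<beta>)) y \<le> ennreal (out_lev f T (\<kappa> y) powr \<beta>)"
proof -
  have [measurable]: "T f \<in> borel_measurable E" by (rule Tf_measurable[OF f K T])
  let ?x = "out_lev f T (\<kappa> y)"
  have x0: "0 \<le> ?x" by (rule out_lev_nonneg[OF f K T])
  have "emeasure E {y \<in> space E. ?x < cmod (T f y)} \<le> ennreal (q powi \<kappa> y)"
    unfolding out_lev_def[OF f K T] by (intro emeasure_above_decr_rearr out_lev_finite[OF f K T]) measurable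
  then have le: "emeasure E {y \<in> space E. ?x < cmod (T f y)} \<le> ennreal (\<rho>E y)"
    by (intro \<kappa>[OF y]) measurable
  have "{z \<in> space E. ?x powr \<beta> < cmod (complex_of_real (cmod (T f z) powr \<beta>))} = {z \<in> space E. ?x < cmod (T f z)}"
  proof -
    have "?x powr \<beta> < t powr \<beta> \<longleftrightarrow> ?x < t" if "0 \<le> t" for t
      using powr_less_mono2[of \<beta> ?x t] powr_mono2[of \<beta> t ?x] x0 that \<open>0 < \<beta>\<close> by fastforce
    then show ?thesis by simp
  qed
  then show ?thesis
    unfolding sym_rearr_def using le by (subst decr_rearr_le_iff) auto
qed

text \<open>The Hardy-Littlewood inequality replaces \<open>|T f|\<close> by its dyadic levels. Every level is dominated by the head or by the
  tail; \<open>head_multiplier\<close> serves the scales of the first kind, \<open>random_multiplier\<close> on the cells of \<open>tail_cells\<close> those of the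
  second. As the set of competitors \<open>G\<close> depends on \<open>f\<close> only, the operator enters through \<open>K\<close> alone.\<close>

theorem Fourier_extremal:
  assumes "0 < \<beta>" "\<beta> \<le> 2" and K: "1 \<le> K"
  obtains A where "0 < A"
    "\<And>f T g B. f \<in> Lp_space D 1 \<Longrightarrow> sublinear_operator D E T \<Longrightarrow> joint_strong_type D E K T \<Longrightarrow> g \<in> borel_measurable E \<Longrightarrow>
      (\<And>G. G \<in> borel_measurable D \<Longrightarrow> AE x in D. cmod (G x) \<le> enn2real (sym_rearr D \<rho>D f x) \<Longrightarrow>
        (\<integral>\<^sup>+y. ennreal (cmod (ft G y) powr \<beta>) * sym_rearr E \<rho>E g y \<partial>E) \<le> B) \<Longrightarrow>
      (\<integral>\<^sup>+y. ennreal (cmod (T f y) powr \<beta>) * ennreal (cmod (g y)) \<partial>E) \<le> ennreal A * B"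
proof
  let ?\<delta> = "(1 - 1 / q) / (8 * K\<^sup>2 * (lam * q))"
  let ?A = "(2 * K * (lam * q) / c) powr \<beta> + 3 * (c * ?\<delta>) powr (- \<beta> / 2)"
  have "0 < 2 * K * (lam * q) / c" using K lam c by simp
  then show "0 < ?A" by (intro add_pos_nonneg) auto
  fix f T g B
  assume f: "f \<in> Lp_space D 1" and T: "sublinear_operator D E T" "joint_strong_type D E K T"
    and g [measurable]: "g \<in> borel_measurable E"
    and B: "\<And>G. G \<in> borel_measurable D \<Longrightarrow> AE x in D. cmod (G x) \<le> enn2real (sym_rearr D \<rho>D f x) \<Longrightarrow>
        (\<integral>\<^sup>+y. ennreal (cmod (ft G y) powr \<beta>) * sym_rearr E \<rho>E g y \<partial>E) \<le> B"
  have [measurable]: "T f \<in> borel_measurable E" by (rule Tf_measurable[OF f K T])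
  have "(\<integral>\<^sup>+y. ennreal (cmod (T f y) powr \<beta>) * ennreal (cmod (g y)) \<partial>E)
      = (\<integral>\<^sup>+y. ennreal (cmod (complex_of_real (cmod (T f y) powr \<beta>))) * ennreal (cmod (g y)) \<partial>E)" by simp
  also have "\<dots> \<le> (\<integral>\<^sup>+y. sym_rearr E \<rho>E (\<lambda>y. complex_of_real (cmod (T f y) powr \<beta>)) y * sym_rearr E \<rho>E g y \<partial>E)"
    by (rule E.Hardy_Littlewood) measurable
  also have "\<dots> \<le> (\<integral>\<^sup>+y. ennreal (out_lev f T (\<kappa> y) powr \<beta>) * sym_rearr E \<rho>E g y \<partial>E)"
  proof (rule nn_integral_mono_AE)
    show "AE y in E. sym_rearr E \<rho>E (\<lambda>y. complex_of_real (cmod (T f y) powr \<beta>)) y * sym_rearr E \<rho>E g y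
      \<le> ennreal (out_lev f T (\<kappa> y) powr \<beta>) * sym_rearr E \<rho>E g y"
      using AE_E' by eventually_elim (rule mult_right_mono[OF rearr_of_image_le[OF f K T \<open>0 < \<beta>\<close>]], auto)
  qed
  also have "\<dots> \<le> ennreal ?A * B"
    using head_plus_tail[OF f K T \<open>0 < \<beta>\<close> \<open>\<beta> \<le> 2\<close> E.measurable_sym_rearr[OF g] B] by (simp add: demand_const_def[OF f K T \<open>0 < \<beta>\<close> \<open>\<beta> \<le> 2\<close> E.measurable_sym_rearr[OF g] B])
  finally show "(\<integral>\<^sup>+y. ennreal (cmod (T f y) powr \<beta>) * ennreal (cmod (g y)) \<partial>E) \<le> ennreal ?A * B" .
qed

text \<open>Right-admissibility bounds \<open>Y G\<close> by \<open>Y f\<close> whenever \<open>|G|\<close> stays below the rearrangement of \<open>f\<close>, hence bounds the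
  functional of \<open>|ft G|\<^sup>\<beta>\<close>. Testing against \<open>g\<close> in the unit ball of the associate functional, left-admissibility permits to
  replace \<open>g\<close> by its rearrangement, and \<open>Fourier_extremal\<close> passes from \<open>ft G\<close> to \<open>T f\<close>. The second associate
  collects these tests.\<close>

theorem tilde_norm_minimal:
  assumes \<beta>: "0 < \<beta>" "\<beta> \<le> 2" and K: "1 \<le> K"
  obtains A where "0 < A"
    "\<And>X Y f. pos_homogeneous E X \<Longrightarrow> left_admissible E \<rho>E X \<Longrightarrow>
      right_admissible D \<rho>D (borel_measurable D) Y \<Longrightarrow>
      (\<And>h. h \<in> Lp_space D 1 \<Longrightarrow> power_norm \<beta> X (ft h) \<le> Y h) \<Longrightarrow> f \<in> Lp_space D 1 \<Longrightarrow>
      tilde_norm D E K \<beta> X f \<le> ennreal A * Y f"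
proof -
  obtain A where A: "0 < A" and main:
    "\<And>f T g B. f \<in> Lp_space D 1 \<Longrightarrow> sublinear_operator D E T \<Longrightarrow> joint_strong_type D E K T \<Longrightarrow> g \<in> borel_measurable E \<Longrightarrow>
      (\<And>G. G \<in> borel_measurable D \<Longrightarrow> AE x in D. cmod (G x) \<le> enn2real (sym_rearr D \<rho>D f x) \<Longrightarrow>
        (\<integral>\<^sup>+y. ennreal (cmod (ft G y) powr \<beta>) * sym_rearr E \<rho>E g y \<partial>E) \<le> B) \<Longrightarrow>
      (\<integral>\<^sup>+y. ennreal (cmod (T f y) powr \<beta>) * ennreal (cmod (g y)) \<partial>E) \<le> ennreal A * B"
    using Fourier_extremal[OF \<beta> K] by blast
  show thesis
  proof (rule that[of "A powr (1 / \<beta>)"])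
    show "0 < A powr (1 / \<beta>)" using A by simp
    fix X :: "('e \<Rightarrow> complex) \<Rightarrow> ennreal" and Y :: "('d \<Rightarrow> complex) \<Rightarrow> ennreal" and f
    assume X: "pos_homogeneous E X" "left_admissible E \<rho>E X"
      and Y: "right_admissible D \<rho>D (borel_measurable D) Y"
      and F: "\<And>h. h \<in> Lp_space D 1 \<Longrightarrow> power_norm \<beta> X (ft h) \<le> Y h" and f: "f \<in> Lp_space D 1"
    have [measurable]: "f \<in> borel_measurable D" using f by (simp add: Lp_space_def)
    show "tilde_norm D E K \<beta> X f \<le> ennreal (A powr (1 / \<beta>)) * Y f"
    proof (cases "Y f < \<infinity>")
      case False
      then show ?thesis using A by (simp add: not_less top_unique ennreal_mult_top)
    next
      case True
      let ?B = "ennreal_powr (Y f) \<beta>"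
      have AEfin: "AE x in D. sym_rearr D \<rho>D f x < \<infinity>" by (intro D.sym_rearr_finite_AE Lp_one_subset f)
      have YG: "X (\<lambda>y. complex_of_real (cmod (ft G y) powr \<beta>)) \<le> ?B"
        if [measurable]: "G \<in> borel_measurable D" and Gle: "AE x in D. cmod (G x) \<le> enn2real (sym_rearr D \<rho>D f x)" for G
      proof -
        let ?r = "fin_rearr D \<rho>D f"
        \<comment> \<open>The quotient of \<open>G\<close> and the rearrangement of \<open>f\<close>, cut off on the null set where it exceeds one.\<close>
        define m where "m x = (if cmod (G x) \<le> cmod (?r x) then G x / ?r x else 0)" for x
        have m1: "cmod (m x) \<le> 1" for x
          by (auto simp: m_def norm_divide divide_le_eq_1)
        have [measurable]: "m \<in> borel_measurable D" unfolding m_def by measurable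
        have mG: "AE x in D. m x * ?r x = G x"
          using Gle by eventually_elim (auto simp: m_def fin_rearr_def)
        have "Linf_norm D m \<le> 1" using m1 by (intro Linf_norm_le_iff[THEN iffD2]) (auto simp: ennreal_le_1)
        then have mL: "m \<in> Linf_space D" by (auto simp: Linf_space_def intro: le_less_trans)
        have Yr: "Y ?r \<le> Y f"
          using Y True AEfin unfolding right_admissible_def fin_rearr_def[abs_def] by auto
        have "Y (\<lambda>x. m x * ?r x) \<le> Y ?r * Linf_norm D m"
          using Y Yr True mL unfolding right_admissible_def by (auto dest: le_less_trans)
        also have "\<dots> \<le> Y f * 1" using Yr \<open>Linf_norm D m \<le> 1\<close> by (intro mult_mono) auto
        finally have Ym: "Y (\<lambda>x. m x * ?r x) \<le> Y f" by simp
        have "(\<integral>\<^sup>+x. ennreal (cmod (m x * ?r x)) \<partial>D) \<le> (\<integral>\<^sup>+x. ennreal (cmod (?r x)) \<partial>D)"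
          using m1 by (intro nn_integral_mono ennreal_leI) (simp add: norm_mult mult_left_le_one_le)
        also have "\<dots> < \<infinity>" using D.fin_rearr_L1[OF f] by (simp add: Lp_space_one_iff)
        finally have "(\<lambda>x. m x * ?r x) \<in> Lp_space D 1" by (simp add: Lp_space_one_iff)
        from F[OF this] Ym have "power_norm \<beta> X (ft (\<lambda>x. m x * ?r x)) \<le> Y f" by simp
        then have "ennreal_powr (power_norm \<beta> X (ft (\<lambda>x. m x * ?r x))) \<beta> \<le> ?B"
          using \<beta> by (intro ennreal_powr_mono) auto
        then have *: "X (\<lambda>y. complex_of_real (cmod (ft (\<lambda>x. m x * ?r x) y) powr \<beta>)) \<le> ?B"
          using \<beta> by (simp add: power_norm_def ennreal_powr_powr)
        have "X (\<lambda>y. complex_of_real (cmod (ft G y) powr \<beta>)) \<le> X (\<lambda>y. complex_of_real (cmod (ft (\<lambda>x. m x * ?r x) y) powr \<beta>))"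
        proof (rule functional_mono_AE[OF X])
          have "ft G y = ft (\<lambda>x. m x * ?r x) y" if "y \<in> space E" for y
            unfolding ft_def using mG kernel_section[OF that]
            by (intro integral_cong_AE) (auto elim: eventually_mono)
          then show "AE y in E. cmod (complex_of_real (cmod (ft G y) powr \<beta>)) \<le> cmod (complex_of_real (cmod (ft (\<lambda>x. m x * ?r x) y) powr \<beta>))"
            by (intro AE_I2) simp
        qed measurable
        with * show ?thesis by simp
      qed
      have fin: "?B < \<infinity>" using True by (simp add: ennreal_powr_def)
      show ?thesis
        unfolding tilde_norm_def
      proof (rule SUP_least, clarify)
        fix T assume T: "sublinear_operator D E T" "joint_strong_type D E K T"
        have [measurable]: "T f \<in> borel_measurable E" by (rule Tf_measurable[OF f K T])
        have "X (\<lambda>y. complex_of_real (cmod (T f y) powr \<beta>)) = associate_norm E (associate_norm E X) (\<lambda>y. complex_of_real (cmod (T f y) powr \<beta>))"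
          by (rule eq_second_associate[OF X]) measurable
        also have "\<dots> \<le> ennreal A * ?B"
          unfolding associate_norm_def[of E "associate_norm E X"] associate_def[of E "associate_norm E X"]
        proof (rule SUP_least, clarify)
          fix g assume g [measurable]: "g \<in> borel_measurable E" and g1: "associate_norm E X g \<le> 1"
          have "associate_norm E X g < \<infinity>" using g1 by (auto intro: le_less_trans)
          then have "associate E X (sym_rearr E \<rho>E g) \<le> associate_norm E X g"
            using X(2) g unfolding left_admissible_def by blast
          then have a1: "associate E X (sym_rearr E \<rho>E g) \<le> 1" using g1 by simp
          have "(\<integral>\<^sup>+y. ennreal (cmod (ft G y) powr \<beta>) * sym_rearr E \<rho>E g y \<partial>E) \<le> ?B"
            if [measurable]: "G \<in> borel_measurable D" and Gle: "AE x in D. cmod (G x) \<le> enn2real (sym_rearr D \<rho>D f x)" for G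
          proof -
            let ?F = "\<lambda>y. complex_of_real (cmod (ft G y) powr \<beta>)"
            have "(\<integral>\<^sup>+y. sym_rearr E \<rho>E g y * ennreal (cmod (?F y)) \<partial>E) \<le> associate E X (sym_rearr E \<rho>E g) * X ?F"
              using a1 YG[OF that] fin by (intro nn_integral_le_associate[OF X(1)]) (auto intro: le_less_trans)
            also have "\<dots> \<le> 1 * ?B" using a1 YG[OF that] by (intro mult_mono) auto
            finally show ?thesis by (simp add: mult.commute)
          qed
          from main[OF f T g this]
          show "(\<integral>\<^sup>+y. ennreal (cmod (complex_of_real (cmod (T f y) powr \<beta>))) * ennreal (cmod (g y)) \<partial>E) \<le> ennreal A * ?B"
            by simp
        qed
        finally have "power_norm \<beta> X (T f) \<le> ennreal_powr (ennreal A * ?B) (1 / \<beta>)"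
          unfolding power_norm_def using \<beta> by (intro ennreal_powr_mono) auto
        also have "\<dots> = ennreal (A powr (1 / \<beta>)) * Y f"
          using A \<beta> by (simp add: ennreal_powr_mult ennreal_powr_powr)
        finally show "power_norm \<beta> X (T f) \<le> ennreal (A powr (1 / \<beta>)) * Y f" .
      qed
    qed
  qed
qed

end

section \<open>Characters on small cells\<close>

lemma cmod_cis_diff_le: "cmod (cis a - cis b) \<le> \<bar>a - b\<bar>"
proof -
  have "(cmod (cis a - cis b))\<^sup>2 = 2 - 2 * cos (a - b)"
  proof -
    have "(cmod (cis a - cis b))\<^sup>2 = (cos a - cos b)\<^sup>2 + (sin a - sin b)\<^sup>2"
      by (simp add: cmod_power2)
    also have "\<dots> = ((sin a)\<^sup>2 + (cos a)\<^sup>2) + ((sin b)\<^sup>2 + (cos b)\<^sup>2) - 2 * (cos a * cos b + sin a * sin b)"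
      by (simp add: power2_eq_square algebra_simps)
    finally show ?thesis by (simp add: cos_diff)
  qed
  also have "\<dots> = (2 * sin ((a - b) / 2))\<^sup>2"
  proof -
    have "cos (a - b) = 1 - 2 * (sin ((a - b) / 2))\<^sup>2"
    proof -
      define h where "h = (a - b) / 2"
      have "a - b = 2 * h" by (simp add: h_def)
      then show ?thesis using cos_double_sin[of h] by simp
    qed
    then show ?thesis by (simp add: power2_eq_square)
  qed
  finally have "sqrt ((cmod (cis a - cis b))\<^sup>2) = sqrt ((2 * sin ((a - b) / 2))\<^sup>2)" by simp
  then have "cmod (cis a - cis b) = \<bar>2 * sin ((a - b) / 2)\<bar>"
    by (simp only: real_sqrt_abs abs_norm_cancel)
  also have "\<dots> \<le> \<bar>a - b\<bar>" using abs_sin_x_le_abs_x[of "(a - b) / 2"] by simp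
  finally show ?thesis .
qed

text \<open>No cancellation occurs where \<open>u\<close> stays close to a constant of modulus one.\<close>

lemma half_measure_le_integral:
  assumes Q [measurable]: "Q \<in> sets M" and fin: "emeasure M Q < \<infinity>"
    and [measurable]: "u \<in> borel_measurable M" and z: "cmod z = 1"
    and near: "\<And>x. x \<in> Q \<Longrightarrow> cmod (u x - z) \<le> 1 / 2"
  shows "measure M Q / 2 \<le> cmod (\<integral>x. indicator Q x * u x \<partial>M)"
proof -
  have iQ2: "integrable M (indicator Q :: _ \<Rightarrow> real)" using fin by auto
  have "integrable M (indicator Q :: _ \<Rightarrow> complex)"
    by (rule Bochner_Integration.integrable_bound[OF iQ2]) (auto split: split_indicator)
  note iQ = this iQ2
  have id: "integrable M (\<lambda>x. indicator Q x * (u x - z))"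
  proof (rule Bochner_Integration.integrable_bound[OF iQ(2)])
    show "AE x in M. norm (indicator Q x * (u x - z)) \<le> norm (indicator Q x :: real)"
    proof (rule AE_I2)
      fix x
      show "norm (indicator Q x * (u x - z)) \<le> norm (indicator Q x :: real)"
        using near[of x] by (cases "x \<in> Q") (auto simp: norm_mult)
    qed
  qed measurable
  have iz: "integrable M (\<lambda>x. indicator Q x * z)" using iQ(1) by (intro integrable_mult_left) auto
  have split: "(\<lambda>x. indicator Q x * u x) = (\<lambda>x. indicator Q x * z + indicator Q x * (u x - z))"
    by (auto simp: algebra_simps)
  have s1: "(\<integral>x. indicator Q x * u x \<partial>M) = (\<integral>x. indicator Q x * z \<partial>M) + (\<integral>x. indicator Q x * (u x - z) \<partial>M)"
    unfolding split by (rule Bochner_Integration.integral_add[OF iz id])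
  have s2: "(\<integral>x. indicator Q x * z \<partial>M) = complex_of_real (measure M Q) * z"
  proof -
    have "(\<lambda>x. indicator Q x * z) = (\<lambda>x. indicator Q x *\<^sub>R z)" by (auto split: split_indicator)
    then show ?thesis using sets.sets_into_space[OF Q] iQ(2)
      by (simp add: integral_scaleR_left Int_absorb2 scaleR_conv_of_real del: integral_mult_left)
  qed
  have eq: "complex_of_real (measure M Q) * z = (\<integral>x. indicator Q x * u x \<partial>M) - (\<integral>x. indicator Q x * (u x - z) \<partial>M)"
    unfolding s1 s2 by (simp only: add_diff_cancel_right')
  have "cmod (\<integral>x. indicator Q x * (u x - z) \<partial>M) \<le> (\<integral>x. indicator Q x * (1 / 2) \<partial>M)"
  proof (rule order_trans[OF integral_norm_bound], rule integral_mono)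
    show "integrable M (\<lambda>x. norm (indicator Q x * (u x - z)))" using id by (rule integrable_norm)
    show "integrable M (\<lambda>x. indicator Q x * (1 / 2) :: real)" using iQ(2) by simp
    fix x
    show "norm (indicator Q x * (u x - z)) \<le> indicator Q x * (1 / 2)"
      using near[of x] by (cases "x \<in> Q") (auto simp: norm_mult)
  qed
  also have "\<dots> = measure M Q / 2" using sets.sets_into_space[OF Q] by (simp add: Int_absorb2)
  finally have small: "cmod (\<integral>x. indicator Q x * (u x - z) \<partial>M) \<le> measure M Q / 2" .
  have "measure M Q = cmod (complex_of_real (measure M Q) * z)" using z by (simp add: norm_mult)
  also have "\<dots> \<le> cmod (\<integral>x. indicator Q x * u x \<partial>M) + cmod (\<integral>x. indicator Q x * (u x - z) \<partial>M)"
    unfolding eq by (rule norm_triangle_ineq4)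
  finally show ?thesis using small by simp
qed

text \<open>The slabs are cut into the fibres of \<open>g j\<close>. Each fibre contributes at least a quarter of the square of its measure, and
  one factor of this square is bounded below by \<open>s j\<close>, so that the other factors add up to the measure of the slab.\<close>

lemma cells_from_slabs:
  fixes S :: "int \<Rightarrow> 'a set" and g :: "int \<Rightarrow> 'a \<Rightarrow> 'z"
  assumes J: "finite J" and disj: "disjoint_family_on S J" and fin: "\<And>j. j \<in> J \<Longrightarrow> finite (g j ` S j)"
    and cell: "\<And>j x. j \<in> J \<Longrightarrow> x \<in> S j \<Longrightarrow> {x' \<in> S j. g j x' = g j x} \<in> sets M \<and>
      emeasure M {x' \<in> S j. g j x' = g j x} < \<infinity> \<and> s j \<le> measure M {x' \<in> S j. g j x' = g j x}"
    and s: "\<And>j. 0 \<le> s j"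
  obtains \<Q> where "finite \<Q>" "disjoint \<Q>" "\<And>Q. Q \<in> \<Q> \<Longrightarrow> Q \<in> sets M \<and> (\<exists>j\<in>J. Q \<subseteq> S j)"
    "\<And>j u. j \<in> J \<Longrightarrow> u \<in> borel_measurable M \<Longrightarrow> (\<And>x. cmod (u x) = 1) \<Longrightarrow>
      (\<And>x x'. x \<in> S j \<Longrightarrow> x' \<in> S j \<Longrightarrow> g j x = g j x' \<Longrightarrow> cmod (u x - u x') \<le> 1 / 2) \<Longrightarrow>
      s j / 4 * measure M (S j) \<le> (\<Sum>Q\<in>\<Q>. (cmod (\<integral>x. indicator Q x * u x \<partial>M))\<^sup>2)"
proof -
  define cl where "cl j x = {x' \<in> S j. g j x' = g j x}" for j x
  define \<Q> where "\<Q> = (\<Union>j\<in>J. cl j ` S j)"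
  have clfin: "finite (cl j ` S j)" if "j \<in> J" for j
  proof -
    have "cl j ` S j = (\<lambda>z. {x' \<in> S j. g j x' = z}) ` g j ` S j" by (auto simp: cl_def image_image)
    then show ?thesis using fin[OF that] by simp
  qed
  show thesis
  proof (rule that)
    show "finite \<Q>" using J clfin by (simp add: \<Q>_def)
    show "disjoint \<Q>"
    proof (rule disjointI)
      fix a b assume "a \<in> \<Q>" "b \<in> \<Q>" "a \<noteq> b"
      then obtain i x j y where *: "i \<in> J" "x \<in> S i" "a = cl i x" "j \<in> J" "y \<in> S j" "b = cl j y"
        by (auto simp: \<Q>_def)
      show "a \<inter> b = {}"
      proof (cases "i = j")
        case True
        then show ?thesis using * \<open>a \<noteq> b\<close> by (auto simp: cl_def)
      next
        case False
        then have "S i \<inter> S j = {}" using disj * by (auto simp: disjoint_family_on_def)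
        then show ?thesis using * by (auto simp: cl_def)
      qed
    qed
    show "Q \<in> sets M \<and> (\<exists>j\<in>J. Q \<subseteq> S j)" if "Q \<in> \<Q>" for Q
      using that cell by (auto simp: \<Q>_def cl_def)
    fix j u assume j: "j \<in> J" and um: "u \<in> borel_measurable M" and u1: "\<And>x. cmod (u x) = 1"
      and near: "\<And>x x'. x \<in> S j \<Longrightarrow> x' \<in> S j \<Longrightarrow> g j x = g j x' \<Longrightarrow> cmod (u x - u x') \<le> 1 / 2"
    let ?R = "cl j ` S j"
    have un: "\<Union>?R = S j" by (auto simp: cl_def)
    have "disjoint ?R" by (rule disjointI) (auto simp: cl_def)
    have R: "Q \<in> sets M \<and> emeasure M Q < \<infinity> \<and> s j \<le> measure M Q" if "Q \<in> ?R" for Q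
      using that cell[OF j] by (auto simp: cl_def)
    have "measure M (\<Union>?R) = (\<Sum>Q\<in>?R. measure M Q)"
      using \<open>disjoint ?R\<close> R
      by (intro measure_Union' clfin j) (auto intro: fmeasurableI)
    then have "measure M (S j) = (\<Sum>Q\<in>?R. measure M Q)" unfolding un .
    then have "s j / 4 * measure M (S j) = (\<Sum>Q\<in>?R. s j * measure M Q / 4)"
      by (simp add: sum_distrib_left)
    also have "\<dots> \<le> (\<Sum>Q\<in>?R. (cmod (\<integral>x. indicator Q x * u x \<partial>M))\<^sup>2)"
    proof (rule sum_mono)
      fix Q assume Q: "Q \<in> ?R"
      then obtain x0 where x0: "x0 \<in> S j" "Q = cl j x0" by auto
      have "measure M Q / 2 \<le> cmod (\<integral>x. indicator Q x * u x \<partial>M)"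
        using R[OF Q] um u1[of x0] near x0 by (intro half_measure_le_integral[where z = "u x0"]) (auto simp: cl_def)
      then have "(measure M Q / 2)\<^sup>2 \<le> (cmod (\<integral>x. indicator Q x * u x \<partial>M))\<^sup>2"
        by (intro power_mono) auto
      moreover have "s j * measure M Q \<le> measure M Q * measure M Q"
        using R[OF Q] by (intro mult_right_mono) auto
      ultimately show "s j * measure M Q / 4 \<le> (cmod (\<integral>x. indicator Q x * u x \<partial>M))\<^sup>2"
        by (simp add: power2_eq_square)
    qed
    also have "\<dots> \<le> (\<Sum>Q\<in>\<Q>. (cmod (\<integral>x. indicator Q x * u x \<partial>M))\<^sup>2)"
      using j J clfin by (intro sum_mono2) (auto simp: \<Q>_def)
    finally show "s j / 4 * measure M (S j) \<le> (\<Sum>Q\<in>\<Q>. (cmod (\<integral>x. indicator Q x * u x \<partial>M))\<^sup>2)" .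
  qed
qed

text \<open>Exchange the integrals and translate; the two factors that arise are complex conjugates of each other.\<close>

lemma autocorrelation:
  fixes M :: "'a :: ab_group_add measure" and ch :: "'a \<Rightarrow> complex"
  assumes sf: "sigma_finite_measure M"
    and add [measurable]: "(\<lambda>(t, x). t + x) \<in> M \<Otimes>\<^sub>M M \<rightarrow>\<^sub>M M"
    and transl: "\<And>t. distr M M (\<lambda>x. t + x) = M" and sp: "space M = UNIV"
    and Q [measurable]: "Q \<in> sets M" and fin: "emeasure M Q < \<infinity>"
    and ch [measurable]: "ch \<in> borel_measurable M" and ch1: "\<And>x. cmod (ch x) = 1" and ch_add: "\<And>t x. ch (t + x) = ch t * ch x"
  shows "(\<integral>x. complex_of_real (\<integral>t. indicator Q t * indicator Q (t + x) \<partial>M) * ch x \<partial>M)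
      = complex_of_real ((cmod (\<integral>x. indicator Q x * ch x \<partial>M))\<^sup>2)"
proof -
  interpret sigma_finite_measure M by (rule sf)
  interpret P: pair_sigma_finite M M ..
  have add' [measurable]: "(\<lambda>x. t + x) \<in> M \<rightarrow>\<^sub>M M" for t
    using measurable_Pair2[OF add, of t] sp by simp
  define I where "I = (\<integral>x. indicator Q x * ch x \<partial>M)"
  let ?f = "\<lambda>t x. indicator Q t * indicator Q (t + x) * ch x :: complex"
  have fm: "(\<lambda>(t, x). ?f t x) \<in> borel_measurable (M \<Otimes>\<^sub>M M)" by measurable
  have int: "integrable (M \<Otimes>\<^sub>M M) (\<lambda>(t, x). ?f t x)"
  proof (rule integrableI_bounded[OF fm])
    have "(\<integral>\<^sup>+p. ennreal (norm (case p of (t, x) \<Rightarrow> ?f t x)) \<partial>(M \<Otimes>\<^sub>M M))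
        = (\<integral>\<^sup>+t. \<integral>\<^sup>+x. ennreal (norm (?f t x)) \<partial>M \<partial>M)"
      by (subst nn_integral_fst[symmetric]) (use fm in auto)
    also have "\<dots> = (\<integral>\<^sup>+t. indicator Q t * emeasure M Q \<partial>M)"
    proof (intro nn_integral_cong)
      fix t
      have "(\<integral>\<^sup>+x. ennreal (norm (?f t x)) \<partial>M) = (\<integral>\<^sup>+x. indicator Q t * indicator Q (t + x) \<partial>M)"
        using ch1 by (intro nn_integral_cong) (auto simp: norm_mult split: split_indicator)
      also have "\<dots> = indicator Q t * (\<integral>\<^sup>+x. indicator Q (t + x) \<partial>M)" by (rule nn_integral_cmult) measurable
      also have "(\<integral>\<^sup>+x. indicator Q (t + x) \<partial>M) = (\<integral>\<^sup>+x. indicator Q x \<partial>distr M M (\<lambda>x. t + x))"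
        by (rule nn_integral_distr[symmetric]) measurable
      finally show "(\<integral>\<^sup>+x. ennreal (norm (?f t x)) \<partial>M) = indicator Q t * emeasure M Q" by (simp add: transl)
    qed
    also have "\<dots> = emeasure M Q * emeasure M Q" by (simp add: nn_integral_multc)
    also have "\<dots> < \<infinity>" using fin by (simp add: ennreal_mult_less_top)
    finally show "(\<integral>\<^sup>+p. ennreal (norm (case p of (t, x) \<Rightarrow> ?f t x)) \<partial>(M \<Otimes>\<^sub>M M)) < \<infinity>" .
  qed
  have "(\<integral>x. complex_of_real (\<integral>t. indicator Q t * indicator Q (t + x) \<partial>M) * ch x \<partial>M) = (\<integral>x. \<integral>t. ?f t x \<partial>M \<partial>M)"
  proof (rule Bochner_Integration.integral_cong[OF refl])
    fix x
    have "complex_of_real (\<integral>t. indicator Q t * indicator Q (t + x) \<partial>M) = (\<integral>t. complex_of_real (indicator Q t * indicator Q (t + x)) \<partial>M)"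
      by (rule integral_complex_of_real[symmetric])
    also have "\<dots> = (\<integral>t. indicator Q t * indicator Q (t + x) \<partial>M)"
      by (rule Bochner_Integration.integral_cong) (auto split: split_indicator)
    finally show "complex_of_real (\<integral>t. indicator Q t * indicator Q (t + x) \<partial>M) * ch x = (\<integral>t. ?f t x \<partial>M)"
      by (simp only: integral_mult_left_zero)
  qed
  also have "\<dots> = (\<integral>t. \<integral>x. ?f t x \<partial>M \<partial>M)" by (rule P.Fubini_integral[OF int])
  also have "\<dots> = (\<integral>t. (indicator Q t * cnj (ch t)) * I \<partial>M)"
  proof (rule Bochner_Integration.integral_cong[OF refl])
    fix t
    have cc: "cnj (ch t) * ch t = 1" using ch1[of t] by (metis complex_norm_square mult.commute of_real_1 power_one)
    have "(\<integral>x. ?f t x \<partial>M) = (\<integral>x. (indicator Q t * cnj (ch t)) * (indicator Q (t + x) * ch (t + x)) \<partial>M)"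
    proof (rule Bochner_Integration.integral_cong[OF refl])
      fix x
      have "(indicator Q t * cnj (ch t)) * (indicator Q (t + x) * ch (t + x)) = (cnj (ch t) * ch t) * ?f t x"
        by (simp add: ch_add ac_simps)
      then show "?f t x = (indicator Q t * cnj (ch t)) * (indicator Q (t + x) * ch (t + x))"
        unfolding cc by (simp only: mult_1_left)
    qed
    also have "\<dots> = (indicator Q t * cnj (ch t)) * (\<integral>x. indicator Q (t + x) * ch (t + x) \<partial>M)"
      by (rule integral_mult_right_zero)
    also have "(\<integral>x. indicator Q (t + x) * ch (t + x) \<partial>M) = (\<integral>x. indicator Q x * ch x \<partial>distr M M (\<lambda>x. t + x))"
      by (rule integral_distr[symmetric]) measurable
    finally show "(\<integral>x. ?f t x \<partial>M) = (indicator Q t * cnj (ch t)) * I" by (simp add: transl I_def)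
  qed
  also have "\<dots> = (\<integral>t. indicator Q t * cnj (ch t) \<partial>M) * I" by (rule integral_mult_left_zero)
  also have "(\<integral>t. indicator Q t * cnj (ch t) \<partial>M) = (\<integral>t. cnj (indicator Q t * ch t) \<partial>M)"
    by (rule Bochner_Integration.integral_cong) (auto split: split_indicator)
  also have "\<dots> = cnj I" unfolding I_def by (simp only: Bochner_Integration.integral_cnj)
  also have "cnj I * I = complex_of_real ((cmod I)\<^sup>2)" by (metis complex_norm_square mult.commute)
  finally show ?thesis unfolding I_def .
qed

text \<open>The autocorrelation of an indicator function, divided by the measure of the set: the Fejer kernel of \<open>Q\<close>.\<close>

lemma Fejer_bump:
  fixes M :: "'a :: ab_group_add measure"
  assumes sf: "sigma_finite_measure M"
    and add [measurable]: "(\<lambda>(t, x). t + x) \<in> M \<Otimes>\<^sub>M M \<rightarrow>\<^sub>M M"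
    and transl: "\<And>t. distr M M (\<lambda>x. t + x) = M" and sp: "space M = UNIV"
    and Q [measurable]: "Q \<in> sets M" and fin: "emeasure M Q < \<infinity>" and pos: "0 < measure M Q"
  obtains \<phi> :: "'a \<Rightarrow> real" where "\<phi> \<in> borel_measurable M" "\<And>x. 0 \<le> \<phi> x" "\<And>x. \<phi> x \<le> 1"
    "\<And>x. \<phi> x \<noteq> 0 \<Longrightarrow> \<exists>t\<in>Q. t + x \<in> Q"
    "\<And>ch. ch \<in> borel_measurable M \<Longrightarrow> (\<And>x. cmod (ch x) = 1) \<Longrightarrow> (\<And>t x. ch (t + x) = ch t * ch x) \<Longrightarrow>
      \<exists>s\<ge>0. (\<integral>x. complex_of_real (\<phi> x) * ch x \<partial>M) = complex_of_real s \<and>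
        ((\<forall>x\<in>Q. \<forall>x'\<in>Q. cmod (ch x - ch x') \<le> 1 / 2) \<longrightarrow> measure M Q / 4 \<le> s)"
proof -
  interpret sigma_finite_measure M by (rule sf)
  have iQ: "integrable M (indicator Q :: _ \<Rightarrow> real)" using fin by auto
  have add' [measurable]: "(\<lambda>t. t + x) \<in> M \<rightarrow>\<^sub>M M" for x
    using measurable_Pair1[OF add, of x] sp by simp
  define \<phi> where "\<phi> x = (\<integral>t. indicator Q t * indicator Q (t + x) \<partial>M) / measure M Q" for x
  have ii: "integrable M (\<lambda>t. indicator Q t * indicator Q (t + x) :: real)" for x
    by (rule Bochner_Integration.integrable_bound[OF iQ]) (auto split: split_indicator)
  show thesis
  proof (rule that)
    have "(\<lambda>(x, t). indicator Q t * indicator Q (t + x) :: real) \<in> borel_measurable (M \<Otimes>\<^sub>M M)"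
      using measurable_compose[OF measurable_pair_swap' add] by measurable
    from borel_measurable_lebesgue_integral[OF this]
    show "\<phi> \<in> borel_measurable M" unfolding \<phi>_def by simp
    show "0 \<le> \<phi> x" for x unfolding \<phi>_def by (intro divide_nonneg_nonneg integral_nonneg) auto
    show "\<phi> x \<le> 1" for x
    proof -
      have "(\<integral>t. indicator Q t * indicator Q (t + x) \<partial>M) \<le> (\<integral>t. (indicator Q t :: real) \<partial>M)"
        using ii iQ by (intro integral_mono) (auto split: split_indicator)
      also have "\<dots> = measure M Q" using sp by simp
      finally show ?thesis using pos by (simp add: \<phi>_def)
    qed
    show "\<exists>t\<in>Q. t + x \<in> Q" if "\<phi> x \<noteq> 0" for x
    proof (rule ccontr)
      assume "\<not> ?thesis"
      then have "(\<lambda>t. indicator Q t * indicator Q (t + x)) = (\<lambda>_. 0 :: real)" by (auto split: split_indicator)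
      then show False using that by (simp add: \<phi>_def)
    qed
    fix ch :: "'a \<Rightarrow> complex"
    assume ch: "ch \<in> borel_measurable M" "\<And>x. cmod (ch x) = 1" "\<And>t x. ch (t + x) = ch t * ch x"
    let ?I = "cmod (\<integral>x. indicator Q x * ch x \<partial>M)"
    have "(\<integral>x. complex_of_real (\<phi> x) * ch x \<partial>M)
        = (\<integral>x. complex_of_real (\<integral>t. indicator Q t * indicator Q (t + x) \<partial>M) * ch x / complex_of_real (measure M Q) \<partial>M)"
      by (simp add: \<phi>_def)
    also have "\<dots> = (\<integral>x. complex_of_real (\<integral>t. indicator Q t * indicator Q (t + x) \<partial>M) * ch x \<partial>M) / complex_of_real (measure M Q)"
      by (rule integral_divide_zero)
    also have "\<dots> = complex_of_real (?I\<^sup>2 / measure M Q)"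
      by (simp add: autocorrelation[OF sf add transl sp Q fin ch])
    finally have eq: "(\<integral>x. complex_of_real (\<phi> x) * ch x \<partial>M) = complex_of_real (?I\<^sup>2 / measure M Q)" .
    have "measure M Q / 4 \<le> ?I\<^sup>2 / measure M Q" if near: "\<forall>x\<in>Q. \<forall>x'\<in>Q. cmod (ch x - ch x') \<le> 1 / 2"
    proof -
      have "Q \<noteq> {}" using pos by auto
      then obtain x0 where x0: "x0 \<in> Q" by auto
      have "measure M Q / 2 \<le> ?I"
        using fin ch near x0 by (intro half_measure_le_integral[where z = "ch x0"]) auto
      then have "(measure M Q / 2)\<^sup>2 \<le> ?I\<^sup>2" by (intro power_mono) auto
      then show ?thesis using pos by (simp add: power2_eq_square field_simps)
    qed
    then show "\<exists>s\<ge>0. (\<integral>x. complex_of_real (\<phi> x) * ch x \<partial>M) = complex_of_real s \<and>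
        ((\<forall>x\<in>Q. \<forall>x'\<in>Q. cmod (ch x - ch x') \<le> 1 / 2) \<longrightarrow> measure M Q / 4 \<le> s)"
      using eq by (intro exI[of _ "?I\<^sup>2 / measure M Q"]) auto
  qed
qed

section \<open>The three measure spaces\<close>

lemma rearr_space_torus: "rearr_space torus_leb torus_pos"
proof -
  have sp: "space torus_leb = {-1/2..1/2}" by (simp add: torus_leb_def)
  have em: "emeasure torus_leb A = emeasure lborel A" if "A \<in> sets borel" "A \<subseteq> {-1/2..1/2}" for A
    using that unfolding torus_leb_def by (subst emeasure_restrict_space) auto
  have one: "emeasure torus_leb {-1/2..1/2} = 1" by (subst em) auto
  interpret finite_measure torus_leb
    by standard (simp only: sp one, simp)
  show ?thesis
  proof
    have [measurable]: "(\<lambda>x. x) \<in> borel_measurable torus_leb"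
      unfolding torus_leb_def by (intro measurable_restrict_space1 measurable_completion) simp
    show "torus_pos \<in> borel_measurable torus_leb" unfolding torus_pos_def by measurable
    show "0 \<le> torus_pos x" for x by (simp add: torus_pos_def)
    fix S assume S: "S \<in> sets torus_leb"
    have le: "emeasure torus_leb S \<le> 1"
      using emeasure_space[of torus_leb S] by (simp only: sp one)
    then obtain r where r: "emeasure torus_leb S = ennreal r" "0 \<le> r"
      by (cases "emeasure torus_leb S") (auto simp: top_unique)
    then have "r \<le> 1" using le by simp
    then have "{x \<in> space torus_leb. ennreal (torus_pos x) < emeasure torus_leb S} = {-(r/2)<..<r/2}"
      using r by (auto simp: sp torus_pos_def ennreal_less_iff)
    moreover have "emeasure torus_leb {-(r/2)<..<r/2} = ennreal r"
      using r \<open>r \<le> 1\<close> by (subst em) auto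
    ultimately show "emeasure torus_leb {x \<in> space torus_leb. ennreal (torus_pos x) < emeasure torus_leb S} = emeasure torus_leb S"
      using r by simp
  next
    have "emeasure torus_leb {0} = 0" by (subst em) auto
    moreover have "{0} \<in> sets torus_leb" by (auto simp: torus_leb_def sets_restrict_space)
    ultimately have "{0} \<in> null_sets torus_leb" by (rule null_setsI)
    then have "AE x in torus_leb. x \<notin> {0}" by (rule AE_not_in)
    then show "AE x in torus_leb. \<exists>\<delta>>0. \<forall>S\<in>sets torus_leb. emeasure torus_leb S \<le> ennreal \<delta> \<longrightarrow> emeasure torus_leb S \<le> ennreal (torus_pos x)"
    proof eventually_elim
      case (elim x)
      then show ?case by (intro exI[of _ "torus_pos x"]) (auto simp: torus_pos_def)
    qed
  qed
qed

lemma int_pos_less_eq: "{n. int_pos n < real m} = (\<lambda>i. if odd i then (int i + 1) div 2 else - (int i div 2)) ` {..<m}"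
proof (intro equalityI subsetI)
  fix n assume "n \<in> {n. int_pos n < real m}"
  then have n: "int_pos n < real m" by simp
  show "n \<in> (\<lambda>i. if odd i then (int i + 1) div 2 else - (int i div 2)) ` {..<m}"
  proof (cases "n > 0")
    case True
    then have "real_of_int (2 * n - 1) < real m" using n by (simp add: int_pos_def)
    then have "2 * n - 1 < int m" by linarith
    moreover have "odd (nat (2 * n - 1))" using True by (simp add: even_nat_iff)
    ultimately show ?thesis using True by (intro image_eqI[of _ _ "nat (2 * n - 1)"]) auto
  next
    case False
    then have "real_of_int (- 2 * n) < real m" using n by (simp add: int_pos_def)
    then have "- 2 * n < int m" by linarith
    moreover have "even (nat (- 2 * n))" using False by (simp add: even_nat_iff)
    ultimately show ?thesis using False by (intro image_eqI[of _ _ "nat (- 2 * n)"]) auto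
  qed
next
  fix n assume "n \<in> (\<lambda>i. if odd i then (int i + 1) div 2 else - (int i div 2)) ` {..<m}"
  then obtain i where i: "i < m" "n = (if odd i then (int i + 1) div 2 else - (int i div 2))" by auto
  show "n \<in> {n. int_pos n < real m}"
  proof (cases "odd i")
    case True
    then obtain l where "i = 2 * l + 1" by (auto elim: oddE)
    then show ?thesis using i by (auto simp: int_pos_def)
  next
    case False
    then obtain l where "i = 2 * l" by (auto elim: evenE)
    then show ?thesis using i by (auto simp: int_pos_def)
  qed
qed

lemma card_int_pos_less: "finite {n. int_pos n < real m}" "card {n. int_pos n < real m} = m"
proof -
  show "finite {n. int_pos n < real m}" unfolding int_pos_less_eq by simp
  have "inj_on (\<lambda>i. if odd i then (int i + 1) div 2 else - (int i div 2)) {..<m}"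
  proof (rule inj_on_inverseI[where g = "\<lambda>n. if n > 0 then nat (2 * n - 1) else nat (- 2 * n)"])
    fix i :: nat
    show "(if (if odd i then (int i + 1) div 2 else - (int i div 2)) > 0
        then nat (2 * (if odd i then (int i + 1) div 2 else - (int i div 2)) - 1)
        else nat (- 2 * (if odd i then (int i + 1) div 2 else - (int i div 2)))) = i"
      by (cases "odd i") (auto elim!: oddE evenE)
  qed
  then show "card {n. int_pos n < real m} = m" unfolding int_pos_less_eq by (simp only: card_image card_lessThan)
qed

lemma int_pos_nonneg: "0 \<le> int_pos n" by (auto simp: int_pos_def)

text \<open>A set of measure at most one half is empty, which is why the origin, where \<^const>\<open>int_pos\<close> vanishes, needs no
  exception.\<close>

lemma rearr_space_int: "rearr_space int_count int_pos"
proof -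
  interpret sigma_finite_measure int_count
    unfolding int_count_def by (rule sigma_finite_measure_count_space)
  show ?thesis
  proof
    show "int_pos \<in> borel_measurable int_count" by (simp add: int_count_def)
    show "0 \<le> int_pos x" for x by (rule int_pos_nonneg)
    fix S :: "int set" assume "S \<in> sets int_count"
    show "emeasure int_count {x \<in> space int_count. ennreal (int_pos x) < emeasure int_count S} = emeasure int_count S"
    proof (cases "finite S")
      case True
      then have "{x \<in> space int_count. ennreal (int_pos x) < emeasure int_count S} = {n. int_pos n < real (card S)}"
        using int_pos_nonneg by (auto simp: int_count_def ennreal_of_nat_eq_real_of_nat ennreal_less_iff)
      then show ?thesis using True card_int_pos_less[of "card S"] by (simp add: int_count_def)
    next
      case False
      then show ?thesis by (simp add: int_count_def infinite_UNIV_int)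
    qed
  next
    show "AE x in int_count. \<exists>\<delta>>0. \<forall>S\<in>sets int_count. emeasure int_count S \<le> ennreal \<delta> \<longrightarrow> emeasure int_count S \<le> ennreal (int_pos x)"
    proof (rule AE_I2, intro exI[of _ "1/2"] conjI ballI impI)
      fix x S assume S: "emeasure int_count S \<le> ennreal (1/2)"
      then have "finite S" by (auto simp: int_count_def emeasure_count_space top_unique split: if_splits)
      then have "ennreal (real (card S)) \<le> ennreal (1/2)"
        using S by (simp add: int_count_def ennreal_of_nat_eq_real_of_nat del: ennreal_half ennreal_numeral)
      then have "real (card S) \<le> 1 / 2" by (subst (asm) ennreal_le_iff) auto
      then have "card S = 0" by linarith
      then show "emeasure int_count S \<le> ennreal (int_pos x)" using \<open>finite S\<close> by (simp add: int_count_def)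
    qed simp
  qed
qed

lemma unit_ball_measure: "0 < measure lborel (ball (0 :: real ^ 'n) 1)"
  "emeasure lebesgue (ball (0 :: real ^ 'n) 1) = ennreal (measure lborel (ball (0 :: real ^ 'n) 1))"
proof -
  have fin: "emeasure lborel (ball (0 :: real ^ 'n) 1) < \<infinity>"
    by (intro emeasure_bounded_finite) auto
  then show "emeasure lebesgue (ball (0 :: real ^ 'n) 1) = ennreal (measure lborel (ball (0 :: real ^ 'n) 1))"
    by (simp add: emeasure_eq_ennreal_measure less_top)
  show "0 < measure lborel (ball (0 :: real ^ 'n) 1)"
    using content_ball_pos[of 1 "0 :: real ^ 'n"] by simp
qed

lemma emeasure_space_leb:
  "emeasure (space_leb :: (real ^ 'n) measure) A = ennreal (1 / measure lborel (ball (0 :: real ^ 'n) 1)) * emeasure lebesgue A"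
  unfolding space_leb_def emeasure_scale_measure unit_ball_measure(2)
  using unit_ball_measure(1)[where 'n = 'n] by (simp only: inverse_ennreal inverse_eq_divide)

lemma rearr_space_space: "rearr_space (space_leb :: (real ^ 'n) measure) space_pos"
proof -
  let ?V = "measure lborel (ball (0 :: real ^ 'n) 1)" and ?M = "space_leb :: (real ^ 'n) measure"
  note V = unit_ball_measure[where 'n = 'n]
  have sp: "space ?M = UNIV" by (simp add: space_leb_def space_scale_measure)
  have st: "sets ?M = sets lebesgue" by (simp add: space_leb_def)
  have ball: "emeasure ?M (ball 0 c) = ennreal (c ^ CARD('n))" if "0 \<le> c" for c :: real
    using that V unfolding emeasure_space_leb
    by (subst emeasure_lebesgue_ball_conv_unit_ball) (auto simp: ennreal_mult[symmetric])
  interpret sigma_finite_measure ?M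
  proof
    show "\<exists>A. countable A \<and> A \<subseteq> sets ?M \<and> \<Union> A = space ?M \<and> (\<forall>a\<in>A. emeasure ?M a \<noteq> \<infinity>)"
    proof (intro exI[of _ "range (\<lambda>n::nat. ball (0 :: real ^ 'n) (real n))"] conjI)
      have "\<exists>n::nat. x \<in> ball 0 (real n)" for x :: "real ^ 'n"
        using reals_Archimedean2[of "norm x"] by auto
      then show "\<Union> (range (\<lambda>n::nat. ball (0 :: real ^ 'n) (real n))) = space ?M" by (auto simp: sp)
    qed (auto simp: st ball)
  qed
  show ?thesis
  proof
    show "space_pos \<in> borel_measurable ?M"
      unfolding space_pos_def[abs_def] by (subst measurable_cong_sets[OF st refl], rule measurable_completion) simp
    show "0 \<le> space_pos x" for x :: "real ^ 'n" by (simp add: space_pos_def)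
    fix S assume "S \<in> sets ?M"
    show "emeasure ?M {x \<in> space ?M. ennreal (space_pos x) < emeasure ?M S} = emeasure ?M S"
    proof (cases "emeasure ?M S")
      case (real r)
      have "{x \<in> space ?M. ennreal (space_pos x) < emeasure ?M S} = ball 0 (root CARD('n) r)"
      proof -
        have "norm x ^ CARD('n) < r \<longleftrightarrow> norm x < root CARD('n) r" for x :: "real ^ 'n"
        proof -
          have "norm x ^ CARD('n) < r \<longleftrightarrow> root CARD('n) (norm x ^ CARD('n)) < root CARD('n) r"
            by (rule real_root_less_iff[symmetric]) simp
          also have "root CARD('n) (norm x ^ CARD('n)) = norm x" by (rule real_root_power_cancel) auto
          finally show ?thesis .
        qed
        then have "ennreal (space_pos x) < emeasure ?M S \<longleftrightarrow> x \<in> ball 0 (root CARD('n) r)" for x :: "real ^ 'n"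
          using real by (simp add: space_pos_def ennreal_less_iff)
        then show ?thesis by (simp only: sp UNIV_I simp_thms Collect_mem_eq)
      qed
      then show ?thesis using real ball[of "root CARD('n) r"] by simp
    next
      case top
      then show ?thesis using V by (simp add: sp emeasure_space_leb ennreal_mult_top)
    qed
  next
    have "{0} \<in> null_sets ?M" by (intro null_setsI) (auto simp: emeasure_space_leb st)
    then have "AE x in ?M. x \<notin> {0}" by (rule AE_not_in)
    then show "AE x in ?M. \<exists>\<delta>>0. \<forall>S\<in>sets ?M. emeasure ?M S \<le> ennreal \<delta> \<longrightarrow> emeasure ?M S \<le> ennreal (space_pos x)"
    proof eventually_elim
      case (elim x)
      then show ?case by (intro exI[of _ "space_pos x"]) (auto simp: space_pos_def)
    qed
  qed
qed

section \<open>Cells and bumps in Euclidean space\<close>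

definition half_open :: "('a::euclidean_space \<Rightarrow> real) \<Rightarrow> ('a \<Rightarrow> real) \<Rightarrow> 'a set" where
  "half_open l u = {x. \<forall>b\<in>Basis. l b \<le> x \<bullet> b \<and> x \<bullet> b < u b}"

lemma half_open_borel [measurable]: "half_open l u \<in> sets borel"
proof -
  have "half_open l u = (\<Inter>b\<in>Basis. {x. l b \<le> x \<bullet> b \<and> x \<bullet> b < u b})" by (auto simp: half_open_def)
  moreover have "{x :: 'a. l b \<le> x \<bullet> b \<and> x \<bullet> b < u b} \<in> sets borel" for b by measurable
  ultimately show ?thesis by (auto intro!: sets.finite_INT)
qed

lemma emeasure_half_open:
  fixes l u :: "'a::euclidean_space \<Rightarrow> real"
  assumes "\<And>b. b \<in> Basis \<Longrightarrow> l b \<le> u b"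
  shows "emeasure lborel (half_open l u) = ennreal (\<Prod>b\<in>Basis. u b - l b)"
proof (rule antisym)
  define l' where "l' = (\<Sum>b\<in>Basis. l b *\<^sub>R b)"
  define u' where "u' = (\<Sum>b\<in>Basis. u b *\<^sub>R b)"
  have lu: "l' \<bullet> b = l b" "u' \<bullet> b = u b" if "b \<in> Basis" for b using that by (auto simp: l'_def u'_def)
  have prod: "(\<Prod>b\<in>Basis. (u' - l') \<bullet> b) = (\<Prod>b\<in>Basis. u b - l b)"
    using lu by (intro prod.cong) (auto simp: inner_diff_left)
  have "emeasure lborel (half_open l u) \<le> emeasure lborel (cbox l' u')"
    using lu by (intro emeasure_mono) (auto simp: half_open_def mem_box less_imp_le)
  also have "\<dots> = ennreal (\<Prod>b\<in>Basis. u b - l b)"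
    using assms lu by (subst emeasure_lborel_cbox) (auto simp: prod)
  finally show "emeasure lborel (half_open l u) \<le> ennreal (\<Prod>b\<in>Basis. u b - l b)" .
  have "ennreal (\<Prod>b\<in>Basis. u b - l b) = emeasure lborel (box l' u')"
    using assms lu by (subst emeasure_lborel_box) (auto simp: prod)
  also have "\<dots> \<le> emeasure lborel (half_open l u)"
    using lu half_open_borel[of l u] by (intro emeasure_mono) (auto simp: half_open_def mem_box less_imp_le)
  finally show "ennreal (\<Prod>b\<in>Basis. u b - l b) \<le> emeasure lborel (half_open l u)" .
qed

lemma norm_le_DIM:
  fixes x :: "'a::euclidean_space" and t :: real
  assumes "\<And>b. b \<in> Basis \<Longrightarrow> \<bar>x \<bullet> b\<bar> \<le> t"
  shows "norm x \<le> DIM('a) * t"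
proof -
  have "norm x \<le> (\<Sum>b\<in>Basis. \<bar>x \<bullet> b\<bar>)" by (rule norm_le_l1)
  also have "\<dots> \<le> (\<Sum>b\<in>(Basis :: 'a set). t)" using assms by (rule sum_mono)
  finally show ?thesis by simp
qed

text \<open>As the faces of the box lie on the grid, whether a point belongs to the box is decided by the integer parts of its
  coordinates; so no grid cell is cut by the boundary.\<close>

lemma grid_cell:
  fixes A B :: "'a::euclidean_space \<Rightarrow> int"
  assumes \<sigma>: "0 < \<sigma>" and l: "\<And>b. b \<in> Basis \<Longrightarrow> l b = \<sigma> * of_int (A b)" and u: "\<And>b. b \<in> Basis \<Longrightarrow> u b = \<sigma> * of_int (B b)"
    and x: "x \<in> half_open l u"
  shows "{x' \<in> half_open l u. \<forall>b\<in>Basis. \<lfloor>x' \<bullet> b / \<sigma>\<rfloor> = \<lfloor>x \<bullet> b / \<sigma>\<rfloor>}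
    = half_open (\<lambda>b. \<sigma> * of_int \<lfloor>x \<bullet> b / \<sigma>\<rfloor>) (\<lambda>b. \<sigma> * (of_int \<lfloor>x \<bullet> b / \<sigma>\<rfloor> + 1))"
proof -
  have fl: "\<lfloor>t / \<sigma>\<rfloor> = z \<longleftrightarrow> \<sigma> * of_int z \<le> t \<and> t < \<sigma> * (of_int z + 1)" for t and z :: int
  proof -
    have "\<lfloor>t / \<sigma>\<rfloor> = z \<longleftrightarrow> of_int z \<le> t / \<sigma> \<and> t / \<sigma> < of_int z + 1" by (rule floor_eq_iff)
    also have "\<dots> \<longleftrightarrow> \<sigma> * of_int z \<le> t \<and> t < \<sigma> * (of_int z + 1)"
      using \<sigma> by (simp add: pos_le_divide_eq pos_divide_less_eq mult.commute)
    finally show ?thesis .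
  qed
  have bd: "(l b \<le> t \<longleftrightarrow> A b \<le> \<lfloor>t / \<sigma>\<rfloor>) \<and> (t < u b \<longleftrightarrow> \<lfloor>t / \<sigma>\<rfloor> < B b)" if "b \<in> Basis" for b t
    using \<sigma> by (simp add: l[OF that] u[OF that] le_floor_iff floor_less_iff pos_le_divide_eq pos_divide_less_eq mult.commute)
  show ?thesis
  proof (intro equalityI subsetI)
    fix x' assume "x' \<in> {x' \<in> half_open l u. \<forall>b\<in>Basis. \<lfloor>x' \<bullet> b / \<sigma>\<rfloor> = \<lfloor>x \<bullet> b / \<sigma>\<rfloor>}"
    then show "x' \<in> half_open (\<lambda>b. \<sigma> * of_int \<lfloor>x \<bullet> b / \<sigma>\<rfloor>) (\<lambda>b. \<sigma> * (of_int \<lfloor>x \<bullet> b / \<sigma>\<rfloor> + 1))"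
      unfolding half_open_def by (simp add: fl)
  next
    fix x' assume "x' \<in> half_open (\<lambda>b. \<sigma> * of_int \<lfloor>x \<bullet> b / \<sigma>\<rfloor>) (\<lambda>b. \<sigma> * (of_int \<lfloor>x \<bullet> b / \<sigma>\<rfloor> + 1))"
    then have eq: "\<forall>b\<in>Basis. \<lfloor>x' \<bullet> b / \<sigma>\<rfloor> = \<lfloor>x \<bullet> b / \<sigma>\<rfloor>" by (simp add: half_open_def fl)
    moreover have "x' \<in> half_open l u" using x eq bd unfolding half_open_def by simp
    ultimately show "x' \<in> {x' \<in> half_open l u. \<forall>b\<in>Basis. \<lfloor>x' \<bullet> b / \<sigma>\<rfloor> = \<lfloor>x \<bullet> b / \<sigma>\<rfloor>}" by simp
  qed
qed

lemma power_power_int: "((2::real) ^ d) powi k = (2 powi k) ^ d"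
  by (cases "0 \<le> k") (auto simp: power_int_def power_mult[symmetric] power_inverse power_one_over inverse_eq_divide mult.commute)

lemma sum_scales_le:
  fixes m n :: int
  shows "(\<Sum>j\<in>{m..n}. (2::real) powi (- j)) \<le> 2 * 2 powi (- m)"
proof (cases "m \<le> n")
  case True
  then have "(\<Sum>j\<in>{m..n}. (2::real) powi (- j)) = 2 * 2 powi (- m) - 2 powi (- n)"
  proof (induction n rule: int_ge_induct)
    case (step n)
    then have "{m..n + 1} = insert (n + 1) {m..n}" by auto
    moreover have "(2::real) powi (- (n + 1)) = 2 powi (- n) / 2" by (simp add: power_int_diff)
    ultimately show ?case using step by simp
  qed simp
  then show ?thesis by simp
next
  case False
  then show ?thesis by simp
qed

text \<open>The number 16 leaves room for \<open>2 \<pi> < 8\<close> and the bound one half.\<close>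

lemma phase_near:
  fixes x x' \<xi> :: "'a::euclidean_space" and \<sigma> t :: real
  assumes "\<And>b. b \<in> Basis \<Longrightarrow> \<bar>(x - x') \<bullet> b\<bar> \<le> \<sigma>" and "norm \<xi> \<le> t" and "16 * DIM('a) * \<sigma> * t \<le> 1"
  shows "cmod (cis (- 2 * pi * (x \<bullet> \<xi>)) - cis (- 2 * pi * (x' \<bullet> \<xi>))) \<le> 1 / 2"
proof -
  have "cmod (cis (- 2 * pi * (x \<bullet> \<xi>)) - cis (- 2 * pi * (x' \<bullet> \<xi>))) \<le> \<bar>- 2 * pi * (x \<bullet> \<xi>) - (- 2 * pi * (x' \<bullet> \<xi>))\<bar>"
    by (rule cmod_cis_diff_le)
  also have "\<dots> = 2 * pi * \<bar>(x - x') \<bullet> \<xi>\<bar>"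
  proof -
    have "- 2 * pi * (x \<bullet> \<xi>) - (- 2 * pi * (x' \<bullet> \<xi>)) = - (2 * pi * ((x - x') \<bullet> \<xi>))"
      by (simp add: inner_diff_left algebra_simps)
    then show ?thesis by (simp only: abs_minus_cancel abs_mult abs_of_pos[OF pi_gt_zero] abs_numeral)
  qed
  also have "\<dots> \<le> 2 * 4 * (norm (x - x') * norm \<xi>)"
    using pi_less_4 Cauchy_Schwarz_ineq2[of "x - x'" \<xi>] by (intro mult_mono) auto
  also have "\<dots> \<le> 2 * 4 * ((DIM('a) * \<sigma>) * t)"
    using norm_le_DIM[OF assms(1)] assms(2) by (intro mult_left_mono mult_mono) (auto intro: order_trans[OF norm_ge_zero])
  also have "\<dots> \<le> 1 / 2" using assms(3) by (simp add: ac_simps)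
  finally show ?thesis .
qed

text \<open>The two Euclidean measures at hand differ from Lebesgue measure on a set \<open>\<Omega>\<close> by a constant factor; the underlying sigma
  algebra consists of Lebesgue measurable sets.\<close>

locale euclidean_chart =
  fixes D :: "'a::euclidean_space measure" and \<Omega> :: "'a set" and a :: real
  assumes a: "0 < a"
    and id_measurable: "(\<lambda>x. x) \<in> D \<rightarrow>\<^sub>M borel"
    and sets_chart: "A \<in> sets borel \<Longrightarrow> A \<subseteq> \<Omega> \<Longrightarrow> A \<in> sets D"
    and emeasure_chart: "A \<in> sets borel \<Longrightarrow> A \<subseteq> \<Omega> \<Longrightarrow> emeasure D A = ennreal a * emeasure lborel A"
    and integral_chart: "(f :: 'a \<Rightarrow> complex) \<in> borel_measurable borel \<Longrightarrow> (\<And>x. x \<notin> \<Omega> \<Longrightarrow> f x = 0) \<Longrightarrow>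
      (\<integral>x. f x \<partial>D) = a *\<^sub>R (\<integral>x. f x \<partial>lborel)"
begin

text \<open>The cube has side \<open>2\<^sup>k / 2\<^sup>r\<close>, where \<open>r\<close> is chosen such that characters of frequency below the dual scale are almost
  constant on it.\<close>

lemma euclidean_bump:
  assumes r: "32 * DIM('a) \<le> (2::real) ^ r" and ball: "cball 0 (2 * DIM('a) * 2 powi k) \<subseteq> \<Omega>"
  shows "\<exists>\<phi>. \<phi> \<in> borel_measurable D \<and> (\<forall>x. 0 \<le> \<phi> x \<and> \<phi> x \<le> 1 \<and> (\<phi> x \<noteq> 0 \<longrightarrow> norm x \<le> 2 * DIM('a) * 2 powi k)) \<and>
    (\<forall>\<xi>. \<exists>s\<ge>0. (\<integral>x. complex_of_real (\<phi> x) * cis (- 2 * pi * (x \<bullet> \<xi>)) \<partial>D) = complex_of_real s \<and>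
      (\<forall>j. k < - j \<longrightarrow> norm \<xi> \<le> 2 powi (j + 1) \<longrightarrow> a / 4 * (1 / 2 ^ r) ^ DIM('a) * (2 ^ DIM('a)) powi k \<le> s))"
proof -
  define \<sigma> where "\<sigma> = (2::real) powi (k - int r)"
  have \<sigma>: "0 < \<sigma>" "\<sigma> \<le> 2 powi k" unfolding \<sigma>_def by (auto intro!: power_int_increasing)
  have \<sigma>r: "\<sigma> = 2 powi k / 2 ^ r" by (simp add: \<sigma>_def power_int_diff)
  let ?Q = "half_open (\<lambda>_. 0) (\<lambda>_. \<sigma>) :: 'a set"
  have eQ: "emeasure lborel ?Q = ennreal (\<sigma> ^ DIM('a))" using \<sigma> by (subst emeasure_half_open) auto
  then have mQ: "measure lborel ?Q = \<sigma> ^ DIM('a)" using \<sigma> by (simp add: measure_def)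
  have sf: "sigma_finite_measure (lborel :: 'a measure)" by (rule lborel.sigma_finite_measure_axioms)
  obtain \<phi> where \<phi>: "\<phi> \<in> borel_measurable lborel" "\<And>x. 0 \<le> \<phi> x" "\<And>x. \<phi> x \<le> 1" "\<And>x. \<phi> x \<noteq> 0 \<Longrightarrow> \<exists>t\<in>?Q. t + x \<in> ?Q"
    and \<phi>ft: "\<And>ch. ch \<in> borel_measurable lborel \<Longrightarrow> (\<And>x. cmod (ch x) = 1) \<Longrightarrow> (\<And>t x. ch (t + x) = ch t * ch x) \<Longrightarrow>
      \<exists>s\<ge>0. (\<integral>x. complex_of_real (\<phi> x) * ch x \<partial>lborel) = complex_of_real s \<and>
        ((\<forall>x\<in>?Q. \<forall>x'\<in>?Q. cmod (ch x - ch x') \<le> 1 / 2) \<longrightarrow> measure lborel ?Q / 4 \<le> s)"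
  proof (rule Fejer_bump[OF sf, of ?Q])
    show "distr lborel lborel (\<lambda>x. t + x) = lborel" for t :: 'a
      using lborel_distr_plus[of t] by (simp add: distr_cong[OF refl sets_lborel refl])
    show "(\<lambda>(t, x). t + x) \<in> lborel \<Otimes>\<^sub>M lborel \<rightarrow>\<^sub>M (lborel :: 'a measure)" by measurable
  qed (use eQ mQ \<sigma> in auto)
  have supp: "norm x \<le> 2 * DIM('a) * 2 powi k" if nz: "\<phi> x \<noteq> 0" for x
  proof -
    obtain t where t: "t \<in> ?Q" "t + x \<in> ?Q" using \<phi>(4)[OF nz] by auto
    have "norm x \<le> DIM('a) * \<sigma>"
    proof (rule norm_le_DIM)
      fix b :: 'a assume "b \<in> Basis"
      then have "0 \<le> t \<bullet> b" "t \<bullet> b < \<sigma>" "0 \<le> t \<bullet> b + x \<bullet> b" "t \<bullet> b + x \<bullet> b < \<sigma>"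
        using t by (auto simp: half_open_def inner_add_left)
      then show "\<bar>x \<bullet> b\<bar> \<le> \<sigma>" by linarith
    qed
    also have "\<dots> \<le> DIM('a) * 2 powi k" using \<sigma> by (intro mult_left_mono) auto
    also have "\<dots> \<le> 2 * DIM('a) * 2 powi k" by simp
    finally show ?thesis .
  qed
  have \<phi>b: "\<phi> \<in> borel_measurable borel" using \<phi>(1) by simp
  have "\<phi> \<in> borel_measurable D" using measurable_compose[OF id_measurable \<phi>b] by simp
  moreover have "\<exists>s\<ge>0. (\<integral>x. complex_of_real (\<phi> x) * cis (- 2 * pi * (x \<bullet> \<xi>)) \<partial>D) = complex_of_real s \<and>
      (\<forall>j. k < - j \<longrightarrow> norm \<xi> \<le> 2 powi (j + 1) \<longrightarrow> a / 4 * (1 / 2 ^ r) ^ DIM('a) * (2 ^ DIM('a)) powi k \<le> s)" for \<xi>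
  proof -
    let ?ch = "\<lambda>x. cis (- 2 * pi * (x \<bullet> \<xi>))"
    have cm: "?ch \<in> borel_measurable borel" unfolding cis_conv_exp by measurable
    have "\<exists>s\<ge>0. (\<integral>x. complex_of_real (\<phi> x) * ?ch x \<partial>lborel) = complex_of_real s \<and>
        ((\<forall>x\<in>?Q. \<forall>x'\<in>?Q. cmod (?ch x - ?ch x') \<le> 1 / 2) \<longrightarrow> measure lborel ?Q / 4 \<le> s)"
      using cm by (intro \<phi>ft) (auto simp: cis_mult inner_add_left algebra_simps)
    then obtain s where s: "0 \<le> s" "(\<integral>x. complex_of_real (\<phi> x) * ?ch x \<partial>lborel) = complex_of_real s"
      "(\<forall>x\<in>?Q. \<forall>x'\<in>?Q. cmod (?ch x - ?ch x') \<le> 1 / 2) \<Longrightarrow> measure lborel ?Q / 4 \<le> s" by blast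
    have "(\<integral>x. complex_of_real (\<phi> x) * ?ch x \<partial>D) = a *\<^sub>R (\<integral>x. complex_of_real (\<phi> x) * ?ch x \<partial>lborel)"
    proof (rule integral_chart)
      show "(\<lambda>x. complex_of_real (\<phi> x) * ?ch x) \<in> borel_measurable borel" using cm \<phi>b by measurable
      fix x assume "x \<notin> \<Omega>"
      then have "\<not> norm x \<le> 2 * DIM('a) * 2 powi k" using ball by auto
      then show "complex_of_real (\<phi> x) * ?ch x = 0" using supp[of x] by auto
    qed
    also have "\<dots> = complex_of_real (a * s)" unfolding s(2) by (simp add: scaleR_conv_of_real)
    finally have eq: "(\<integral>x. complex_of_real (\<phi> x) * ?ch x \<partial>D) = complex_of_real (a * s)" .
    have "a / 4 * (1 / 2 ^ r) ^ DIM('a) * (2 ^ DIM('a)) powi k \<le> a * s" if j: "k < - j" "norm \<xi> \<le> 2 powi (j + 1)" for j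
    proof -
      have "16 * DIM('a) * \<sigma> * 2 powi (j + 1) = 16 * DIM('a) * 2 powi (k + j + 1) / 2 ^ r"
        by (simp add: \<sigma>r power_int_add)
      also have "\<dots> \<le> 16 * DIM('a) * 2 powi 0 / 2 ^ r"
        using j by (intro divide_right_mono mult_left_mono power_int_increasing) auto
      also have "\<dots> \<le> 1" using r by (simp add: divide_le_eq_1)
      finally have small: "16 * DIM('a) * \<sigma> * 2 powi (j + 1) \<le> 1" .
      have "\<forall>x\<in>?Q. \<forall>x'\<in>?Q. cmod (?ch x - ?ch x') \<le> 1 / 2"
      proof (intro ballI phase_near[OF _ j(2) small])
        fix x x' b :: 'a assume "x \<in> ?Q" "x' \<in> ?Q" "b \<in> Basis"
        then have "0 \<le> x \<bullet> b" "x \<bullet> b < \<sigma>" "0 \<le> x' \<bullet> b" "x' \<bullet> b < \<sigma>" by (auto simp: half_open_def)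
        then show "\<bar>(x - x') \<bullet> b\<bar> \<le> \<sigma>" unfolding inner_diff_left by linarith
      qed
      then have "\<sigma> ^ DIM('a) / 4 \<le> s" using s(3) mQ by simp
      then have "a * (\<sigma> ^ DIM('a) / 4) \<le> a * s" using a by (intro mult_left_mono) auto
      moreover have "\<sigma> ^ DIM('a) = (1 / 2 ^ r) ^ DIM('a) * (2 ^ DIM('a)) powi k"
        by (simp add: \<sigma>r power_power_int power_divide)
      ultimately show ?thesis by simp
    qed
    then show ?thesis using eq s(1) a by (intro exI[of _ "a * s"]) auto
  qed
  ultimately show ?thesis using \<phi>(2,3) supp by blast
qed

text \<open>A cube of side \<open>2\<^sup>k\<close>. Regions for different \<open>k\<close> are told apart by the distinguished coordinate \<open>b0\<close>, along which they
  are later cut into slabs.\<close>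

definition region :: "int \<Rightarrow> 'a set" where
  "region k = (let b0 = (SOME b. b \<in> Basis) in
    half_open (\<lambda>b. if b = b0 then 2 powi k else 0) (\<lambda>b. if b = b0 then 2 * 2 powi k else 2 powi k))"

lemma region_norm: "x \<in> region k \<Longrightarrow> norm x \<le> 2 * DIM('a) * 2 powi k"
proof -
  assume x: "x \<in> region k"
  have "norm x \<le> DIM('a) * (2 * 2 powi k)"
  proof (rule norm_le_DIM)
    fix b :: 'a assume b: "b \<in> Basis"
    have p: "0 < (2::real) powi k" by simp
    show "\<bar>x \<bullet> b\<bar> \<le> 2 * 2 powi k"
      using x b p by (auto simp: region_def half_open_def Let_def split: if_splits)
  qed
  then show ?thesis by (simp add: ac_simps)
qed

lemma region_disjoint: assumes "k \<noteq> k'" shows "region k \<inter> region k' = {}"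
proof -
  let ?b0 = "SOME b. b \<in> (Basis :: 'a set)"
  have b0: "?b0 \<in> Basis" by (rule someI_ex) (use nonempty_Basis in blast)
  have in_region: "2 powi i \<le> x \<bullet> ?b0 \<and> x \<bullet> ?b0 < 2 powi (i + 1)" if "x \<in> region i" for x i
    using that b0 by (auto simp: region_def half_open_def Let_def power_int_add)
  have "False" if "x \<in> region i" "x \<in> region i'" "i < i'" for x i i'
  proof -
    have "(2::real) powi (i + 1) \<le> 2 powi i'" using that(3) by (intro power_int_increasing) auto
    then show False using in_region[OF that(1)] in_region[OF that(2)] by linarith
  qed
  then show ?thesis using assms by (metis disjoint_iff linorder_neqE)
qed

text \<open>Frequency scale \<open>j\<close> receives a slab of relative thickness at least \<open>\<theta> j / 2\<close>, cut into cubes of side \<open>\<sigma> j\<close>. Halving the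
  shares makes room for rounding the slabs to the grid of these cubes: the mesh sizes relative to the region form a
  geometric series with sum at most one half.\<close>

lemma euclidean_cells:
  fixes \<theta> :: "int \<Rightarrow> real"
  assumes r: "32 * DIM('a) \<le> (2::real) ^ r" and ball: "cball 0 (2 * DIM('a) * 2 powi k) \<subseteq> \<Omega>"
    and \<theta>: "\<And>j. 0 \<le> \<theta> j" "(\<Sum>j\<in>{-k..n}. \<theta> j) \<le> 1"
  shows "\<exists>\<Q>. finite \<Q> \<and> disjoint \<Q> \<and> (\<forall>Q\<in>\<Q>. Q \<in> sets D \<and> Q \<subseteq> region k) \<and>
    (\<forall>j \<xi>. - k \<le> j \<and> j \<le> n \<longrightarrow> norm \<xi> \<le> 2 powi (j + 1) \<longrightarrow>
      a\<^sup>2 / 8 * (1 / 2 ^ r) ^ DIM('a) * (2 ^ DIM('a)) powi (k - j) * \<theta> j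
        \<le> (\<Sum>Q\<in>\<Q>. (cmod (\<integral>x. indicator Q x * cis (- 2 * pi * (x \<bullet> \<xi>)) \<partial>D))\<^sup>2))"
proof -
  define b0 where "b0 = (SOME b. b \<in> (Basis :: 'a set))"
  have b0: "b0 \<in> Basis" unfolding b0_def by (rule someI_ex) (use nonempty_Basis in blast)
  define L where "L = (2::real) powi k"
  have L: "0 < L" by (simp add: L_def)
  define \<sigma> where "\<sigma> j = (2::real) powi (- j - int r)" for j
  have \<sigma>: "0 < \<sigma> j" for j by (simp add: \<sigma>_def)
  define \<eta> where "\<eta> j = \<sigma> j / L" for j
  have \<eta>: "0 < \<eta> j" for j using \<sigma> L by (simp add: \<eta>_def)
  have L\<sigma>: "\<exists>l :: int. L = of_int l * \<sigma> j" if "- k \<le> j" for j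
  proof -
    have "L = 2 powi (k + j + int r) * \<sigma> j" by (simp add: L_def \<sigma>_def flip: power_int_add)
    also have "(2::real) powi (k + j + int r) = 2 ^ nat (k + j + int r)" using that by (simp add: power_int_def)
    finally have "L = of_int (2 ^ nat (k + j + int r)) * \<sigma> j" by simp
    then show ?thesis by blast
  qed
  have r4: "4 \<le> (2::real) ^ r"
  proof -
    have "1 \<le> real DIM('a)" by (simp add: DIM_positive Suc_leI)
    then show ?thesis using r by linarith
  qed
  have total: "(\<Sum>j\<in>{-k..n}. \<theta> j / 2 + \<eta> j) \<le> 1"
  proof -
    have "(\<Sum>j\<in>{-k..n}. \<eta> j) = (\<Sum>j\<in>{-k..n}. 2 powi (- j)) / (2 ^ r * L)"
      unfolding sum_divide_distrib by (intro sum.cong) (auto simp: \<eta>_def \<sigma>_def power_int_diff)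
    also have "\<dots> \<le> 2 * 2 powi k / (2 ^ r * L)"
      using sum_scales_le[of "- k" n] L by (intro divide_right_mono) auto
    also have "\<dots> = 2 / 2 ^ r" by (simp add: L_def)
    also have "\<dots> \<le> 1 / 2" using r4 by (simp add: field_simps)
    finally show ?thesis using \<theta>(2) by (simp add: sum.distrib sum_divide_distrib[symmetric])
  qed
  obtain p :: "int \<Rightarrow> real" where p: "p (- k) = 0" "mono_on {- k..n + 1} p" "p (n + 1) \<le> 1"
    "\<And>j. - k \<le> j \<Longrightarrow> j \<le> n \<Longrightarrow> \<theta> j / 2 \<le> p (j + 1) - p j"
    "\<And>j. - k \<le> j \<Longrightarrow> j \<le> n \<Longrightarrow> \<exists>a b :: int. p j = of_int a * \<eta> j \<and> p (j + 1) = of_int b * \<eta> j"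
  proof (rule aligned_intervals[of "- k" n \<eta> "\<lambda>j. \<theta> j / 2"])
    show "\<exists>l :: int. \<eta> j = of_int l * \<eta> (j + 1)" for j
    proof (intro exI[of _ 2])
      have "\<sigma> j = 2 * \<sigma> (j + 1)" by (simp add: \<sigma>_def power_int_diff)
      then show "\<eta> j = of_int 2 * \<eta> (j + 1)" by (simp add: \<eta>_def)
    qed
  qed (use \<eta> \<theta> total in auto)
  have p01: "0 \<le> p j" "p j \<le> 1" if "- k \<le> j" "j \<le> n + 1" for j
    using mono_onD[OF p(2), of "- k" j] mono_onD[OF p(2), of j "n + 1"] that p(1,3) by auto
  define lo where "lo j b = (if b = b0 then L * (1 + p j) else 0)" for j and b :: 'a
  define hi where "hi j b = (if b = b0 then L * (1 + p (j + 1)) else L)" for j and b :: 'a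
  define S where "S j = half_open (lo j) (hi j)" for j
  have S_sub: "S j \<subseteq> region k" if "- k \<le> j" "j \<le> n" for j
  proof
    fix x assume x: "x \<in> S j"
    have 1: "L \<le> L * (1 + p j)" using p01[of j] that L by (simp add: distrib_left)
    have "L * (1 + p (j + 1)) \<le> L * 2" using p01[of "j + 1"] that L by (intro mult_left_mono) auto
    then have 2: "L * (1 + p (j + 1)) \<le> 2 * L" by simp
    show "x \<in> region k"
      unfolding region_def Let_def b0_def[symmetric] half_open_def
    proof (intro CollectI ballI)
      fix b :: 'a assume "b \<in> Basis"
      then have "lo j b \<le> x \<bullet> b" "x \<bullet> b < hi j b" using x by (auto simp: S_def half_open_def)
      then show "(if b = b0 then 2 powi k else 0) \<le> x \<bullet> b \<and> x \<bullet> b < (if b = b0 then 2 * 2 powi k else 2 powi k)"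
        using 1 2 by (auto simp: lo_def hi_def L_def[symmetric])
    qed
  qed
  have region_sub: "region k \<subseteq> \<Omega>" using region_norm ball by fastforce
  have aligned: "\<exists>A B :: 'a \<Rightarrow> int. \<forall>b. lo j b = \<sigma> j * of_int (A b) \<and> hi j b = \<sigma> j * of_int (B b)"
    if j: "- k \<le> j" "j \<le> n" for j
  proof -
    obtain l :: int where l: "L = of_int l * \<sigma> j" using L\<sigma>[OF j(1)] by auto
    obtain m m' :: int where m: "p j = of_int m * \<eta> j" "p (j + 1) = of_int m' * \<eta> j" using p(5)[OF j] by blast
    have L\<eta>: "L * (of_int i * \<eta> j) = \<sigma> j * of_int i" for i :: int using L by (simp add: \<eta>_def)
    have "L * (1 + p j) = \<sigma> j * of_int (l + m)" "L * (1 + p (j + 1)) = \<sigma> j * of_int (l + m')"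
      unfolding m distrib_left L\<eta> using l by (simp_all add: distrib_left mult.commute)
    then show ?thesis
      using l by (intro exI[of _ "\<lambda>b. if b = b0 then l + m else 0"] exI[of _ "\<lambda>b. if b = b0 then l + m' else l"])
        (auto simp: lo_def hi_def mult.commute)
  qed
  define g where "g j x = (\<lambda>b\<in>Basis. \<lfloor>x \<bullet> b / \<sigma> j\<rfloor>)" for j and x :: 'a
  have g_eq: "g j x = g j x' \<longleftrightarrow> (\<forall>b\<in>Basis. \<lfloor>x \<bullet> b / \<sigma> j\<rfloor> = \<lfloor>x' \<bullet> b / \<sigma> j\<rfloor>)" for j x x'
    unfolding g_def by (metis (no_types, lifting) restrict_apply' restrict_ext)
  have cell_eq: "{x' \<in> S j. g j x' = g j x} = half_open (\<lambda>b. \<sigma> j * of_int \<lfloor>x \<bullet> b / \<sigma> j\<rfloor>) (\<lambda>b. \<sigma> j * (of_int \<lfloor>x \<bullet> b / \<sigma> j\<rfloor> + 1))"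
    if j: "- k \<le> j" "j \<le> n" and x: "x \<in> S j" for j x
  proof -
    obtain A B :: "'a \<Rightarrow> int" where "\<forall>b. lo j b = \<sigma> j * of_int (A b) \<and> hi j b = \<sigma> j * of_int (B b)"
      using aligned[OF j] by blast
    then show ?thesis using grid_cell[OF \<sigma>[of j], of "lo j" A "hi j" B x] x by (simp add: S_def g_eq)
  qed
  obtain \<Q> where \<Q>: "finite \<Q>" "disjoint \<Q>" "\<And>Q. Q \<in> \<Q> \<Longrightarrow> Q \<in> sets D \<and> (\<exists>j\<in>{- k..n}. Q \<subseteq> S j)"
    and main: "\<And>j u. j \<in> {- k..n} \<Longrightarrow> u \<in> borel_measurable D \<Longrightarrow> (\<And>x. cmod (u x) = 1) \<Longrightarrow>
      (\<And>x x'. x \<in> S j \<Longrightarrow> x' \<in> S j \<Longrightarrow> g j x = g j x' \<Longrightarrow> cmod (u x - u x') \<le> 1 / 2) \<Longrightarrow>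
      a * \<sigma> j ^ DIM('a) / 4 * measure D (S j) \<le> (\<Sum>Q\<in>\<Q>. (cmod (\<integral>x. indicator Q x * u x \<partial>D))\<^sup>2)"
  proof (rule cells_from_slabs[of "{- k..n}" S g D "\<lambda>j. a * \<sigma> j ^ DIM('a)"])
    show "disjoint_family_on S {- k..n}"
      unfolding disjoint_family_on_def
    proof (intro ballI impI)
      have *: "S i \<inter> S j = {}" if ij: "i \<in> {- k..n}" "j \<in> {- k..n}" "i < j" for i j
      proof -
        have "p (i + 1) \<le> p j" using ij by (intro mono_onD[OF p(2)]) auto
        then have "L * (1 + p (i + 1)) \<le> L * (1 + p j)" using L by simp
        then show ?thesis using b0 unfolding S_def half_open_def lo_def hi_def by fastforce
      qed
      fix i j assume ij: "i \<in> {- k..n}" "j \<in> {- k..n}" "i \<noteq> j"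
      then consider "i < j" | "j < i" by linarith
      then show "S i \<inter> S j = {}" using *[OF ij(1,2)] *[OF ij(2,1)] by cases auto
    qed
    show "finite (g j ` S j)" if "j \<in> {- k..n}" for j
    proof (rule finite_subset)
      show "g j ` S j \<subseteq> PiE Basis (\<lambda>_. {0..\<lfloor>2 * L / \<sigma> j\<rfloor>})"
      proof (intro image_subsetI PiE_I)
        fix x b :: 'a assume x: "x \<in> S j" and b: "b \<in> Basis"
        have "0 \<le> lo j b" "hi j b \<le> 2 * L" using that p01[of j] p01[of "j + 1"] L by (auto simp: lo_def hi_def)
        then have "0 \<le> x \<bullet> b" "x \<bullet> b \<le> 2 * L" using x b by (auto simp: S_def half_open_def intro: order_trans less_imp_le)
        then have "0 \<le> x \<bullet> b / \<sigma> j" "x \<bullet> b / \<sigma> j \<le> 2 * L / \<sigma> j" using \<sigma>[of j] by (auto intro!: divide_right_mono simp: less_imp_le)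
        then have "0 \<le> \<lfloor>x \<bullet> b / \<sigma> j\<rfloor>" "\<lfloor>x \<bullet> b / \<sigma> j\<rfloor> \<le> \<lfloor>2 * L / \<sigma> j\<rfloor>" by (simp_all add: floor_mono)
        then show "g j x b \<in> {0..\<lfloor>2 * L / \<sigma> j\<rfloor>}" using b by (simp add: g_def)
      qed (simp add: g_def)
    qed (auto intro: finite_PiE)
    show "{x' \<in> S j. g j x' = g j x} \<in> sets D \<and> emeasure D {x' \<in> S j. g j x' = g j x} < \<infinity> \<and>
        a * \<sigma> j ^ DIM('a) \<le> measure D {x' \<in> S j. g j x' = g j x}"
      if j: "j \<in> {- k..n}" and x: "x \<in> S j" for j x
    proof -
      let ?c = "{x' \<in> S j. g j x' = g j x}"
      have ce: "?c = half_open (\<lambda>b. \<sigma> j * of_int \<lfloor>x \<bullet> b / \<sigma> j\<rfloor>) (\<lambda>b. \<sigma> j * (of_int \<lfloor>x \<bullet> b / \<sigma> j\<rfloor> + 1))"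
        using j x by (intro cell_eq) auto
      have sub: "?c \<subseteq> \<Omega>" using S_sub[of j] region_sub j by auto
      have bor: "?c \<in> sets borel" unfolding ce by (rule half_open_borel)
      have "emeasure lborel ?c = ennreal (\<sigma> j ^ DIM('a))"
        unfolding ce using \<sigma>[of j] by (subst emeasure_half_open) (auto simp: algebra_simps)
      then have "emeasure D ?c = ennreal (a * \<sigma> j ^ DIM('a))"
        using emeasure_chart[OF bor sub] a \<sigma>[of j] by (simp add: ennreal_mult)
      then show ?thesis using sets_chart[OF bor sub] a \<sigma>[of j] by (simp add: measure_def)
    qed
  qed (use a \<sigma> in \<open>auto simp: less_imp_le\<close>)
  have "a\<^sup>2 / 8 * (1 / 2 ^ r) ^ DIM('a) * (2 ^ DIM('a)) powi (k - j) * \<theta> j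
        \<le> (\<Sum>Q\<in>\<Q>. (cmod (\<integral>x. indicator Q x * cis (- 2 * pi * (x \<bullet> \<xi>)) \<partial>D))\<^sup>2)"
    if j: "- k \<le> j \<and> j \<le> n" and \<xi>: "norm \<xi> \<le> 2 powi (j + 1)" for j \<xi>
  proof -
    have d1: "L * (1 + p (j + 1)) - L * (1 + p j) = L * (p (j + 1) - p j)" by (simp add: algebra_simps)
    have pj: "0 \<le> p (j + 1) - p j" using p(4)[of j] \<theta>(1)[of j] j by auto
    have le: "lo j b \<le> hi j b" if "b \<in> Basis" for b using L pj by (auto simp: lo_def hi_def)
    have "emeasure lborel (S j) = ennreal (\<Prod>b\<in>Basis. hi j b - lo j b)"
      unfolding S_def by (rule emeasure_half_open[OF le])
    also have "(\<Prod>b\<in>Basis. hi j b - lo j b) = (hi j b0 - lo j b0) * (\<Prod>b\<in>Basis - {b0}. hi j b - lo j b)"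
      using b0 by (intro prod.remove) auto
    also have "(\<Prod>b\<in>Basis - {b0}. hi j b - lo j b) = (\<Prod>b\<in>Basis - {b0}. L)"
      by (intro prod.cong) (auto simp: hi_def lo_def)
    also have "(hi j b0 - lo j b0) * (\<Prod>b\<in>Basis - {b0}. L) = (p (j + 1) - p j) * (L * L ^ (DIM('a) - 1))"
      using b0 by (simp add: hi_def lo_def d1)
    also have "L * L ^ (DIM('a) - 1) = L ^ DIM('a)" using DIM_positive[where 'a='a] by (simp add: power_eq_if)
    finally have em: "emeasure lborel (S j) = ennreal ((p (j + 1) - p j) * L ^ DIM('a))" .
    have "S j \<in> sets borel" "S j \<subseteq> \<Omega>" using S_sub[of j] region_sub j by (auto simp: S_def)
    then have "emeasure D (S j) = ennreal (a * ((p (j + 1) - p j) * L ^ DIM('a)))"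
      using emeasure_chart[of "S j"] a em pj L by (simp add: ennreal_mult)
    then have mS: "measure D (S j) = a * ((p (j + 1) - p j) * L ^ DIM('a))"
      using a pj L by (simp add: measure_def)
    have "a\<^sup>2 / 8 * (1 / 2 ^ r) ^ DIM('a) * (2 ^ DIM('a)) powi (k - j) * \<theta> j
        = a * \<sigma> j ^ DIM('a) / 4 * (a * (\<theta> j / 2 * L ^ DIM('a)))"
    proof -
      have "(1 / 2 ^ r) ^ DIM('a) * (2 ^ DIM('a)) powi (k - j) = (\<sigma> j * L) ^ DIM('a)"
        unfolding power_power_int power_mult_distrib[symmetric]
        by (intro arg_cong[where f = "\<lambda>x. x ^ DIM('a)"]) (simp add: \<sigma>_def L_def power_int_diff power_int_minus field_simps)
      then show ?thesis by (simp add: power_mult_distrib power2_eq_square)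
    qed
    also have "\<dots> \<le> a * \<sigma> j ^ DIM('a) / 4 * (a * ((p (j + 1) - p j) * L ^ DIM('a)))"
      using a \<sigma>[of j] L p(4)[of j] j by (intro mult_left_mono mult_right_mono) auto
    also have "\<dots> \<le> (\<Sum>Q\<in>\<Q>. (cmod (\<integral>x. indicator Q x * cis (- 2 * pi * (x \<bullet> \<xi>)) \<partial>D))\<^sup>2)"
      unfolding mS[symmetric]
    proof (rule main)
      show "(\<lambda>x. cis (- 2 * pi * (x \<bullet> \<xi>))) \<in> borel_measurable D"
        unfolding cis_conv_exp using id_measurable by measurable
      fix x x' assume xx: "x \<in> S j" "x' \<in> S j" "g j x = g j x'"
      have small: "16 * DIM('a) * \<sigma> j * 2 powi (j + 1) \<le> 1"
      proof -
        have "\<sigma> j * 2 powi (j + 1) = 2 / 2 ^ r"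
          by (simp add: \<sigma>_def power_int_diff power_int_minus power_int_add field_simps)
        then have "16 * DIM('a) * \<sigma> j * 2 powi (j + 1) = 16 * DIM('a) * (2 / 2 ^ r)" by (simp only: mult.assoc)
        then show ?thesis using r by (simp add: divide_le_eq_1)
      qed
      show "cmod (cis (- 2 * pi * (x \<bullet> \<xi>)) - cis (- 2 * pi * (x' \<bullet> \<xi>))) \<le> 1 / 2"
      proof (rule phase_near[OF _ \<xi> small])
        fix b :: 'a assume b: "b \<in> Basis"
        have "\<lfloor>x \<bullet> b / \<sigma> j\<rfloor> = \<lfloor>x' \<bullet> b / \<sigma> j\<rfloor>" using xx(3) b by (simp add: g_eq)
        then have "\<bar>x \<bullet> b / \<sigma> j - x' \<bullet> b / \<sigma> j\<bar> \<le> 1" by linarith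
        then have "\<bar>(x - x') \<bullet> b\<bar> / \<sigma> j \<le> 1"
          using \<sigma>[of j] by (simp add: inner_diff_left diff_divide_distrib[symmetric] abs_divide)
        then show "\<bar>(x - x') \<bullet> b\<bar> \<le> \<sigma> j" using \<sigma>[of j] by (simp add: divide_le_eq_1)
      qed
    qed (use j in auto)
    finally show ?thesis .
  qed
  moreover have "Q \<in> sets D \<and> Q \<subseteq> region k" if "Q \<in> \<Q>" for Q
    using \<Q>(3)[OF that] S_sub by fastforce
  ultimately show ?thesis using \<Q>(1,2) by blast
qed

end

section \<open>Fourier pairs on Euclidean space and on the torus\<close>

lemma chart_space: "euclidean_chart (space_leb :: (real ^ 'n) measure) UNIV (1 / measure lborel (ball (0 :: real ^ 'n) 1))"
proof -
  let ?V = "measure lborel (ball (0 :: real ^ 'n) 1)" and ?M = "space_leb :: (real ^ 'n) measure"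
  note V = unit_ball_measure(1)[where 'n = 'n]
  have st: "sets ?M = sets lebesgue" by (simp add: space_leb_def)
  show ?thesis
  proof
    show "0 < 1 / ?V" using V by simp
    show "(\<lambda>x. x) \<in> ?M \<rightarrow>\<^sub>M borel"
      by (subst measurable_cong_sets[OF st refl], rule measurable_completion) simp
    fix A :: "(real ^ 'n) set" assume A: "A \<in> sets borel"
    then show "A \<in> sets ?M" unfolding st by (intro sets_completionI_sets) simp
    show "emeasure ?M A = ennreal (1 / ?V) * emeasure lborel A"
      unfolding emeasure_space_leb using A by simp
  next
    fix f :: "real ^ 'n \<Rightarrow> complex" assume f: "f \<in> borel_measurable borel"
    have fl: "f \<in> borel_measurable lebesgue" using f by (intro measurable_completion) simp
    have "?M = density lebesgue (\<lambda>_. ennreal (1 / ?V))"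
    proof (rule measure_eqI)
      fix A assume "A \<in> sets ?M"
      then show "emeasure ?M A = emeasure (density lebesgue (\<lambda>_. ennreal (1 / ?V))) A"
        unfolding emeasure_space_leb st by (subst emeasure_density_const) auto
    qed (simp add: st)
    then have "(\<integral>x. f x \<partial>?M) = (\<integral>x. f x \<partial>density lebesgue (\<lambda>_. ennreal (1 / ?V)))" by simp
    also have "\<dots> = (\<integral>x. (1 / ?V) *\<^sub>R f x \<partial>lebesgue)"
      using V fl by (subst integral_density) auto
    also have "\<dots> = (1 / ?V) *\<^sub>R (\<integral>x. f x \<partial>lebesgue)" by (rule Bochner_Integration.integral_scaleR_right)
    also have "(\<integral>x. f x \<partial>lebesgue) = (\<integral>x. f x \<partial>lborel)" using f by (intro integral_completion) simp
    finally show "(\<integral>x. f x \<partial>?M) = (1 / ?V) *\<^sub>R (\<integral>x. f x \<partial>lborel)" .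
  qed
qed

lemma torus_id_measurable: "(\<lambda>x. x) \<in> torus_leb \<rightarrow>\<^sub>M borel"
  unfolding torus_leb_def by (intro measurable_restrict_space1 measurable_completion) simp

lemma chart_torus: "euclidean_chart torus_leb {-1/2..1/2} 1"
proof
  show "(\<lambda>x. x) \<in> torus_leb \<rightarrow>\<^sub>M borel" by (rule torus_id_measurable)
  fix A :: "real set" assume A: "A \<in> sets borel" "A \<subseteq> {-1/2..1/2}"
  have "A \<in> sets lebesgue" using A(1) by (intro sets_completionI_sets) simp
  then show "A \<in> sets torus_leb"
    unfolding torus_leb_def using A(2) by (subst sets_restrict_space_iff) auto
  show "emeasure torus_leb A = ennreal 1 * emeasure lborel A"
    using A unfolding torus_leb_def by (subst emeasure_restrict_space) auto
next
  fix f :: "real \<Rightarrow> complex" assume f: "f \<in> borel_measurable borel" and z: "\<And>x. x \<notin> {-1/2..1/2} \<Longrightarrow> f x = 0"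
  have "(\<integral>x. f x \<partial>torus_leb) = (\<integral>x. indicator {-1/2..1/2} x *\<^sub>R f x \<partial>lebesgue)"
    unfolding torus_leb_def by (rule integral_restrict_space) simp
  also have "\<dots> = (\<integral>x. f x \<partial>lebesgue)"
    using z by (intro Bochner_Integration.integral_cong refl) (metis indicator_simps scaleR_one scaleR_zero_right)
  also have "\<dots> = (\<integral>x. f x \<partial>lborel)" using f by (intro integral_completion) simp
  finally show "(\<integral>x. f x \<partial>torus_leb) = 1 *\<^sub>R (\<integral>x. f x \<partial>lborel)" by simp
qed simp

lemma floor_log2_bounds:
  assumes "0 < x"
  shows "(2::real) powi \<lfloor>log 2 x\<rfloor> \<le> x" "x < 2 powi (\<lfloor>log 2 x\<rfloor> + 1)"
proof -
  have p: "(2::real) powi z = 2 powr of_int z" for z by (simp add: powr_real_of_int')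
  have "of_int \<lfloor>log 2 x\<rfloor> \<le> log 2 x" "log 2 x < of_int (\<lfloor>log 2 x\<rfloor> + 1)" by linarith+
  then show "(2::real) powi \<lfloor>log 2 x\<rfloor> \<le> x" "x < 2 powi (\<lfloor>log 2 x\<rfloor> + 1)"
    unfolding p using assms by (simp_all only: le_log_iff log_less_iff one_less_numeral_iff semiring_norm)
qed

lemma fourier_pair_space:
  obtains lam c \<kappa> E' C where "fourier_pair (space_leb :: (real ^ 'n) measure) space_pos (space_leb :: (real ^ 'n) measure) space_pos
    (\<lambda>x \<xi>. cis (- 2 * pi * (x \<bullet> \<xi>))) (2 ^ CARD('n)) lam c \<kappa> E' C"
proof -
  let ?M = "space_leb :: (real ^ 'n) measure" and ?d = "CARD('n)"
  let ?a = "1 / measure lborel (ball (0 :: real ^ 'n) 1)"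
  interpret ch: euclidean_chart ?M UNIV ?a by (rule chart_space)
  obtain r where "32 * real ?d < 2 ^ r" using real_arch_pow[of 2] by auto
  then have r: "32 * DIM(real ^ 'n) \<le> (2::real) ^ r" by simp
  define c where "c = min (?a / 4) (?a\<^sup>2 / 8) * (1 / 2 ^ r) ^ ?d"
  have c: "0 < c" "c \<le> ?a / 4 * (1 / 2 ^ r) ^ ?d" "c \<le> ?a\<^sup>2 / 8 * (1 / 2 ^ r) ^ ?d"
  proof -
    show "0 < c" unfolding c_def using ch.a by (intro mult_pos_pos) auto
    show "c \<le> ?a / 4 * (1 / 2 ^ r) ^ ?d" "c \<le> ?a\<^sup>2 / 8 * (1 / 2 ^ r) ^ ?d"
      unfolding c_def by (rule mult_right_mono, simp_all)+
  qed
  define lam where "lam = (2 * real ?d) ^ ?d"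
  define \<kappa> where "\<kappa> \<xi> = \<lfloor>log 2 (norm \<xi>)\<rfloor>" for \<xi> :: "real ^ 'n"
  have ball: "space_pos x \<le> lam * (2 ^ ?d) powi k" if "norm x \<le> 2 * DIM(real ^ 'n) * 2 powi k" for x :: "real ^ 'n" and k
  proof -
    have "space_pos x \<le> (2 * real ?d * 2 powi k) ^ ?d" unfolding space_pos_def using that by (intro power_mono) auto
    then show ?thesis by (simp add: lam_def power_power_int power_mult_distrib)
  qed
  have idm [measurable]: "(\<lambda>x. x) \<in> ?M \<rightarrow>\<^sub>M borel" by (rule ch.id_measurable)
  have "fourier_pair ?M space_pos ?M space_pos (\<lambda>x \<xi>. cis (- 2 * pi * (x \<bullet> \<xi>))) (2 ^ ?d) lam c \<kappa> (- {0}) ch.region"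
  proof (intro fourier_pair.intro fourier_pair_axioms.intro rearr_space_space)
    show "(1::real) < 2 ^ ?d" by (rule one_less_power) auto
    show "0 < lam" by (simp add: lam_def)
    show "0 < c" by (rule c)
    show "(\<lambda>(y, x). cis (- 2 * pi * (x \<bullet> y))) \<in> borel_measurable (?M \<Otimes>\<^sub>M ?M)"
    proof -
      have [measurable]: "fst \<in> ?M \<Otimes>\<^sub>M ?M \<rightarrow>\<^sub>M borel" "snd \<in> ?M \<Otimes>\<^sub>M ?M \<rightarrow>\<^sub>M borel"
        using measurable_compose[OF measurable_fst idm] measurable_compose[OF measurable_snd idm] by simp_all
      show ?thesis unfolding cis_conv_exp split_def by measurable
    qed
    show "cmod (cis (- 2 * pi * (x \<bullet> y))) \<le> 1" for x y :: "real ^ 'n" by simp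
    show "\<kappa> \<in> ?M \<rightarrow>\<^sub>M count_space UNIV" unfolding \<kappa>_def using idm by measurable
    have "{0} \<in> null_sets ?M"
      by (intro null_setsI) (auto simp: ch.emeasure_chart ch.sets_chart)
    then have "AE y in ?M. y \<notin> {0}" by (rule AE_not_in)
    then show "AE y in ?M. y \<in> - {0}" by simp
    show "emeasure ?M S \<le> ennreal (space_pos y)" if "y \<in> - {0}" "emeasure ?M S \<le> ennreal ((2 ^ ?d) powi \<kappa> y)" for y S
    proof -
      have "(2 powi \<kappa> y) ^ ?d \<le> norm y ^ ?d"
        using floor_log2_bounds(1)[of "norm y"] that(1) by (intro power_mono) (auto simp: \<kappa>_def)
      then show ?thesis using that(2) by (auto simp: space_pos_def power_power_int intro: order_trans ennreal_leI)
    qed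
    have ny: "norm y \<le> 2 powi (\<kappa> y + 1)" if "y \<in> - {0}" for y :: "real ^ 'n"
      using floor_log2_bounds(2)[of "norm y"] that by (simp add: \<kappa>_def less_imp_le)
    show "\<exists>\<phi>. \<phi> \<in> borel_measurable ?M \<and> (\<forall>x. 0 \<le> \<phi> x \<and> \<phi> x \<le> 1 \<and> (\<phi> x \<noteq> 0 \<longrightarrow> space_pos x \<le> lam * (2 ^ ?d) powi k)) \<and>
        (\<forall>y\<in>- {0}. \<exists>s\<ge>0. (\<integral>x. complex_of_real (\<phi> x) * cis (- 2 * pi * (x \<bullet> y)) \<partial>?M) = complex_of_real s \<and>
          (k < - \<kappa> y \<longrightarrow> c * (2 ^ ?d) powi k \<le> s))" for k
    proof -
      obtain \<phi> where \<phi>: "\<phi> \<in> borel_measurable ?M"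
        "\<forall>x. 0 \<le> \<phi> x \<and> \<phi> x \<le> 1 \<and> (\<phi> x \<noteq> 0 \<longrightarrow> norm x \<le> 2 * DIM(real ^ 'n) * 2 powi k)"
        "\<forall>\<xi>. \<exists>s\<ge>0. (\<integral>x. complex_of_real (\<phi> x) * cis (- 2 * pi * (x \<bullet> \<xi>)) \<partial>?M) = complex_of_real s \<and>
          (\<forall>j. k < - j \<longrightarrow> norm \<xi> \<le> 2 powi (j + 1) \<longrightarrow> ?a / 4 * (1 / 2 ^ r) ^ DIM(real ^ 'n) * (2 ^ DIM(real ^ 'n)) powi k \<le> s)"
        using ch.euclidean_bump[OF r, of k] by auto
      have "\<exists>s\<ge>0. (\<integral>x. complex_of_real (\<phi> x) * cis (- 2 * pi * (x \<bullet> y)) \<partial>?M) = complex_of_real s \<and>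
          (k < - \<kappa> y \<longrightarrow> c * (2 ^ ?d) powi k \<le> s)" if y: "y \<in> - {0}" for y
      proof -
        obtain s where s: "0 \<le> s" "(\<integral>x. complex_of_real (\<phi> x) * cis (- 2 * pi * (x \<bullet> y)) \<partial>?M) = complex_of_real s"
          "\<forall>j. k < - j \<longrightarrow> norm y \<le> 2 powi (j + 1) \<longrightarrow> ?a / 4 * (1 / 2 ^ r) ^ DIM(real ^ 'n) * (2 ^ DIM(real ^ 'n)) powi k \<le> s"
          using \<phi>(3) by blast
        have "c * (2 ^ ?d) powi k \<le> s" if "k < - \<kappa> y"
        proof -
          have "c * (2 ^ ?d) powi k \<le> ?a / 4 * (1 / 2 ^ r) ^ ?d * (2 ^ ?d) powi k"
            using c(2) by (intro mult_right_mono) auto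
          also have "\<dots> \<le> s" using s(3) that ny[OF y] by simp
          finally show ?thesis .
        qed
        then show ?thesis using s by blast
      qed
      then show ?thesis using \<phi>(1,2) ball by blast
    qed
    show "ch.region k \<subseteq> {x. space_pos x \<le> lam * (2 ^ ?d) powi k}" for k
      using ch.region_norm ball by blast
    show "ch.region k \<inter> ch.region k' = {}" if "k \<noteq> k'" for k k' using that by (rule ch.region_disjoint)
    show "\<exists>\<Q>. finite \<Q> \<and> disjoint \<Q> \<and> (\<forall>Q\<in>\<Q>. Q \<in> sets ?M \<and> Q \<subseteq> ch.region k) \<and>
        (\<forall>y\<in>- {0}. - k \<le> \<kappa> y \<and> \<kappa> y \<le> n \<longrightarrow> c * (2 ^ ?d) powi (k - \<kappa> y) * \<theta> (\<kappa> y)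
          \<le> (\<Sum>Q\<in>\<Q>. (cmod (\<integral>x. indicator Q x * cis (- 2 * pi * (x \<bullet> y)) \<partial>?M))\<^sup>2))"
      if \<theta>: "\<And>j. 0 \<le> \<theta> j" "(\<Sum>j\<in>{- k..n}. \<theta> j) \<le> 1" for k n and \<theta> :: "int \<Rightarrow> real"
    proof -
      obtain \<Q> where \<Q>: "finite \<Q>" "disjoint \<Q>" "\<forall>Q\<in>\<Q>. Q \<in> sets ?M \<and> Q \<subseteq> ch.region k"
        "\<forall>j \<xi>. - k \<le> j \<and> j \<le> n \<longrightarrow> norm \<xi> \<le> 2 powi (j + 1) \<longrightarrow>
          ?a\<^sup>2 / 8 * (1 / 2 ^ r) ^ DIM(real ^ 'n) * (2 ^ DIM(real ^ 'n)) powi (k - j) * \<theta> j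
          \<le> (\<Sum>Q\<in>\<Q>. (cmod (\<integral>x. indicator Q x * cis (- 2 * pi * (x \<bullet> \<xi>)) \<partial>?M))\<^sup>2)"
        using ch.euclidean_cells[where k = k and n = n, OF r _ \<theta>] by auto
      have "c * (2 ^ ?d) powi (k - \<kappa> y) * \<theta> (\<kappa> y) \<le> (\<Sum>Q\<in>\<Q>. (cmod (\<integral>x. indicator Q x * cis (- 2 * pi * (x \<bullet> y)) \<partial>?M))\<^sup>2)"
        if y: "y \<in> - {0}" "- k \<le> \<kappa> y \<and> \<kappa> y \<le> n" for y
      proof -
        have "c * (2 ^ ?d) powi (k - \<kappa> y) * \<theta> (\<kappa> y) \<le> ?a\<^sup>2 / 8 * (1 / 2 ^ r) ^ ?d * (2 ^ ?d) powi (k - \<kappa> y) * \<theta> (\<kappa> y)"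
          using c(3) \<theta>(1) by (intro mult_right_mono) auto
        also have "\<dots> \<le> (\<Sum>Q\<in>\<Q>. (cmod (\<integral>x. indicator Q x * cis (- 2 * pi * (x \<bullet> y)) \<partial>?M))\<^sup>2)"
          using \<Q>(4)[rule_format, OF y(2) ny[OF y(1)]] by simp
        finally show ?thesis .
      qed
      then show ?thesis using \<Q>(1,2,3) by blast
    qed
  qed
  then show thesis by (rule that)
qed

text \<open>The frequency zero is an atom of unit measure and is assigned the scale \<open>-1\<close>: the rearrangement of a sequence is
  constant on the interval from zero to one.\<close>

lemma fourier_pair_torus:
  obtains lam c \<kappa> E' C where "fourier_pair torus_leb torus_pos int_count int_pos
    (\<lambda>x n. cis (- 2 * pi * real_of_int n * x)) 2 lam c \<kappa> E' C"
proof -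
  interpret ch: euclidean_chart torus_leb "{-1/2..1/2}" 1 by (rule chart_torus)
  have r: "32 * DIM(real) \<le> (2::real) ^ 5" by simp
  define c where "c = (1/8) * (1 / 2 ^ 5 :: real)"
  define \<kappa> where "\<kappa> n = (if n = 0 then - 1 else \<lfloor>log 2 (int_pos n)\<rfloor>)" for n :: int
  have ball: "torus_pos x \<le> 4 * 2 powi k" if "norm x \<le> 2 * DIM(real) * 2 powi k" for x and k
    using that by (simp add: torus_pos_def)
  have sp: "emeasure torus_leb (space torus_leb) = 1"
    using ch.emeasure_chart[of "{-1/2..1/2}"] by (simp add: torus_leb_def)
  have sub: "cball 0 (2 * DIM(real) * 2 powi k) \<subseteq> {-1/2..1/2 :: real}" if "ennreal (4 * 2 powi k) < emeasure torus_leb (space torus_leb)" for k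
  proof -
    have "4 * (2::real) powi k < 1" using that unfolding sp by (simp add: ennreal_less_one_iff)
    then show ?thesis by (auto simp: dist_real_def)
  qed
  have ker: "cis (- 2 * pi * (x \<bullet> real_of_int n)) = cis (- 2 * pi * real_of_int n * x)" for x n
    by (simp add: ac_simps)
  have idm [measurable]: "(\<lambda>x. x) \<in> torus_leb \<rightarrow>\<^sub>M borel" by (rule ch.id_measurable)
  have pos1: "1 \<le> int_pos n" if "n \<noteq> 0" for n
  proof -
    have "1 \<le> n \<or> n \<le> - 1" using that by linarith
    then have "1 \<le> real_of_int n \<or> real_of_int n \<le> - 1" by auto
    then show ?thesis by (auto simp: int_pos_def)
  qed
  have ny: "norm (real_of_int n) \<le> 2 powi (\<kappa> n + 1)" for n
  proof (cases "n = 0")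
    case False
    have "\<bar>real_of_int n\<bar> \<le> int_pos n"
    proof -
      have "1 \<le> n \<or> n \<le> - 1" using False by linarith
      then have "1 \<le> real_of_int n \<or> real_of_int n \<le> - 1" by auto
      then show ?thesis by (auto simp: int_pos_def)
    qed
    also have "\<dots> \<le> 2 powi (\<kappa> n + 1)"
      using floor_log2_bounds(2)[of "int_pos n"] pos1[OF False] False by (simp add: \<kappa>_def less_imp_le)
    finally show ?thesis by simp
  qed (simp add: \<kappa>_def)
  have "fourier_pair torus_leb torus_pos int_count int_pos (\<lambda>x n. cis (- 2 * pi * real_of_int n * x)) 2 4 c \<kappa> UNIV ch.region"
  proof (intro fourier_pair.intro fourier_pair_axioms.intro rearr_space_torus rearr_space_int)
    show "0 < c" by (simp add: c_def)
    show "(\<lambda>(n, x). cis (- 2 * pi * real_of_int n * x)) \<in> borel_measurable (int_count \<Otimes>\<^sub>M torus_leb)"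
    proof -
      have [measurable]: "snd \<in> int_count \<Otimes>\<^sub>M torus_leb \<rightarrow>\<^sub>M borel"
        using measurable_compose[OF measurable_snd idm] by simp
      have "real_of_int \<in> int_count \<rightarrow>\<^sub>M borel" by (simp add: int_count_def)
      then have [measurable]: "(\<lambda>p. real_of_int (fst p)) \<in> int_count \<Otimes>\<^sub>M torus_leb \<rightarrow>\<^sub>M borel"
        by (rule measurable_compose[OF measurable_fst])
      show ?thesis unfolding cis_conv_exp split_def by measurable
    qed
    show "\<kappa> \<in> int_count \<rightarrow>\<^sub>M count_space UNIV" by (simp add: int_count_def)
    show "emeasure int_count S \<le> ennreal (int_pos n)" if S: "emeasure int_count S \<le> ennreal (2 powi \<kappa> n)" for n S
    proof (cases "n = 0")
      case True
      then have S2: "emeasure int_count S \<le> ennreal (1 / 2)" using S by (simp add: \<kappa>_def power_int_minus inverse_eq_divide)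
      then have "finite S" by (auto simp: int_count_def emeasure_count_space top_unique split: if_splits)
      then have "ennreal (real (card S)) \<le> ennreal (1 / 2)"
        using S2 by (simp add: int_count_def ennreal_of_nat_eq_real_of_nat del: ennreal_half ennreal_numeral)
      then have "real (card S) \<le> 1 / 2" by (subst (asm) ennreal_le_iff) auto
      then have "card S = 0" by linarith
      then show ?thesis using \<open>finite S\<close> by (simp add: int_count_def)
    next
      case False
      have "2 powi \<kappa> n \<le> int_pos n"
        using floor_log2_bounds(1)[of "int_pos n"] pos1[OF False] False by (simp add: \<kappa>_def)
      then show ?thesis using S by (auto intro: order_trans ennreal_leI)
    qed
    show "\<exists>\<phi>. \<phi> \<in> borel_measurable torus_leb \<and> (\<forall>x. 0 \<le> \<phi> x \<and> \<phi> x \<le> 1 \<and> (\<phi> x \<noteq> 0 \<longrightarrow> torus_pos x \<le> 4 * 2 powi k)) \<and>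
        (\<forall>n\<in>UNIV. \<exists>s\<ge>0. (\<integral>x. complex_of_real (\<phi> x) * cis (- 2 * pi * real_of_int n * x) \<partial>torus_leb) = complex_of_real s \<and>
          (k < - \<kappa> n \<longrightarrow> c * 2 powi k \<le> s))" if k: "ennreal (4 * 2 powi k) < emeasure torus_leb (space torus_leb)" for k
    proof -
      obtain \<phi> where \<phi>: "\<phi> \<in> borel_measurable torus_leb"
        "\<forall>x. 0 \<le> \<phi> x \<and> \<phi> x \<le> 1 \<and> (\<phi> x \<noteq> 0 \<longrightarrow> norm x \<le> 2 * DIM(real) * 2 powi k)"
        "\<forall>\<xi>. \<exists>s\<ge>0. (\<integral>x. complex_of_real (\<phi> x) * cis (- 2 * pi * (x \<bullet> \<xi>)) \<partial>torus_leb) = complex_of_real s \<and>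
          (\<forall>j. k < - j \<longrightarrow> norm \<xi> \<le> 2 powi (j + 1) \<longrightarrow> 1 / 4 * (1 / 2 ^ 5) ^ DIM(real) * (2 ^ DIM(real)) powi k \<le> s)"
        using ch.euclidean_bump[OF r sub[OF k]] by auto
      have "\<exists>s\<ge>0. (\<integral>x. complex_of_real (\<phi> x) * cis (- 2 * pi * real_of_int n * x) \<partial>torus_leb) = complex_of_real s \<and>
          (k < - \<kappa> n \<longrightarrow> c * 2 powi k \<le> s)" for n
      proof -
        obtain s where s: "0 \<le> s" "(\<integral>x. complex_of_real (\<phi> x) * cis (- 2 * pi * (x \<bullet> real_of_int n)) \<partial>torus_leb) = complex_of_real s"
          "\<forall>j. k < - j \<longrightarrow> norm (real_of_int n) \<le> 2 powi (j + 1) \<longrightarrow> 1 / 4 * (1 / 2 ^ 5) ^ DIM(real) * (2 ^ DIM(real)) powi k \<le> s"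
          using \<phi>(3) by blast
        have "c * 2 powi k \<le> s" if "k < - \<kappa> n"
        proof -
          have "c * 2 powi k \<le> 1 / 4 * (1 / 2 ^ 5) * 2 powi k" unfolding c_def by (intro mult_right_mono) auto
          also have "\<dots> \<le> s" using s(3)[rule_format, OF that ny] by simp
          finally show ?thesis .
        qed
        then show ?thesis using s(1,2) unfolding ker by blast
      qed
      then show ?thesis using \<phi>(1,2) ball by blast
    qed
    show "ch.region k \<subseteq> {x. torus_pos x \<le> 4 * 2 powi k}" for k
      using ch.region_norm ball by blast
    show "ch.region k \<inter> ch.region k' = {}" if "k \<noteq> k'" for k k' using that by (rule ch.region_disjoint)
    show "\<exists>\<Q>. finite \<Q> \<and> disjoint \<Q> \<and> (\<forall>Q\<in>\<Q>. Q \<in> sets torus_leb \<and> Q \<subseteq> ch.region k) \<and>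
        (\<forall>y\<in>UNIV. - k \<le> \<kappa> y \<and> \<kappa> y \<le> n \<longrightarrow> c * 2 powi (k - \<kappa> y) * \<theta> (\<kappa> y)
          \<le> (\<Sum>Q\<in>\<Q>. (cmod (\<integral>x. indicator Q x * cis (- 2 * pi * real_of_int y * x) \<partial>torus_leb))\<^sup>2))"
      if k: "ennreal (4 * 2 powi k) < emeasure torus_leb (space torus_leb)"
        and \<theta>: "\<And>j. 0 \<le> \<theta> j" "(\<Sum>j\<in>{- k..n}. \<theta> j) \<le> 1" for k n and \<theta> :: "int \<Rightarrow> real"
    proof -
      obtain \<Q> where \<Q>: "finite \<Q>" "disjoint \<Q>" "\<forall>Q\<in>\<Q>. Q \<in> sets torus_leb \<and> Q \<subseteq> ch.region k"
        "\<forall>j \<xi>. - k \<le> j \<and> j \<le> n \<longrightarrow> norm \<xi> \<le> 2 powi (j + 1) \<longrightarrow>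
          1\<^sup>2 / 8 * (1 / 2 ^ 5) ^ DIM(real) * (2 ^ DIM(real)) powi (k - j) * \<theta> j
          \<le> (\<Sum>Q\<in>\<Q>. (cmod (\<integral>x. indicator Q x * cis (- 2 * pi * (x \<bullet> \<xi>)) \<partial>torus_leb))\<^sup>2)"
        using ch.euclidean_cells[OF r sub[OF k] \<theta>] by auto
      have "c * 2 powi (k - \<kappa> y) * \<theta> (\<kappa> y) \<le> (\<Sum>Q\<in>\<Q>. (cmod (\<integral>x. indicator Q x * cis (- 2 * pi * real_of_int y * x) \<partial>torus_leb))\<^sup>2)"
        if y: "- k \<le> \<kappa> y \<and> \<kappa> y \<le> n" for y
        using \<Q>(4)[rule_format, OF y ny] unfolding ker c_def by simp
      then show ?thesis using \<Q>(1,2,3) by blast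
    qed
  qed auto
  then show thesis by (rule that)
qed

section \<open>The Fourier pair on the integers\<close>

definition int_region :: "int \<Rightarrow> int set" where
  "int_region k = (if k < 0 then {} else {2 ^ nat (k + 2)..<2 ^ nat (k + 3)})"

lemma int_char_near:
  fixes m m' :: int and x :: real
  assumes "\<bar>m - m'\<bar> < 2 ^ l" "l = 0 \<or> 16 * 2 ^ l * \<bar>x\<bar> \<le> 1"
  shows "cmod (cis (2 * pi * real_of_int m * x) - cis (2 * pi * real_of_int m' * x)) \<le> 1 / 2"
proof (cases "l = 0")
  case True
  then show ?thesis using assms(1) by simp
next
  case False
  have "\<bar>real_of_int m - real_of_int m'\<bar> = real_of_int \<bar>m - m'\<bar>" by simp
  also have "\<dots> \<le> real_of_int (2 ^ l)" using assms(1) by (intro of_int_le_iff[THEN iffD2]) simp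
  finally have d: "\<bar>real_of_int m - real_of_int m'\<bar> \<le> 2 ^ l" by simp
  have "cmod (cis (2 * pi * real_of_int m * x) - cis (2 * pi * real_of_int m' * x)) \<le> \<bar>2 * pi * real_of_int m * x - 2 * pi * real_of_int m' * x\<bar>"
    by (rule cmod_cis_diff_le)
  also have "2 * pi * real_of_int m * x - 2 * pi * real_of_int m' * x = 2 * pi * ((real_of_int m - real_of_int m') * x)"
    by (simp add: algebra_simps)
  also have "\<bar>\<dots>\<bar> = 2 * pi * (\<bar>real_of_int m - real_of_int m'\<bar> * \<bar>x\<bar>)" by (simp add: abs_mult)
  also have "\<dots> \<le> 2 * 4 * (2 ^ l * \<bar>x\<bar>)" using pi_less_4 d by (intro mult_mono) auto
  also have "\<dots> \<le> 1 / 2" using assms(2) False by simp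
  finally show ?thesis .
qed

lemma int_count_facts:
  "sigma_finite_measure int_count" "(\<lambda>(t, x). t + x) \<in> int_count \<Otimes>\<^sub>M int_count \<rightarrow>\<^sub>M int_count"
  "distr int_count int_count (\<lambda>x. t + x) = int_count" "space int_count = UNIV"
  "finite A \<Longrightarrow> measure int_count A = real (card A)" "finite A \<Longrightarrow> emeasure int_count A < \<infinity>"
proof -
  show "sigma_finite_measure int_count" unfolding int_count_def by (rule sigma_finite_measure_count_space)
  show "(\<lambda>(t, x). t + x) \<in> int_count \<Otimes>\<^sub>M int_count \<rightarrow>\<^sub>M int_count"
    unfolding int_count_def by (subst pair_measure_countable) auto
  have "bij (\<lambda>x. t + x)" by (rule bij_plus)
  then show "distr int_count int_count (\<lambda>x. t + x) = int_count"
    unfolding int_count_def by (rule distr_bij_count_space)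
  show "space int_count = UNIV" by (simp add: int_count_def)
  show "measure int_count A = real (card A)" "emeasure int_count A < \<infinity>" if "finite A"
    using that by (simp_all add: int_count_def measure_count_space ennreal_of_nat_eq_real_of_nat)
qed

text \<open>At small scales the interval \<open>Q\<close> is a single point and the bump a unit mass at the origin, whose transform is constant.\<close>

lemma int_bump:
  shows "\<exists>\<phi>. \<phi> \<in> borel_measurable int_count \<and> (\<forall>m. 0 \<le> \<phi> m \<and> \<phi> m \<le> 1 \<and> (\<phi> m \<noteq> 0 \<longrightarrow> int_pos m \<le> 16 * 2 powi k)) \<and>
    (\<forall>x. \<exists>s\<ge>0. (\<integral>m. complex_of_real (\<phi> m) * cis (2 * pi * real_of_int m * x) \<partial>int_count) = complex_of_real s \<and>
      (\<forall>j. k < - j \<longrightarrow> \<bar>x\<bar> \<le> 2 powi j \<longrightarrow> 1 / 64 * 2 powi k \<le> s))"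
proof -
  \<comment> \<open>The conversion to a natural number cuts off at zero and so yields a single point when \<open>k < 4\<close>.\<close>
  define l where "l = nat (k - 4)"
  let ?Q = "{0..<2 ^ l} :: int set"
  have mQ: "measure int_count ?Q = 2 ^ l" by (subst int_count_facts(5)) auto
  obtain \<phi> where \<phi>: "\<phi> \<in> borel_measurable int_count" "\<And>x. 0 \<le> \<phi> x" "\<And>x. \<phi> x \<le> 1" "\<And>x. \<phi> x \<noteq> 0 \<Longrightarrow> \<exists>t\<in>?Q. t + x \<in> ?Q"
    and \<phi>ft: "\<And>ch. ch \<in> borel_measurable int_count \<Longrightarrow> (\<And>x. cmod (ch x) = 1) \<Longrightarrow> (\<And>t x. ch (t + x) = ch t * ch x) \<Longrightarrow>
      \<exists>s\<ge>0. (\<integral>x. complex_of_real (\<phi> x) * ch x \<partial>int_count) = complex_of_real s \<and>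
        ((\<forall>x\<in>?Q. \<forall>x'\<in>?Q. cmod (ch x - ch x') \<le> 1 / 2) \<longrightarrow> measure int_count ?Q / 4 \<le> s)"
    by (rule Fejer_bump[OF int_count_facts(1-4), of ?Q]) (use mQ in \<open>auto simp: int_count_def ennreal_of_nat_eq_real_of_nat\<close>)
  have lk: "2 powi k \<le> 16 * (2::real) ^ l" "l \<noteq> 0 \<Longrightarrow> 16 * (2::real) ^ l = 2 powi k"
  proof -
    show eq: "16 * (2::real) ^ l = 2 powi k" if "l \<noteq> 0"
    proof -
      have "k = int l + 4" using that by (simp add: l_def)
      then show ?thesis by (simp add: power_int_add)
    qed
    show "2 powi k \<le> 16 * (2::real) ^ l"
    proof (cases "l = 0")
      case True
      then have "k \<le> 4" by (simp add: l_def)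
      then have "(2::real) powi k \<le> 2 powi 4" by (intro power_int_increasing) auto
      then show ?thesis using True by simp
    qed (simp add: eq)
  qed
  have supp: "int_pos m \<le> 16 * 2 powi k" if nz: "\<phi> m \<noteq> 0" for m
  proof -
    obtain t where "t \<in> ?Q" "t + m \<in> ?Q" using \<phi>(4)[OF nz] by auto
    then have m: "\<bar>m\<bar> < 2 ^ l" by auto
    show ?thesis
    proof (cases "l = 0")
      case True
      then show ?thesis using m by (simp add: int_pos_def)
    next
      case False
      have "real_of_int \<bar>m\<bar> \<le> real_of_int (2 ^ l)" using m by (intro of_int_le_iff[THEN iffD2]) simp
      then have "\<bar>real_of_int m\<bar> \<le> 2 ^ l" by simp
      moreover have "int_pos m \<le> 2 * \<bar>real_of_int m\<bar>" by (auto simp: int_pos_def)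
      moreover have "2 * (2::real) ^ l \<le> 16 * 2 powi k" unfolding lk(2)[OF False, symmetric] by simp
      ultimately show ?thesis by linarith
    qed
  qed
  have "\<exists>s\<ge>0. (\<integral>m. complex_of_real (\<phi> m) * cis (2 * pi * real_of_int m * x) \<partial>int_count) = complex_of_real s \<and>
      (\<forall>j. k < - j \<longrightarrow> \<bar>x\<bar> \<le> 2 powi j \<longrightarrow> 1 / 64 * 2 powi k \<le> s)" for x
  proof -
    let ?ch = "\<lambda>m. cis (2 * pi * real_of_int m * x)"
    have "\<exists>s\<ge>0. (\<integral>m. complex_of_real (\<phi> m) * ?ch m \<partial>int_count) = complex_of_real s \<and>
        ((\<forall>m\<in>?Q. \<forall>m'\<in>?Q. cmod (?ch m - ?ch m') \<le> 1 / 2) \<longrightarrow> measure int_count ?Q / 4 \<le> s)"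
      by (intro \<phi>ft) (auto simp: cis_mult int_count_def algebra_simps)
    then obtain s where s: "0 \<le> s" "(\<integral>m. complex_of_real (\<phi> m) * ?ch m \<partial>int_count) = complex_of_real s"
      "(\<forall>m\<in>?Q. \<forall>m'\<in>?Q. cmod (?ch m - ?ch m') \<le> 1 / 2) \<Longrightarrow> measure int_count ?Q / 4 \<le> s" by blast
    have "1 / 64 * 2 powi k \<le> s" if j: "k < - j" "\<bar>x\<bar> \<le> 2 powi j" for j
    proof -
      have "l = 0 \<or> 16 * 2 ^ l * \<bar>x\<bar> \<le> 1"
      proof (cases "l = 0")
        case False
        have "16 * 2 ^ l * \<bar>x\<bar> \<le> 2 powi k * 2 powi j" unfolding lk(2)[OF False] using j by (intro mult_left_mono) auto
        also have "\<dots> = (2::real) powi (k + j)" by (simp add: power_int_add)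
        also have "\<dots> \<le> 2 powi 0" using j by (intro power_int_increasing) auto
        finally show ?thesis by simp
      qed simp
      then have "\<forall>m\<in>?Q. \<forall>m'\<in>?Q. cmod (?ch m - ?ch m') \<le> 1 / 2"
        by (intro ballI int_char_near[of _ _ l]) auto
      from s(3)[OF this] show ?thesis using lk(1) unfolding mQ by simp
    qed
    then show ?thesis using s(1,2) by blast
  qed
  then show ?thesis using \<phi>(1,2,3) supp by blast
qed

lemma sum_int_scales_le:
  fixes k n :: int
  assumes "0 \<le> k" "n \<le> 0"
  shows "(\<Sum>j\<in>{- k..n}. (2::real) ^ nat (- j - 4)) \<le> 2 * 2 powi k"
proof -
  have "(\<Sum>j\<in>{- k..n}. (2::real) ^ nat (- j - 4)) \<le> (\<Sum>j\<in>{- k..n}. 2 powi (- j) / 16 + 1)"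
  proof (rule sum_mono)
    fix j
    show "(2::real) ^ nat (- j - 4) \<le> 2 powi (- j) / 16 + 1"
    proof (cases "4 \<le> - j")
      case True
      then have "(2::real) ^ nat (- j - 4) = 2 powi (- j - 4)" by (simp add: power_int_def)
      also have "\<dots> = 2 powi (- j) / 16" by (simp add: power_int_diff)
      finally show ?thesis by simp
    qed simp
  qed
  also have "\<dots> = (\<Sum>j\<in>{- k..n}. 2 powi (- j)) / 16 + real (card {- k..n})"
    by (simp add: sum.distrib sum_divide_distrib)
  also have "\<dots> \<le> (2 * 2 powi k) / 16 + 2 powi k"
  proof (intro add_mono divide_right_mono)
    show "(\<Sum>j\<in>{- k..n}. (2::real) powi (- j)) \<le> 2 * 2 powi k" using sum_scales_le[of "- k" n] by simp
    have "card {- k..n} \<le> nat k + 1" using assms by simp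
    also have "\<dots> \<le> 2 ^ nat k" using less_exp[of "nat k"] by linarith
    finally have "real (card {- k..n}) \<le> real (2 ^ nat k)" by (simp only: of_nat_le_iff)
    then show "real (card {- k..n}) \<le> 2 powi k" using assms by (simp add: power_int_def)
  qed simp
  also have "\<dots> \<le> 2 * 2 powi k" by simp
  finally show ?thesis .
qed

text \<open>Cells have length \<open>2\<^sup>-\<^sup>j / 16\<close>, except that for \<open>j > -4\<close> they are single points, on which characters are trivially
  constant. The regions start at \<open>4 * 2\<^sup>k\<close> in order to be long enough for the rounding to these cells.\<close>

lemma int_cells:
  fixes \<theta> :: "int \<Rightarrow> real"
  assumes k: "0 \<le> k" and n: "n \<le> 0" and \<theta>: "\<And>j. 0 \<le> \<theta> j" "(\<Sum>j\<in>{-k..n}. \<theta> j) \<le> 1"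
  shows "\<exists>\<Q>. finite \<Q> \<and> disjoint \<Q> \<and> (\<forall>Q\<in>\<Q>. Q \<subseteq> int_region k) \<and>
    (\<forall>j x. - k \<le> j \<and> j \<le> n \<longrightarrow> \<bar>x\<bar> \<le> 2 powi j \<longrightarrow>
      1 / 64 * 2 powi (k - j) * \<theta> j \<le> (\<Sum>Q\<in>\<Q>. (cmod (\<integral>m. indicator Q m * cis (2 * pi * real_of_int m * x) \<partial>int_count))\<^sup>2))"
proof -
  define N where "N = (2::int) ^ nat (k + 2)"
  have N: "0 < N" "real_of_int N = 4 * 2 powi k"
    using k by (simp_all add: N_def power_int_def nat_add_distrib)
  define l where "l j = nat (- j - 4)" for j :: int
  define \<sigma> where "\<sigma> j = (2::int) ^ l j" for j
  have \<sigma>: "0 < \<sigma> j" for j by (simp add: \<sigma>_def)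
  have N\<sigma>: "\<exists>i. N = i * \<sigma> j" if "- k \<le> j" for j
  proof -
    have "nat (k + 2) = (nat (k + 2) - l j) + l j" using that k by (simp add: l_def)
    then have "N = 2 ^ (nat (k + 2) - l j) * \<sigma> j" unfolding N_def \<sigma>_def by (metis power_add)
    then show ?thesis by blast
  qed
  define \<eta> where "\<eta> j = real_of_int (\<sigma> j) / real_of_int N" for j
  have \<eta>: "0 < \<eta> j" for j using \<sigma> N by (simp add: \<eta>_def)
  have total: "(\<Sum>j\<in>{-k..n}. \<theta> j / 2 + \<eta> j) \<le> 1"
  proof -
    have "(\<Sum>j\<in>{-k..n}. \<eta> j) = (\<Sum>j\<in>{-k..n}. 2 ^ nat (- j - 4)) / real_of_int N"
      by (simp add: \<eta>_def \<sigma>_def l_def sum_divide_distrib)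
    also have "\<dots> \<le> 2 * 2 powi k / real_of_int N"
      using sum_int_scales_le[OF k n] N by (intro divide_right_mono) auto
    also have "\<dots> = 1 / 2" unfolding N(2) by simp
    finally show ?thesis using \<theta>(2) by (simp add: sum.distrib sum_divide_distrib[symmetric])
  qed
  obtain p :: "int \<Rightarrow> real" where p: "p (- k) = 0" "mono_on {- k..n + 1} p" "p (n + 1) \<le> 1"
    "\<And>j. - k \<le> j \<Longrightarrow> j \<le> n \<Longrightarrow> \<theta> j / 2 \<le> p (j + 1) - p j"
    "\<And>j. - k \<le> j \<Longrightarrow> j \<le> n \<Longrightarrow> \<exists>a b :: int. p j = of_int a * \<eta> j \<and> p (j + 1) = of_int b * \<eta> j"
  proof (rule aligned_intervals[of "- k" n \<eta> "\<lambda>j. \<theta> j / 2"])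
    show "\<exists>i :: int. \<eta> j = of_int i * \<eta> (j + 1)" for j
    proof (cases "l j = 0")
      case True
      then have "l (j + 1) = 0" by (simp add: l_def)
      then show ?thesis using True by (intro exI[of _ 1]) (simp add: \<eta>_def \<sigma>_def)
    next
      case False
      then have "l j = Suc (l (j + 1))" by (simp add: l_def)
      then show ?thesis by (intro exI[of _ 2]) (simp add: \<eta>_def \<sigma>_def)
    qed
  qed (use \<eta> \<theta> total in auto)
  have p01: "0 \<le> p j" "p j \<le> 1" if "- k \<le> j" "j \<le> n + 1" for j
    using mono_onD[OF p(2), of "- k" j] mono_onD[OF p(2), of j "n + 1"] that p(1,3) by auto
  define S where "S j = {m :: int. real_of_int N * (1 + p j) \<le> m \<and> m < real_of_int N * (1 + p (j + 1))}" for j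
  have S_sub: "S j \<subseteq> int_region k" if "- k \<le> j" "j \<le> n" for j
  proof
    fix m assume m: "m \<in> S j"
    have "real_of_int N * 1 \<le> real_of_int N * (1 + p j)" using p01[of j] that N by (intro mult_left_mono) auto
    moreover have "real_of_int N * (1 + p (j + 1)) \<le> real_of_int N * 2" using p01[of "j + 1"] that N by (intro mult_left_mono) auto
    ultimately have "real_of_int N \<le> m" "m < real_of_int (2 * N)" using m by (auto simp: S_def)
    then have "N \<le> m" "m < 2 * N" by linarith+
    moreover have "2 * N = 2 ^ nat (k + 3)"
    proof -
      have "nat (k + 3) = Suc (nat (k + 2))" using k by simp
      then show ?thesis by (simp add: N_def)
    qed
    ultimately show "m \<in> int_region k" using k by (simp add: int_region_def N_def)
  qed
  have S_eq: "\<exists>A B. S j = {\<sigma> j * A..<\<sigma> j * B} \<and> real_of_int (\<sigma> j * B - \<sigma> j * A) = real_of_int N * (p (j + 1) - p j)"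
    if j: "- k \<le> j" "j \<le> n" for j
  proof -
    obtain i where i: "N = i * \<sigma> j" using N\<sigma>[OF j(1)] by auto
    obtain a b :: int where ab: "p j = of_int a * \<eta> j" "p (j + 1) = of_int b * \<eta> j" using p(5)[OF j] by blast
    have N\<eta>: "real_of_int N * (of_int z * \<eta> j) = of_int (\<sigma> j * z)" for z using N by (simp add: \<eta>_def)
    have eqs: "real_of_int N * (1 + p j) = of_int (\<sigma> j * (i + a))" "real_of_int N * (1 + p (j + 1)) = of_int (\<sigma> j * (i + b))"
      unfolding ab distrib_left N\<eta> by (simp_all add: i distrib_left mult.commute)
    have "S j = {\<sigma> j * (i + a)..<\<sigma> j * (i + b)}"
      unfolding S_def eqs of_int_le_iff of_int_less_iff by auto
    moreover have "real_of_int (\<sigma> j * (i + b) - \<sigma> j * (i + a)) = real_of_int N * (p (j + 1) - p j)"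
      unfolding of_int_diff eqs[symmetric] by (simp add: algebra_simps)
    ultimately show ?thesis by blast
  qed
  define g where "g j m = m div \<sigma> j" for j m
  have cell_eq: "{m' \<in> S j. g j m' = g j m} = {\<sigma> j * g j m..<\<sigma> j * g j m + \<sigma> j}"
    if j: "- k \<le> j" "j \<le> n" and m: "m \<in> S j" for j m
  proof -
    obtain A B where AB: "S j = {\<sigma> j * A..<\<sigma> j * B}" using S_eq[OF j] by blast
    have div: "m' div \<sigma> j = z \<longleftrightarrow> \<sigma> j * z \<le> m' \<and> m' < \<sigma> j * z + \<sigma> j" for m' z
    proof
      assume z: "m' div \<sigma> j = z"
      have "\<sigma> j * (m' div \<sigma> j) + m' mod \<sigma> j = m'" by (rule mult_div_mod_eq)
      then show "\<sigma> j * z \<le> m' \<and> m' < \<sigma> j * z + \<sigma> j"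
        using pos_mod_bound[OF \<sigma>[of j], of m'] pos_mod_sign[OF \<sigma>[of j], of m'] unfolding z by linarith
    next
      assume "\<sigma> j * z \<le> m' \<and> m' < \<sigma> j * z + \<sigma> j"
      then show "m' div \<sigma> j = z" by (intro int_div_pos_eq[of m' "\<sigma> j" z "m' - \<sigma> j * z"]) auto
    qed
    have "A \<le> g j m" "g j m < B"
    proof -
      have "\<sigma> j * A \<le> m" "m < \<sigma> j * B" using m AB by auto
      moreover have "\<sigma> j * g j m \<le> m" "m < \<sigma> j * g j m + \<sigma> j" using div[of m "g j m"] by (auto simp: g_def)
      ultimately have "\<sigma> j * A < \<sigma> j * (g j m + 1)" "\<sigma> j * g j m < \<sigma> j * B"
        unfolding distrib_left mult_1_right by linarith+
      then show "A \<le> g j m" "g j m < B" using \<sigma>[of j] by (auto simp: mult_less_cancel_left_pos)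
    qed
    then have AB': "\<sigma> j * A \<le> \<sigma> j * g j m" "\<sigma> j * g j m + \<sigma> j \<le> \<sigma> j * B"
      using \<sigma>[of j] mult_left_mono[of A "g j m" "\<sigma> j"] mult_left_mono[of "g j m + 1" B "\<sigma> j"]
      by (simp_all add: distrib_left)
    show ?thesis
    proof (intro equalityI subsetI)
      fix m' assume "m' \<in> {m' \<in> S j. g j m' = g j m}"
      then have "m' div \<sigma> j = g j m" using g_def[of j m'] by simp
      then show "m' \<in> {\<sigma> j * g j m..<\<sigma> j * g j m + \<sigma> j}" unfolding div by simp
    next
      fix m' assume m': "m' \<in> {\<sigma> j * g j m..<\<sigma> j * g j m + \<sigma> j}"
      then have "m' div \<sigma> j = g j m" unfolding div by simp
      then have "g j m' = g j m" using g_def[of j m'] by simp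
      moreover have "\<sigma> j * A \<le> m'" "m' < \<sigma> j * B" using m'[unfolded atLeastLessThan_iff] AB' by linarith+
      ultimately show "m' \<in> {m' \<in> S j. g j m' = g j m}" by (simp add: AB)
    qed
  qed
  obtain \<Q> where \<Q>: "finite \<Q>" "disjoint \<Q>" "\<And>Q. Q \<in> \<Q> \<Longrightarrow> Q \<in> sets int_count \<and> (\<exists>j\<in>{- k..n}. Q \<subseteq> S j)"
    and main: "\<And>j u. j \<in> {- k..n} \<Longrightarrow> u \<in> borel_measurable int_count \<Longrightarrow> (\<And>x. cmod (u x) = 1) \<Longrightarrow>
      (\<And>x x'. x \<in> S j \<Longrightarrow> x' \<in> S j \<Longrightarrow> g j x = g j x' \<Longrightarrow> cmod (u x - u x') \<le> 1 / 2) \<Longrightarrow>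
      real_of_int (\<sigma> j) / 4 * measure int_count (S j) \<le> (\<Sum>Q\<in>\<Q>. (cmod (\<integral>x. indicator Q x * u x \<partial>int_count))\<^sup>2)"
  proof (rule cells_from_slabs[of "{- k..n}" S g int_count "\<lambda>j. real_of_int (\<sigma> j)"])
    show "disjoint_family_on S {- k..n}"
      unfolding disjoint_family_on_def
    proof (intro ballI impI)
      have *: "S i \<inter> S j = {}" if ij: "i \<in> {- k..n}" "j \<in> {- k..n}" "i < j" for i j
      proof -
        have "p (i + 1) \<le> p j" using ij by (intro mono_onD[OF p(2)]) auto
        then have "real_of_int N * (1 + p (i + 1)) \<le> real_of_int N * (1 + p j)" using N by (intro mult_left_mono) auto
        then show ?thesis unfolding S_def by auto
      qed
      fix i j assume ij: "i \<in> {- k..n}" "j \<in> {- k..n}" "i \<noteq> j"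
      then consider "i < j" | "j < i" by linarith
      then show "S i \<inter> S j = {}" using *[OF ij(1,2)] *[OF ij(2,1)] by cases auto
    qed
    show "finite (g j ` S j)" if j: "j \<in> {- k..n}" for j
    proof -
      obtain A B where "S j = {\<sigma> j * A..<\<sigma> j * B}" using S_eq[of j] j by auto
      then show ?thesis by simp
    qed
    show "{x' \<in> S j. g j x' = g j x} \<in> sets int_count \<and> emeasure int_count {x' \<in> S j. g j x' = g j x} < \<infinity> \<and>
        real_of_int (\<sigma> j) \<le> measure int_count {x' \<in> S j. g j x' = g j x}"
      if j: "j \<in> {- k..n}" and x: "x \<in> S j" for j x
    proof -
      have ce: "{x' \<in> S j. g j x' = g j x} = {\<sigma> j * g j x..<\<sigma> j * g j x + \<sigma> j}" using j x by (intro cell_eq) auto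
      show ?thesis unfolding ce using \<sigma>[of j] by (simp add: int_count_facts(5)) (simp add: int_count_def ennreal_of_nat_eq_real_of_nat)
    qed
  qed (use \<sigma> in \<open>auto simp: less_imp_le\<close>)
  have "1 / 64 * 2 powi (k - j) * \<theta> j \<le> (\<Sum>Q\<in>\<Q>. (cmod (\<integral>m. indicator Q m * cis (2 * pi * real_of_int m * x) \<partial>int_count))\<^sup>2)"
    if j: "- k \<le> j \<and> j \<le> n" and x: "\<bar>x\<bar> \<le> 2 powi j" for j x
  proof -
    obtain A B where AB: "S j = {\<sigma> j * A..<\<sigma> j * B}" "real_of_int (\<sigma> j * B - \<sigma> j * A) = real_of_int N * (p (j + 1) - p j)"
      using S_eq[of j] j by blast
    have pj: "0 \<le> p (j + 1) - p j" using p(4)[of j] \<theta>(1)[of j] j by auto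
    have "0 \<le> real_of_int (\<sigma> j * B - \<sigma> j * A)" unfolding AB(2) using pj N by simp
    then have "0 \<le> \<sigma> j * B - \<sigma> j * A" by (simp only: of_int_0_le_iff)
    then have mS: "measure int_count (S j) = real_of_int N * (p (j + 1) - p j)"
      unfolding AB(1) AB(2)[symmetric] by (subst int_count_facts(5)) auto
    have \<sigma>j: "2 powi (- j) / 16 \<le> real_of_int (\<sigma> j)" and \<sigma>0: "l j \<noteq> 0 \<Longrightarrow> real_of_int (\<sigma> j) = 2 powi (- j) / 16"
    proof -
      show eq: "real_of_int (\<sigma> j) = 2 powi (- j) / 16" if "l j \<noteq> 0"
      proof -
        have "- j = int (l j) + 4" using that by (simp add: l_def)
        then have "(2::real) powi (- j) = 2 powi (int (l j) + 4)" by simp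
        then show ?thesis by (simp add: \<sigma>_def power_int_add)
      qed
      show "2 powi (- j) / 16 \<le> real_of_int (\<sigma> j)"
      proof (cases "l j = 0")
        case True
        then have "(2::real) powi (- j) \<le> 2 powi 4" by (intro power_int_increasing) (auto simp: l_def)
        then show ?thesis using True by (simp add: \<sigma>_def)
      qed (simp add: eq)
    qed
    have "1 / 64 * 2 powi (k - j) * \<theta> j = (2 powi (- j) / 16) / 4 * (2 powi k * \<theta> j)"
      by (simp add: power_int_diff power_int_minus field_simps)
    also have "\<dots> \<le> real_of_int (\<sigma> j) / 4 * (real_of_int N * (p (j + 1) - p j))"
    proof (rule mult_mono)
      show "2 powi (- j) / 16 / 4 \<le> real_of_int (\<sigma> j) / 4" using \<sigma>j by simp
      have "2 powi k * \<theta> j \<le> 4 * 2 powi k * (\<theta> j / 2)" using \<theta>(1)[of j] by simp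
      also have "\<dots> \<le> 4 * 2 powi k * (p (j + 1) - p j)" using p(4)[of j] j by (intro mult_left_mono) auto
      finally show "2 powi k * \<theta> j \<le> real_of_int N * (p (j + 1) - p j)" by (simp only: N(2))
    qed (use \<theta>(1) \<sigma>[of j] in auto)
    also have "\<dots> \<le> (\<Sum>Q\<in>\<Q>. (cmod (\<integral>m. indicator Q m * cis (2 * pi * real_of_int m * x) \<partial>int_count))\<^sup>2)"
      unfolding mS[symmetric]
    proof (rule main)
      fix m m' assume mm: "m \<in> S j" "m' \<in> S j" "g j m = g j m'"
      have "m \<in> {\<sigma> j * g j m..<\<sigma> j * g j m + \<sigma> j}" "m' \<in> {\<sigma> j * g j m..<\<sigma> j * g j m + \<sigma> j}"
        using cell_eq[of j m] mm j by auto
      then have "\<bar>m - m'\<bar> < 2 ^ l j" by (auto simp: \<sigma>_def)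
      moreover have "l j = 0 \<or> 16 * 2 ^ l j * \<bar>x\<bar> \<le> 1"
      proof (cases "l j = 0")
        case False
        then have "16 * (2::real) ^ l j = 2 powi (- j)" using \<sigma>0 by (simp add: \<sigma>_def)
        then have "16 * 2 ^ l j * \<bar>x\<bar> \<le> 2 powi (- j) * 2 powi j" using x by (metis mult_left_mono zero_le_power_int zero_le_numeral)
        then show ?thesis by (simp add: power_int_minus)
      qed simp
      ultimately show "cmod (cis (2 * pi * real_of_int m * x) - cis (2 * pi * real_of_int m' * x)) \<le> 1 / 2"
        by (rule int_char_near)
    qed (use j in \<open>auto simp: int_count_def\<close>)
    finally show ?thesis .
  qed
  moreover have "Q \<subseteq> int_region k" if "Q \<in> \<Q>" for Q
    using \<Q>(3)[OF that] S_sub by fastforce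
  ultimately show ?thesis using \<Q>(1,2) by blast
qed

text \<open>Frequency scales are at most zero because the torus has measure one, so regions with \<open>k < 0\<close> are never asked for
  cells.\<close>

lemma fourier_pair_int:
  obtains lam c \<kappa> E' C where "fourier_pair int_count int_pos torus_leb torus_pos
    (\<lambda>m x. cis (2 * pi * real_of_int m * x)) 2 lam c \<kappa> E' C"
proof -
  define \<kappa> where "\<kappa> x = \<lfloor>log 2 (torus_pos x)\<rfloor>" for x
  let ?E = "{-1/2..1/2} - {0 :: real}"
  interpret ch: euclidean_chart torus_leb "{-1/2..1/2}" 1 by (rule chart_torus)
  have idm [measurable]: "(\<lambda>x. x) \<in> torus_leb \<rightarrow>\<^sub>M borel" by (rule torus_id_measurable)
  have pos: "0 < torus_pos x" if "x \<in> ?E" for x using that by (simp add: torus_pos_def)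
  have \<kappa>0: "\<kappa> x \<le> 0" if "x \<in> ?E" for x
  proof -
    have "torus_pos x \<le> 1" using that by (auto simp: torus_pos_def)
    then have "log 2 (torus_pos x) \<le> 0" using pos[OF that] by simp
    then show ?thesis unfolding \<kappa>_def by linarith
  qed
  have x\<kappa>: "\<bar>x\<bar> \<le> 2 powi \<kappa> x" if "x \<in> ?E" for x
  proof -
    have "torus_pos x < 2 powi (\<kappa> x + 1)" unfolding \<kappa>_def by (rule floor_log2_bounds(2)[OF pos[OF that]])
    then show ?thesis by (simp add: torus_pos_def power_int_add)
  qed
  have "fourier_pair int_count int_pos torus_leb torus_pos (\<lambda>m x. cis (2 * pi * real_of_int m * x)) 2 16 (1/64) \<kappa> ?E int_region"
  proof (intro fourier_pair.intro fourier_pair_axioms.intro rearr_space_torus rearr_space_int)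
    show "(\<lambda>(x, m). cis (2 * pi * real_of_int m * x)) \<in> borel_measurable (torus_leb \<Otimes>\<^sub>M int_count)"
    proof -
      have [measurable]: "fst \<in> torus_leb \<Otimes>\<^sub>M int_count \<rightarrow>\<^sub>M borel"
        using measurable_compose[OF measurable_fst idm] by simp
      have "real_of_int \<in> int_count \<rightarrow>\<^sub>M borel" by (simp add: int_count_def)
      then have [measurable]: "(\<lambda>p. real_of_int (snd p)) \<in> torus_leb \<Otimes>\<^sub>M int_count \<rightarrow>\<^sub>M borel"
        by (rule measurable_compose[OF measurable_snd])
      show ?thesis unfolding cis_conv_exp split_def by measurable
    qed
    show "\<kappa> \<in> torus_leb \<rightarrow>\<^sub>M count_space UNIV" unfolding \<kappa>_def torus_pos_def using idm by measurable
    have "{0} \<in> null_sets torus_leb"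
      by (intro null_setsI) (auto simp: ch.emeasure_chart ch.sets_chart)
    then have "AE y in torus_leb. y \<notin> {0}" by (rule AE_not_in)
    then show "AE y in torus_leb. y \<in> ?E" using AE_space by eventually_elim (auto simp: torus_leb_def)
    show "emeasure torus_leb S \<le> ennreal (torus_pos y)" if "y \<in> ?E" "emeasure torus_leb S \<le> ennreal (2 powi \<kappa> y)" for y S
      using floor_log2_bounds(1)[OF pos[OF that(1)]] that(2) by (auto simp: \<kappa>_def intro: order_trans ennreal_leI)
    show "\<exists>\<phi>. \<phi> \<in> borel_measurable int_count \<and> (\<forall>x. 0 \<le> \<phi> x \<and> \<phi> x \<le> 1 \<and> (\<phi> x \<noteq> 0 \<longrightarrow> int_pos x \<le> 16 * 2 powi k)) \<and>
        (\<forall>y\<in>?E. \<exists>s\<ge>0. (\<integral>x. complex_of_real (\<phi> x) * cis (2 * pi * real_of_int x * y) \<partial>int_count) = complex_of_real s \<and>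
          (k < - \<kappa> y \<longrightarrow> 1 / 64 * 2 powi k \<le> s))" for k
    proof -
      obtain \<phi> where \<phi>: "\<phi> \<in> borel_measurable int_count" "\<forall>m. 0 \<le> \<phi> m \<and> \<phi> m \<le> 1 \<and> (\<phi> m \<noteq> 0 \<longrightarrow> int_pos m \<le> 16 * 2 powi k)"
        "\<forall>x. \<exists>s\<ge>0. (\<integral>m. complex_of_real (\<phi> m) * cis (2 * pi * real_of_int m * x) \<partial>int_count) = complex_of_real s \<and>
          (\<forall>j. k < - j \<longrightarrow> \<bar>x\<bar> \<le> 2 powi j \<longrightarrow> 1 / 64 * 2 powi k \<le> s)"
        using int_bump[of k] by auto
      then show ?thesis using x\<kappa> by blast
    qed
    show "int_region k \<subseteq> {x. int_pos x \<le> 16 * 2 powi k}" for k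
    proof
      fix m assume m: "m \<in> int_region k"
      moreover have "(0::int) < 2 ^ nat (k + 2)" by simp
      ultimately have k: "0 \<le> k" "0 \<le> m" "m < 2 ^ nat (k + 3)"
        unfolding int_region_def by (auto simp del: zero_less_power split: if_splits)
      have "real_of_int m \<le> real_of_int (2 ^ nat (k + 3))" using k by (intro of_int_le_iff[THEN iffD2]) simp
      also have "\<dots> = 8 * 2 powi k" using k by (simp add: power_int_def nat_add_distrib power_add)
      finally have "int_pos m \<le> 16 * 2 powi k" using k by (auto simp: int_pos_def)
      then show "m \<in> {x. int_pos x \<le> 16 * 2 powi k}" by simp
    qed
    show "int_region k \<inter> int_region k' = {}" if "k \<noteq> k'" for k k'
    proof -
      have *: "int_region i \<inter> int_region j = {}" if "i < j" for i j
      proof (cases "0 \<le> i")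
        case True
        then have "(2::int) ^ nat (i + 3) \<le> 2 ^ nat (j + 2)" using that by (intro power_increasing) auto
        then show ?thesis by (auto simp: int_region_def)
      qed (simp add: int_region_def)
      show ?thesis using *[of k k'] *[of k' k] that by (cases "k < k'") auto
    qed
    show "\<exists>\<Q>. finite \<Q> \<and> disjoint \<Q> \<and> (\<forall>Q\<in>\<Q>. Q \<in> sets int_count \<and> Q \<subseteq> int_region k) \<and>
        (\<forall>y\<in>?E. - k \<le> \<kappa> y \<and> \<kappa> y \<le> n \<longrightarrow> 1 / 64 * 2 powi (k - \<kappa> y) * \<theta> (\<kappa> y)
          \<le> (\<Sum>Q\<in>\<Q>. (cmod (\<integral>x. indicator Q x * cis (2 * pi * real_of_int x * y) \<partial>int_count))\<^sup>2))"
      if \<theta>: "\<And>j. 0 \<le> \<theta> j" "(\<Sum>j\<in>{- k..n}. \<theta> j) \<le> 1" for k n and \<theta> :: "int \<Rightarrow> real"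
    proof (cases "0 \<le> k")
      case True
      have "(\<Sum>j\<in>{- k..min n 0}. \<theta> j) \<le> (\<Sum>j\<in>{- k..n}. \<theta> j)" using \<theta>(1) by (intro sum_mono2) auto
      then have "(\<Sum>j\<in>{- k..min n 0}. \<theta> j) \<le> 1" using \<theta>(2) by simp
      then obtain \<Q> where \<Q>: "finite \<Q>" "disjoint \<Q>" "\<forall>Q\<in>\<Q>. Q \<subseteq> int_region k"
        "\<forall>j x. - k \<le> j \<and> j \<le> min n 0 \<longrightarrow> \<bar>x\<bar> \<le> 2 powi j \<longrightarrow>
          1 / 64 * 2 powi (k - j) * \<theta> j \<le> (\<Sum>Q\<in>\<Q>. (cmod (\<integral>m. indicator Q m * cis (2 * pi * real_of_int m * x) \<partial>int_count))\<^sup>2)"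
        using int_cells[where k = k and n = "min n 0" and \<theta> = \<theta>] True \<theta>(1) by auto
      have "1 / 64 * 2 powi (k - \<kappa> y) * \<theta> (\<kappa> y) \<le> (\<Sum>Q\<in>\<Q>. (cmod (\<integral>x. indicator Q x * cis (2 * pi * real_of_int x * y) \<partial>int_count))\<^sup>2)"
        if y: "y \<in> ?E" "- k \<le> \<kappa> y \<and> \<kappa> y \<le> n" for y
        using \<Q>(4)[rule_format, OF _ x\<kappa>[OF y(1)]] y(2) \<kappa>0[OF y(1)] by simp
      then show ?thesis using \<Q>(1,2,3) by (intro exI[of _ \<Q>]) (auto simp: int_count_def)
    next
      case False
      then have "\<not> - k \<le> \<kappa> y" if "y \<in> ?E" for y using \<kappa>0[OF that] by linarith
      then show ?thesis by (intro exI[of _ "{}"]) auto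
    qed
  qed auto
  then show thesis by (rule that)
qed

lemma int_fourier_eq_integral:
  assumes "f \<in> Lp_space int_count 1"
  shows "int_fourier f x = (\<integral>m. f m * cis (2 * pi * real_of_int m * x) \<partial>int_count)"
proof -
  have "integrable (count_space UNIV) (\<lambda>m. f m * cis (2 * pi * real_of_int m * x))"
  proof (rule integrableI_bounded)
    show "(\<integral>\<^sup>+m. ennreal (norm (f m * cis (2 * pi * real_of_int m * x))) \<partial>count_space UNIV) < \<infinity>"
      using assms by (simp add: Lp_space_one_iff int_count_def norm_mult)
  qed simp
  then have "Infinite_Set_Sum.abs_summable_on (\<lambda>m. f m * cis (2 * pi * real_of_int m * x)) UNIV"
    by (simp add: Infinite_Set_Sum.abs_summable_on_def)
  then show ?thesis
    unfolding int_fourier_def int_count_def by (subst infsetsum_infsum[symmetric]) (simp_all add: infsetsum_def)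
qed

section \<open>The extremal functional\<close>

context fourier_pair
begin

theorem tilde_norm_properties:
  assumes \<beta>: "0 < \<beta>" "\<beta> \<le> 2" and K: "1 \<le> K" and F: "\<And>h. h \<in> Lp_space D 1 \<Longrightarrow> F h = ft h"
  shows "\<exists>A>0. \<forall>X. pos_homogeneous E X \<longrightarrow> left_admissible E \<rho>E X \<longrightarrow>
    rearrangement_invariant D (L1_plus_L2 D) (tilde_norm D E K \<beta> X) \<and>
    right_admissible D \<rho>D (L1_plus_L2 D) (tilde_norm D E K \<beta> X) \<and>
    (\<forall>Y. right_admissible D \<rho>D (borel_measurable D) Y \<longrightarrow>
      (\<forall>f\<in>Lp_space D 1. power_norm \<beta> X (F f) \<le> Y f) \<longrightarrow>
      (\<forall>f\<in>Lp_space D 1. tilde_norm D E K \<beta> X f \<le> ennreal A * Y f))"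
proof -
  obtain A where A: "0 < A"
    "\<And>X Y f. pos_homogeneous E X \<Longrightarrow> left_admissible E \<rho>E X \<Longrightarrow>
      right_admissible D \<rho>D (borel_measurable D) Y \<Longrightarrow>
      (\<And>h. h \<in> Lp_space D 1 \<Longrightarrow> power_norm \<beta> X (ft h) \<le> Y h) \<Longrightarrow> f \<in> Lp_space D 1 \<Longrightarrow>
      tilde_norm D E K \<beta> X f \<le> ennreal A * Y f"
    using tilde_norm_minimal[OF \<beta> K] by blast
  show ?thesis
  proof (intro exI[of _ A] conjI allI impI ballI A(1))
    fix X assume X: "pos_homogeneous E X" "left_admissible E \<rho>E X"
    show "rearrangement_invariant D (L1_plus_L2 D) (tilde_norm D E K \<beta> X)"
      by (rule tilde_norm_rearrangement_invariant[OF X \<beta>(1)])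
    show "right_admissible D \<rho>D (L1_plus_L2 D) (tilde_norm D E K \<beta> X)"
      by (rule D.tilde_norm_right_admissible[OF X \<beta>(1)])
    fix Y f assume Y: "right_admissible D \<rho>D (borel_measurable D) Y" "\<forall>f\<in>Lp_space D 1. power_norm \<beta> X (F f) \<le> Y f"
      and f: "f \<in> Lp_space D 1"
    show "tilde_norm D E K \<beta> X f \<le> ennreal A * Y f"
      using Y(2) F by (intro A(2)[OF X Y(1) _ f]) auto
  qed
qed

end

theorem corollary1p7:
  fixes \<beta> K :: real
  assumes "0 < \<beta>" and "\<beta> \<le> 1" and "1 \<le> K"
  shows
    "(\<exists>C>0. \<forall>X :: (real ^ 'n \<Rightarrow> complex) \<Rightarrow> ennreal.
        pos_homogeneous space_leb X \<longrightarrow> left_admissible space_leb space_pos X \<longrightarrow>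
          rearrangement_invariant space_leb (L1_plus_L2 space_leb)
            (tilde_norm (space_leb :: (real ^ 'n) measure) space_leb K \<beta> X) \<and>
          right_admissible space_leb space_pos (L1_plus_L2 space_leb)
            (tilde_norm (space_leb :: (real ^ 'n) measure) space_leb K \<beta> X) \<and>
          (\<forall>Y :: (real ^ 'n \<Rightarrow> complex) \<Rightarrow> ennreal.
             right_admissible space_leb space_pos (borel_measurable space_leb) Y \<longrightarrow>
             (\<forall>f\<in>Lp_space space_leb 1. power_norm \<beta> X (space_fourier f) \<le> Y f) \<longrightarrow>
             (\<forall>f\<in>Lp_space space_leb 1. tilde_norm space_leb space_leb K \<beta> X f \<le> ennreal C * Y f)))
     \<and>
     (\<exists>C>0. \<forall>X :: (real \<Rightarrow> complex) \<Rightarrow> ennreal.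
        pos_homogeneous torus_leb X \<longrightarrow> left_admissible torus_leb torus_pos X \<longrightarrow>
          rearrangement_invariant int_count (L1_plus_L2 int_count)
            (tilde_norm int_count torus_leb K \<beta> X) \<and>
          right_admissible int_count int_pos (L1_plus_L2 int_count)
            (tilde_norm int_count torus_leb K \<beta> X) \<and>
          (\<forall>Y :: (int \<Rightarrow> complex) \<Rightarrow> ennreal.
             right_admissible int_count int_pos (borel_measurable int_count) Y \<longrightarrow>
             (\<forall>f\<in>Lp_space int_count 1. power_norm \<beta> X (int_fourier f) \<le> Y f) \<longrightarrow>
             (\<forall>f\<in>Lp_space int_count 1. tilde_norm int_count torus_leb K \<beta> X f \<le> ennreal C * Y f)))
     \<and>
     (\<exists>C>0. \<forall>X :: (int \<Rightarrow> complex) \<Rightarrow> ennreal.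
        pos_homogeneous int_count X \<longrightarrow> left_admissible int_count int_pos X \<longrightarrow>
          rearrangement_invariant torus_leb (L1_plus_L2 torus_leb)
            (tilde_norm torus_leb int_count K \<beta> X) \<and>
          right_admissible torus_leb torus_pos (L1_plus_L2 torus_leb)
            (tilde_norm torus_leb int_count K \<beta> X) \<and>
          (\<forall>Y :: (real \<Rightarrow> complex) \<Rightarrow> ennreal.
             right_admissible torus_leb torus_pos (borel_measurable torus_leb) Y \<longrightarrow>
             (\<forall>f\<in>Lp_space torus_leb 1. power_norm \<beta> X (torus_fourier f) \<le> Y f) \<longrightarrow>
             (\<forall>f\<in>Lp_space torus_leb 1. tilde_norm torus_leb int_count K \<beta> X f \<le> ennreal C * Y f)))"
proof (intro conjI)
  have \<beta>2: "\<beta> \<le> 2" using assms(2) by simp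
  obtain lam c \<kappa> E' C where A: "fourier_pair (space_leb :: (real ^ 'n) measure) space_pos (space_leb :: (real ^ 'n) measure) space_pos
      (\<lambda>x \<xi>. cis (- 2 * pi * (x \<bullet> \<xi>))) (2 ^ CARD('n)) lam c \<kappa> E' C"
    by (rule fourier_pair_space)
  show "\<exists>C>0. \<forall>X :: (real ^ 'n \<Rightarrow> complex) \<Rightarrow> ennreal.
        pos_homogeneous space_leb X \<longrightarrow> left_admissible space_leb space_pos X \<longrightarrow>
          rearrangement_invariant space_leb (L1_plus_L2 space_leb)
            (tilde_norm (space_leb :: (real ^ 'n) measure) space_leb K \<beta> X) \<and>
          right_admissible space_leb space_pos (L1_plus_L2 space_leb)
            (tilde_norm (space_leb :: (real ^ 'n) measure) space_leb K \<beta> X) \<and>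
          (\<forall>Y :: (real ^ 'n \<Rightarrow> complex) \<Rightarrow> ennreal.
             right_admissible space_leb space_pos (borel_measurable space_leb) Y \<longrightarrow>
             (\<forall>f\<in>Lp_space space_leb 1. power_norm \<beta> X (space_fourier f) \<le> Y f) \<longrightarrow>
             (\<forall>f\<in>Lp_space space_leb 1. tilde_norm space_leb space_leb K \<beta> X f \<le> ennreal C * Y f))"
    by (rule fourier_pair.tilde_norm_properties[OF A assms(1) \<beta>2 assms(3)])
      (intro ext, simp only: fourier_pair.ft_def[OF A] space_fourier_def)
  obtain lam c \<kappa> E' C where B: "fourier_pair int_count int_pos torus_leb torus_pos
      (\<lambda>m x. cis (2 * pi * real_of_int m * x)) 2 lam c \<kappa> E' C"
    by (rule fourier_pair_int)
  show "\<exists>C>0. \<forall>X :: (real \<Rightarrow> complex) \<Rightarrow> ennreal.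
        pos_homogeneous torus_leb X \<longrightarrow> left_admissible torus_leb torus_pos X \<longrightarrow>
          rearrangement_invariant int_count (L1_plus_L2 int_count)
            (tilde_norm int_count torus_leb K \<beta> X) \<and>
          right_admissible int_count int_pos (L1_plus_L2 int_count)
            (tilde_norm int_count torus_leb K \<beta> X) \<and>
          (\<forall>Y :: (int \<Rightarrow> complex) \<Rightarrow> ennreal.
             right_admissible int_count int_pos (borel_measurable int_count) Y \<longrightarrow>
             (\<forall>f\<in>Lp_space int_count 1. power_norm \<beta> X (int_fourier f) \<le> Y f) \<longrightarrow>
             (\<forall>f\<in>Lp_space int_count 1. tilde_norm int_count torus_leb K \<beta> X f \<le> ennreal C * Y f))"
    by (rule fourier_pair.tilde_norm_properties[OF B assms(1) \<beta>2 assms(3)])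
      (intro ext, simp only: fourier_pair.ft_def[OF B] int_fourier_eq_integral)
  obtain lam c \<kappa> E' C where C: "fourier_pair torus_leb torus_pos int_count int_pos
      (\<lambda>x n. cis (- 2 * pi * real_of_int n * x)) 2 lam c \<kappa> E' C"
    by (rule fourier_pair_torus)
  show "\<exists>C>0. \<forall>X :: (int \<Rightarrow> complex) \<Rightarrow> ennreal.
        pos_homogeneous int_count X \<longrightarrow> left_admissible int_count int_pos X \<longrightarrow>
          rearrangement_invariant torus_leb (L1_plus_L2 torus_leb)
            (tilde_norm torus_leb int_count K \<beta> X) \<and>
          right_admissible torus_leb torus_pos (L1_plus_L2 torus_leb)
            (tilde_norm torus_leb int_count K \<beta> X) \<and>
          (\<forall>Y :: (real \<Rightarrow> complex) \<Rightarrow> ennreal.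
             right_admissible torus_leb torus_pos (borel_measurable torus_leb) Y \<longrightarrow>
             (\<forall>f\<in>Lp_space torus_leb 1. power_norm \<beta> X (torus_fourier f) \<le> Y f) \<longrightarrow>
             (\<forall>f\<in>Lp_space torus_leb 1. tilde_norm torus_leb int_count K \<beta> X f \<le> ennreal C * Y f))"
    by (rule fourier_pair.tilde_norm_properties[OF C assms(1) \<beta>2 assms(3)])
      (intro ext, simp only: fourier_pair.ft_def[OF C] torus_fourier_def)
qed

end
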